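(* Let $A=A(\mathcal X)$ be a $\sigma(\mathcal X)$-measurable random field on $\mathbb R^d$, where $\mathcal X$ is a completely independent random field on some measure space $E=\biguplus_{x\in\mathbb Z^d,t\in\mathbb Z^l}E_{x,t}$ with values in some measurable space $M$. Let $\mathcal X'$ be an i.i.d. copy of $\mathcal X$. For all $B\subset\mathbb Z^d\times\mathbb Z^l$ let the perturbed random field $\mathcal X^B$ be defined by $$\mathcal X^{B}|_{\cup_{(x,t)\in B}E_{x,t}}=\mathcal X'|_{\cup_{(x,t)\in B}E_{x,t}},\qquad \mathcal X^{B}|_{\cup_{(x,t)\notin B}E_{x,t}}=\mathcal X|_{\cup_{(x,t)\notin B}E_{x,t}},$$ and set $\mathcal X^{x,t}:=\mathcal X^{\{(x,t)\}}$, $\mathcal X^{x,t;x',t'}:=\mathcal X^{\{(x,t),(x',t')\}}$. Assume: (a) For all $x,t$ and all $B\subset\mathbb Z^d\times\mathbb Z^l$ there exists an action radius $\rho_{x,t}(\mathcal X^B)$ for $A(\mathcal X^B)$ with respect to $\mathcal X^B$ in $E_{x,t}$ with reference perturbation $\mathcal X'$, and set $\tilde\rho_{x,t}:=\sup\{\rho_{x,t}(\mathcal X^B): B\subset\mathbb Z^d\times\mathbb Z^l\}$. (b) The transformation $A$ of $\mathcal X$ is stationary, that is, the random fields $A(\mathcal X(\cdot+z,\cdot))$ and $A(\mathcal X)(\cdot+z)$ have the same law for all $z\in\mathbb Z^d$. For all $t\in\mathbb Z^l$ and $\ell\ge1$ define the weight $$\pi(t,\ell):=\mathbb P\big[\ell-1\le\tilde\rho_{0,t}<\ell,\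 \mathcal X\ne\mathcal X^{0,t}\big].$$ Let $Z=Z(A)$ be any $\sigma(A)$-measurable random variable with $0<\sigma^2:=\mathrm{Var}[Z]<\infty$. With the discrete derivatives $\partial^{\rm dis}_{\ell,x,t}Z$ and $\partial^{\rm dis}_{\ell,x,t}\partial^{\rm dis}_{\ell',x',t'}Z$ defined in the context, set, for $\theta\in(0,1]$ (sums over $x,x',x''\in\mathbb Z^d$, $t,t',t''\in\mathbb Z^l$, and integers $\ell,\ell',\ell''\ge1$), $$S_1(\theta):=\sigma^{-2}\inf_{0<\lambda<1}\Bigg(\sum_{x,x',x''}\sum_{t,t',t''}\sum_{\ell,\ell',\ell''=1}^\infty\big(\pi(t,\ell)^\theta\pi(t',\ell')^\theta\pi(t'',\ell'')^\theta\big)^{\lambda}\,\mathbb E\Big[\big|\partial^{\rm dis}_{\ell,x,t}\partial^{\rm dis}_{\ell',x',t'}Z\big|^{\frac4{1-\lambda}}\Big]^{\frac{1-\lambda}4}$$ $$\times\,\mathbb E\Big[\big|\partial^{\rm dis}_{\ell,x,t}\partial^{\rm dis}_{\ell'',x'',t''}Z\big|^{\frac4{1-\lambda}}\Big]^{\frac{1-\lambda}4}\,\mathbb E\Big[\big|\partial^{\rm dis}_{\ell',x',t'}Z\big|^{\frac4{1-\lambda}}\Big]^{\frac{1-\lambda}4}\,\mathbb E\Big[\big|\partial^{\rm dis}_{\ell'',x'',t''}Z\big|^{\frac4{1-\lambda}}\Big]^{\frac{1-\lambda}4}\Bigg)^{\frac12},$$ $$S_2(\theta):=\sigma^{-2}\inf_{0<\lambda<1}\Bigg(\sum_{x,x'}\sum_{t,t'}\sum_{\ell,\ell'=1}^\infty\big(\pi(t,\ell)^\theta\pi(t',\ell')^\theta\big)^{\lambda}\,\mathbb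 E\Big[\big|\partial^{\rm dis}_{\ell,x,t}\partial^{\rm dis}_{\ell',x',t'}Z\big|^{\frac4{1-\lambda}}\Big]^{\frac{1-\lambda}2}\,\mathbb E\Big[\big|\partial^{\rm dis}_{\ell',x',t'}Z\big|^{\frac4{1-\lambda}}\Big]^{\frac{1-\lambda}2}\Bigg)^{\frac12},$$ $$S_3:=\sigma^{-2}\inf_{0<\lambda<1}\Bigg(\sum_{x}\sum_t\sum_{\ell=1}^\infty\pi(t,\ell)^{\lambda}\,\mathbb E\Big[\big|\partial^{\rm dis}_{\ell,x,t}Z\big|^{\frac4{1-\lambda}}\Big]^{1-\lambda}\Bigg)^{\frac12},$$ $$S_4:=\sigma^{-3}\inf_{0<\lambda<1}\sum_{x}\sum_t\sum_{\ell=1}^\infty\pi(t,\ell)^{\lambda}\,\mathbb E\Big[\big|\partial^{\rm dis}_{\ell,x,t}Z\big|^{\frac3{1-\lambda}}\Big]^{1-\lambda},$$ $$G_1:=\sigma^{-3}\inf_{0<\lambda<1}\sum_x\sum_t\Bigg(\sum_{\ell=1}^\infty\pi(t,\ell)^\lambda\,\mathbb E\Big[\big|\partial^{\rm dis}_{\ell,x,t}Z\big|^{\frac6{1-\lambda}}\Big]^{1-\lambda}\Bigg)^{\frac12},$$ $$G_2:=\sigma^{-3}\inf_{0<\lambda<1}\sum_x\sum_t\sum_{\ell=1}^\infty\pi(t,\ell)^\lambda\,\mathbb E\Big[\big|\partial^{\rm dis}_{\ell,x,t}Z\big|^{\frac6{1-\lambda}}\Big]^{\frac{1-\lambda}2}.$$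 Then: (i) $\ \mathrm d_{\mathrm W}\big(\sigma^{-1}(Z-\mathbb E[Z]),\mathcal N\big)\lesssim S_1(\tfrac13)+S_2(\tfrac12)+S_3+S_4.$ (ii) $\ \mathrm d_{\mathrm K}\big(\sigma^{-1}(Z-\mathbb E[Z]),\mathcal N\big)\lesssim S_1(\tfrac13)+S_2(\tfrac12)+S_3+S_4+G_1.$ If in addition for all $x,t$ there exists a $\sigma(\mathcal X|_{E_{x,t}},\mathcal X'|_{E_{x,t}})$-measurable action radius $\rho_{x,t}$ for $A(\mathcal X)$ with respect to $\mathcal X$ on $E_{x,t}$, then one has simply $\tilde\rho_{x,t}=\rho_{x,t}$ for all $x,t$, and the bounds improve to $$\mathrm d_{\mathrm W}\big(\sigma^{-1}(Z-\mathbb E[Z]),\mathcal N\big)\lesssim S_1(1)+S_2(1)+S_3+S_4,\qquad \mathrm d_{\mathrm K}\big(\sigma^{-1}(Z-\mathbb E[Z]),\mathcal N\big)\lesssim S_1(1)+S_2(1)+S_3+S_4+G_2.$$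
   Context: Notation. $\lesssim$ means $\le$ up to a positive multiplicative constant that only depends on the dimension $d$ and possibly on other controlled quantities. $\mathcal N$ is a standard normal random variable; $\mathrm d_{\mathrm W}$ and $\mathrm d_{\mathrm K}$ are the $1$-Wasserstein and Kolmogorov distances. $Q:=[-\frac12,\frac12)^d$, $Q(x):=x+Q$, $Q_r(x):=x+rQ$, and $B_\rho$ is the ball of radius $\rho$ centered at $0$ in $\mathbb R^d$. $\mathds{1}$ denotes an indicator function. Complete independence. $\mathcal X$ is a random field defined on a measure space $E$ with values in a measurable space $M$; $E=\biguplus_{x\in\mathbb Z^d,t\in\mathbb Z^l}E_{x,t}$ is a partition, and $\mathcal X$ is completely independent on it if the restrictions $(\mathcal X|_{E_{x,t}})_{x\in\mathbb Z^d,t\in\mathbb Z^l}$ are all independent. (Typical examples: $E=\mathbb R^d\times\mathbb R^l$ with $E_{x,t}=Q^d(x)\times Q^l(t)$, where $Q^k(y):=y+[-\frac12,\frac12)^k$; or $E=\mathbb Z^d\times\mathbb Z^l\times E'$ with $E_{x,t}=\{x\}\times\{t\}\times E'$. The shift $\mathcal X(\cdot+z,\cdot)$, $z\in\mathbb Z^d$, acts on the $\mathbb R^d$- or $\mathbb Z^d$-coordinate.) $A(\mathcal X^B)$ denotes the field obtained by applying to $\mathcal X^B$ the same measurable map $\mathcal X\mapsto A(\mathcal X)$; similarly $Z(A(\mathcal X^B))$ is the measurable function $Z(\cdot)$ evaluated at $A(\mathcal X^B)$. Action radius. Given the i.i.d. copy $\mathcal X'$ of $\mathcal X$, an action radius for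 $A$ with respect to $\mathcal X$ on $E_{x,t}$ (with reference perturbation $\mathcal X'$), if it exists, is a nonnegative $\sigma(\mathcal X,\mathcal X')$-measurable random variable $\rho$ such that a.s. $A(\mathcal X^{x,t})|_{\mathbb R^d\setminus(Q(x)+B_\rho)}=A(\mathcal X)|_{\mathbb R^d\setminus(Q(x)+B_\rho)}$, where $\mathcal X^{x,t}$ equals $\mathcal X$ on $E\setminus E_{x,t}$ and $\mathcal X'$ on $E_{x,t}$. The analogous notion for $A(\mathcal X^B)$ with respect to $\mathcal X^B$ compares $A(\mathcal X^B)$ and $A(\mathcal X^{B\cup\{(x,t)\}})$. Discrete derivatives. For $x,x'\in\mathbb Z^d$, $t,t'\in\mathbb Z^l$, integers $\ell,\ell'\ge1$, $$\partial^{\rm dis}_{\ell,x,t}Z:=\big(Z(A)-Z(A(\mathcal X^{x,t}))\big)\,\mathds{1}_{A(\mathcal X^{x,t})|_{\mathbb R^d\setminus Q_{2\ell+1}(x)}=A|_{\mathbb R^d\setminus Q_{2\ell+1}(x)}},$$ $$\partial^{\rm dis}_{\ell,x,t}\partial^{\rm dis}_{\ell',x',t'}Z:=\big(Z(A)-Z(A(\mathcal X^{x,t}))-Z(A(\mathcal X^{x',t'}))+Z(A(\mathcal X^{x,t;x',t'}))\big)$$ $$\times\mathds{1}_{A(\mathcal X^{x,t})|_{\mathbb R^d\setminus Q_{2\ell+1}(x)}=A|_{\mathbb R^d\setminus Q_{2\ell+1}(x)}}\ \mathds{1}_{A(\mathcal X^{x,t;x',t'})|_{\mathbb R^d\setminus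 Q_{2\ell+1}(x)}=A(\mathcal X^{x',t'})|_{\mathbb R^d\setminus Q_{2\ell+1}(x)}}$$ $$\times\mathds{1}_{A(\mathcal X^{x',t'})|_{\mathbb R^d\setminus Q_{2\ell'+1}(x')}=A|_{\mathbb R^d\setminus Q_{2\ell'+1}(x')}}\ \mathds{1}_{A(\mathcal X^{x,t;x',t'})|_{\mathbb R^d\setminus Q_{2\ell'+1}(x')}=A(\mathcal X^{x,t})|_{\mathbb R^d\setminus Q_{2\ell'+1}(x')}}.$$
   Formalization: (b) is read as: the law of X is shift-invariant and A(X(.+z,.)) = A(X)(.+z) a.s. (equality in law alone makes the claim false); the sup of the radii is assumed measurable and a.s. finite, the coincidence events measurable; the constant is stated per choice of carrier types. *)

theory Defs
  imports "HOL-Probability.Probability"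
begin

section \<open>Distances between laws on the real nine\<close>

text \<open>The 1-Wasserstein distance in its Lipschitz-dual form, as is customary in Stein's method:
  the supremum of the differences of expectations over all 1-Lipschitz test functions.\<close>

definition wasserstein_dist :: "real measure \<Rightarrow> real measure \<Rightarrow> ennreal" where
  "wasserstein_dist \<mu> \<nu> =
     (SUP h\<in>{h :: real \<Rightarrow> real. 1-lipschitz_on UNIV h}.
        ennreal \<bar>(\<integral>u. h u \<partial>\<mu>) - (\<integral>u. h u \<partial>\<nu>)\<bar>)"

definition kolmogorov_dist :: "real measure \<Rightarrow> real measure \<Rightarrow> ennreal" where
  "kolmogorov_dist \<mu> \<nu> = (SUP u. ennreal \<bar>cdf \<mu> u - cdf \<nu> u\<bar>)"

text \<open>Positive real powers on \<^typ>\<open>ennreal\<close>, with \<^term>\<open>\<top>\<close> sent to \<^term>\<open>\<top>\<close>.\<close>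

definition epowr :: "ennreal \<Rightarrow> real \<Rightarrow> ennreal" where
  "epowr a p = (if a = \<top> then \<top> else ennreal (enn2real a powr p))"


section \<open>Cubes\<close>

definition rvec :: "int ^ 'd \<Rightarrow> real ^ 'd" where
  "rvec x = (\<chi> i. of_int (x $ i))"

text \<open>\<open>cube r x = x + r [-1/2, 1/2)\<^sup>d\<close>; \<open>fat_cube x r = x + [-1/2, 1/2)\<^sup>d + B\<^sub>r\<close>. The ball is closed, so
  that a vanishing action radius means that only the values in the unit cube at \<open>x\<close> may change.\<close>

definition cube :: "real \<Rightarrow> int ^ 'd::finite \<Rightarrow> (real ^ 'd) set" where
  "cube r x = {y. \<forall>i. rvec x $ i - r / 2 \<le> y $ i \<and> y $ i < rvec x $ i + r / 2}"

definition fat_cube :: "int ^ 'd::finite \<Rightarrow> real \<Rightarrow> (real ^ 'd) set" where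
  "fat_cube x r = {q + b | q b. q \<in> cube 1 x \<and> b \<in> cball 0 r}"


section \<open>Random fields and their perturbations\<close>

text \<open>
  The random field \<open>\<X>\<close> and its copy \<open>\<X>'\<close> are maps from the probability space to functions
  on (the carrier of) \<open>E\<close> with values in \<open>M\<close>; \<open>A\<close> is the transformation mapping configurations on
  \<open>E\<close> to fields on \<open>\<real>\<^sup>d\<close> with values in the measurable space \<open>V\<close>. Points of \<open>\<int>\<^sup>l\<close> are integer lists of
  length \<open>l\<close>, so that \<open>l\<close> is an ordinary (possibly zero) natural number. Spaces of
  functions carry the product sigma-algebra. The field \<open>shift\<close> is the action of \<open>\<int>\<^sup>d\<close> on \<open>E\<close>,
  \<open>shift z e\<close> standing for the translate of \<open>e\<close> by \<open>z\<close> in the \<open>\<real>\<^sup>d\<close>- or \<open>\<int>\<^sup>d\<close>-coordinate.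
\<close>

record ('w, 'e, 'm, 'v, 'd) field_model =
  PS :: "'w measure"
  ldim :: nat
  base :: "'e measure"
  cell :: "int ^ 'd \<Rightarrow> int list \<Rightarrow> 'e set"
  valM :: "'m measure"
  field_X :: "'w \<Rightarrow> 'e \<Rightarrow> 'm"
  field_X' :: "'w \<Rightarrow> 'e \<Rightarrow> 'm"
  shift :: "int ^ 'd \<Rightarrow> 'e \<Rightarrow> 'e"
  valV :: "'v measure"
  transf :: "('e \<Rightarrow> 'm) \<Rightarrow> real ^ 'd \<Rightarrow> 'v"

definition Zl :: "('w, 'e, 'm, 'v, 'd::finite) field_model \<Rightarrow> int list set" where
  "Zl D = {t. length t = ldim D}"

definition sites :: "('w, 'e, 'm, 'v, 'd::finite) field_model \<Rightarrow> ((int ^ 'd) \<times> int list) set" where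
  "sites D = UNIV \<times> Zl D"

definition confs :: "('w, 'e, 'm, 'v, 'd::finite) field_model \<Rightarrow> ('e \<Rightarrow> 'm) measure" where
  "confs D = PiM (space (base D)) (\<lambda>_. valM D)"

definition out_fields :: "('w, 'e, 'm, 'v, 'd::finite) field_model \<Rightarrow> (real ^ 'd \<Rightarrow> 'v) measure" where
  "out_fields D = PiM UNIV (\<lambda>_. valV D)"

text \<open>\<open>splice D B \<xi> \<eta>\<close> is \<open>\<eta>\<close> on the cells indexed by \<open>B\<close> and \<open>\<xi>\<close> elsewhere;
  \<open>pert D B\<close> is the perturbed field \<open>\<X>\<^sup>B\<close>.\<close>

definition splice ::
  "('w, 'e, 'm, 'v, 'd::finite) field_model \<Rightarrow> ((int ^ 'd) \<times> int list) set
     \<Rightarrow> ('e \<Rightarrow> 'm) \<Rightarrow> ('e \<Rightarrow> 'm) \<Rightarrow> 'e \<Rightarrow> 'm" where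
  "splice D B \<xi> \<eta> = (\<lambda>e. if \<exists>(x, t)\<in>B. e \<in> cell D x t then \<eta> e else \<xi> e)"

definition pert ::
  "('w, 'e, 'm, 'v, 'd::finite) field_model \<Rightarrow> ((int ^ 'd) \<times> int list) set \<Rightarrow> 'w \<Rightarrow> 'e \<Rightarrow> 'm" where
  "pert D B \<omega> = splice D B (field_X D \<omega>) (field_X' D \<omega>)"

definition translate ::
  "('w, 'e, 'm, 'v, 'd::finite) field_model \<Rightarrow> int ^ 'd \<Rightarrow> ('e \<Rightarrow> 'm) \<Rightarrow> 'e \<Rightarrow> 'm" where
  "translate D z \<xi> = (\<lambda>e\<in>space (base D). \<xi> (shift D z e))"

text \<open>The joint law of \<open>(\<X>, \<X>')\<close>, and the sigma-algebras \<open>\<sigma>(\<X>, \<X>')\<close> and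
  \<open>\<sigma>(\<X>|E\<^sub>x\<^sub>,\<^sub>t, \<X>'|E\<^sub>x\<^sub>,\<^sub>t)\<close> on the probability space.\<close>

definition pair_law ::
  "('w, 'e, 'm, 'v, 'd::finite) field_model \<Rightarrow> (('e \<Rightarrow> 'm) \<times> ('e \<Rightarrow> 'm)) measure" where
  "pair_law D =
     distr (PS D) (confs D \<Otimes>\<^sub>M confs D) (\<lambda>\<omega>. (field_X D \<omega>, field_X' D \<omega>))"

definition pair_algebra :: "('w, 'e, 'm, 'v, 'd::finite) field_model \<Rightarrow> 'w measure" where
  "pair_algebra D =
     vimage_algebra (space (PS D)) (\<lambda>\<omega>. (field_X D \<omega>, field_X' D \<omega>)) (confs D \<Otimes>\<^sub>M confs D)"

definition cell_algebra ::
  "('w, 'e, 'm, 'v, 'd::finite) field_model \<Rightarrow> int ^ 'd \<Rightarrow> int list \<Rightarrow> 'w measure" where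
  "cell_algebra D x t =
     vimage_algebra (space (PS D))
       (\<lambda>\<omega>. (restrict (field_X D \<omega>) (cell D x t), restrict (field_X' D \<omega>) (cell D x t)))
       (PiM (cell D x t) (\<lambda>_. valM D) \<Otimes>\<^sub>M PiM (cell D x t) (\<lambda>_. valM D))"


section \<open>Standing assumptions\<close>

definition partitioned_fields :: "('w, 'e, 'm, 'v, 'd::finite) field_model \<Rightarrow> bool" where
  "partitioned_fields D \<longleftrightarrow>
     prob_space (PS D) \<and>
     disjoint_family_on (\<lambda>(x, t). cell D x t) (sites D) \<and>
     (\<Union>(x, t)\<in>sites D. cell D x t) = space (base D) \<and>
     field_X D \<in> PS D \<rightarrow>\<^sub>M confs D \<and>
     transf D \<in> confs D \<rightarrow>\<^sub>M out_fields D"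

definition completely_independent :: "('w, 'e, 'm, 'v, 'd::finite) field_model \<Rightarrow> bool" where
  "completely_independent D \<longleftrightarrow>
     prob_space.indep_vars (PS D)
       (\<lambda>(x, t). PiM (cell D x t) (\<lambda>_. valM D))
       (\<lambda>(x, t) \<omega>. restrict (field_X D \<omega>) (cell D x t)) (sites D)"

definition iid_copy :: "('w, 'e, 'm, 'v, 'd::finite) field_model \<Rightarrow> bool" where
  "iid_copy D \<longleftrightarrow>
     field_X' D \<in> PS D \<rightarrow>\<^sub>M confs D \<and>
     distr (PS D) (confs D) (field_X' D) = distr (PS D) (confs D) (field_X D) \<and>
     prob_space.indep_var (PS D) (confs D) (field_X D) (confs D) (field_X' D)"

definition shift_action :: "('w, 'e, 'm, 'v, 'd::finite) field_model \<Rightarrow> bool" where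
  "shift_action D \<longleftrightarrow>
     (\<forall>e\<in>space (base D). shift D 0 e = e) \<and>
     (\<forall>z z'. \<forall>e\<in>space (base D). shift D (z + z') e = shift D z (shift D z' e)) \<and>
     (\<forall>z x. \<forall>t\<in>Zl D. shift D z ` cell D x t = cell D (x + z) t)"

text \<open>
  Stationarity of the transformation: \<open>\<X>\<close> is stationary and \<open>A\<close> almost surely commutes with
  translations. This contains the equality in law of \<open>A(\<X>(\<cdot>+z,\<cdot>))\<close> and \<open>A(\<X>)(\<cdot>+z)\<close>, see
  \<open>stationary_transformation_same_law\<close>. Equality in law alone would say nothing
  about how the action of \<open>\<X>\<close> on the cells \<open>E\<^sub>x\<^sub>,\<^sub>t\<close>, \<open>x \<noteq> 0\<close>, compares with that on \<open>E\<^sub>0\<^sub>,\<^sub>t\<close>,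
  whereas the weight below only involves the latter. (If \<open>\<X>\<close> is deterministic on the cells with
  \<open>x = 0\<close> and \<open>A(\<X>) = \<X>\<close>, say, the weight vanishes identically.)
\<close>

definition stationary_transformation :: "('w, 'e, 'm, 'v, 'd::finite) field_model \<Rightarrow> bool" where
  "stationary_transformation D \<longleftrightarrow>
     (\<forall>z. distr (PS D) (confs D) (\<lambda>\<omega>. translate D z (field_X D \<omega>))
            = distr (PS D) (confs D) (field_X D) \<and>
          (AE \<xi> in distr (PS D) (confs D) (field_X D).
             transf D (translate D z \<xi>) = (\<lambda>y. transf D \<xi> (y + rvec z))))"

lemma stationary_transformation_same_law:
  assumes "partitioned_fields D" "shift_action D" "stationary_transformation D"
  shows "distr (PS D) (out_fields D) (\<lambda>\<omega>. transf D (translate D z (field_X D \<omega>)))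
       = distr (PS D) (out_fields D) (\<lambda>\<omega> y. transf D (field_X D \<omega>) (y + rvec z))"
proof -
  have X: "field_X D \<in> PS D \<rightarrow>\<^sub>M confs D" and A: "transf D \<in> confs D \<rightarrow>\<^sub>M out_fields D"
    and cov: "(\<Union>(x, t)\<in>sites D. cell D x t) = space (base D)"
    using assms(1) by (auto simp: partitioned_fields_def)
  have sh: "shift D z e \<in> space (base D)" if "e \<in> space (base D)" for e
  proof -
    have "e \<in> (\<Union>(x, t)\<in>sites D. cell D x t)"
      using that cov by simp
    then obtain x t where xt: "t \<in> Zl D" "e \<in> cell D x t"
      by (auto simp: sites_def)
    have "shift D z ` cell D x t = cell D (x + z) t"
      using assms(2) xt(1) by (simp add: shift_action_def)
    then have "shift D z e \<in> cell D (x + z) t"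
      using xt(2) by (metis imageI)
    moreover have "(x + z, t) \<in> sites D"
      using xt(1) by (simp add: sites_def)
    ultimately have "shift D z e \<in> (\<Union>(x, t)\<in>sites D. cell D x t)"
      by (intro UN_I[of "(x + z, t)"]) simp_all
    then show ?thesis
      by (simp only: cov)
  qed
  have T: "translate D z \<in> confs D \<rightarrow>\<^sub>M confs D"
    unfolding translate_def confs_def
    by (rule measurable_restrict) (rule measurable_component_singleton[OF sh])
  have S: "(\<lambda>f y. f (y + rvec z)) \<in> out_fields D \<rightarrow>\<^sub>M out_fields D"
    unfolding out_fields_def by (rule measurable_PiM_single') (auto simp: space_PiM)
  have "AE \<omega> in PS D. transf D (translate D z (field_X D \<omega>))
          = (\<lambda>y. transf D (field_X D \<omega>) (y + rvec z))"
    using assms(3) AE_distrD[OF X] unfolding stationary_transformation_def by blast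
  then show ?thesis
    using measurable_compose[OF measurable_compose[OF X T] A]
      measurable_compose[OF measurable_compose[OF X A] S]
    by (intro distr_cong_AE) auto
qed

text \<open>
  Measurability of the events entering the definitions below: fields on \<open>\<real>\<^sup>d\<close> are compared at
  uncountably many points and need not be regular. The first two items only ask for
  measurability with respect to the completed law of \<open>(\<X>, \<X>')\<close>.
\<close>

definition measurable_events :: "('w, 'e, 'm, 'v, 'd::finite) field_model \<Rightarrow> bool" where
  "measurable_events D \<longleftrightarrow>
     (\<forall>x. \<forall>t\<in>Zl D.
        (\<forall>n::nat. n \<ge> 1 \<longrightarrow>
           {p \<in> space (confs D \<Otimes>\<^sub>M confs D). \<forall>y. y \<notin> cube (2 * real n + 1) x \<longrightarrow>
              transf D (splice D {(x, t)} (fst p) (snd p)) y = transf D (fst p) y}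
             \<in> sets (completion (pair_law D))) \<and>
        (\<forall>r \<in> borel_measurable (confs D \<Otimes>\<^sub>M confs D).
           {p \<in> space (confs D \<Otimes>\<^sub>M confs D). \<forall>y. y \<notin> fat_cube x (r p) \<longrightarrow>
              transf D (splice D {(x, t)} (fst p) (snd p)) y = transf D (fst p) y}
             \<in> sets (completion (pair_law D))) \<and>
        {\<omega> \<in> space (PS D). field_X D \<omega> \<noteq> pert D {(x, t)} \<omega>} \<in> sets (PS D))"

definition admissible_model :: "('w, 'e, 'm, 'v, 'd::finite) field_model \<Rightarrow> bool" where
  "admissible_model D \<longleftrightarrow>
     partitioned_fields D \<and> completely_independent D \<and> iid_copy D \<and>
     shift_action D \<and> stationary_transformation D \<and> measurable_events D"


section \<open>Action radii and weight\<close>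

text \<open>\<open>r\<close> is an action radius for \<open>A(\<X>\<^sup>B)\<close> with respect to \<open>\<X>\<^sup>B\<close> on \<open>E\<^sub>x\<^sub>,\<^sub>t\<close>, with reference
  perturbation \<open>\<X>'\<close>; for \<open>A(\<X>)\<close> itself take \<open>B = {}\<close>.\<close>

definition action_radius ::
  "('w, 'e, 'm, 'v, 'd::finite) field_model \<Rightarrow> ((int ^ 'd) \<times> int list) set
     \<Rightarrow> int ^ 'd \<Rightarrow> int list \<Rightarrow> ('w \<Rightarrow> real) \<Rightarrow> bool" where
  "action_radius D B x t r \<longleftrightarrow>
     r \<in> borel_measurable (pair_algebra D) \<and>
     (\<forall>\<omega>\<in>space (PS D). 0 \<le> r \<omega>) \<and>
     (AE \<omega> in PS D. \<forall>y. y \<notin> fat_cube x (r \<omega>) \<longrightarrow>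
        transf D (pert D (insert (x, t) B) \<omega>) y = transf D (pert D B \<omega>) y)"

definition sup_radius ::
  "('w, 'e, 'm, 'v, 'd::finite) field_model
     \<Rightarrow> (int ^ 'd \<Rightarrow> int list \<Rightarrow> ((int ^ 'd) \<times> int list) set \<Rightarrow> 'w \<Rightarrow> real)
     \<Rightarrow> int ^ 'd \<Rightarrow> int list \<Rightarrow> 'w \<Rightarrow> ennreal" where
  "sup_radius D \<rho> x t \<omega> = (SUP B\<in>Pow (sites D). ennreal (\<rho> x t B \<omega>))"

text \<open>The supremum over the uncountably many \<open>B\<close> is required to be again a \<open>\<sigma>(\<X>, \<X>')\<close>-measurable,
  almost surely finite random variable; were it infinite, the weight would vanish.\<close>

definition radius_family ::
  "('w, 'e, 'm, 'v, 'd::finite) field_model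
     \<Rightarrow> (int ^ 'd \<Rightarrow> int list \<Rightarrow> ((int ^ 'd) \<times> int list) set \<Rightarrow> 'w \<Rightarrow> real) \<Rightarrow> bool" where
  "radius_family D \<rho> \<longleftrightarrow>
     (\<forall>x. \<forall>t\<in>Zl D.
        (\<forall>B\<subseteq>sites D. action_radius D B x t (\<rho> x t B)) \<and>
        sup_radius D \<rho> x t \<in> borel_measurable (pair_algebra D) \<and>
        (AE \<omega> in PS D. sup_radius D \<rho> x t \<omega> < \<top>))"

definition local_radii ::
  "('w, 'e, 'm, 'v, 'd::finite) field_model \<Rightarrow> (int ^ 'd \<Rightarrow> int list \<Rightarrow> 'w \<Rightarrow> real) \<Rightarrow> bool" where
  "local_radii D r \<longleftrightarrow>
     (\<forall>x. \<forall>t\<in>Zl D. action_radius D {} x t (r x t) \<and>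
        r x t \<in> borel_measurable (cell_algebra D x t))"

definition weight ::
  "('w, 'e, 'm, 'v, 'd::finite) field_model
     \<Rightarrow> (int ^ 'd \<Rightarrow> int list \<Rightarrow> ((int ^ 'd) \<times> int list) set \<Rightarrow> 'w \<Rightarrow> real)
     \<Rightarrow> int list \<Rightarrow> nat \<Rightarrow> real" where
  "weight D \<rho> t n =
     \<P>(\<omega> in PS D. ennreal (real n - 1) \<le> sup_radius D \<rho> 0 t \<omega> \<and>
        sup_radius D \<rho> 0 t \<omega> < ennreal (real n) \<and> field_X D \<omega> \<noteq> pert D {(0, t)} \<omega>)"


section \<open>The random variable and its discrete derivatives\<close>

text \<open>\<open>\<zeta>\<close> is the measurable function on fields representing the \<open>\<sigma>(A)\<close>-measurable random variable,
  and \<open>Zpert D \<zeta> B = Z(A(\<X>\<^sup>B))\<close>.\<close>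

definition Zpert ::
  "('w, 'e, 'm, 'v, 'd::finite) field_model \<Rightarrow> ((real ^ 'd \<Rightarrow> 'v) \<Rightarrow> real)
     \<Rightarrow> ((int ^ 'd) \<times> int list) set \<Rightarrow> 'w \<Rightarrow> real" where
  "Zpert D \<zeta> B \<omega> = \<zeta> (transf D (pert D B \<omega>))"

definition Zvar ::
  "('w, 'e, 'm, 'v, 'd::finite) field_model \<Rightarrow> ((real ^ 'd \<Rightarrow> 'v) \<Rightarrow> real) \<Rightarrow> 'w \<Rightarrow> real" where
  "Zvar D \<zeta> \<omega> = \<zeta> (transf D (field_X D \<omega>))"

definition Zmean ::
  "('w, 'e, 'm, 'v, 'd::finite) field_model \<Rightarrow> ((real ^ 'd \<Rightarrow> 'v) \<Rightarrow> real) \<Rightarrow> real" where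
  "Zmean D \<zeta> = (\<integral>\<omega>. Zvar D \<zeta> \<omega> \<partial>PS D)"

definition Zsigma ::
  "('w, 'e, 'm, 'v, 'd::finite) field_model \<Rightarrow> ((real ^ 'd \<Rightarrow> 'v) \<Rightarrow> real) \<Rightarrow> real" where
  "Zsigma D \<zeta> = sqrt (\<integral>\<omega>. (Zvar D \<zeta> \<omega> - Zmean D \<zeta>)\<^sup>2 \<partial>PS D)"

definition admissible_Z ::
  "('w, 'e, 'm, 'v, 'd::finite) field_model \<Rightarrow> ((real ^ 'd \<Rightarrow> 'v) \<Rightarrow> real) \<Rightarrow> bool" where
  "admissible_Z D \<zeta> \<longleftrightarrow>
     \<zeta> \<in> borel_measurable (out_fields D) \<and>
     integrable (PS D) (\<lambda>\<omega>. (Zvar D \<zeta> \<omega>)\<^sup>2) \<and> 0 < Zsigma D \<zeta>"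

definition normalized_law ::
  "('w, 'e, 'm, 'v, 'd::finite) field_model \<Rightarrow> ((real ^ 'd \<Rightarrow> 'v) \<Rightarrow> real) \<Rightarrow> real measure" where
  "normalized_law D \<zeta> =
     distr (PS D) borel (\<lambda>\<omega>. (Zvar D \<zeta> \<omega> - Zmean D \<zeta>) / Zsigma D \<zeta>)"

text \<open>\<open>agree D R B B' \<omega>\<close>: the realizations of \<open>A(\<X>\<^sup>B)\<close> and \<open>A(\<X>\<^sup>B\<^sup>')\<close> coincide outside \<open>R\<close>.\<close>

definition agree ::
  "('w, 'e, 'm, 'v, 'd::finite) field_model \<Rightarrow> (real ^ 'd) set
     \<Rightarrow> ((int ^ 'd) \<times> int list) set \<Rightarrow> ((int ^ 'd) \<times> int list) set \<Rightarrow> 'w \<Rightarrow> bool" where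
  "agree D R B B' \<omega> \<longleftrightarrow> (\<forall>y. y \<notin> R \<longrightarrow> transf D (pert D B \<omega>) y = transf D (pert D B' \<omega>) y)"

definition deriv1 ::
  "('w, 'e, 'm, 'v, 'd::finite) field_model \<Rightarrow> ((real ^ 'd \<Rightarrow> 'v) \<Rightarrow> real)
     \<Rightarrow> (int ^ 'd) \<times> int list \<times> nat \<Rightarrow> 'w \<Rightarrow> real" where
  "deriv1 D \<zeta> = (\<lambda>(x, t, n) \<omega>.
     (Zpert D \<zeta> {} \<omega> - Zpert D \<zeta> {(x, t)} \<omega>)
       * of_bool (agree D (cube (2 * real n + 1) x) {(x, t)} {} \<omega>))"

definition deriv2 ::
  "('w, 'e, 'm, 'v, 'd::finite) field_model \<Rightarrow> ((real ^ 'd \<Rightarrow> 'v) \<Rightarrow> real)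
     \<Rightarrow> (int ^ 'd) \<times> int list \<times> nat \<Rightarrow> (int ^ 'd) \<times> int list \<times> nat \<Rightarrow> 'w \<Rightarrow> real" where
  "deriv2 D \<zeta> = (\<lambda>(x, t, n) (x', t', n') \<omega>.
     (Zpert D \<zeta> {} \<omega> - Zpert D \<zeta> {(x, t)} \<omega> - Zpert D \<zeta> {(x', t')} \<omega>
        + Zpert D \<zeta> {(x, t), (x', t')} \<omega>)
       * of_bool (agree D (cube (2 * real n + 1) x) {(x, t)} {} \<omega>)
       * of_bool (agree D (cube (2 * real n + 1) x) {(x, t), (x', t')} {(x', t')} \<omega>)
       * of_bool (agree D (cube (2 * real n' + 1) x') {(x', t')} {} \<omega>)
       * of_bool (agree D (cube (2 * real n' + 1) x') {(x, t), (x', t')} {(x, t)} \<omega>))"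

definition abs_moment :: "'w measure \<Rightarrow> real \<Rightarrow> ('w \<Rightarrow> real) \<Rightarrow> ennreal" where
  "abs_moment P q f = (\<integral>\<^sup>+ \<omega>. ennreal (\<bar>f \<omega>\<bar> powr q) \<partial>P)"


section \<open>The bounds\<close>

text \<open>Indices \<open>(x, t, n)\<close> of the sums. All quantities take values in \<^typ>\<open>ennreal\<close>, where
  \<^term>\<open>0 * (\<top> :: ennreal) = 0\<close>.\<close>

definition idx ::
  "('w, 'e, 'm, 'v, 'd::finite) field_model \<Rightarrow> ((int ^ 'd) \<times> int list \<times> nat) set" where
  "idx D = UNIV \<times> Zl D \<times> {1..}"

definition idx_weight ::
  "('w, 'e, 'm, 'v, 'd::finite) field_model
     \<Rightarrow> (int ^ 'd \<Rightarrow> int list \<Rightarrow> ((int ^ 'd) \<times> int list) set \<Rightarrow> 'w \<Rightarrow> real)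
     \<Rightarrow> (int ^ 'd) \<times> int list \<times> nat \<Rightarrow> real" where
  "idx_weight D \<rho> = (\<lambda>(x, t, n). weight D \<rho> t n)"

definition S1 ::
  "('w, 'e, 'm, 'v, 'd::finite) field_model
     \<Rightarrow> (int ^ 'd \<Rightarrow> int list \<Rightarrow> ((int ^ 'd) \<times> int list) set \<Rightarrow> 'w \<Rightarrow> real)
     \<Rightarrow> ((real ^ 'd \<Rightarrow> 'v) \<Rightarrow> real) \<Rightarrow> real \<Rightarrow> ennreal" where
  "S1 D \<rho> \<zeta> \<theta> = ennreal (1 / Zsigma D \<zeta> ^ 2) *
     (INF lam\<in>{0<..<1}. epowr
        (\<Sum>\<^sub>\<infinity>(i, i', i'')\<in>idx D \<times> idx D \<times> idx D.
           ennreal ((idx_weight D \<rho> i powr \<theta> * idx_weight D \<rho> i' powr \<theta>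
                       * idx_weight D \<rho> i'' powr \<theta>) powr lam)
           * epowr (abs_moment (PS D) (4 / (1 - lam)) (deriv2 D \<zeta> i i')) ((1 - lam) / 4)
           * epowr (abs_moment (PS D) (4 / (1 - lam)) (deriv2 D \<zeta> i i'')) ((1 - lam) / 4)
           * epowr (abs_moment (PS D) (4 / (1 - lam)) (deriv1 D \<zeta> i')) ((1 - lam) / 4)
           * epowr (abs_moment (PS D) (4 / (1 - lam)) (deriv1 D \<zeta> i'')) ((1 - lam) / 4))
        (1 / 2))"

definition S2 ::
  "('w, 'e, 'm, 'v, 'd::finite) field_model
     \<Rightarrow> (int ^ 'd \<Rightarrow> int list \<Rightarrow> ((int ^ 'd) \<times> int list) set \<Rightarrow> 'w \<Rightarrow> real)
     \<Rightarrow> ((real ^ 'd \<Rightarrow> 'v) \<Rightarrow> real) \<Rightarrow> real \<Rightarrow> ennreal" where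
  "S2 D \<rho> \<zeta> \<theta> = ennreal (1 / Zsigma D \<zeta> ^ 2) *
     (INF lam\<in>{0<..<1}. epowr
        (\<Sum>\<^sub>\<infinity>(i, i')\<in>idx D \<times> idx D.
           ennreal ((idx_weight D \<rho> i powr \<theta> * idx_weight D \<rho> i' powr \<theta>) powr lam)
           * epowr (abs_moment (PS D) (4 / (1 - lam)) (deriv2 D \<zeta> i i')) ((1 - lam) / 2)
           * epowr (abs_moment (PS D) (4 / (1 - lam)) (deriv1 D \<zeta> i')) ((1 - lam) / 2))
        (1 / 2))"

definition S3 ::
  "('w, 'e, 'm, 'v, 'd::finite) field_model
     \<Rightarrow> (int ^ 'd \<Rightarrow> int list \<Rightarrow> ((int ^ 'd) \<times> int list) set \<Rightarrow> 'w \<Rightarrow> real)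
     \<Rightarrow> ((real ^ 'd \<Rightarrow> 'v) \<Rightarrow> real) \<Rightarrow> ennreal" where
  "S3 D \<rho> \<zeta> = ennreal (1 / Zsigma D \<zeta> ^ 2) *
     (INF lam\<in>{0<..<1}. epowr
        (\<Sum>\<^sub>\<infinity>i\<in>idx D. ennreal (idx_weight D \<rho> i powr lam)
           * epowr (abs_moment (PS D) (4 / (1 - lam)) (deriv1 D \<zeta> i)) (1 - lam))
        (1 / 2))"

definition S4 ::
  "('w, 'e, 'm, 'v, 'd::finite) field_model
     \<Rightarrow> (int ^ 'd \<Rightarrow> int list \<Rightarrow> ((int ^ 'd) \<times> int list) set \<Rightarrow> 'w \<Rightarrow> real)
     \<Rightarrow> ((real ^ 'd \<Rightarrow> 'v) \<Rightarrow> real) \<Rightarrow> ennreal" where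
  "S4 D \<rho> \<zeta> = ennreal (1 / Zsigma D \<zeta> ^ 3) *
     (INF lam\<in>{0<..<1}.
        \<Sum>\<^sub>\<infinity>i\<in>idx D. ennreal (idx_weight D \<rho> i powr lam)
          * epowr (abs_moment (PS D) (3 / (1 - lam)) (deriv1 D \<zeta> i)) (1 - lam))"

definition G1 ::
  "('w, 'e, 'm, 'v, 'd::finite) field_model
     \<Rightarrow> (int ^ 'd \<Rightarrow> int list \<Rightarrow> ((int ^ 'd) \<times> int list) set \<Rightarrow> 'w \<Rightarrow> real)
     \<Rightarrow> ((real ^ 'd \<Rightarrow> 'v) \<Rightarrow> real) \<Rightarrow> ennreal" where
  "G1 D \<rho> \<zeta> = ennreal (1 / Zsigma D \<zeta> ^ 3) *
     (INF lam\<in>{0<..<1}.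
        \<Sum>\<^sub>\<infinity>(x, t)\<in>sites D. epowr
          (\<Sum>\<^sub>\<infinity>n\<in>{1..}. ennreal (weight D \<rho> t n powr lam)
             * epowr (abs_moment (PS D) (6 / (1 - lam)) (deriv1 D \<zeta> (x, t, n))) (1 - lam))
          (1 / 2))"

definition G2 ::
  "('w, 'e, 'm, 'v, 'd::finite) field_model
     \<Rightarrow> (int ^ 'd \<Rightarrow> int list \<Rightarrow> ((int ^ 'd) \<times> int list) set \<Rightarrow> 'w \<Rightarrow> real)
     \<Rightarrow> ((real ^ 'd \<Rightarrow> 'v) \<Rightarrow> real) \<Rightarrow> ennreal" where
  "G2 D \<rho> \<zeta> = ennreal (1 / Zsigma D \<zeta> ^ 3) *
     (INF lam\<in>{0<..<1}.
        \<Sum>\<^sub>\<infinity>i\<in>idx D. ennreal (idx_weight D \<rho> i powr lam)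
          * epowr (abs_moment (PS D) (6 / (1 - lam)) (deriv1 D \<zeta> i)) ((1 - lam) / 2))"

end

theory Submission
  imports Defs
begin

text \<open>
  Enumerate the sites and glue the independent cells together, so that \<open>Z\<close> becomes a square
  integrable function of countably many independent coordinates. Replacing the coordinates one by
  one by those of an independent copy gives a Stein pair whose discrepancy splits into a fluctuation
  of \<open>\<Sum>\<^sub>i D\<^sub>i Z \<cdot> D\<^sub>i Z'\<close> and a third order term. The Efron--Stein inequality bounds the former by
  first and second differences. Each difference is then decomposed according to the scale of
  the action radius: on the event that the radius is below \<open>n\<close> it coincides with the discrete derivative at
  scale \<open>n\<close>, and Hoelder's inequality separates the probability of that event, which is the weight. Triple
  products of such events cost the power \<open>1/3\<close> of the weights in general, while for local radii the events at
  distinct sites are independent.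
\<close>

section \<open>Independent copies over countably many sites\<close>

text \<open>All copies live on one space \<open>Q\<close> indexed by (copy, site): copies 0 and 1
  form the Stein pair, copies 2 and 3 a second pair for the Efron-Stein step. Exchanging copies on a
  set of sites preserves \<open>Q\<close>, so exchangeability arguments become relabellings. Three
  obstacles shape the rest. For the Kolmogorov distance the derivative of the Stein solution jumps;
  the jump term has a definite sign, and an exchange at one site turns its expectation into that of
  an indicator times a summand of \<Sum> u |v|, whose variance obeys the same bound as that of
  \<Sum> u v. Next, the event that two values at a site differ need not be measurable in the
  product; its place is taken by the measurable event that exchanging the values influences the
  functional. Finally, the weight only sees the origin, so the radii at other sites are obtained by
  translating those at the origin, and differences at a perturbed field X^B are reduced to
  differences at X by exchanging X and X' on B, which preserves their joint law.\<close>

lemma discriminant_le: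
  fixes a b c :: real
  assumes q: "\<And>t. 0 \<le> a - 2 * t * c + t\<^sup>2 * b" and b: "b \<ge> 0"
  shows "c\<^sup>2 \<le> a * b"
proof (cases "b = 0")
  case True
  have "c = 0"
  proof (rule ccontr)
    assume "c \<noteq> 0"
    \<comment> \<open>For b = 0 the quadratic is affine in t; this t gives it the value -1.\<close>
    then show False using q[of "(a + 1) / (2 * c)"] True by simp
  qed
  then show ?thesis using True by simp
next
  case False
  then have "b > 0" using b by linarith
  have "a - 2 * (c / b) * c + (c / b)\<^sup>2 * b = a - c\<^sup>2 / b"
    using False by (simp add: power2_eq_square field_simps)
  then have "c\<^sup>2 / b \<le> a" using q[of "c / b"] by linarith
  then show ?thesis using \<open>b > 0\<close> by (simp add: pos_divide_le_eq)
qed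

locale site_copies =
  fixes M :: "nat \<Rightarrow> 'a measure"
  assumes prob_M: "\<And>i. prob_space (M i)"
begin

definition P :: "(nat \<Rightarrow> 'a) measure" where "P = PiM UNIV M"
text \<open>The coordinate (c, i) is copy c of site i. Infinitely many copies are kept on one space,
  so that every configuration occurring later is a selection \<open>sel s\<close> of copies, and
  resampling permutes coordinates instead of enlarging the probability space.\<close>

definition Q :: "(nat \<times> nat \<Rightarrow> 'a) measure" where "Q = PiM UNIV (\<lambda>k. M (snd k))"
definition sel :: "(nat \<Rightarrow> nat) \<Rightarrow> (nat \<times> nat \<Rightarrow> 'a) \<Rightarrow> nat \<Rightarrow> 'a"
  where "sel s \<omega> = (\<lambda>i. \<omega> (s i, i))"
definition relabel :: "(nat \<Rightarrow> nat \<Rightarrow> nat) \<Rightarrow> (nat \<times> nat \<Rightarrow> 'a) \<Rightarrow> nat \<times> nat \<Rightarrow> 'a"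
  where "relabel p \<omega> = (\<lambda>k. \<omega> (p (snd k) (fst k), snd k))"
text \<open>For an involution \<open>\<tau>\<close> this exchanges copies at the sites of
  \<open>A\<close>: the same map is a resampling of these sites and a symmetry of
  \<open>Q\<close>.\<close>

definition resamp :: "(nat \<Rightarrow> nat) \<Rightarrow> nat set \<Rightarrow> (nat \<times> nat \<Rightarrow> 'a) \<Rightarrow> nat \<times> nat \<Rightarrow> 'a"
  where "resamp \<tau> A = relabel (\<lambda>i. if i \<in> A then \<tau> else id)"

sublocale P: prob_space P
  unfolding P_def by (rule prob_space_PiM) (rule prob_M)
sublocale Q: prob_space Q
  unfolding Q_def by (rule prob_space_PiM) (rule prob_M)

lemma coord_measurable [measurable]: "(\<lambda>\<omega>. \<omega> (c, i)) \<in> Q \<rightarrow>\<^sub>M M i"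
  unfolding Q_def using measurable_component_singleton[of "(c,i)" UNIV "\<lambda>k. M (snd k)"] by simp

lemma sel_measurable [measurable]: "sel s \<in> Q \<rightarrow>\<^sub>M P"
  unfolding P_def sel_def by (rule measurable_abs_UNIV) measurable

lemma relabel_measurable [measurable]: "relabel p \<in> Q \<rightarrow>\<^sub>M Q"
proof -
  have "(\<lambda>\<omega> k. \<omega> (p (snd k) (fst k), snd k)) \<in> Q \<rightarrow>\<^sub>M PiM UNIV (\<lambda>k. M (snd k))"
    by (rule measurable_abs_UNIV) measurable
  then show ?thesis
    unfolding relabel_def[abs_def] Q_def[symmetric] .
qed

lemma resamp_measurable [measurable]: "resamp p A \<in> Q \<rightarrow>\<^sub>M Q"
  unfolding resamp_def by measurable

text \<open>The map i -> (s i, i) is injective however the copies are mixed, so every selection has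
  the law of a single configuration.\<close>

lemma distr_sel: "distr Q P (sel s) = P"
  using distr_PiM_reindex[of UNIV "\<lambda>k. M (snd k)" "\<lambda>i. (s i, i)" UNIV] prob_M
  by (simp add: P_def Q_def sel_def[abs_def] inj_on_def restrict_def)

lemma distr_relabel:
  assumes "\<And>i. inj (p i)"
  shows "distr Q Q (relabel p) = Q"
proof -
  have "inj (\<lambda>k. (p (snd k) (fst k), snd k))"
    using assms by (auto simp: inj_def)
  from distr_PiM_reindex[OF _ this, of UNIV "\<lambda>k. M (snd k)"] show ?thesis
    using prob_M by (simp add: Q_def relabel_def[abs_def] restrict_def)
qed

lemma distr_resamp:
  assumes "inj \<tau>" shows "distr Q Q (resamp \<tau> A) = Q"
  unfolding resamp_def by (rule distr_relabel) (simp add: assms)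

lemma sel_resamp: "sel s (resamp \<tau> A \<omega>) = sel (\<lambda>i. if i \<in> A then \<tau> (s i) else s i) \<omega>"
  by (auto simp: resamp_def relabel_def fun_eq_iff sel_def)

lemma nn_integral_resamp:
  "inj \<tau> \<Longrightarrow> g \<in> borel_measurable Q \<Longrightarrow> (\<integral>\<^sup>+\<omega>. g (resamp \<tau> A \<omega>) \<partial>Q) = (\<integral>\<^sup>+\<omega>. g \<omega> \<partial>Q)"
  by (subst (2) distr_resamp[of \<tau> A, symmetric]) (simp_all add: nn_integral_distr)

lemma integral_resamp:
  fixes g :: "_ \<Rightarrow> real"
  shows "inj \<tau> \<Longrightarrow> g \<in> borel_measurable Q \<Longrightarrow> (\<integral>\<omega>. g (resamp \<tau> A \<omega>) \<partial>Q) = (\<integral>\<omega>. g \<omega> \<partial>Q)"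
  by (subst (2) distr_resamp[of \<tau> A, symmetric]) (simp_all add: integral_distr)

lemma integrable_resamp:
  fixes g :: "_ \<Rightarrow> real"
  assumes "inj \<tau>" "integrable Q g" shows "integrable Q (\<lambda>\<omega>. g (resamp \<tau> A \<omega>))"
proof (rule integrable_distr[of _ Q Q])
  show "integrable (distr Q Q (resamp \<tau> A)) g"
    using assms by (simp add: distr_resamp)
qed measurable

lemma indep_coords: "Q.indep_vars (\<lambda>k. M (snd k)) (\<lambda>k \<omega>. \<omega> k) UNIV"
proof -
  have 1: "(\<lambda>\<omega>. \<omega> k) \<in> Q \<rightarrow>\<^sub>M M (snd k)" for k
    using coord_measurable[of "fst k" "snd k"] by simp
  have 2: "distr Q (M (snd k)) (\<lambda>\<omega>. \<omega> k) = M (snd k)" for k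
    unfolding Q_def by (rule distr_PiM_component) (auto intro: prob_M)
  show ?thesis
    by (subst Q.indep_vars_iff_distr_eq_PiM) (simp_all add: 1 2, simp add: Q_def restrict_def distr_id2)
qed

text \<open>A function of the coordinates in \<open>A\<close> is given extensionally, through its invariance under
  changes outside \<open>A\<close>.\<close>

lemma indep_disjoint:
  assumes F: "F \<in> Q \<rightarrow>\<^sub>M N1" and G: "G \<in> Q \<rightarrow>\<^sub>M N2" and AB: "A \<inter> B = {}"
    and depF: "\<And>\<omega> \<omega>'. (\<And>k. k \<in> A \<Longrightarrow> \<omega> k = \<omega>' k) \<Longrightarrow> F \<omega> = F \<omega>'"
    and depG: "\<And>\<omega> \<omega>'. (\<And>k. k \<in> B \<Longrightarrow> \<omega> k = \<omega>' k) \<Longrightarrow> G \<omega> = G \<omega>'"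
  shows "Q.indep_var N1 F N2 G"
proof -
  let ?M = "\<lambda>k::nat\<times>nat. M (snd k)"
  obtain c where c: "c \<in> space Q" using Q.not_empty by blast
  \<comment> \<open>\<open>E A\<close> extends a configuration on \<open>A\<close> by the fixed
    values \<open>c\<close>. As \<open>F\<close> only sees \<open>A\<close>, it factors through the
    restriction to \<open>A\<close>, which is the form that \<open>indep_var_restrict\<close>
    handles.\<close>
  define E where "E A x = (\<lambda>k. if k \<in> A then x k else c k)" for A and x :: "nat \<times> nat \<Rightarrow> 'a"
  have ck: "c k \<in> space (?M k)" for k
    using c by (auto simp: Q_def space_PiM)
  have E: "E A \<in> PiM A ?M \<rightarrow>\<^sub>M Q" for A
    unfolding Q_def E_def
  proof (rule measurable_abs_UNIV)
    fix k show "(\<lambda>x. if k \<in> A then x k else c k) \<in> PiM A ?M \<rightarrow>\<^sub>M ?M k"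
      by (cases "k \<in> A") (simp_all add: ck)
  qed
  have "Q.indep_var (PiM A ?M) (\<lambda>\<omega>. restrict (\<lambda>i. \<omega> i) A) (PiM B ?M) (\<lambda>\<omega>. restrict (\<lambda>i. \<omega> i) B)"
    by (rule Q.indep_var_restrict[OF indep_coords AB]) auto
  from Q.indep_var_compose[OF this measurable_compose[OF E F] measurable_compose[OF E G]]
  have "Q.indep_var N1 (\<lambda>\<omega>. F (E A (restrict \<omega> A))) N2 (\<lambda>\<omega>. G (E B (restrict \<omega> B)))"
    by (simp add: comp_def)
  moreover have "F (E A (restrict \<omega> A)) = F \<omega>" "G (E B (restrict \<omega> B)) = G \<omega>" for \<omega>
    by (auto intro!: depF depG simp: E_def)
  ultimately show ?thesis by simp
qed

text \<open>The two selections read disjoint sets of coordinates. Hence a statement on the law of an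
  independent pair of configurations may be read in any two selections that differ at every
  site.\<close>

lemma distr_sel_pair:
  assumes "\<And>i. s i \<noteq> t i"
  shows "distr Q (P \<Otimes>\<^sub>M P) (\<lambda>\<omega>. (sel s \<omega>, sel t \<omega>)) = P \<Otimes>\<^sub>M P"
proof -
  have "Q.indep_var P (sel s) P (sel t)"
  proof (rule indep_disjoint[where A="range (\<lambda>i. (s i, i))" and B="range (\<lambda>i. (t i, i))"])
    show "range (\<lambda>i. (s i, i)) \<inter> range (\<lambda>i. (t i, i)) = {}"
      using assms by auto
  qed (auto simp: sel_def fun_eq_iff)
  then show ?thesis
    by (simp add: Q.indep_var_distribution_eq distr_sel)
qed

lemma nn_integral_sel_pair:
  assumes "\<And>i. s i \<noteq> t i" "g \<in> borel_measurable (P \<Otimes>\<^sub>M P)"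
  shows "(\<integral>\<^sup>+\<omega>. g (sel s \<omega>, sel t \<omega>) \<partial>Q) = (\<integral>\<^sup>+p. g p \<partial>(P \<Otimes>\<^sub>M P))"
  by (subst distr_sel_pair[of s t, symmetric])
     (use assms in \<open>simp_all add: nn_integral_distr\<close>)


subsection \<open>Continuity in \<open>L\<^sup>2\<close> of partial resampling\<close>

text \<open>The sets with this property form a sigma-algebra. It contains the generators, since
  these depend on a single coordinate and are treated alike by both resamplings once n exceeds its
  site.\<close>

lemma resamp_sets_tendsto:
  assumes \<tau>: "inj \<tau>" and A: "A \<in> sets Q"
  shows "(\<lambda>n. measure Q {\<omega>\<in>space Q. (resamp \<tau> {..<n} \<omega> \<in> A) \<noteq> (resamp \<tau> UNIV \<omega> \<in> A)}) \<longlonglongrightarrow> 0"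
    (is "(\<lambda>n. ?d n A) \<longlonglongrightarrow> 0")
proof -
  let ?G = "{{f\<in>\<Pi>\<^sub>E i\<in>UNIV. space (M (snd i)). f i \<in> B} | i B. i \<in> (UNIV::(nat\<times>nat) set) \<and> B \<in> sets (M (snd i))}"
  have sp: "(\<Pi>\<^sub>E i\<in>UNIV. space (M (snd i))) = space Q" by (simp add: Q_def space_PiM)
  have sQ: "sets Q = sigma_sets (space Q) ?G"
    unfolding Q_def by (subst sets_PiM_single) (simp add: space_PiM)
  have [measurable]: "{\<omega>\<in>space Q. (resamp \<tau> {..<n} \<omega> \<in> B) \<noteq> (resamp \<tau> UNIV \<omega> \<in> B)} \<in> sets Q"
    if [measurable]: "B \<in> sets Q" for B n
    by measurable
  have pres: "measure Q {\<omega>\<in>space Q. resamp \<tau> C \<omega> \<in> B} = measure Q B" if [measurable]: "B \<in> sets Q" for B C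
  proof -
    have "measure Q B = measure (distr Q Q (resamp \<tau> C)) B" by (simp add: distr_resamp \<tau>)
    also have "\<dots> = measure Q (resamp \<tau> C -` B \<inter> space Q)" by (rule measure_distr) auto
    also have "resamp \<tau> C -` B \<inter> space Q = {\<omega>\<in>space Q. resamp \<tau> C \<omega> \<in> B}" by auto
    finally show ?thesis by simp
  qed
  have "A \<in> sigma_sets (space Q) ?G" using A sQ by simp
  then show ?thesis
  proof (induction rule: sigma_sets.induct)
    case (Basic a)
    then obtain k B where a: "a = {f \<in> space Q. f k \<in> B}" "B \<in> sets (M (snd k))"
      unfolding sp by blast
    have "eventually (\<lambda>n. ?d n a = 0) sequentially"
      using eventually_gt_at_top[of "snd k"]
    proof eventually_elim
      case (elim n)
      have *: "(resamp \<tau> {..<n} \<omega> \<in> a) = (resamp \<tau> UNIV \<omega> \<in> a)" if "\<omega> \<in> space Q" for \<omega>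
      proof -
        have "resamp \<tau> C \<omega> \<in> space Q" for C
          using that by (rule measurable_space[OF resamp_measurable])
        moreover have "resamp \<tau> {..<n} \<omega> k = resamp \<tau> UNIV \<omega> k"
          using elim by (simp add: resamp_def relabel_def)
        ultimately show ?thesis
          by (simp add: a)
      qed
      show ?case
        by (simp add: * cong: conj_cong)
    qed
    then show ?case by (rule tendsto_eventually)
  next
    case Empty show ?case by simp
  next
    case (Compl a)
    have "?d n (space Q - a) = ?d n a" for n
      using measurable_space[OF resamp_measurable]
      by (intro arg_cong[where f="measure Q"]) auto
    then show ?case using Compl.IH by simp
  next
    case (Union a)
    have aQ[measurable]: "a k \<in> sets Q" for k using Union.hyps sQ by simp
    define U where "U K = (\<Union>k<K. a k)" for K
    have [measurable]: "U K \<in> sets Q" for K unfolding U_def by measurable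
    let ?V = "\<Union>k. a k"
    have incU: "incseq U" unfolding U_def by (intro incseq_SucI UN_mono) auto
    have UV: "(\<Union>K. U K) = ?V" by (auto simp: U_def)
    have "(\<lambda>K. measure Q (U K)) \<longlonglongrightarrow> measure Q ?V"
      using Q.finite_Lim_measure_incseq[OF _ incU] unfolding UV by (auto intro: \<open>\<And>K. U K \<in> sets Q\<close>)
    then have lim: "(\<lambda>K. measure Q ?V - measure Q (U K)) \<longlonglongrightarrow> 0"
      using tendsto_diff[OF tendsto_const[of "measure Q ?V"]] by fastforce
    show ?case
    proof (rule LIMSEQ_I)
      fix e :: real assume e: "e > 0"
      have "eventually (\<lambda>K. measure Q ?V - measure Q (U K) < e / 4) sequentially"
        using order_tendstoD(2)[OF lim, of "e/4"] e by simp
      then obtain K where K: "measure Q ?V - measure Q (U K) < e / 4"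
        by (auto simp: eventually_sequentially)
      have diff: "measure Q (?V - U K) < e / 4"
        using K incU by (subst Q.finite_measure_Diff) (auto simp: U_def)
      \<comment> \<open>A discrepancy for the union is one for some \<open>a k\<close> with k < K,
        unless one of the two resampled points lies in the remainder \<open>?V - U K\<close>. Each
        of these last events has the probability of the remainder, because resampling preserves
        \<open>Q\<close>.\<close>
      have bound: "?d n ?V \<le> (\<Sum>k<K. ?d n (a k)) + 2 * measure Q (?V - U K)" for n
      proof -
        let ?S = "\<Union>k<K. {\<omega>\<in>space Q. (resamp \<tau> {..<n} \<omega> \<in> a k) \<noteq> (resamp \<tau> UNIV \<omega> \<in> a k)}"
        let ?T = "\<lambda>C. {\<omega>\<in>space Q. resamp \<tau> C \<omega> \<in> ?V - U K}"
        have "?d n ?V \<le> measure Q (?S \<union> ?T {..<n} \<union> ?T UNIV)"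
          by (intro Q.finite_measure_mono) (auto simp: U_def)
        also have "\<dots> \<le> measure Q ?S + measure Q (?T {..<n}) + measure Q (?T UNIV)"
          by (intro order_trans[OF measure_Un_le] add_mono) auto
        also have "\<dots> = measure Q ?S + 2 * measure Q (?V - U K)"
          by (subst (1 2) pres) auto
        also have "measure Q ?S \<le> (\<Sum>k<K. ?d n (a k))"
          by (rule Q.finite_measure_subadditive_finite) auto
        finally show ?thesis by simp
      qed
      have "(\<lambda>n. \<Sum>k<K. ?d n (a k)) \<longlonglongrightarrow> (\<Sum>k<K. 0)"
        by (intro tendsto_sum Union.IH)
      then have "eventually (\<lambda>n. (\<Sum>k<K. ?d n (a k)) < e / 2) sequentially"
        using order_tendstoD(2)[of _ 0 sequentially "e/2"] e by simp
      then obtain N where N: "\<And>n. n \<ge> N \<Longrightarrow> (\<Sum>k<K. ?d n (a k)) < e / 2"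
        by (auto simp: eventually_sequentially)
      show "\<exists>no. \<forall>n\<ge>no. norm (?d n ?V - 0) < e"
      proof (intro exI[of _ N] allI impI)
        fix n assume "n \<ge> N"
        then have "?d n ?V < e" using bound[of n] N[of n] diff by linarith
        then show "norm (?d n ?V - 0) < e" by simp
      qed
    qed
  qed
qed

definition sqint :: "((nat \<times> nat \<Rightarrow> 'a) \<Rightarrow> real) \<Rightarrow> bool" where
  "sqint F \<longleftrightarrow> F \<in> borel_measurable Q \<and> integrable Q (\<lambda>\<omega>. (F \<omega>)\<^sup>2)"

lemma sqint_meas: "sqint F \<Longrightarrow> F \<in> borel_measurable Q"
  by (simp add: sqint_def)

lemma sqint_mult: "sqint F \<Longrightarrow> sqint G \<Longrightarrow> integrable Q (\<lambda>\<omega>. F \<omega> * G \<omega>)"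
proof -
  assume F: "sqint F" and G: "sqint G"
  have *: "\<bar>a * b\<bar> \<le> a\<^sup>2 + b\<^sup>2" for a b :: real
    using sum_squares_bound[of "\<bar>a\<bar>" "\<bar>b\<bar>"] mult_nonneg_nonneg[of "\<bar>a\<bar>" "\<bar>b\<bar>"]
    by (simp add: abs_mult del: mult_nonneg_nonneg)
  have "integrable Q (\<lambda>\<omega>. (F \<omega>)\<^sup>2 + (G \<omega>)\<^sup>2)" using F G by (simp add: sqint_def)
  then show ?thesis
    by (rule Bochner_Integration.integrable_bound)
       (use F G * in \<open>auto simp: sqint_def\<close>)
qed

lemma sqint_const: "sqint (\<lambda>_. c)" by (simp add: sqint_def)

lemma sqint_integrable: "sqint F \<Longrightarrow> integrable Q F"
  using sqint_mult[OF _ sqint_const[of 1], of F] by simp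

lemma sqint_bound:
  assumes "sqint F" "G \<in> borel_measurable Q" "\<And>\<omega>. \<bar>G \<omega>\<bar> \<le> c * \<bar>F \<omega>\<bar> + d"
  shows "sqint G"
  unfolding sqint_def
proof
  have "integrable Q (\<lambda>\<omega>. (\<bar>c\<bar> * \<bar>F \<omega>\<bar> + \<bar>d\<bar>)\<^sup>2)"
    using assms(1) sqint_integrable[OF assms(1)]
    by (simp add: power2_sum power_mult_distrib sqint_def)
  then show "integrable Q (\<lambda>\<omega>. (G \<omega>)\<^sup>2)"
  proof (rule Bochner_Integration.integrable_bound)
    have "(G \<omega>)\<^sup>2 \<le> (\<bar>c\<bar> * \<bar>F \<omega>\<bar> + \<bar>d\<bar>)\<^sup>2" for \<omega>
    proof -
      have "c * \<bar>F \<omega>\<bar> \<le> \<bar>c\<bar> * \<bar>F \<omega>\<bar>" by (intro mult_right_mono) auto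
      then have "\<bar>G \<omega>\<bar> \<le> \<bar>c\<bar> * \<bar>F \<omega>\<bar> + \<bar>d\<bar>" using assms(3)[of \<omega>] by linarith
      then show ?thesis
        using power_mono[of "\<bar>G \<omega>\<bar>" _ 2] by simp
    qed
    then show "AE \<omega> in Q. norm ((G \<omega>)\<^sup>2) \<le> norm ((\<bar>c\<bar> * \<bar>F \<omega>\<bar> + \<bar>d\<bar>)\<^sup>2)" by simp
  qed (use assms(2) in measurable)
qed (fact assms(2))

lemma sqint_add: "sqint F \<Longrightarrow> sqint G \<Longrightarrow> sqint (\<lambda>\<omega>. F \<omega> + G \<omega>)"
  using sqint_mult[of F G] by (auto simp: sqint_def power2_sum mult.assoc)

lemma sqint_cmult: "sqint F \<Longrightarrow> sqint (\<lambda>\<omega>. c * F \<omega>)"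
  by (auto simp: sqint_def power_mult_distrib)

lemma sqint_diff: "sqint F \<Longrightarrow> sqint G \<Longrightarrow> sqint (\<lambda>\<omega>. F \<omega> - G \<omega>)"
  using sqint_add[OF _ sqint_cmult[of G "-1"], of F] by simp

lemma sqint_abs: "sqint F \<Longrightarrow> sqint (\<lambda>\<omega>. \<bar>F \<omega>\<bar>)"
  by (auto simp: sqint_def)

lemma sqint_sum: "(\<And>i. i \<in> I \<Longrightarrow> sqint (F i)) \<Longrightarrow> sqint (\<lambda>\<omega>. \<Sum>i\<in>I. F i \<omega>)"
  by (induction I rule: infinite_finite_induct) (simp_all add: sqint_const sqint_add)

lemma sqint_resamp:
  assumes "inj \<tau>" "sqint F" shows "sqint (\<lambda>\<omega>. F (resamp \<tau> A \<omega>))"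
proof -
  have [measurable]: "F \<in> borel_measurable Q" using assms(2) by (rule sqint_meas)
  show ?thesis
    using assms integrable_resamp[OF assms(1), of "\<lambda>\<omega>. (F \<omega>)\<^sup>2" A] by (simp add: sqint_def)
qed

lemma sqint_sel:
  assumes "f \<in> borel_measurable P" "integrable P (\<lambda>x. (f x)\<^sup>2)"
  shows "sqint (\<lambda>\<omega>. f (sel s \<omega>))"
proof -
  note [measurable] = assms(1)
  have "integrable Q (\<lambda>\<omega>. (f (sel s \<omega>))\<^sup>2)"
    by (rule integrable_distr[of _ Q P]) (simp_all add: distr_sel assms)
  then show ?thesis by (simp add: sqint_def)
qed

text \<open>The value can only change where membership in some level set changes, and then by at
  most twice the maximal modulus b; there are finitely many levels.\<close>

lemma resamp_simple_tendsto:
  assumes \<tau>: "inj \<tau>" and g: "simple_function Q g"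
  shows "(\<lambda>n. \<integral>\<omega>. (g (resamp \<tau> {..<n} \<omega>) - g (resamp \<tau> UNIV \<omega>))\<^sup>2 \<partial>Q) \<longlonglongrightarrow> (0::real)"
proof -
  note [measurable] = borel_measurable_simple_function[OF g]
  let ?V = "g ` space Q"
  have fin: "finite ?V" using g by (rule simple_functionD)
  define b where "b = Max (insert 0 (abs ` ?V))"
  have b: "\<bar>v\<bar> \<le> b" if "v \<in> ?V" for v using fin that by (auto simp: b_def)
  let ?A = "\<lambda>v. g -` {v} \<inter> space Q"
  let ?D = "\<lambda>n v. {\<omega>\<in>space Q. (resamp \<tau> {..<n} \<omega> \<in> ?A v) \<noteq> (resamp \<tau> UNIV \<omega> \<in> ?A v)}"
  have rs: "resamp \<tau> C \<omega> \<in> space Q" if "\<omega> \<in> space Q" for C \<omega>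
    using that by (rule measurable_space[OF resamp_measurable])
  have pt: "(g (resamp \<tau> {..<n} \<omega>) - g (resamp \<tau> UNIV \<omega>))\<^sup>2 \<le> 4 * b\<^sup>2 * (\<Sum>v\<in>?V. indicator (?D n v) \<omega>)"
    if w: "\<omega> \<in> space Q" for n \<omega>
  proof (cases "g (resamp \<tau> {..<n} \<omega>) = g (resamp \<tau> UNIV \<omega>)")
    case True then show ?thesis by (simp add: sum_nonneg)
  next
    case False
    let ?v = "g (resamp \<tau> {..<n} \<omega>)" and ?u = "g (resamp \<tau> UNIV \<omega>)"
    have v: "?v \<in> ?V" "?u \<in> ?V" using rs[OF w] by auto
    have "\<bar>?v - ?u\<bar> \<le> 2 * b" using b[OF v(1)] b[OF v(2)] by linarith
    then have "(?v - ?u)\<^sup>2 \<le> (2 * b)\<^sup>2" using power_mono[of "\<bar>?v - ?u\<bar>" "2*b" 2] by simp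
    also have "\<dots> = 4 * b\<^sup>2 * 1" by (simp add: power2_eq_square)
    also have "\<dots> \<le> 4 * b\<^sup>2 * (\<Sum>v\<in>?V. indicator (?D n v) \<omega>)"
    proof (intro mult_left_mono)
      have "(1::real) = indicator (?D n ?v) \<omega>" using False w rs[OF w] by (auto simp: indicator_def)
      also have "\<dots> \<le> (\<Sum>v\<in>?V. indicator (?D n v) \<omega>)"
        using v fin by (intro member_le_sum) auto
      finally show "(1::real) \<le> (\<Sum>v\<in>?V. indicator (?D n v) \<omega>)" .
    qed simp
    finally show ?thesis .
  qed
  have bd: "(\<integral>\<omega>. (g (resamp \<tau> {..<n} \<omega>) - g (resamp \<tau> UNIV \<omega>))\<^sup>2 \<partial>Q) \<le> 4 * b\<^sup>2 * (\<Sum>v\<in>?V. measure Q (?D n v))" for n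
  proof -
    have "(\<integral>\<omega>. (g (resamp \<tau> {..<n} \<omega>) - g (resamp \<tau> UNIV \<omega>))\<^sup>2 \<partial>Q)
        \<le> (\<integral>\<omega>. 4 * b\<^sup>2 * (\<Sum>v\<in>?V. indicator (?D n v) \<omega>) \<partial>Q)"
      using pt by (intro integral_mono' integrable_mult_right integrable_sum) (auto simp: Q.emeasure_eq_measure intro!: mult_nonneg_nonneg sum_nonneg)
    also have "\<dots> = 4 * b\<^sup>2 * (\<Sum>v\<in>?V. measure Q (?D n v))"
      by (subst integral_mult_right_zero, subst Bochner_Integration.integral_sum)
         (auto simp: Q.emeasure_eq_measure intro!: sum.cong arg_cong[where f="measure Q"])
    finally show ?thesis .
  qed
  have "(\<lambda>n. 4 * b\<^sup>2 * (\<Sum>v\<in>?V. measure Q (?D n v))) \<longlonglongrightarrow> 4 * b\<^sup>2 * (\<Sum>v\<in>?V. 0)"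
    by (intro tendsto_mult tendsto_const tendsto_sum resamp_sets_tendsto \<tau>) measurable
  then have lim: "(\<lambda>n. 4 * b\<^sup>2 * (\<Sum>v\<in>?V. measure Q (?D n v))) \<longlonglongrightarrow> 0" by simp
  show ?thesis
    by (rule Lim_null_comparison[OF _ lim]) (use bd in simp)
qed

text \<open>Simple functions are dense in L2 and resampling is an L2 isometry, so the approximation
  error is the same before and after resampling.\<close>

lemma resamp_L2_tendsto:
  assumes \<tau>: "inj \<tau>" and F: "sqint F"
  shows "(\<lambda>n. \<integral>\<omega>. (F (resamp \<tau> {..<n} \<omega>) - F (resamp \<tau> UNIV \<omega>))\<^sup>2 \<partial>Q) \<longlonglongrightarrow> (0::real)"
proof -
  note [measurable] = sqint_meas[OF F]
  from borel_measurable_implies_sequence_metric[of F Q 0] obtain g where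
    "\<forall>i. simple_function Q (g i)" "\<forall>x\<in>space Q. (\<lambda>i. g i x) \<longlonglongrightarrow> F x"
    "\<forall>i. \<forall>x\<in>space Q. dist (g i x) 0 \<le> 2 * dist (F x) 0"
    by (auto simp del: dist_0_norm)
  then have g: "\<And>i. simple_function Q (g i)" "\<And>x. x \<in> space Q \<Longrightarrow> (\<lambda>i. g i x) \<longlonglongrightarrow> F x"
    "\<And>i x. x \<in> space Q \<Longrightarrow> norm (g i x) \<le> 2 * norm (F x)"
    by (auto simp: dist_norm)
  note [measurable] = borel_measurable_simple_function[OF g(1)]
  have sg: "sqint (g i)" for i
    unfolding sqint_def
  proof
    show "integrable Q (\<lambda>\<omega>. (g i \<omega>)\<^sup>2)"
    proof (rule Bochner_Integration.integrable_bound[of _ "\<lambda>\<omega>. 4 * (F \<omega>)\<^sup>2"])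
      show "AE x in Q. norm ((g i x)\<^sup>2) \<le> norm (4 * (F x)\<^sup>2)"
        using g(3)[of _ i] power_mono[of "\<bar>g i _\<bar>" "2 * \<bar>F _\<bar>" 2]
        by (auto simp: power_mult_distrib intro!: AE_I2)
    qed (use F in \<open>auto simp: sqint_def\<close>)
  qed measurable
  have "(\<lambda>i. \<integral>\<omega>. (F \<omega> - g i \<omega>)\<^sup>2 \<partial>Q) \<longlonglongrightarrow> (\<integral>\<omega>. 0 \<partial>Q)"
  proof (rule integral_dominated_convergence[where w="\<lambda>\<omega>. 9 * (F \<omega>)\<^sup>2"])
    show "AE x in Q. (\<lambda>i. (F x - g i x)\<^sup>2) \<longlonglongrightarrow> 0"
    proof (rule AE_I2)
      fix x assume "x \<in> space Q"
      then have "(\<lambda>i. (F x - g i x)\<^sup>2) \<longlonglongrightarrow> (F x - F x)\<^sup>2" by (intro tendsto_intros g(2))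
      then show "(\<lambda>i. (F x - g i x)\<^sup>2) \<longlonglongrightarrow> 0" by simp
    qed
    fix i show "AE x in Q. norm ((F x - g i x)\<^sup>2) \<le> 9 * (F x)\<^sup>2"
    proof (rule AE_I2)
      fix x assume "x \<in> space Q"
      then have "\<bar>F x - g i x\<bar> \<le> 3 * \<bar>F x\<bar>" using g(3)[of x i] by simp
      then show "norm ((F x - g i x)\<^sup>2) \<le> 9 * (F x)\<^sup>2"
        using power_mono[of "\<bar>F x - g i x\<bar>" "3 * \<bar>F x\<bar>" 2] by (simp add: power_mult_distrib)
    qed
  qed (use F in \<open>auto simp: sqint_def\<close>)
  then have lim: "(\<lambda>i. \<integral>\<omega>. (F \<omega> - g i \<omega>)\<^sup>2 \<partial>Q) \<longlonglongrightarrow> 0" by simp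
  show ?thesis
  proof (rule LIMSEQ_I)
    fix e :: real assume e: "e > 0"
    \<comment> \<open>The splitting below has three squares with factor 3 each: 3 (e/12 + e/6 +
      e/12) = e.\<close>
    have "eventually (\<lambda>i. (\<integral>\<omega>. (F \<omega> - g i \<omega>)\<^sup>2 \<partial>Q) < e / 12) sequentially"
      using order_tendstoD(2)[OF lim, of "e/12"] e by simp
    then obtain i where i: "(\<integral>\<omega>. (F \<omega> - g i \<omega>)\<^sup>2 \<partial>Q) < e / 12"
      by (auto simp: eventually_sequentially)
    have "eventually (\<lambda>n. (\<integral>\<omega>. (g i (resamp \<tau> {..<n} \<omega>) - g i (resamp \<tau> UNIV \<omega>))\<^sup>2 \<partial>Q) < e / 6) sequentially"
      using order_tendstoD(2)[OF resamp_simple_tendsto[OF \<tau> g(1)], of "e/6"] e by simp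
    then obtain N where N: "\<And>n. n \<ge> N \<Longrightarrow> (\<integral>\<omega>. (g i (resamp \<tau> {..<n} \<omega>) - g i (resamp \<tau> UNIV \<omega>))\<^sup>2 \<partial>Q) < e / 6"
      by (auto simp: eventually_sequentially)
    show "\<exists>no. \<forall>n\<ge>no. norm ((\<integral>\<omega>. (F (resamp \<tau> {..<n} \<omega>) - F (resamp \<tau> UNIV \<omega>))\<^sup>2 \<partial>Q) - 0) < e"
    proof (intro exI[of _ N] allI impI)
      fix n assume n: "n \<ge> N"
      let ?n = "resamp \<tau> {..<n}" and ?U = "resamp \<tau> UNIV"
      have *: "(a - b)\<^sup>2 \<le> 3 * (a - c)\<^sup>2 + 3 * (c - d)\<^sup>2 + 3 * (b - d)\<^sup>2" for a b c d :: real
      proof -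
        have "3 * (a - c)\<^sup>2 + 3 * (c - d)\<^sup>2 + 3 * (b - d)\<^sup>2 - (a - b)\<^sup>2
          = ((a - c) - (c - d))\<^sup>2 + ((a - c) + (b - d))\<^sup>2 + ((c - d) + (b - d))\<^sup>2"
          by (simp add: power2_eq_square algebra_simps)
        moreover have "\<dots> \<ge> 0" by simp
        ultimately show ?thesis by linarith
      qed
      have s1: "sqint (\<lambda>\<omega>. F \<omega> - g i \<omega>)" by (intro sqint_diff F sg)
      have s2: "sqint (\<lambda>\<omega>. g i (?n \<omega>) - g i (?U \<omega>))"
        by (intro sqint_diff sqint_resamp \<tau> sg)
      note s3 = sqint_resamp[OF \<tau> s1]
      have "(\<integral>\<omega>. (F (?n \<omega>) - F (?U \<omega>))\<^sup>2 \<partial>Q) \<le>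
        (\<integral>\<omega>. 3 * (F (?n \<omega>) - g i (?n \<omega>))\<^sup>2 + 3 * (g i (?n \<omega>) - g i (?U \<omega>))\<^sup>2 + 3 * (F (?U \<omega>) - g i (?U \<omega>))\<^sup>2 \<partial>Q)"
        using s2 s3 * by (intro integral_mono') (auto simp: sqint_def)
      also have "\<dots> = 3 * (\<integral>\<omega>. (F (?n \<omega>) - g i (?n \<omega>))\<^sup>2 \<partial>Q) + 3 * (\<integral>\<omega>. (g i (?n \<omega>) - g i (?U \<omega>))\<^sup>2 \<partial>Q)
         + 3 * (\<integral>\<omega>. (F (?U \<omega>) - g i (?U \<omega>))\<^sup>2 \<partial>Q)"
        using s2 s3 by (simp add: sqint_def)
      also have "(\<integral>\<omega>. (F (?n \<omega>) - g i (?n \<omega>))\<^sup>2 \<partial>Q) = (\<integral>\<omega>. (F \<omega> - g i \<omega>)\<^sup>2 \<partial>Q)"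
        by (rule integral_resamp[OF \<tau>, of "\<lambda>\<omega>. (F \<omega> - g i \<omega>)\<^sup>2"]) measurable
      also have "(\<integral>\<omega>. (F (?U \<omega>) - g i (?U \<omega>))\<^sup>2 \<partial>Q) = (\<integral>\<omega>. (F \<omega> - g i \<omega>)\<^sup>2 \<partial>Q)"
        by (rule integral_resamp[OF \<tau>, of "\<lambda>\<omega>. (F \<omega> - g i \<omega>)\<^sup>2"]) measurable
      finally show "norm ((\<integral>\<omega>. (F (?n \<omega>) - F (?U \<omega>))\<^sup>2 \<partial>Q) - 0) < e"
        using i N[OF n] by simp
    qed
  qed
qed

lemma Cauchy_Schwarz_Q:
  assumes "sqint F" "sqint G"
  shows "\<bar>\<integral>\<omega>. F \<omega> * G \<omega> \<partial>Q\<bar> \<le> sqrt (\<integral>\<omega>. (F \<omega>)\<^sup>2 \<partial>Q) * sqrt (\<integral>\<omega>. (G \<omega>)\<^sup>2 \<partial>Q)"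
proof -
  have "(\<integral>\<omega>. F \<omega> * G \<omega> \<partial>Q)\<^sup>2 \<le> (\<integral>\<omega>. (F \<omega>)\<^sup>2 \<partial>Q) * (\<integral>\<omega>. (G \<omega>)\<^sup>2 \<partial>Q)"
  proof -
    let ?a = "\<integral>\<omega>. (F \<omega>)\<^sup>2 \<partial>Q" and ?b = "\<integral>\<omega>. (G \<omega>)\<^sup>2 \<partial>Q" and ?c = "\<integral>\<omega>. F \<omega> * G \<omega> \<partial>Q"
    have q: "0 \<le> ?a - 2 * t * ?c + t\<^sup>2 * ?b" for t
    proof -
      have "0 \<le> (\<integral>\<omega>. (F \<omega> - t * G \<omega>)\<^sup>2 \<partial>Q)" by simp
      also have "(\<lambda>\<omega>. (F \<omega> - t * G \<omega>)\<^sup>2) = (\<lambda>\<omega>. (F \<omega>)\<^sup>2 - 2 * t * (F \<omega> * G \<omega>) + t\<^sup>2 * (G \<omega>)\<^sup>2)"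
        by (simp add: fun_eq_iff power2_eq_square algebra_simps)
      finally show ?thesis
        using assms sqint_mult[OF assms] by (simp add: sqint_def)
    qed
    show ?thesis
      by (rule discriminant_le[OF q]) simp
  qed
  then have "sqrt ((\<integral>\<omega>. F \<omega> * G \<omega> \<partial>Q)\<^sup>2) \<le> sqrt ((\<integral>\<omega>. (F \<omega>)\<^sup>2 \<partial>Q) * (\<integral>\<omega>. (G \<omega>)\<^sup>2 \<partial>Q))"
    by (rule real_sqrt_le_mono)
  then show ?thesis by (simp add: real_sqrt_mult)
qed

lemma resamp_integral_tendsto:
  assumes \<tau>: "inj \<tau>" and F: "sqint F" and G: "sqint G"
  shows "(\<lambda>n. \<integral>\<omega>. G \<omega> * F (resamp \<tau> {..<n} \<omega>) \<partial>Q) \<longlonglongrightarrow> (\<integral>\<omega>. G \<omega> * F (resamp \<tau> UNIV \<omega>) \<partial>Q)"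
proof (rule Lim_null[THEN iffD2])
  let ?D = "\<lambda>n \<omega>. F (resamp \<tau> {..<n} \<omega>) - F (resamp \<tau> UNIV \<omega>)"
  note sF = sqint_resamp[OF \<tau> F]
  have sD: "sqint (?D n)" for n by (intro sqint_diff sF)
  have "(\<lambda>n. sqrt (\<integral>\<omega>. (G \<omega>)\<^sup>2 \<partial>Q) * sqrt (\<integral>\<omega>. (?D n \<omega>)\<^sup>2 \<partial>Q)) \<longlonglongrightarrow> sqrt (\<integral>\<omega>. (G \<omega>)\<^sup>2 \<partial>Q) * sqrt 0"
    by (intro tendsto_intros resamp_L2_tendsto \<tau> F)
  then have *: "(\<lambda>n. sqrt (\<integral>\<omega>. (G \<omega>)\<^sup>2 \<partial>Q) * sqrt (\<integral>\<omega>. (?D n \<omega>)\<^sup>2 \<partial>Q)) \<longlonglongrightarrow> 0" by simp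
  have "(\<integral>\<omega>. G \<omega> * F (resamp \<tau> {..<n} \<omega>) \<partial>Q) - (\<integral>\<omega>. G \<omega> * F (resamp \<tau> UNIV \<omega>) \<partial>Q) = (\<integral>\<omega>. G \<omega> * ?D n \<omega> \<partial>Q)" for n
    using sqint_mult[OF G sF] by (simp add: right_diff_distrib)
  then show "(\<lambda>n. (\<integral>\<omega>. G \<omega> * F (resamp \<tau> {..<n} \<omega>) \<partial>Q) - (\<integral>\<omega>. G \<omega> * F (resamp \<tau> UNIV \<omega>) \<partial>Q)) \<longlonglongrightarrow> 0"
    by (intro Lim_null_comparison[OF _ *]) (auto intro!: always_eventually Cauchy_Schwarz_Q G sD)
qed


subsection \<open>Interpolation by successive resampling\<close>

text \<open>Telescoping over j. Each increment of \<open>F\<close> is odd under exchanging the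
  copies at site j, so its pairing with \<open>G\<close> is half its pairing with the increment of
  \<open>G\<close> at j.\<close>

lemma resamp_interpolation:
  assumes inv: "\<And>c. \<tau> (\<tau> c) = c" and F: "sqint F" and G: "sqint G"
  shows "(\<integral>\<omega>. G \<omega> * (F \<omega> - F (resamp \<tau> {..<n} \<omega>)) \<partial>Q) =
    (\<Sum>j<n. (\<integral>\<omega>. (G \<omega> - G (resamp \<tau> {j} \<omega>)) * (F (resamp \<tau> {..<j} \<omega>) - F (resamp \<tau> {..<Suc j} \<omega>)) \<partial>Q) / 2)"
proof -
  have \<tau>: "inj \<tau>" using inv by (metis injI)
  note sF = sqint_resamp[OF \<tau> F] and sG = sqint_resamp[OF \<tau> G]
  note [measurable] = sqint_meas[OF F] sqint_meas[OF G]
  let ?D = "\<lambda>j \<omega>. F (resamp \<tau> {..<j} \<omega>) - F (resamp \<tau> {..<Suc j} \<omega>)"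
  have sD: "sqint (?D j)" for j by (intro sqint_diff sF)
  have swap: "?D j (resamp \<tau> {j} \<omega>) = - ?D j \<omega>" for j \<omega>
  proof -
    have "resamp \<tau> {..<j} (resamp \<tau> {j} \<omega>) = resamp \<tau> {..<Suc j} \<omega>"
      "resamp \<tau> {..<Suc j} (resamp \<tau> {j} \<omega>) = resamp \<tau> {..<j} \<omega>"
      by (auto simp: resamp_def relabel_def fun_eq_iff inv)
    then show ?thesis by simp
  qed
  have half: "(\<integral>\<omega>. G \<omega> * ?D j \<omega> \<partial>Q) = (\<integral>\<omega>. (G \<omega> - G (resamp \<tau> {j} \<omega>)) * ?D j \<omega> \<partial>Q) / 2" for j
  proof -
    have "(\<integral>\<omega>. G \<omega> * ?D j \<omega> \<partial>Q) = (\<integral>\<omega>. G (resamp \<tau> {j} \<omega>) * ?D j (resamp \<tau> {j} \<omega>) \<partial>Q)"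
      by (rule integral_resamp[OF \<tau>, symmetric]) measurable
    also have "\<dots> = - (\<integral>\<omega>. G (resamp \<tau> {j} \<omega>) * ?D j \<omega> \<partial>Q)"
      unfolding swap mult_minus_right by (rule integral_minus)
    finally have "(\<integral>\<omega>. G \<omega> * ?D j \<omega> \<partial>Q) = - (\<integral>\<omega>. G (resamp \<tau> {j} \<omega>) * ?D j \<omega> \<partial>Q)" .
    moreover have "(\<integral>\<omega>. (G \<omega> - G (resamp \<tau> {j} \<omega>)) * ?D j \<omega> \<partial>Q)
       = (\<integral>\<omega>. G \<omega> * ?D j \<omega> \<partial>Q) - (\<integral>\<omega>. G (resamp \<tau> {j} \<omega>) * ?D j \<omega> \<partial>Q)"
      unfolding left_diff_distrib
      by (rule Bochner_Integration.integral_diff) (rule sqint_mult; fact G sG sD)+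
    ultimately show ?thesis by simp
  qed
  have tele: "F \<omega> - F (resamp \<tau> {..<n} \<omega>) = (\<Sum>j<n. ?D j \<omega>)" for \<omega>
  proof -
    have "resamp \<tau> {..<0} \<omega> = \<omega>" by (simp add: resamp_def relabel_def)
    then show ?thesis using sum_lessThan_telescope'[of "\<lambda>j. F (resamp \<tau> {..<j} \<omega>)" n] by simp
  qed
  have "(\<integral>\<omega>. G \<omega> * (F \<omega> - F (resamp \<tau> {..<n} \<omega>)) \<partial>Q) = (\<integral>\<omega>. (\<Sum>j<n. G \<omega> * ?D j \<omega>) \<partial>Q)"
    unfolding tele sum_distrib_left ..
  also have "\<dots> = (\<Sum>j<n. \<integral>\<omega>. G \<omega> * ?D j \<omega> \<partial>Q)"
    by (rule Bochner_Integration.integral_sum) (rule sqint_mult[OF G sD])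
  finally show ?thesis by (simp add: half)
qed

text \<open>The variance is the limit of E[F (F - F after resampling n sites)], to which the
  interpolation applies with G = F. Independence enters as the identity \<open>ind\<close>, because
  \<open>F\<close> may itself involve several copies, all of which \<open>\<tau>\<close> then has to
  move.\<close>

lemma Efron_Stein:
  assumes inv: "\<And>c. \<tau> (\<tau> c) = c" and F: "sqint F"
    and ind: "(\<integral>\<omega>. F \<omega> * F (resamp \<tau> UNIV \<omega>) \<partial>Q) = (\<integral>\<omega>. F \<omega> \<partial>Q)\<^sup>2"
    and K: "\<And>n. (\<Sum>j<n. \<integral>\<omega>. (F \<omega> - F (resamp \<tau> {j} \<omega>))\<^sup>2 \<partial>Q) \<le> 2 * K"
  shows "(\<integral>\<omega>. (F \<omega>)\<^sup>2 \<partial>Q) - (\<integral>\<omega>. F \<omega> \<partial>Q)\<^sup>2 \<le> K"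
proof -
  have \<tau>: "inj \<tau>" using inv by (metis injI)
  note sF = sqint_resamp[OF \<tau> F]
  note [measurable] = sqint_meas[OF F]
  have bound: "(\<integral>\<omega>. (F \<omega>)\<^sup>2 \<partial>Q) - (\<integral>\<omega>. F \<omega> * F (resamp \<tau> {..<n} \<omega>) \<partial>Q) \<le> K" for n
  proof -
    have "(\<integral>\<omega>. (F \<omega>)\<^sup>2 \<partial>Q) - (\<integral>\<omega>. F \<omega> * F (resamp \<tau> {..<n} \<omega>) \<partial>Q) = (\<integral>\<omega>. F \<omega> * (F \<omega> - F (resamp \<tau> {..<n} \<omega>)) \<partial>Q)"
      using sqint_mult[OF F sF] F by (simp add: right_diff_distrib sqint_def power2_eq_square)
    also have "\<dots> = (\<Sum>j<n. (\<integral>\<omega>. (F \<omega> - F (resamp \<tau> {j} \<omega>)) * (F (resamp \<tau> {..<j} \<omega>) - F (resamp \<tau> {..<Suc j} \<omega>)) \<partial>Q) / 2)"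
      by (rule resamp_interpolation[OF inv F F])
    also have "\<dots> \<le> (\<Sum>j<n. (\<integral>\<omega>. (F \<omega> - F (resamp \<tau> {j} \<omega>))\<^sup>2 \<partial>Q) / 2)"
    proof (intro sum_mono divide_right_mono)
      fix j assume "j \<in> {..<n}"
      let ?a = "\<lambda>\<omega>. F \<omega> - F (resamp \<tau> {j} \<omega>)"
      let ?b = "\<lambda>\<omega>. F (resamp \<tau> {..<j} \<omega>) - F (resamp \<tau> {..<Suc j} \<omega>)"
      have sa: "sqint ?a" and sb: "sqint ?b" by (intro sqint_diff F sF)+
      \<comment> \<open>The increment after resampling the sites below j is the one-site increment
        evaluated at the resampled point, so both factors have the same second moment.\<close>
      have b: "?b \<omega> = ?a (resamp \<tau> {..<j} \<omega>)" for \<omega>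
      proof -
        have "resamp \<tau> {j} (resamp \<tau> {..<j} \<omega>) = resamp \<tau> {..<Suc j} \<omega>"
          by (auto simp: resamp_def relabel_def fun_eq_iff)
        then show ?thesis by simp
      qed
      have eq: "(\<integral>\<omega>. (?b \<omega>)\<^sup>2 \<partial>Q) = (\<integral>\<omega>. (?a \<omega>)\<^sup>2 \<partial>Q)"
        unfolding b by (rule integral_resamp[OF \<tau>, of "\<lambda>\<omega>. (?a \<omega>)\<^sup>2"]) measurable
      have "(\<integral>\<omega>. ?a \<omega> * ?b \<omega> \<partial>Q) \<le> sqrt (\<integral>\<omega>. (?a \<omega>)\<^sup>2 \<partial>Q) * sqrt (\<integral>\<omega>. (?b \<omega>)\<^sup>2 \<partial>Q)"
        using Cauchy_Schwarz_Q[OF sa sb] by linarith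
      also have "\<dots> = (\<integral>\<omega>. (?a \<omega>)\<^sup>2 \<partial>Q)" unfolding eq by simp
      finally show "(\<integral>\<omega>. ?a \<omega> * ?b \<omega> \<partial>Q) \<le> (\<integral>\<omega>. (?a \<omega>)\<^sup>2 \<partial>Q)" .
    qed simp
    also have "\<dots> \<le> K" using K[of n] by (simp add: sum_divide_distrib[symmetric])
    finally show ?thesis .
  qed
  have "(\<lambda>n. (\<integral>\<omega>. (F \<omega>)\<^sup>2 \<partial>Q) - (\<integral>\<omega>. F \<omega> * F (resamp \<tau> {..<n} \<omega>) \<partial>Q))
    \<longlonglongrightarrow> (\<integral>\<omega>. (F \<omega>)\<^sup>2 \<partial>Q) - (\<integral>\<omega>. F \<omega> * F (resamp \<tau> UNIV \<omega>) \<partial>Q)"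
    by (intro tendsto_intros resamp_integral_tendsto \<tau> F)
  from LIMSEQ_le_const2[OF this] bound ind show ?thesis by auto
qed

end

section \<open>The Stein equation\<close>

abbreviation (input) nd :: "real \<Rightarrow> real" where "nd \<equiv> std_normal_density"

lemma nd_pos: "0 < nd x" by (simp add: normal_density_pos)

lemma DERIV_nd: "(nd has_real_derivative - x * nd x) (at x)"
  unfolding std_normal_density_def[abs_def]
  by (auto intro!: derivative_eq_intros simp: field_simps)

lemma nd_even: "nd (- x) = nd x" by (simp add: std_normal_density_def)

lemma nd_decay: assumes "t \<ge> 1" shows "(1 + t) * nd t \<le> 4 / t"
proof -
  have "1 + t\<^sup>2 / 2 \<le> exp (t\<^sup>2 / 2)" by (rule exp_ge_add_one_self_aux) simp
  moreover have "0 < t\<^sup>2 / 2" using assms by simp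
  ultimately have "exp (- t\<^sup>2 / 2) \<le> 2 / t\<^sup>2"
    by (simp add: exp_minus field_simps del: exp_ge_add_one_self)
  moreover have "1 / sqrt (2 * pi) \<le> 1"
  proof -
    have "1 \<le> sqrt (2 * pi)" using pi_ge_two by (intro real_le_rsqrt) simp
    then show ?thesis by simp
  qed
  ultimately have "nd t \<le> 1 * (2 / t\<^sup>2)"
    unfolding std_normal_density_def by (intro mult_mono) auto
  then have "(1 + t) * nd t \<le> (2 * t) * (2 / t\<^sup>2)"
    using assms by (intro mult_mono) auto
  then show ?thesis using assms by (simp add: power2_eq_square)
qed

lemma nd_decay_at_top: "((\<lambda>t. (1 + t) * nd t) \<longlongrightarrow> 0) at_top"
proof (rule tendsto_sandwich[where f="\<lambda>_. 0" and h="\<lambda>t. 4 / t"])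
  show "\<forall>\<^sub>F t in at_top. 0 \<le> (1 + t) * nd t"
    using eventually_ge_at_top[of "0::real"] by eventually_elim simp
  show "\<forall>\<^sub>F t in at_top. (1 + t) * nd t \<le> 4 / t"
    using eventually_ge_at_top[of "1::real"] by eventually_elim (rule nd_decay)
  show "((\<lambda>t::real. 4 / t) \<longlongrightarrow> 0) at_top"
    by (intro tendsto_divide_0[OF tendsto_const] filterlim_at_top_imp_at_infinity filterlim_ident)
qed simp

text \<open>Comparison with m(t) = (\<alpha> + 2 \<beta> / (1 + t)) nd(t): since 2 (t (1 + t) + 1)
  \<ge> (1 + t)^2, the derivative of -m dominates |a|. Hence A - m and -A - m are nondecreasing with
  limit 0, and thus nonpositive. For \<alpha> = 0 this is a bound of Mills ratio type.\<close>

lemma gauss_tail: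
  assumes A: "\<And>x. x \<ge> 0 \<Longrightarrow> (A has_real_derivative a x) (at x)"
    and a: "\<And>x. x \<ge> 0 \<Longrightarrow> \<bar>a x\<bar> \<le> (\<alpha> * x + \<beta>) * nd x"
    and lim: "(A \<longlongrightarrow> 0) at_top" and x: "x \<ge> 0" and \<alpha>: "\<alpha> \<ge> 0" and \<beta>: "\<beta> \<ge> 0"
  shows "\<bar>A x\<bar> \<le> (\<alpha> + 2 * \<beta> / (1 + x)) * nd x"
proof -
  define m where "m t = (\<alpha> + 2 * \<beta> / (1 + t)) * nd t" for t
  define m' where "m' t = - (2 * \<beta> / (1 + t)\<^sup>2) * nd t - t * ((\<alpha> + 2 * \<beta> / (1 + t)) * nd t)" for t
  have Dm: "(m has_real_derivative m' t) (at t)" if "t \<ge> 0" for t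
  proof -
    have "((\<lambda>t. \<alpha> + 2 * \<beta> / (1 + t)) has_real_derivative - (2 * \<beta> / (1 + t)\<^sup>2)) (at t)"
      using that by (auto intro!: derivative_eq_intros simp: power2_eq_square)
    note DERIV_mult[OF this DERIV_nd]
    moreover have "- (2 * \<beta> / (1 + t)\<^sup>2) * nd t + - t * nd t * (\<alpha> + 2 * \<beta> / (1 + t)) = m' t"
      by (simp add: m'_def)
    ultimately show ?thesis
      unfolding m_def[abs_def] by simp
  qed
  have m': "- m' t \<ge> (\<alpha> * t + \<beta>) * nd t" if "t \<ge> 0" for t
  proof -
    have "2 * (t * (1 + t) + 1) \<ge> (1 + t)\<^sup>2" by (simp add: power2_eq_square algebra_simps)
    then have "1 \<le> 2 * (t * (1 + t) + 1) / (1 + t)\<^sup>2" using that by simp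
    then have "\<beta> * 1 \<le> \<beta> * (2 * (t * (1 + t) + 1) / (1 + t)\<^sup>2)" using \<beta> by (rule mult_left_mono)
    also have "\<dots> = 2 * \<beta> / (1 + t)\<^sup>2 + t * (2 * \<beta> / (1 + t))"
    proof -
      have "t * (1 + t) / (1 + t)\<^sup>2 = t / (1 + t)" using that by (simp add: power2_eq_square)
      then have "\<beta> * (2 * (t * (1 + t) / (1 + t)\<^sup>2 + 1 / (1 + t)\<^sup>2)) = \<beta> * (2 * (t / (1 + t) + 1 / (1 + t)\<^sup>2))"
        by simp
      then show ?thesis by (simp add: add_divide_distrib algebra_simps)
    qed
    finally have "\<alpha> * t + \<beta> \<le> 2 * \<beta> / (1 + t)\<^sup>2 + t * (\<alpha> + 2 * \<beta> / (1 + t))"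
      by (simp add: algebra_simps)
    from mult_right_mono[OF this, of "nd t"] show ?thesis
      by (simp add: m'_def algebra_simps)
  qed
  have m0: "(m \<longlongrightarrow> 0) at_top"
  proof (rule tendsto_sandwich[where f="\<lambda>_. 0" and h="\<lambda>t. (\<alpha> + 2 * \<beta>) * ((1 + t) * nd t)"])
    show "\<forall>\<^sub>F t in at_top. 0 \<le> m t"
      using eventually_ge_at_top[of "0::real"] by eventually_elim (use \<alpha> \<beta> in \<open>simp add: m_def\<close>)
    show "\<forall>\<^sub>F t in at_top. m t \<le> (\<alpha> + 2 * \<beta>) * ((1 + t) * nd t)"
      using eventually_ge_at_top[of "0::real"]
    proof eventually_elim
      case (elim t)
      have "2 * \<beta> / (1 + t) \<le> 2 * \<beta> / 1" using elim \<beta> by (intro divide_left_mono) auto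
      then have "m t \<le> (\<alpha> + 2 * \<beta>) * nd t" unfolding m_def by (intro mult_right_mono) auto
      also have "\<dots> \<le> (\<alpha> + 2 * \<beta>) * ((1 + t) * nd t)"
        using elim \<alpha> \<beta> mult_right_mono[of 1 "1 + t" "nd t"] by (intro mult_left_mono) auto
      finally show ?case .
    qed
    show "((\<lambda>t. (\<alpha> + 2 * \<beta>) * ((1 + t) * nd t)) \<longlongrightarrow> 0) at_top"
      using tendsto_mult_right_zero[OF nd_decay_at_top] .
  qed simp
  have mono: "F x \<le> 0" if D: "\<And>t. t \<ge> 0 \<Longrightarrow> (F has_real_derivative F' t) (at t)"
      and pos: "\<And>t. t \<ge> 0 \<Longrightarrow> F' t \<ge> 0" and F0: "(F \<longlongrightarrow> 0) at_top" for F F'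
  proof (rule tendsto_lowerbound[OF F0])
    show "\<forall>\<^sub>F t in at_top. F x \<le> F t"
      using eventually_ge_at_top[of x]
    proof eventually_elim
      case (elim t)
      then show ?case
        using x D pos by (intro DERIV_nonneg_imp_nondecreasing[OF elim]) (meson order_trans)
    qed
  qed simp
  have "A x - m x \<le> 0"
  proof (rule mono)
    fix t :: real assume t: "t \<ge> 0"
    show "((\<lambda>t. A t - m t) has_real_derivative a t - m' t) (at t)"
      using t by (intro derivative_intros A Dm)
    show "a t - m' t \<ge> 0" using a[OF t] m'[OF t] by linarith
  next
    show "((\<lambda>t. A t - m t) \<longlongrightarrow> 0) at_top" using tendsto_diff[OF lim m0] by simp
  qed
  moreover have "- A x - m x \<le> 0"
  proof (rule mono)
    fix t :: real assume t: "t \<ge> 0"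
    show "((\<lambda>t. - A t - m t) has_real_derivative - a t - m' t) (at t)"
      using t by (intro derivative_intros A Dm)
    show "- a t - m' t \<ge> 0" using a[OF t] m'[OF t] by linarith
  next
    show "((\<lambda>t. - A t - m t) \<longlongrightarrow> 0) at_top" using tendsto_diff[OF tendsto_minus[OF lim] m0] by simp
  qed
  ultimately show ?thesis unfolding m_def by linarith
qed

lemma gauss_tail_both:
  assumes A: "\<And>x. (A has_real_derivative a x) (at x)"
    and a: "\<And>x. \<bar>a x\<bar> \<le> (\<alpha> * \<bar>x\<bar> + \<beta>) * nd x"
    and lim: "(A \<longlongrightarrow> 0) at_top" "(A \<longlongrightarrow> 0) at_bot" and \<alpha>: "\<alpha> \<ge> 0" and \<beta>: "\<beta> \<ge> 0"
  shows "\<bar>A x\<bar> \<le> (\<alpha> + 2 * \<beta> / (1 + \<bar>x\<bar>)) * nd x"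
proof (cases "x \<ge> 0")
  case True
  then show ?thesis
    using gauss_tail[of A a \<alpha> \<beta> x] A a lim \<alpha> \<beta> by (metis abs_of_nonneg)
next
  case False
  have "\<bar>A (- (- x))\<bar> \<le> (\<alpha> + 2 * \<beta> / (1 + (- x))) * nd (- x)"
  proof (rule gauss_tail[of "\<lambda>x. A (- x)" "\<lambda>x. - a (- x)"])
    fix t :: real assume t: "t \<ge> 0"
    show "((\<lambda>x. A (- x)) has_real_derivative - a (- t)) (at t)"
      using A[of "- t"] by (simp add: DERIV_mirror)
    show "\<bar>- a (- t)\<bar> \<le> (\<alpha> * t + \<beta>) * nd t"
      using a[of "- t"] t by (simp add: nd_even)
  next
    show "((\<lambda>x. A (- x)) \<longlongrightarrow> 0) at_top"
      using lim(2) by (simp add: filterlim_at_bot_mirror)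
  qed (use False \<alpha> \<beta> in auto)
  then show ?thesis using False by (simp add: nd_even)
qed

text \<open>Both limits matter: an integrand of zero total integral has an antiderivative vanishing
  at both ends, which is what the two-sided tail bound asks for.\<close>

lemma antiderivative_line:
  fixes a :: "real \<Rightarrow> real"
  assumes cont: "\<And>x. isCont a x" and int: "integrable lborel a"
  defines "B \<equiv> \<lambda>x. \<integral>t. indicator {..x} t * a t \<partial>lborel"
  shows "(B has_real_derivative a x) (at x)" "(B \<longlongrightarrow> 0) at_bot" "(B \<longlongrightarrow> (\<integral>t. a t \<partial>lborel)) at_top"
proof -
  obtain A where A: "\<And>x. (A has_real_derivative a x) (at x)"
    using einterval_antiderivative[of "-\<infinity>" "\<infinity>" a] cont
    by (auto simp: has_real_derivative_iff_has_vector_derivative)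
  have m[measurable]: "a \<in> borel_measurable borel" using int by simp
  have i: "integrable lborel (\<lambda>t. indicator S t * a t)" if "S \<in> sets borel" for S
    using integrable_mult_indicator[OF _ int, of S] that by simp
  have BA: "B y - B x = A y - A x" if "x \<le> y" for x y
  proof -
    have "B y - B x = (\<integral>t. indicator {..y} t * a t - indicator {..x} t * a t \<partial>lborel)"
      unfolding B_def by (rule Bochner_Integration.integral_diff[symmetric]) (auto intro: i)
    also have "\<dots> = (\<integral>t. a t * indicator {x..y} t \<partial>lborel)"
    proof (rule integral_cong_AE)
      show "AE t in lborel. indicator {..y} t * a t - indicator {..x} t * a t = a t * indicator {x..y} t"
        using AE_lborel_singleton[of x] by eventually_elim (use that in \<open>auto simp: indicator_def\<close>)
    qed measurable
    also have "\<dots> = A y - A x"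
      by (rule integral_FTC_Icc_real[OF that A]) (rule cont)
    finally show ?thesis .
  qed
  have "B = (\<lambda>x. A x + (B 0 - A 0))"
  proof
    fix x show "B x = A x + (B 0 - A 0)" using BA[of x 0] BA[of 0 x] by (cases "x \<le> 0") auto
  qed
  moreover have "((\<lambda>x. A x + (B 0 - A 0)) has_real_derivative a x) (at x)" for x
    using A[of x] by (auto intro!: derivative_eq_intros)
  ultimately show "(B has_real_derivative a x) (at x)" by simp
  show "(B \<longlongrightarrow> (\<integral>t. a t \<partial>lborel)) at_top"
    using tendsto_integral_at_top[OF _ int] by (simp add: B_def)
  have "((\<lambda>y. B (- y)) \<longlongrightarrow> (\<integral>t. 0 \<partial>(lborel::real measure))) at_top"
  proof (rule tendsto_at_topI_sequentially)
    fix X :: "nat \<Rightarrow> real" assume X: "filterlim X at_top sequentially"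
    show "(\<lambda>n. B (- X n)) \<longlonglongrightarrow> (\<integral>t. 0 \<partial>(lborel::real measure))"
      unfolding B_def
    proof (rule integral_dominated_convergence[where w="\<lambda>t. \<bar>a t\<bar>"])
      show "AE x in lborel. (\<lambda>n. indicator {..- X n} x * a x) \<longlonglongrightarrow> 0"
      proof (rule AE_I2)
        fix x :: real
        have "\<forall>\<^sub>F n in sequentially. X n > - x"
          using X by (simp add: filterlim_at_top_dense)
        then have "\<forall>\<^sub>F n in sequentially. indicator {..- X n} x * a x = 0"
          by eventually_elim (auto simp: indicator_def)
        then show "(\<lambda>n. indicator {..- X n} x * a x) \<longlonglongrightarrow> 0" by (rule tendsto_eventually)
      qed
    qed (use int in \<open>auto simp: indicator_def\<close>)
  qed
  then show "(B \<longlongrightarrow> 0) at_bot" by (simp add: filterlim_at_bot_mirror)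
qed

lemma std_normal_abs_moment: "(\<integral>s. \<bar>s\<bar> \<partial>std_normal_distribution) \<le> 1" "integrable std_normal_distribution (\<lambda>s. s)"
proof -
  have "sqrt (2 / pi) \<le> 1" using pi_ge_two by simp
  then show "(\<integral>s. \<bar>s\<bar> \<partial>std_normal_distribution) \<le> 1"
    using std_normal_distribution_odd_moments_abs[of 0] by simp
  show "integrable std_normal_distribution (\<lambda>s. s)"
    using integrable_std_normal_distribution_moment[of 1] by simp
qed

lemma lipschitz_integrable:
  fixes h :: "real \<Rightarrow> real"
  assumes "prob_space \<mu>" "sets \<mu> = sets borel" "integrable \<mu> (\<lambda>s. s)"
    and h: "\<And>x y. \<bar>h x - h y\<bar> \<le> \<bar>x - y\<bar>"
  shows "integrable \<mu> h"
proof -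
  interpret prob_space \<mu> by fact
  have "continuous_on UNIV h"
    by (rule lipschitz_on_continuous_on[of 1], rule lipschitz_onI) (use h in \<open>auto simp: dist_real_def\<close>)
  then have "h \<in> borel_measurable borel" by (rule borel_measurable_continuous_onI)
  then have [measurable]: "h \<in> borel_measurable \<mu>"
    using assms(2) by (simp cong: measurable_cong_sets)
  have "integrable \<mu> (\<lambda>s. \<bar>h 0\<bar> + \<bar>s\<bar>)" using assms(3) by simp
  then show ?thesis
  proof (rule Bochner_Integration.integrable_bound)
    show "AE x in \<mu>. norm (h x) \<le> norm (\<bar>h 0\<bar> + \<bar>x\<bar>)"
    proof (rule AE_I2)
      fix x show "norm (h x) \<le> norm (\<bar>h 0\<bar> + \<bar>x\<bar>)" using h[of x 0] by simp
    qed
  qed measurable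
qed

lemma std_normal_prob: "prob_space std_normal_distribution"
  using real_dist_normal_dist by (simp add: real_distribution_def)

lemma std_normal_UNIV: "measure std_normal_distribution UNIV = 1"
  using prob_space.prob_space[OF std_normal_prob] by simp

text \<open>Compare h(t) with h(s) for a normal s and use that E|N| = sqrt(2/pi) is at most
  1.\<close>

lemma lipschitz_centred:
  assumes h: "\<And>x y. \<bar>h x - h y\<bar> \<le> \<bar>x - y\<bar>"
  shows "\<bar>h t - (\<integral>s. h s \<partial>std_normal_distribution)\<bar> \<le> \<bar>t\<bar> + 1"
proof -
  interpret N: prob_space std_normal_distribution by (rule std_normal_prob)
  have ih: "integrable std_normal_distribution h"
    by (rule lipschitz_integrable[OF std_normal_prob _ std_normal_abs_moment(2) h]) simp
  have "h t - (\<integral>s. h s \<partial>std_normal_distribution) = (\<integral>s. h t - h s \<partial>std_normal_distribution)"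
    using ih by (simp add: std_normal_UNIV)
  also have "\<bar>\<dots>\<bar> \<le> (\<integral>s. \<bar>t\<bar> + \<bar>s\<bar> \<partial>std_normal_distribution)"
  proof (rule order_trans[OF integral_abs_bound], rule integral_mono)
    fix s show "\<bar>h t - h s\<bar> \<le> \<bar>t\<bar> + \<bar>s\<bar>" using h[of t s] by linarith
  qed (use ih std_normal_abs_moment(2) in auto)
  also have "\<dots> = \<bar>t\<bar> + (\<integral>s. \<bar>s\<bar> \<partial>std_normal_distribution)"
    using std_normal_abs_moment(2) by (simp add: std_normal_UNIV)
  finally show ?thesis using std_normal_abs_moment(1) by linarith
qed

text \<open>The solution is the antiderivative of nd times the centred test function, divided by nd.
  The tail bounds give 1 + 2 = 3 for g and 2 (3 + 1) = 8 for its derivative u; the derivative of u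
  is then at most 3 + 8 + 1 = 12.\<close>

lemma stein_C1:
  assumes h: "\<And>x. (h has_real_derivative h' x) (at x)" "\<And>x. \<bar>h' x\<bar> \<le> 1"
  defines "m \<equiv> \<integral>s. h s \<partial>std_normal_distribution"
  obtains g u where "\<And>x. (g has_real_derivative u x) (at x)" "\<And>x. u x = x * g x + h x - m"
    "\<And>x. \<bar>g x\<bar> \<le> 3" "\<And>x. \<bar>u x\<bar> \<le> 8" "\<And>x y. \<bar>u x - u y\<bar> \<le> 12 * \<bar>x - y\<bar>"
proof -
  have lip: "\<bar>h x - h y\<bar> \<le> \<bar>x - y\<bar>" for x y
    using field_differentiable_bound[of UNIV h h' 1 x y] h by simp
  define k where "k x = h x - m" for x
  have k: "\<bar>k x\<bar> \<le> \<bar>x\<bar> + 1" for x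
    unfolding k_def m_def by (rule lipschitz_centred[OF lip])
  have hc: "isCont h x" for x using h(1) by (rule DERIV_isCont)
  interpret N: prob_space std_normal_distribution by (rule std_normal_prob)
  have ih: "integrable std_normal_distribution h"
    by (rule lipschitz_integrable[OF std_normal_prob _ std_normal_abs_moment(2) lip]) simp
  have hm[measurable]: "h \<in> borel_measurable borel" using ih by simp
  have [measurable]: "k \<in> borel_measurable borel" unfolding k_def by measurable
  have ik: "integrable std_normal_distribution k" unfolding k_def using ih by simp
  then have ia: "integrable lborel (\<lambda>x. nd x * k x)"
    by (subst (asm) integrable_density) (auto simp: normal_density_nonneg)
  have "(\<integral>x. nd x * k x \<partial>lborel) = (\<integral>x. k x \<partial>std_normal_distribution)"
    by (subst integral_density) (auto simp: normal_density_nonneg)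
  also have "\<dots> = 0" unfolding k_def using ih by (simp add: std_normal_UNIV m_def)
  finally have a0: "(\<integral>x. nd x * k x \<partial>lborel) = 0" .
  have ca: "isCont (\<lambda>x. nd x * k x) x" for x
    unfolding k_def by (intro isCont_mult isCont_diff hc DERIV_isCont[OF DERIV_nd] continuous_const)
  define A where "A x = (\<integral>t. indicator {..x} t * (nd t * k t) \<partial>lborel)" for x
  note A = antiderivative_line[OF ca ia, folded A_def, unfolded a0]
  define g where "g x = A x / nd x" for x
  define u where "u x = x * g x + k x" for x
  have nd0: "nd x \<noteq> 0" for x using nd_pos[of x] by simp
  have Dg: "(g has_real_derivative u x) (at x)" for x
  proof -
    have "(g has_real_derivative (nd x * k x * nd x - A x * (- x * nd x)) / (nd x * nd x)) (at x)"
      unfolding g_def[abs_def] by (rule DERIV_divide[OF A(1) DERIV_nd nd0])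
    moreover have "(nd x * k x * nd x - A x * (- x * nd x)) / (nd x * nd x) = u x"
      using nd0 by (simp add: u_def g_def field_simps)
    ultimately show ?thesis by simp
  qed
  have Ab: "\<bar>A x\<bar> \<le> (1 + 2 * 1 / (1 + \<bar>x\<bar>)) * nd x" for x
  proof (rule gauss_tail_both[OF A(1) _ A(3) A(2)])
    fix t show "\<bar>nd t * k t\<bar> \<le> (1 * \<bar>t\<bar> + 1) * nd t"
      using mult_left_mono[OF k[of t], of "nd t"] by (simp add: abs_mult mult.commute)
  qed auto
  have g3: "\<bar>g x\<bar> \<le> 3" for x
  proof -
    have "(1 + 2 * 1 / (1 + \<bar>x\<bar>)) \<le> 3" by (simp add: field_simps)
    then have "(1 + 2 * 1 / (1 + \<bar>x\<bar>)) * nd x \<le> 3 * nd x" by (rule mult_right_mono) simp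
    with Ab[of x] have "\<bar>A x\<bar> \<le> 3 * nd x" by linarith
    then show ?thesis using nd_pos[of x] by (simp add: g_def abs_divide pos_divide_le_eq)
  qed
  define u' where "u' x = g x + x * u x + h' x" for x
  have Du: "(u has_real_derivative u' x) (at x)" for x
    unfolding u_def[abs_def] u'_def k_def using Dg[of x] h(1)[of x]
    by (auto intro!: derivative_eq_intros simp: u_def k_def)
  \<comment> \<open>Multiplying by nd cancels the term x u in the derivative of u and leaves the
    bounded factor g + h', to which the tail bound applies a second time.\<close>
  define U where "U x = u x * nd x" for x
  have DU: "(U has_real_derivative (g x + h' x) * nd x) (at x)" for x
    unfolding U_def[abs_def] using Du[of x] DERIV_nd[of x]
    by (auto intro!: derivative_eq_intros simp: u'_def algebra_simps)
  have Ub: "\<bar>U x\<bar> \<le> 4 * ((1 + \<bar>x\<bar>) * nd x)" for x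
  proof -
    have "\<bar>u x\<bar> \<le> \<bar>x\<bar> * 3 + (\<bar>x\<bar> + 1)"
      unfolding u_def using k[of x] mult_left_mono[OF g3[of x], of "\<bar>x\<bar>"]
      by (intro order_trans[OF abs_triangle_ineq] add_mono) (auto simp: abs_mult)
    then have "\<bar>u x\<bar> \<le> 4 * (1 + \<bar>x\<bar>)" by simp
    then show ?thesis using mult_right_mono[of "\<bar>u x\<bar>" "4 * (1 + \<bar>x\<bar>)" "nd x"]
      by (simp add: U_def abs_mult algebra_simps)
  qed
  have z: "((\<lambda>x. 4 * ((1 + \<bar>x\<bar>) * nd x)) \<longlongrightarrow> 0) at_top"
  proof (rule Lim_transform_eventually[OF tendsto_mult_right_zero[OF nd_decay_at_top, of 4]])
    show "\<forall>\<^sub>F x in at_top. 4 * ((1 + x) * nd x) = 4 * ((1 + \<bar>x\<bar>) * nd x)"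
      using eventually_ge_at_top[of "0::real"] by eventually_elim simp
  qed
  have U0: "(U \<longlongrightarrow> 0) at_top"
    by (rule Lim_null_comparison[OF always_eventually z]) (simp add: Ub)
  have "((\<lambda>x. U (- x)) \<longlongrightarrow> 0) at_top"
    by (rule Lim_null_comparison[OF always_eventually z]) (use Ub[of "- _"] in \<open>simp add: nd_even\<close>)
  then have U1: "(U \<longlongrightarrow> 0) at_bot" by (simp add: filterlim_at_bot_mirror)
  have "\<bar>U x\<bar> \<le> (0 + 2 * 4 / (1 + \<bar>x\<bar>)) * nd x" for x
  proof (rule gauss_tail_both[OF DU _ U0 U1])
    fix t have "\<bar>g t + h' t\<bar> \<le> 4" using g3[of t] h(2)[of t] by linarith
    then show "\<bar>(g t + h' t) * nd t\<bar> \<le> (0 * \<bar>t\<bar> + 4) * nd t"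
      using mult_right_mono[of "\<bar>g t + h' t\<bar>" 4 "nd t"] by (simp add: abs_mult)
  qed auto
  then have ub: "\<bar>u x\<bar> \<le> 8 / (1 + \<bar>x\<bar>)" for x
  proof -
    have "\<bar>u x\<bar> * nd x \<le> 8 / (1 + \<bar>x\<bar>) * nd x"
      using \<open>\<And>x. \<bar>U x\<bar> \<le> (0 + 2 * 4 / (1 + \<bar>x\<bar>)) * nd x\<close>[of x] by (simp add: U_def abs_mult)
    then show ?thesis using nd_pos[of x] by (rule mult_right_le_imp_le)
  qed
  have u8: "\<bar>u x\<bar> \<le> 8" for x
    by (rule order_trans[OF ub]) (simp add: field_simps)
  have "\<bar>x * u x\<bar> \<le> 8" for x
  proof -
    have "\<bar>x * u x\<bar> \<le> \<bar>x\<bar> * (8 / (1 + \<bar>x\<bar>))" unfolding abs_mult by (intro mult_left_mono ub) auto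
    also have "\<dots> \<le> 8" by (simp add: field_simps)
    finally show ?thesis .
  qed
  then have u'12: "\<bar>u' x\<bar> \<le> 12" for x
  proof -
    have "\<bar>u' x\<bar> \<le> \<bar>g x\<bar> + \<bar>x * u x\<bar> + \<bar>h' x\<bar>" unfolding u'_def by linarith
    then show ?thesis using g3[of x] h(2)[of x] \<open>\<And>x. \<bar>x * u x\<bar> \<le> 8\<close>[of x] by linarith
  qed
  have ul: "\<bar>u x - u y\<bar> \<le> 12 * \<bar>x - y\<bar>" for x y
    using field_differentiable_bound[of UNIV u u' 12 x y] Du u'12 by simp
  show thesis
    by (rule that[of g u]) (use Dg g3 u8 ul in \<open>auto simp: u_def k_def\<close>)
qed

text \<open>The Lipschitz estimate for u is anchored at x, so \<open>L\<close> may depend on x; the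
  half-line test functions use it with L = 4|x| + 2.\<close>

lemma taylor_lipschitz:
  fixes g u :: "real \<Rightarrow> real"
  assumes "\<And>x. (g has_real_derivative u x) (at x)" "\<And>z. \<bar>u z - u x\<bar> \<le> L * \<bar>z - x\<bar>" "L \<ge> 0"
  shows "\<bar>g y - g x - u x * (y - x)\<bar> \<le> L * (y - x)\<^sup>2"
proof (cases "y = x")
  case False
  have "\<exists>z. \<bar>z - x\<bar> \<le> \<bar>y - x\<bar> \<and> g y - g x = (y - x) * u z"
  proof (cases "x < y")
    case True
    then obtain z where "x < z" "z < y" "g y - g x = (y - x) * u z"
      using MVT2[of x y g u] assms(1) by auto
    then show ?thesis by (intro exI[of _ z]) auto
  next
    case False
    then obtain z where "y < z" "z < x" "g x - g y = (x - y) * u z"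
      using MVT2[of y x g u] assms(1) \<open>y \<noteq> x\<close> by auto
    then show ?thesis by (intro exI[of _ z]) (auto simp: algebra_simps)
  qed
  then obtain z where z: "\<bar>z - x\<bar> \<le> \<bar>y - x\<bar>" "g y - g x = (y - x) * u z" by blast
  then have "\<bar>g y - g x - u x * (y - x)\<bar> = \<bar>u z - u x\<bar> * \<bar>y - x\<bar>"
    by (simp add: z(2) abs_mult[symmetric] algebra_simps)
  also have "\<dots> \<le> (L * \<bar>y - x\<bar>) * \<bar>y - x\<bar>"
  proof (intro mult_right_mono)
    from z(1) show "\<bar>u z - u x\<bar> \<le> L * \<bar>y - x\<bar>"
      by (intro order_trans[OF assms(2)] mult_left_mono assms(3))
  qed simp
  also have "\<dots> = L * (y - x)\<^sup>2"
    by (simp add: power2_eq_square abs_mult_self_eq mult.assoc)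
  finally show ?thesis .
qed simp

text \<open>The smoothing is the average of h over [x, x + e], written as a difference quotient of
  an antiderivative; its derivative is a difference quotient of h, hence at most 1.\<close>

lemma lipschitz_smoothing:
  fixes h :: "real \<Rightarrow> real"
  assumes h: "\<And>x y. \<bar>h x - h y\<bar> \<le> \<bar>x - y\<bar>" and e: "e > 0"
  obtains k k' where "\<And>x. (k has_real_derivative k' x) (at x)" "\<And>x. \<bar>k' x\<bar> \<le> 1" "\<And>x. \<bar>k x - h x\<bar> \<le> e"
proof -
  have c: "continuous_on UNIV h"
    by (rule lipschitz_on_continuous_on[of 1], rule lipschitz_onI) (use h in \<open>auto simp: dist_real_def\<close>)
  obtain H where H: "\<And>x. (H has_real_derivative h x) (at x)"
    using einterval_antiderivative[of "-\<infinity>" "\<infinity>" h] c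
    by (auto simp: has_real_derivative_iff_has_vector_derivative continuous_on_eq_continuous_at)
  show thesis
  proof (rule that[of "\<lambda>x. (H (x + e) - H x) / e" "\<lambda>x. (h (x + e) - h x) / e"])
    fix x
    show "((\<lambda>x. (H (x + e) - H x) / e) has_real_derivative (h (x + e) - h x) / e) (at x)"
      using DERIV_shift[of H "h (x + e)" x e] H
      by (intro DERIV_cdivide DERIV_diff) auto
    show "\<bar>(h (x + e) - h x) / e\<bar> \<le> 1" using h[of "x + e" x] e by (simp add: abs_divide)
    obtain z where z: "x < z" "z < x + e" "H (x + e) - H x = (x + e - x) * h z"
      using MVT2[of x "x + e" H h] H e by auto
    then have "(H (x + e) - H x) / e = h z" using e by simp
    then show "\<bar>(H (x + e) - H x) / e - h x\<bar> \<le> e" using h[of z x] z by simp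
  qed
qed

lemma DERIV_glue:
  fixes a b :: "real \<Rightarrow> real"
  assumes a: "(a has_real_derivative D) (at z)" and b: "(b has_real_derivative D) (at z)" and ab: "a z = b z"
  shows "((\<lambda>t. if t \<le> z then a t else b t) has_real_derivative D) (at z)"
  unfolding has_field_derivative_iff
proof (rule filterlim_split_at)
  let ?q = "\<lambda>y. ((if y \<le> z then a y else b y) - (if z \<le> z then a z else b z)) / (y - z)"
  have "((\<lambda>y. (a y - a z) / (y - z)) \<longlongrightarrow> D) (at_left z)"
    using a by (simp add: has_field_derivative_iff filterlim_at_split)
  then show "(?q \<longlongrightarrow> D) (at_left z)"
    by (rule Lim_transform_eventually) (auto simp: eventually_at_filter)
  have "((\<lambda>y. (b y - b z) / (y - z)) \<longlongrightarrow> D) (at_right z)"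
    using b by (simp add: has_field_derivative_iff filterlim_at_split)
  then show "(?q \<longlongrightarrow> D) (at_right z)"
    by (rule Lim_transform_eventually) (auto simp: eventually_at_filter ab)
qed

text \<open>The derivative x g + 1(x \<le> z) - p of the Stein solution jumps at z. The last bound
  therefore separates a smooth second order error, whose coefficient grows linearly in x, from a
  term that vanishes unless x and y lie on different sides of z.\<close>

lemma stein_indicator:
  fixes z :: real
  defines "p \<equiv> cdf std_normal_distribution z"
  obtains g where "\<And>x. \<bar>g x\<bar> \<le> 2" "g \<in> borel_measurable borel"
    "\<And>x. \<bar>x * g x + of_bool (x \<le> z) - p\<bar> \<le> 3" "\<And>x y. \<bar>g x - g y\<bar> \<le> 4 * \<bar>x - y\<bar>"
    "\<And>x y. \<bar>g y - g x - (x * g x + of_bool (x \<le> z) - p) * (y - x)\<bar>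
       \<le> (4 * \<bar>x\<bar> + 2) * (y - x)\<^sup>2 + \<bar>(y - x) * (of_bool (y \<le> z) - of_bool (x \<le> z))\<bar>"
proof -
  interpret N: prob_space std_normal_distribution by (rule std_normal_prob)
  have ind: "integrable lborel nd" by simp
  have cnd: "isCont nd x" for x by (rule DERIV_isCont[OF DERIV_nd])
  have int1: "(\<integral>t. nd t \<partial>lborel) = 1" by simp
  define F where "F x = (\<integral>t. indicator {..x} t * nd t \<partial>lborel)" for x
  note F = antiderivative_line[OF cnd ind, folded F_def, unfolded int1]
  have Fcdf: "F x = cdf std_normal_distribution x" for x
  proof -
    have "cdf std_normal_distribution x = (\<integral>t. indicator {..x} t \<partial>std_normal_distribution)"
      by (simp add: cdf_def)
    also have "\<dots> = (\<integral>t. nd t * indicator {..x} t \<partial>lborel)"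
      by (subst integral_density) (auto simp: normal_density_nonneg)
    finally show ?thesis by (simp add: F_def mult.commute)
  qed
  have F01: "0 \<le> F x" "F x \<le> 1" for x unfolding Fcdf cdf_def by auto
  have pF: "p = F z" by (simp add: p_def Fcdf)
  have Fmono: "F x \<le> F y" if "x \<le> y" for x y
    unfolding Fcdf cdf_def using that by (intro N.finite_measure_mono) auto
  have nd0: "nd x \<noteq> 0" for x using nd_pos[of x] by simp
  have up: "1 - F x \<le> 2 / (1 + x) * nd x" if "x \<ge> 0" for x
  proof -
    have "\<bar>1 - F x\<bar> \<le> (0 + 2 * 1 / (1 + x)) * nd x"
    proof (rule gauss_tail[where a="\<lambda>x. - nd x"])
      fix t show "((\<lambda>x. 1 - F x) has_real_derivative - nd t) (at t)"
        using F(1)[of t] by (auto intro!: derivative_eq_intros)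
      show "((\<lambda>x. 1 - F x) \<longlongrightarrow> 0) at_top"
        using tendsto_diff[OF tendsto_const F(3), of 1] by simp
    qed (use that in auto)
    then show ?thesis by simp
  qed
  have lo: "F (- x) \<le> 2 / (1 + x) * nd x" if "x \<ge> 0" for x
  proof -
    have "\<bar>F (- x)\<bar> \<le> (0 + 2 * 1 / (1 + x)) * nd x"
    proof (rule gauss_tail[where a="\<lambda>x. - nd x"])
      fix t :: real show "((\<lambda>x. F (- x)) has_real_derivative - nd t) (at t)"
        using F(1)[of "- t"] by (simp add: DERIV_mirror nd_even)
      show "((\<lambda>x. F (- x)) \<longlongrightarrow> 0) at_top"
        using F(2) by (simp add: filterlim_at_bot_mirror)
    qed (use that in auto)
    then show ?thesis by simp
  qed
  \<comment> \<open>Numerator of the classical solution. It is at most F(x) and at most 1 - F(x), so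
    on each half-line the better of the two Gaussian tail bounds is available.\<close>
  define A where "A x = (if x \<le> z then F x * (1 - F z) else F z * (1 - F x))" for x
  have A0: "0 \<le> A x" for x unfolding A_def using F01 by auto
  have A1: "A x \<le> 2 / (1 + \<bar>x\<bar>) * nd x" for x
  proof -
    have "A x \<le> F x" "A x \<le> 1 - F x"
    proof -
      have *: "a * b \<le> a" "a * b \<le> b" if "0 \<le> a" "a \<le> 1" "0 \<le> b" "b \<le> 1" for a b :: real
        using that mult_left_le[of b a] mult_right_le_one_le[of b a] by (auto simp: mult.commute)
      show "A x \<le> F x"
      proof (cases "x \<le> z")
        case True
        then show ?thesis using *(1)[of "F x" "1 - F z"] F01 by (simp add: A_def)
      next
        case False
        then show ?thesis using *(1)[of "F z" "1 - F x"] F01[of x] F01[of z] Fmono[of z x]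
          by (simp add: A_def)
      qed
      show "A x \<le> 1 - F x"
      proof (cases "x \<le> z")
        case True
        then show ?thesis using *(2)[of "F x" "1 - F z"] F01[of x] F01[of z] Fmono[of x z]
          by (simp add: A_def)
      next
        case False
        then show ?thesis using *(2)[of "F z" "1 - F x"] F01[of x] F01[of z] by (simp add: A_def)
      qed
    qed
    then show ?thesis
      using up[of x] lo[of "- x"] by (cases "x \<ge> 0") (auto simp: nd_even)
  qed
  define g where "g x = A x / nd x" for x
  have gb: "\<bar>g x\<bar> \<le> 2 / (1 + \<bar>x\<bar>)" for x
    using A0[of x] A1[of x] nd_pos[of x] by (simp add: g_def pos_divide_le_eq)
  have g2: "\<bar>g x\<bar> \<le> 2" for x
    by (rule order_trans[OF gb]) (simp add: field_simps)
  have xg: "\<bar>x * g x\<bar> \<le> 2" for x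
  proof -
    have "\<bar>x * g x\<bar> \<le> \<bar>x\<bar> * (2 / (1 + \<bar>x\<bar>))" unfolding abs_mult by (intro mult_left_mono gb) auto
    also have "\<dots> \<le> 2" by (simp add: field_simps)
    finally show ?thesis .
  qed
  \<comment> \<open>Subtracting \<open>min t z\<close> removes the kink of g at z: the derivative t
    g - p of q has no jump, and Taylor expansion applies to q.\<close>
  define q where "q t = g t - min t z" for t
  have Dq: "(q has_real_derivative t * g t - p) (at t)" for t
  proof -
    define l where "l t = F t * (1 - F z) / nd t - t" for t
    define r where "r t = F z * (1 - F t) / nd t - z" for t
    have ql: "q = (\<lambda>t. if t \<le> z then l t else r t)"
      by (auto simp: q_def g_def A_def l_def r_def fun_eq_iff)
    have Dl: "(l has_real_derivative t * (F t * (1 - F z) / nd t) - p) (at t)" for t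
      unfolding l_def[abs_def] using F(1)[of t] DERIV_nd[of t] nd0[of t]
      by (auto intro!: derivative_eq_intros simp: pF field_simps)
    have Dr: "(r has_real_derivative t * (F z * (1 - F t) / nd t) - p) (at t)" for t
      unfolding r_def[abs_def] using F(1)[of t] DERIV_nd[of t] nd0[of t]
      by (auto intro!: derivative_eq_intros simp: pF field_simps)
    consider "t < z" | "t = z" | "t > z" by linarith
    then show ?thesis
    proof cases
      case 1
      show ?thesis
      proof (rule has_field_derivative_transform_within_open[of l _ t "{..<z}"])
        show "(l has_real_derivative t * g t - p) (at t)" using Dl[of t] 1 by (simp add: g_def A_def)
      qed (use 1 in \<open>auto simp: ql\<close>)
    next
      case 2
      show ?thesis unfolding ql
        using Dl[of z] Dr[of z] 2 by (auto intro!: DERIV_glue simp: g_def A_def) (simp add: l_def r_def field_simps)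
    next
      case 3
      show ?thesis
      proof (rule has_field_derivative_transform_within_open[of r _ t "{z<..}"])
        show "(r has_real_derivative t * g t - p) (at t)" using Dr[of t] 3 by (simp add: g_def A_def)
      qed (use 3 in \<open>auto simp: ql\<close>)
    qed
  qed
  have p01: "0 \<le> p" "p \<le> 1" using F01 pF by auto
  have q3: "\<bar>t * g t - p\<bar> \<le> 3" for t using xg[of t] p01 by linarith
  have "\<bar>q x - q y\<bar> \<le> 3 * \<bar>x - y\<bar>" for x y
    using field_differentiable_bound[of UNIV q "\<lambda>t. t * g t - p" 3 x y] Dq q3 by simp
  then have gl: "\<bar>g x - g y\<bar> \<le> 4 * \<bar>x - y\<bar>" for x y
  proof -
    have "\<bar>min x z - min y z\<bar> \<le> \<bar>x - y\<bar>" by (auto simp: min_def)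
    moreover have "g x - g y = (q x - q y) + (min x z - min y z)" by (simp add: q_def)
    ultimately have "\<bar>g x - g y\<bar> \<le> \<bar>q x - q y\<bar> + \<bar>x - y\<bar>"
      using abs_triangle_ineq[of "q x - q y" "min x z - min y z"] by (metis add_left_mono order_trans)
    then show ?thesis using \<open>\<And>x y. \<bar>q x - q y\<bar> \<le> 3 * \<bar>x - y\<bar>\<close>[of x y] by simp
  qed
  have "continuous_on UNIV g"
    by (rule lipschitz_on_continuous_on[of 4], rule lipschitz_onI) (use gl in \<open>auto simp: dist_real_def\<close>)
  then have gm: "g \<in> borel_measurable borel" by (rule borel_measurable_continuous_onI)
  have qt: "\<bar>q y - q x - (x * g x - p) * (y - x)\<bar> \<le> (4 * \<bar>x\<bar> + 2) * (y - x)\<^sup>2" for x y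
  proof (rule taylor_lipschitz[OF Dq])
    fix w
    have "(w * g w - p) - (x * g x - p) = x * (g w - g x) + (w - x) * g w" by (simp add: algebra_simps)
    also have "\<bar>\<dots>\<bar> \<le> \<bar>x\<bar> * (4 * \<bar>w - x\<bar>) + \<bar>w - x\<bar> * 2"
      by (intro order_trans[OF abs_triangle_ineq] add_mono)
         (auto simp: abs_mult intro!: mult_left_mono gl g2)
    finally show "\<bar>(w * g w - p) - (x * g x - p)\<bar> \<le> (4 * \<bar>x\<bar> + 2) * \<bar>w - x\<bar>"
      by (simp add: algebra_simps)
  qed simp
  show thesis
  proof (rule that[of g])
    fix x y
    show "\<bar>x * g x + of_bool (x \<le> z) - p\<bar> \<le> 3" using xg[of x] p01 by (cases "x \<le> z") auto
    have m: "\<bar>min y z - min x z - of_bool (x \<le> z) * (y - x)\<bar> \<le> \<bar>(y - x) * (of_bool (y \<le> z) - of_bool (x \<le> z))\<bar>"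
      by (auto simp: min_def)
    have e: "g y - g x - (x * g x + of_bool (x \<le> z) - p) * (y - x)
      = (q y - q x - (x * g x - p) * (y - x)) + (min y z - min x z - of_bool (x \<le> z) * (y - x))"
      by (simp add: q_def algebra_simps)
    show "\<bar>g y - g x - (x * g x + of_bool (x \<le> z) - p) * (y - x)\<bar>
       \<le> (4 * \<bar>x\<bar> + 2) * (y - x)\<^sup>2 + \<bar>(y - x) * (of_bool (y \<le> z) - of_bool (x \<le> z))\<bar>"
      unfolding e by (rule order_trans[OF abs_triangle_ineq add_mono[OF qt m]])
  qed (fact g2 gm gl)+
qed

section \<open>The Stein discrepancy\<close>

definition sw1 :: "nat \<Rightarrow> nat" where "sw1 c = (if c = 0 then 1 else if c = 1 then 0 else c)"
text \<open>Moves both copies of the Stein pair (0, 1) to the fresh pair (2, 3) at once, as required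
  when Efron-Stein is applied to a functional of both copies.\<close>

definition sw2 :: "nat \<Rightarrow> nat" where
  "sw2 c = (if c = 0 then 2 else if c = 1 then 3 else if c = 2 then 0 else if c = 3 then 1 else c)"

lemma sw1_inv: "sw1 (sw1 c) = c" by (simp add: sw1_def)
lemma sw2_inv: "sw2 (sw2 c) = c" by (simp add: sw2_def)
lemma sw1_inj: "inj sw1" by (metis injI sw1_inv)
lemma sw2_inj: "inj sw2" by (metis injI sw2_inv)

definition lead :: "nat \<Rightarrow> nat \<Rightarrow> nat" where "lead j = (\<lambda>i. if i < j then 1 else 0)"

section \<open>Increments of a normalized functional and the exchangeable pair\<close>

locale centred_functional = site_copies M for M :: "nat \<Rightarrow> 'a measure" +
  fixes f :: "(nat \<Rightarrow> 'a) \<Rightarrow> real"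
  assumes f_meas [measurable]: "f \<in> borel_measurable P"
    and f_sq: "integrable P (\<lambda>x. (f x)\<^sup>2)"
    and f_mean: "(\<integral>x. f x \<partial>P) = 0"
    and f_var: "(\<integral>x. (f x)\<^sup>2 \<partial>P) = 1"
begin

definition W :: "(nat \<Rightarrow> nat) \<Rightarrow> (nat \<times> nat \<Rightarrow> 'a) \<Rightarrow> real" where "W s \<omega> = f (sel s \<omega>)"

definition D1 :: "(nat \<Rightarrow> nat) \<Rightarrow> nat \<Rightarrow> nat \<Rightarrow> (nat \<times> nat \<Rightarrow> 'a) \<Rightarrow> real" where
  "D1 s j c \<omega> = W s \<omega> - W (s(j := c)) \<omega>"

definition D2 :: "(nat \<Rightarrow> nat) \<Rightarrow> nat \<Rightarrow> nat \<Rightarrow> nat \<Rightarrow> nat \<Rightarrow> (nat \<times> nat \<Rightarrow> 'a) \<Rightarrow> real" where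
  "D2 s i b j c \<omega> = W s \<omega> - W (s(i := b)) \<omega> - W (s(j := c)) \<omega> + W (s(i := b, j := c)) \<omega>"

lemma W_meas [measurable]: "W s \<in> borel_measurable Q"
  unfolding W_def[abs_def] by measurable
lemma D1_meas [measurable]: "D1 s j c \<in> borel_measurable Q"
  unfolding D1_def[abs_def] by measurable
lemma D2_meas [measurable]: "D2 s i b j c \<in> borel_measurable Q"
  unfolding D2_def[abs_def] by measurable

lemma sqint_W: "sqint (W s)"
  unfolding W_def[abs_def] by (rule sqint_sel[OF f_meas f_sq])

lemma sqint_D1: "sqint (D1 s j c)"
  unfolding D1_def[abs_def] by (intro sqint_diff sqint_W)

lemma integral_W: "(\<integral>\<omega>. W s \<omega> \<partial>Q) = 0" "(\<integral>\<omega>. (W s \<omega>)\<^sup>2 \<partial>Q) = 1"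
proof -
  have "(\<integral>\<omega>. W s \<omega> \<partial>Q) = (\<integral>x. f x \<partial>distr Q P (sel s))"
    unfolding W_def by (rule integral_distr[symmetric]) measurable
  then show "(\<integral>\<omega>. W s \<omega> \<partial>Q) = 0" by (simp add: distr_sel f_mean)
  have "(\<integral>\<omega>. (W s \<omega>)\<^sup>2 \<partial>Q) = (\<integral>x. (f x)\<^sup>2 \<partial>distr Q P (sel s))"
    unfolding W_def by (rule integral_distr[symmetric]) measurable
  then show "(\<integral>\<omega>. (W s \<omega>)\<^sup>2 \<partial>Q) = 1" by (simp add: distr_sel f_var)
qed

lemma W_resamp: "W s (resamp \<tau> A \<omega>) = W (\<lambda>i. if i \<in> A then \<tau> (s i) else s i) \<omega>"
  by (simp add: W_def sel_resamp)

lemma W_dep: "(\<And>k. k \<in> A \<Longrightarrow> \<omega> k = \<omega>' k) \<Longrightarrow> (\<And>i. (s i, i) \<in> A) \<Longrightarrow> W s \<omega> = W s \<omega>'"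
  by (simp add: W_def sel_def)

abbreviation W0 where "W0 \<equiv> W (\<lambda>_. 0)"
definition u :: "nat \<Rightarrow> (nat \<times> nat \<Rightarrow> 'a) \<Rightarrow> real" where "u j = D1 (\<lambda>_. 0) j 1"
definition v :: "nat \<Rightarrow> (nat \<times> nat \<Rightarrow> 'a) \<Rightarrow> real" where "v j = D1 (lead j) j 1"
text \<open>For \<open>\<phi>\<close> the identity, the mean of T is E[W (W - W_n)], where W_n has
  its first n sites resampled, and tends to the variance 1. For \<open>\<phi>\<close> = abs the mean
  is 0, and T controls the jumps in the Kolmogorov case.\<close>

definition T :: "(real \<Rightarrow> real) \<Rightarrow> nat \<Rightarrow> (nat \<times> nat \<Rightarrow> 'a) \<Rightarrow> real" where
  "T \<phi> n \<omega> = (\<Sum>j<n. u j \<omega> * \<phi> (v j \<omega>)) / 2"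

lemma lead_upd: "(lead j)(j := 1) = lead (Suc j)"
  by (auto simp: lead_def fun_eq_iff)

lemma lead_resamp: "W0 (resamp sw1 {..<j} \<omega>) = W (lead j) \<omega>"
  unfolding W_resamp by (rule arg_cong[where f="\<lambda>s. W s \<omega>"]) (auto simp: lead_def sw1_def)

lemma v_eq: "v j \<omega> = W (lead j) \<omega> - W (lead (Suc j)) \<omega>"
  unfolding v_def D1_def lead_upd ..

lemma u_eq: "u j \<omega> = W0 \<omega> - W ((\<lambda>_. 0)(j := 1)) \<omega>"
  by (simp add: u_def D1_def)

lemma uv_meas [measurable]: "u j \<in> borel_measurable Q" "v j \<in> borel_measurable Q"
  by (simp_all add: u_def v_def)

lemma sqint_uv: "sqint (u j)" "sqint (v j)"
  by (simp_all add: u_def v_def sqint_D1)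

lemma W0_swap: "W0 (resamp sw1 {j} \<omega>) = W ((\<lambda>_. 0)(j := 1)) \<omega>"
  unfolding W_resamp by (rule arg_cong[where f="\<lambda>s. W s \<omega>"]) (auto simp: sw1_def)

lemma u_swap: "u j (resamp sw1 {j} \<omega>) = - u j \<omega>"
proof -
  have "W ((\<lambda>_. 0)(j := 1)) (resamp sw1 {j} \<omega>) = W0 \<omega>"
    unfolding W_resamp by (rule arg_cong[where f="\<lambda>s. W s \<omega>"]) (auto simp: sw1_def)
  then show ?thesis by (simp add: u_eq W0_swap)
qed

lemma v_swap: "v j (resamp sw1 {j} \<omega>) = - v j \<omega>"
proof -
  have "(\<lambda>i. if i \<in> {j} then sw1 (lead j i) else lead j i) = lead (Suc j)"
    "(\<lambda>i. if i \<in> {j} then sw1 (lead (Suc j) i) else lead (Suc j) i) = lead j"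
    by (auto simp: lead_def sw1_def fun_eq_iff)
  then show ?thesis by (simp add: v_eq W_resamp)
qed

text \<open>\<open>v j\<close> is \<open>u j\<close> evaluated after exchanging copies 0 and 1 at
  the sites below j, a map that preserves \<open>Q\<close>.\<close>

lemma nn_v_eq_u:
  assumes [measurable]: "g \<in> borel_measurable borel"
  shows "(\<integral>\<^sup>+\<omega>. g (v j \<omega>) \<partial>Q) = (\<integral>\<^sup>+\<omega>. g (u j \<omega>) \<partial>Q)"
proof -
  have "v j \<omega> = u j (resamp sw1 {..<j} \<omega>)" for \<omega>
  proof -
    have "(\<lambda>i. if i \<in> {..<j} then sw1 (((\<lambda>_. 0)(j := 1)) i) else ((\<lambda>_. 0)(j := 1)) i) = lead (Suc j)"
      by (auto simp: lead_def sw1_def fun_eq_iff)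
    then show ?thesis
      unfolding v_eq u_eq lead_resamp W_resamp[of "(\<lambda>_. 0)(j := 1)"] by (simp only:)
  qed
  then show ?thesis using nn_integral_resamp[OF sw1_inj, of "\<lambda>\<omega>. g (u j \<omega>)" "{..<j}"] by simp
qed

text \<open>The features shared by the identity and abs that make the product rule for T go
  through.\<close>

definition nice :: "(real \<Rightarrow> real) \<Rightarrow> bool" where
  "nice \<phi> \<longleftrightarrow> \<phi> \<in> borel_measurable borel \<and> (\<forall>x. \<bar>\<phi> x\<bar> = \<bar>x\<bar>) \<and> (\<forall>x y. \<bar>\<phi> x - \<phi> y\<bar> \<le> \<bar>x - y\<bar>)"

lemma nice_id: "nice (\<lambda>x. x)" by (simp add: nice_def)
lemma nice_abs: "nice abs" by (auto simp: nice_def)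

definition fourth :: bool where "fourth \<longleftrightarrow> (\<forall>j. integrable Q (\<lambda>\<omega>. (u j \<omega>) ^ 4))"

lemma mult_sq_le: "(a * b)\<^sup>2 \<le> a ^ 4 + b ^ 4" for a b :: real
proof -
  have e: "x ^ 4 = (x\<^sup>2)\<^sup>2" for x :: real by simp
  have "2 * (a\<^sup>2 * b\<^sup>2) \<le> (a\<^sup>2)\<^sup>2 + (b\<^sup>2)\<^sup>2" using sum_squares_bound[of "a\<^sup>2" "b\<^sup>2"] by simp
  moreover have "0 \<le> a\<^sup>2 * b\<^sup>2" by simp
  ultimately show ?thesis unfolding e power_mult_distrib by linarith
qed

lemma sqint_uphi:
  assumes "fourth" "nice \<phi>"
  shows "sqint (\<lambda>\<omega>. u j \<omega> * \<phi> (v j \<omega>))"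
proof -
  have [measurable]: "\<phi> \<in> borel_measurable borel" using assms(2) by (simp add: nice_def)
  have iu: "integrable Q (\<lambda>\<omega>. (u j \<omega>) ^ 4)" using assms(1) by (simp add: fourth_def)
  have "(\<integral>\<^sup>+\<omega>. ennreal (norm ((v j \<omega>) ^ 4)) \<partial>Q) = (\<integral>\<^sup>+\<omega>. ennreal (norm ((u j \<omega>) ^ 4)) \<partial>Q)"
    by (rule nn_v_eq_u) measurable
  then have iv: "integrable Q (\<lambda>\<omega>. (v j \<omega>) ^ 4)"
    using iu by (simp add: integrable_iff_bounded)
  have "integrable Q (\<lambda>\<omega>. (u j \<omega>) ^ 4 + (v j \<omega>) ^ 4)" using iu iv by simp
  then have "integrable Q (\<lambda>\<omega>. (u j \<omega> * \<phi> (v j \<omega>))\<^sup>2)"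
  proof (rule Bochner_Integration.integrable_bound)
    have "(u j \<omega> * \<phi> (v j \<omega>))\<^sup>2 \<le> (u j \<omega>) ^ 4 + (v j \<omega>) ^ 4" for \<omega>
    proof -
      have "(u j \<omega> * \<phi> (v j \<omega>))\<^sup>2 = (u j \<omega> * v j \<omega>)\<^sup>2"
        using assms(2) by (metis nice_def power_mult_distrib power2_abs)
      then show ?thesis using mult_sq_le by simp
    qed
    then show "AE \<omega> in Q. norm ((u j \<omega> * \<phi> (v j \<omega>))\<^sup>2) \<le> norm ((u j \<omega>) ^ 4 + (v j \<omega>) ^ 4)" by simp
  qed measurable
  then show ?thesis by (simp add: sqint_def)
qed

lemma sqint_T: "fourth \<Longrightarrow> nice \<phi> \<Longrightarrow> sqint (T \<phi> n)"
  unfolding T_def[abs_def] using sqint_cmult[OF sqint_sum[of "{..<n}" "\<lambda>j \<omega>. u j \<omega> * \<phi> (v j \<omega>)"], of "1/2"] sqint_uphi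
  by simp

text \<open>Copies 0 and 1 are independent and W is centred. This kills the contribution of the
  fully resampled configuration in the limit of the interpolation.\<close>

lemma indep_W_all:
  assumes g: "g \<in> borel_measurable borel" "sqint (\<lambda>\<omega>. g (W0 \<omega>))"
  shows "(\<integral>\<omega>. g (W0 \<omega>) * W (\<lambda>_. 1) \<omega> \<partial>Q) = 0"
proof -
  note [measurable] = g(1)
  have "Q.indep_var borel (\<lambda>\<omega>. g (W0 \<omega>)) borel (W (\<lambda>_. 1))"
  proof (rule indep_disjoint[where A="{0} \<times> UNIV" and B="{1} \<times> UNIV"])
    fix \<omega> \<omega>' :: "nat \<times> nat \<Rightarrow> 'a"
    assume "\<And>k. k \<in> {0} \<times> UNIV \<Longrightarrow> \<omega> k = \<omega>' k"
    then show "g (W0 \<omega>) = g (W0 \<omega>')" by (subst W_dep[of "{0} \<times> UNIV" \<omega> \<omega>']) auto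
  next
    fix \<omega> \<omega>' :: "nat \<times> nat \<Rightarrow> 'a"
    assume "\<And>k. k \<in> {1} \<times> UNIV \<Longrightarrow> \<omega> k = \<omega>' k"
    then show "W (\<lambda>_. 1) \<omega> = W (\<lambda>_. 1) \<omega>'" by (subst W_dep[of "{1} \<times> UNIV" \<omega> \<omega>']) auto
  qed auto
  from Q.indep_var_lebesgue_integral[OF this] show ?thesis
    using g(2) sqint_W by (simp add: sqint_integrable integral_W)
qed

text \<open>Exchanging the copies at j flips the sign of \<open>u j\<close> and keeps |v j|.\<close>

lemma T_abs_mean: assumes "fourth" shows "(\<integral>\<omega>. T abs n \<omega> \<partial>Q) = 0"
proof -
  have "(\<integral>\<omega>. u j \<omega> * \<bar>v j \<omega>\<bar> \<partial>Q) = 0" for j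
  proof -
    have "(\<integral>\<omega>. u j \<omega> * \<bar>v j \<omega>\<bar> \<partial>Q) = (\<integral>\<omega>. u j (resamp sw1 {j} \<omega>) * \<bar>v j (resamp sw1 {j} \<omega>)\<bar> \<partial>Q)"
      by (rule integral_resamp[OF sw1_inj, symmetric]) measurable
    also have "\<dots> = - (\<integral>\<omega>. u j \<omega> * \<bar>v j \<omega>\<bar> \<partial>Q)"
      by (simp add: u_swap v_swap)
    finally show ?thesis by simp
  qed
  then show ?thesis
    unfolding T_def using sqint_integrable[OF sqint_uphi[OF assms nice_abs]]
    by (simp add: Bochner_Integration.integral_sum)
qed

lemma integral_abs_le_sqrt:
  assumes "sqint F" shows "(\<integral>\<omega>. \<bar>F \<omega>\<bar> \<partial>Q) \<le> sqrt (\<integral>\<omega>. (F \<omega>)\<^sup>2 \<partial>Q)"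
  using Cauchy_Schwarz_Q[OF sqint_abs[OF assms] sqint_const[of 1]] by (simp add: Q.prob_space)

text \<open>Interpolation writes E[W g(W)] as a limit of sums of E[(g(W0) - g(V_j)) v_j] / 2, where
  V_j has only site j resampled. Replacing the increment of g by g'(W0) u_j produces E[g'(W0) T],
  and T is close to 1: its mean tends to 1 and its standard deviation is at most K. In the
  remainder, \<open>L\<close> bounds the smooth part and \<open>K'\<close> the jumps at z.\<close>

lemma stein_discrepancy:
  assumes fo: "fourth"
    and g: "g \<in> borel_measurable borel" "\<And>x y. \<bar>g x - g y\<bar> \<le> Lg * \<bar>x - y\<bar>"
    and g': "g' \<in> borel_measurable borel" "\<And>x. \<bar>g' x\<bar> \<le> c1"
    and rem: "\<And>x y. \<bar>g y - g x - g' x * (y - x)\<bar> \<le> \<psi> x * (y - x)\<^sup>2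
        + c * \<bar>(y - x) * (of_bool (y \<le> z) - of_bool (x \<le> z))\<bar>"
    and \<psi>: "\<psi> \<in> borel_measurable borel" "\<And>x. \<psi> x \<ge> 0" and c: "c \<ge> 0"
    and K: "\<And>n. (\<integral>\<omega>. (T (\<lambda>x. x) n \<omega>)\<^sup>2 \<partial>Q) - (\<integral>\<omega>. T (\<lambda>x. x) n \<omega> \<partial>Q)\<^sup>2 \<le> K\<^sup>2"
    and K': "\<And>n. (\<integral>\<omega>. (T abs n \<omega>)\<^sup>2 \<partial>Q) - (\<integral>\<omega>. T abs n \<omega> \<partial>Q)\<^sup>2 \<le> K'\<^sup>2"
    and K0: "K \<ge> 0" "K' \<ge> 0" and L0: "L \<ge> 0"
    and L: "\<And>n. (\<Sum>j<n. \<integral>\<^sup>+\<omega>. ennreal (\<psi> (W0 \<omega>) * ((u j \<omega>)\<^sup>2 * \<bar>v j \<omega>\<bar>)) \<partial>Q) \<le> ennreal (2 * L)"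
  shows "\<bar>(\<integral>x. g' x - x * g x \<partial>distr Q borel W0)\<bar> \<le> c1 * K + L + c * K'"
proof -
  note [measurable] = g(1) g'(1) \<psi>(1)
  let ?V = "\<lambda>j. W ((\<lambda>_. 0)(j := 1))"
  have c1: "c1 \<ge> 0" using g'(2)[of 0] by simp
  have sG: "sqint (\<lambda>\<omega>. g (W s \<omega>))" for s
  proof (rule sqint_bound[OF sqint_W[of s]])
    fix \<omega> show "\<bar>g (W s \<omega>)\<bar> \<le> Lg * \<bar>W s \<omega>\<bar> + \<bar>g 0\<bar>" using g(2)[of "W s \<omega>" 0] by simp
  qed measurable
  have sG': "sqint (\<lambda>\<omega>. g' (W0 \<omega>) * F \<omega>)" if F: "sqint F" for F
  proof (rule sqint_bound[OF F])
    show "(\<lambda>\<omega>. g' (W0 \<omega>) * F \<omega>) \<in> borel_measurable Q" using sqint_meas[OF F] by measurable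
    fix \<omega> show "\<bar>g' (W0 \<omega>) * F \<omega>\<bar> \<le> c1 * \<bar>F \<omega>\<bar> + 0"
      using g'(2) by (simp add: abs_mult mult_right_mono)
  qed
  have sB: "sqint (\<lambda>\<omega>. F \<omega> * (of_bool (W s \<omega> \<le> z) :: real))" if F: "sqint F" for F s
  proof (rule sqint_bound[OF F])
    show "(\<lambda>\<omega>. F \<omega> * (of_bool (W s \<omega> \<le> z) :: real)) \<in> borel_measurable Q" using sqint_meas[OF F] by measurable
    fix \<omega> show "\<bar>F \<omega> * of_bool (W s \<omega> \<le> z)\<bar> \<le> 1 * \<bar>F \<omega>\<bar> + 0" by auto
  qed
  have sT: "sqint (T (\<lambda>x. x) n)" for n by (rule sqint_T[OF fo nice_id])
  have sTa: "sqint (T abs n)" for n by (rule sqint_T[OF fo nice_abs])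
  define X where "X j \<omega> = (u j \<omega> * of_bool (?V j \<omega> \<le> z) - u j \<omega> * of_bool (W0 \<omega> \<le> z)) * \<bar>v j \<omega>\<bar>" for j \<omega>
  \<comment> \<open>\<open>u j\<close> = W0 - V_j is nonnegative where the difference of the
    indicators is 1 and nonpositive where it is -1, so the product equals its absolute
    value.\<close>
  have X0: "X j \<omega> = \<bar>u j \<omega> * (of_bool (?V j \<omega> \<le> z) - of_bool (W0 \<omega> \<le> z))\<bar> * \<bar>v j \<omega>\<bar>" for j \<omega>
    by (auto simp: X_def u_eq)
  have iX: "integrable Q (X j)" for j
    unfolding X_def[abs_def] by (intro sqint_mult sqint_diff sB sqint_uv sqint_abs)
  \<comment> \<open>The exchange at j maps W0 to V_j and \<open>u j\<close> to its negative, so the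
    two terms of X contribute equally to the integral.\<close>
  have intX: "(\<integral>\<omega>. X j \<omega> \<partial>Q) = - 2 * (\<integral>\<omega>. of_bool (W0 \<omega> \<le> z) * (u j \<omega> * \<bar>v j \<omega>\<bar>) \<partial>Q)" for j
  proof -
    have i: "integrable Q (\<lambda>\<omega>. u j \<omega> * of_bool (W s \<omega> \<le> z) * \<bar>v j \<omega>\<bar>)" for s
      by (intro sqint_mult sB sqint_uv sqint_abs)
    have "(\<integral>\<omega>. u j \<omega> * of_bool (W0 \<omega> \<le> z) * \<bar>v j \<omega>\<bar> \<partial>Q)
        = (\<integral>\<omega>. u j (resamp sw1 {j} \<omega>) * of_bool (W0 (resamp sw1 {j} \<omega>) \<le> z) * \<bar>v j (resamp sw1 {j} \<omega>)\<bar> \<partial>Q)"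
      by (rule integral_resamp[OF sw1_inj, symmetric]) measurable
    also have "\<dots> = - (\<integral>\<omega>. u j \<omega> * of_bool (?V j \<omega> \<le> z) * \<bar>v j \<omega>\<bar> \<partial>Q)"
      by (simp add: u_swap v_swap W0_swap)
    finally have "(\<integral>\<omega>. u j \<omega> * of_bool (?V j \<omega> \<le> z) * \<bar>v j \<omega>\<bar> \<partial>Q) = - (\<integral>\<omega>. u j \<omega> * of_bool (W0 \<omega> \<le> z) * \<bar>v j \<omega>\<bar> \<partial>Q)"
      by simp
    moreover have "(\<integral>\<omega>. X j \<omega> \<partial>Q) = (\<integral>\<omega>. u j \<omega> * of_bool (?V j \<omega> \<le> z) * \<bar>v j \<omega>\<bar> \<partial>Q)
        - (\<integral>\<omega>. u j \<omega> * of_bool (W0 \<omega> \<le> z) * \<bar>v j \<omega>\<bar> \<partial>Q)"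
      unfolding X_def left_diff_distrib by (rule Bochner_Integration.integral_diff) (rule i)+
    moreover have "(\<lambda>\<omega>. of_bool (W0 \<omega> \<le> z) * (u j \<omega> * \<bar>v j \<omega>\<bar>)) = (\<lambda>\<omega>. u j \<omega> * of_bool (W0 \<omega> \<le> z) * \<bar>v j \<omega>\<bar>)"
      by (simp add: fun_eq_iff mult.commute mult.left_commute)
    ultimately show ?thesis by simp
  qed
  have sumX: "(\<Sum>j<n. \<integral>\<omega>. X j \<omega> \<partial>Q) \<le> 2 * K'" for n
  proof -
    have iu: "integrable Q (\<lambda>\<omega>. of_bool (W0 \<omega> \<le> z) * (u j \<omega> * \<bar>v j \<omega>\<bar>))" for j
      using sqint_integrable[OF sB[OF sqint_uphi[OF fo nice_abs]], of j "\<lambda>_. 0"] by (simp add: mult.commute)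
    have iT: "integrable Q (\<lambda>\<omega>. of_bool (W0 \<omega> \<le> z) * T abs n \<omega>)"
      using sqint_integrable[OF sB[OF sTa], of n "\<lambda>_. 0"] by (simp add: mult.commute)
    have "(\<Sum>j<n. \<integral>\<omega>. X j \<omega> \<partial>Q) = - 2 * (\<Sum>j<n. \<integral>\<omega>. of_bool (W0 \<omega> \<le> z) * (u j \<omega> * \<bar>v j \<omega>\<bar>) \<partial>Q)"
      by (simp add: intX sum_distrib_left sum_negf)
    also have "(\<Sum>j<n. \<integral>\<omega>. of_bool (W0 \<omega> \<le> z) * (u j \<omega> * \<bar>v j \<omega>\<bar>) \<partial>Q) = (\<integral>\<omega>. 2 * (of_bool (W0 \<omega> \<le> z) * T abs n \<omega>) \<partial>Q)"
    proof (subst Bochner_Integration.integral_sum[symmetric])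
      have "(\<Sum>j<n. of_bool (W0 \<omega> \<le> z) * (u j \<omega> * \<bar>v j \<omega>\<bar>)) = 2 * (of_bool (W0 \<omega> \<le> z) * T abs n \<omega>)" for \<omega>
        unfolding T_def sum_distrib_left[symmetric] by simp
      then show "(\<integral>\<omega>. (\<Sum>j<n. of_bool (W0 \<omega> \<le> z) * (u j \<omega> * \<bar>v j \<omega>\<bar>)) \<partial>Q) = (\<integral>\<omega>. 2 * (of_bool (W0 \<omega> \<le> z) * T abs n \<omega>) \<partial>Q)"
        by simp
    qed (rule iu)
    also have "- 2 * \<dots> = - 4 * (\<integral>\<omega>. of_bool (W0 \<omega> \<le> z) * T abs n \<omega> \<partial>Q)" by simp
    \<comment> \<open>The indicator may be centred at 1/2 because T abs has mean zero. Its modulus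
      is then constantly 1/2, which turns the 4 into a 2.\<close>
    also have "\<dots> = - 4 * (\<integral>\<omega>. (of_bool (W0 \<omega> \<le> z) - 1/2) * T abs n \<omega> \<partial>Q)"
    proof -
      have "(\<integral>\<omega>. (of_bool (W0 \<omega> \<le> z) - 1/2) * T abs n \<omega> \<partial>Q) =
        (\<integral>\<omega>. of_bool (W0 \<omega> \<le> z) * T abs n \<omega> \<partial>Q) - (\<integral>\<omega>. 1/2 * T abs n \<omega> \<partial>Q)"
        unfolding left_diff_distrib using sqint_integrable[OF sTa, of n]
        by (intro Bochner_Integration.integral_diff iT) simp
      then show ?thesis using T_abs_mean[OF fo] by simp
    qed
    also have "\<dots> \<le> 4 * (\<integral>\<omega>. \<bar>T abs n \<omega>\<bar> / 2 \<partial>Q)"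
    proof -
      have "- (\<integral>\<omega>. (of_bool (W0 \<omega> \<le> z) - 1/2) * T abs n \<omega> \<partial>Q) \<le> (\<integral>\<omega>. \<bar>(of_bool (W0 \<omega> \<le> z) - 1/2) * T abs n \<omega>\<bar> \<partial>Q)"
        using integral_abs_bound[of Q "\<lambda>\<omega>. (of_bool (W0 \<omega> \<le> z) - 1/2) * T abs n \<omega>"] by linarith
      also have "\<dots> = (\<integral>\<omega>. \<bar>T abs n \<omega>\<bar> / 2 \<partial>Q)"
        by (intro Bochner_Integration.integral_cong) (auto simp: abs_mult)
      finally show ?thesis by simp
    qed
    also have "\<dots> \<le> 2 * sqrt (\<integral>\<omega>. (T abs n \<omega>)\<^sup>2 \<partial>Q)"
      using integral_abs_le_sqrt[OF sTa[of n]] by simp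
    also have "\<dots> \<le> 2 * K'"
      using K'[of n] K0 by (simp add: T_abs_mean[OF fo] real_le_lsqrt)
    finally show ?thesis .
  qed
  define r where "r j \<omega> = (g (W0 \<omega>) - g (?V j \<omega>)) * v j \<omega> - g' (W0 \<omega>) * u j \<omega> * v j \<omega>" for j \<omega>
  have i1: "integrable Q (\<lambda>\<omega>. (g (W0 \<omega>) - g (?V j \<omega>)) * v j \<omega>)" for j
    by (intro sqint_mult sqint_diff sG sqint_uv)
  have i2: "integrable Q (\<lambda>\<omega>. g' (W0 \<omega>) * u j \<omega> * v j \<omega>)" for j
    by (intro sqint_mult sG' sqint_uv)
  have ir: "integrable Q (r j)" for j
    unfolding r_def[abs_def] using i1 i2 by (rule Bochner_Integration.integrable_diff)
  have rle: "\<bar>r j \<omega>\<bar> \<le> \<psi> (W0 \<omega>) * ((u j \<omega>)\<^sup>2 * \<bar>v j \<omega>\<bar>) + c * X j \<omega>" for j \<omega>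
  proof -
    have d: "?V j \<omega> - W0 \<omega> = - u j \<omega>" by (simp add: u_eq)
    have "\<bar>r j \<omega>\<bar> = \<bar>g (?V j \<omega>) - g (W0 \<omega>) - g' (W0 \<omega>) * (?V j \<omega> - W0 \<omega>)\<bar> * \<bar>v j \<omega>\<bar>"
      unfolding d abs_mult[symmetric] r_def by (subst abs_minus_cancel[symmetric]) (simp add: algebra_simps)
    also have "\<dots> \<le> (\<psi> (W0 \<omega>) * (?V j \<omega> - W0 \<omega>)\<^sup>2
        + c * \<bar>(?V j \<omega> - W0 \<omega>) * (of_bool (?V j \<omega> \<le> z) - of_bool (W0 \<omega> \<le> z))\<bar>) * \<bar>v j \<omega>\<bar>"
      by (intro mult_right_mono rem) auto
    also have "\<dots> = \<psi> (W0 \<omega>) * ((u j \<omega>)\<^sup>2 * \<bar>v j \<omega>\<bar>) + c * X j \<omega>"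
      unfolding d X0 by (simp add: algebra_simps)
    finally show ?thesis .
  qed
  have sumr: "(\<Sum>j<n. \<integral>\<omega>. \<bar>r j \<omega>\<bar> \<partial>Q) \<le> 2 * L + 2 * (c * K')" for n
  proof -
    have X00: "X j \<omega> \<ge> 0" for j \<omega> unfolding X0 by simp
    have "ennreal (\<Sum>j<n. \<integral>\<omega>. \<bar>r j \<omega>\<bar> \<partial>Q) = (\<Sum>j<n. \<integral>\<^sup>+\<omega>. ennreal \<bar>r j \<omega>\<bar> \<partial>Q)"
      using ir by (simp add: sum_ennreal nn_integral_eq_integral)
    also have "\<dots> \<le> (\<Sum>j<n. (\<integral>\<^sup>+\<omega>. ennreal (\<psi> (W0 \<omega>) * ((u j \<omega>)\<^sup>2 * \<bar>v j \<omega>\<bar>)) \<partial>Q) + (\<integral>\<^sup>+\<omega>. ennreal (c * X j \<omega>) \<partial>Q))"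
    proof (intro sum_mono)
      fix j
      have "(\<integral>\<^sup>+\<omega>. ennreal \<bar>r j \<omega>\<bar> \<partial>Q) \<le> (\<integral>\<^sup>+\<omega>. ennreal (\<psi> (W0 \<omega>) * ((u j \<omega>)\<^sup>2 * \<bar>v j \<omega>\<bar>)) + ennreal (c * X j \<omega>) \<partial>Q)"
        using rle[of j] \<psi>(2) c X00 by (intro nn_integral_mono) (simp add: ennreal_plus[symmetric] del: ennreal_plus)
      also have "\<dots> = (\<integral>\<^sup>+\<omega>. ennreal (\<psi> (W0 \<omega>) * ((u j \<omega>)\<^sup>2 * \<bar>v j \<omega>\<bar>)) \<partial>Q) + (\<integral>\<^sup>+\<omega>. ennreal (c * X j \<omega>) \<partial>Q)"
        using borel_measurable_integrable[OF iX[of j]] by (intro nn_integral_add) measurable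
      finally show "(\<integral>\<^sup>+\<omega>. ennreal \<bar>r j \<omega>\<bar> \<partial>Q) \<le> \<dots>" .
    qed
    also have "\<dots> = (\<Sum>j<n. (\<integral>\<^sup>+\<omega>. ennreal (\<psi> (W0 \<omega>) * ((u j \<omega>)\<^sup>2 * \<bar>v j \<omega>\<bar>)) \<partial>Q)) + (\<Sum>j<n. \<integral>\<^sup>+\<omega>. ennreal (c * X j \<omega>) \<partial>Q)"
      by (rule sum.distrib)
    also have "(\<Sum>j<n. \<integral>\<^sup>+\<omega>. ennreal (c * X j \<omega>) \<partial>Q) = ennreal (\<Sum>j<n. c * (\<integral>\<omega>. X j \<omega> \<partial>Q))"
      using iX c X00 by (subst sum_ennreal[symmetric]) (auto simp: nn_integral_eq_integral)
    also have "\<dots> \<le> ennreal (2 * (c * K'))"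
      using mult_left_mono[OF sumX[of n] c] by (simp add: sum_distrib_left[symmetric] ennreal_leI algebra_simps)
    finally have "ennreal (\<Sum>j<n. \<integral>\<omega>. \<bar>r j \<omega>\<bar> \<partial>Q) \<le> ennreal (2 * L) + ennreal (2 * (c * K'))"
      using L[of n] by (meson add_mono order_trans order_refl)
    then show ?thesis
      using L0 c K0 by (simp add: ennreal_plus[symmetric] ennreal_le_iff del: ennreal_plus)
  qed
  have ET: "(\<integral>\<omega>. T (\<lambda>x. x) n \<omega> \<partial>Q) = (\<integral>\<omega>. W0 \<omega> * (W0 \<omega> - W0 (resamp sw1 {..<n} \<omega>)) \<partial>Q)" for n
  proof -
    have "(\<integral>\<omega>. W0 \<omega> * (W0 \<omega> - W0 (resamp sw1 {..<n} \<omega>)) \<partial>Q) = (\<Sum>j<n. (\<integral>\<omega>. u j \<omega> * v j \<omega> \<partial>Q) / 2)"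
      using resamp_interpolation[OF sw1_inv sqint_W sqint_W, of "\<lambda>_. 0" "\<lambda>_. 0" n]
      by (simp add: lead_resamp u_eq v_eq W0_swap)
    also have "\<dots> = (\<integral>\<omega>. T (\<lambda>x. x) n \<omega> \<partial>Q)"
      unfolding T_def using sqint_mult[OF sqint_uv]
      by (simp add: Bochner_Integration.integral_sum sum_divide_distrib)
    finally show ?thesis ..
  qed
  have iWl: "integrable Q (\<lambda>\<omega>. F \<omega> * W0 (resamp sw1 {..<n} \<omega>))" if "sqint F" for F n
    by (intro sqint_mult that sqint_resamp sw1_inj sqint_W)
  have limF: "(\<lambda>n. \<integral>\<omega>. F \<omega> * (W0 \<omega> - W0 (resamp sw1 {..<n} \<omega>)) \<partial>Q) \<longlonglongrightarrow> (\<integral>\<omega>. F \<omega> * W0 \<omega> \<partial>Q)"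
    if F: "sqint F" "(\<integral>\<omega>. F \<omega> * W (\<lambda>_. 1) \<omega> \<partial>Q) = 0" for F
  proof -
    have "(\<lambda>n. (\<integral>\<omega>. F \<omega> * W0 \<omega> \<partial>Q) - (\<integral>\<omega>. F \<omega> * W0 (resamp sw1 {..<n} \<omega>) \<partial>Q)) \<longlonglongrightarrow>
        (\<integral>\<omega>. F \<omega> * W0 \<omega> \<partial>Q) - (\<integral>\<omega>. F \<omega> * W0 (resamp sw1 UNIV \<omega>) \<partial>Q)"
      by (intro tendsto_diff tendsto_const resamp_integral_tendsto sw1_inj sqint_W F)
    moreover have "(\<integral>\<omega>. F \<omega> * W0 (resamp sw1 UNIV \<omega>) \<partial>Q) = 0"
      using F(2) by (simp add: W_resamp sw1_def)
    ultimately show ?thesis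
      using sqint_mult[OF F(1) sqint_W[of "\<lambda>_. 0"]] iWl[OF F(1)] by (simp add: right_diff_distrib)
  qed
  have limT: "(\<lambda>n. \<integral>\<omega>. T (\<lambda>x. x) n \<omega> \<partial>Q) \<longlonglongrightarrow> 1"
  proof -
    have "(\<integral>\<omega>. W0 \<omega> * W (\<lambda>_. 1) \<omega> \<partial>Q) = 0"
      using indep_W_all[of "\<lambda>x. x"] sqint_W by simp
    from limF[OF sqint_W this] show ?thesis
      unfolding ET using integral_W(2) by (simp add: power2_eq_square)
  qed
  have limg: "(\<lambda>n. \<integral>\<omega>. g (W0 \<omega>) * (W0 \<omega> - W0 (resamp sw1 {..<n} \<omega>)) \<partial>Q) \<longlonglongrightarrow> (\<integral>\<omega>. g (W0 \<omega>) * W0 \<omega> \<partial>Q)"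
    by (rule limF[OF sG indep_W_all[OF g(1) sG]])
  have main: "\<bar>(\<integral>\<omega>. g' (W0 \<omega>) \<partial>Q) - (\<integral>\<omega>. g (W0 \<omega>) * (W0 \<omega> - W0 (resamp sw1 {..<n} \<omega>)) \<partial>Q)\<bar>
      \<le> c1 * (\<bar>1 - (\<integral>\<omega>. T (\<lambda>x. x) n \<omega> \<partial>Q)\<bar> + K) + (L + c * K')" for n
  proof -
    let ?T = "T (\<lambda>x. x) n" and ?t = "\<integral>\<omega>. T (\<lambda>x. x) n \<omega> \<partial>Q"
    have e1: "(\<integral>\<omega>. g (W0 \<omega>) * (W0 \<omega> - W0 (resamp sw1 {..<n} \<omega>)) \<partial>Q)
        = (\<Sum>j<n. (\<integral>\<omega>. (g (W0 \<omega>) - g (?V j \<omega>)) * v j \<omega> \<partial>Q) / 2)"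
      using resamp_interpolation[OF sw1_inv sqint_W sG, of "\<lambda>_. 0" "\<lambda>_. 0" n]
      by (simp add: lead_resamp v_eq W0_swap)
    have e2: "(\<integral>\<omega>. g' (W0 \<omega>) * ?T \<omega> \<partial>Q) = (\<Sum>j<n. (\<integral>\<omega>. g' (W0 \<omega>) * u j \<omega> * v j \<omega> \<partial>Q) / 2)"
    proof -
      have "(\<integral>\<omega>. g' (W0 \<omega>) * ?T \<omega> \<partial>Q) = (\<integral>\<omega>. (\<Sum>j<n. g' (W0 \<omega>) * u j \<omega> * v j \<omega>) / 2 \<partial>Q)"
        by (simp add: T_def sum_distrib_left mult.assoc)
      then show ?thesis using i2 by (simp add: Bochner_Integration.integral_sum sum_divide_distrib)
    qed
    have "(\<integral>\<omega>. g (W0 \<omega>) * (W0 \<omega> - W0 (resamp sw1 {..<n} \<omega>)) \<partial>Q) - (\<integral>\<omega>. g' (W0 \<omega>) * ?T \<omega> \<partial>Q)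
        = (\<Sum>j<n. (\<integral>\<omega>. r j \<omega> \<partial>Q) / 2)"
      unfolding e1 e2 r_def sum_subtractf[symmetric] diff_divide_distrib[symmetric]
      using i1 i2 by simp
    also have "\<bar>\<dots>\<bar> \<le> (\<Sum>j<n. (\<integral>\<omega>. \<bar>r j \<omega>\<bar> \<partial>Q) / 2)"
      by (rule order_trans[OF sum_abs]) (auto intro!: sum_mono divide_right_mono integral_abs_bound)
    also have "\<dots> \<le> L + c * K'"
      using sumr[of n] by (simp add: sum_divide_distrib[symmetric])
    finally have A: "\<bar>(\<integral>\<omega>. g (W0 \<omega>) * (W0 \<omega> - W0 (resamp sw1 {..<n} \<omega>)) \<partial>Q) - (\<integral>\<omega>. g' (W0 \<omega>) * ?T \<omega> \<partial>Q)\<bar> \<le> L + c * K'" .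
    have s1: "sqint (\<lambda>\<omega>. ?T \<omega> - ?t)" by (intro sqint_diff sT sqint_const)
    have s2: "sqint (\<lambda>\<omega>. 1 - ?T \<omega>)" by (intro sqint_diff sT sqint_const)
    have "(\<integral>\<omega>. (?T \<omega> - ?t)\<^sup>2 \<partial>Q) = (\<integral>\<omega>. (?T \<omega>)\<^sup>2 \<partial>Q) - ?t\<^sup>2"
      using Q.variance_eq[of ?T] sT[of n] sqint_integrable[OF sT[of n]] by (simp add: sqint_def)
    then have "(\<integral>\<omega>. (?T \<omega> - ?t)\<^sup>2 \<partial>Q) \<le> K\<^sup>2" using K[of n] by simp
    then have "sqrt (\<integral>\<omega>. (?T \<omega> - ?t)\<^sup>2 \<partial>Q) \<le> K" using K0(1) by (intro real_le_lsqrt)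
    then have sd: "(\<integral>\<omega>. \<bar>?T \<omega> - ?t\<bar> \<partial>Q) \<le> K"
      using integral_abs_le_sqrt[OF s1] by (rule order_trans[rotated])
    \<comment> \<open>|1 - T| is split at the mean of T: the distance of the mean to 1 disappears as
      n grows, and the fluctuation around the mean is at most K in L1.\<close>
    have "(\<integral>\<omega>. g' (W0 \<omega>) \<partial>Q) - (\<integral>\<omega>. g' (W0 \<omega>) * ?T \<omega> \<partial>Q) = (\<integral>\<omega>. g' (W0 \<omega>) * (1 - ?T \<omega>) \<partial>Q)"
      using sqint_integrable[OF sG'[OF sqint_const[of 1]]] sqint_integrable[OF sG'[OF sT[of n]]]
      by (simp add: right_diff_distrib)
    also have "\<bar>\<dots>\<bar> \<le> (\<integral>\<omega>. c1 * (\<bar>1 - ?t\<bar> + \<bar>?T \<omega> - ?t\<bar>) \<partial>Q)"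
    proof (rule order_trans[OF integral_abs_bound], rule integral_mono)
      show "integrable Q (\<lambda>\<omega>. \<bar>g' (W0 \<omega>) * (1 - ?T \<omega>)\<bar>)"
        using sqint_integrable[OF sG'[OF s2]] by simp
      show "integrable Q (\<lambda>\<omega>. c1 * (\<bar>1 - ?t\<bar> + \<bar>?T \<omega> - ?t\<bar>))"
        using sqint_integrable[OF s1] by simp
      fix \<omega> show "\<bar>g' (W0 \<omega>) * (1 - ?T \<omega>)\<bar> \<le> c1 * (\<bar>1 - ?t\<bar> + \<bar>?T \<omega> - ?t\<bar>)"
        unfolding abs_mult using c1 by (intro mult_mono g'(2)) auto
    qed
    also have "\<dots> = c1 * (\<bar>1 - ?t\<bar> + (\<integral>\<omega>. \<bar>?T \<omega> - ?t\<bar> \<partial>Q))"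
      using sqint_integrable[OF s1] by (simp add: Q.prob_space)
    also have "\<dots> \<le> c1 * (\<bar>1 - ?t\<bar> + K)" using sd c1 by (intro mult_left_mono) auto
    finally show ?thesis using A by linarith
  qed
  have "\<bar>(\<integral>\<omega>. g' (W0 \<omega>) \<partial>Q) - (\<integral>\<omega>. g (W0 \<omega>) * W0 \<omega> \<partial>Q)\<bar> \<le> c1 * (\<bar>1 - 1\<bar> + K) + (L + c * K')"
  proof (rule LIMSEQ_le)
    show "(\<lambda>n. \<bar>(\<integral>\<omega>. g' (W0 \<omega>) \<partial>Q) - (\<integral>\<omega>. g (W0 \<omega>) * (W0 \<omega> - W0 (resamp sw1 {..<n} \<omega>)) \<partial>Q)\<bar>)
      \<longlonglongrightarrow> \<bar>(\<integral>\<omega>. g' (W0 \<omega>) \<partial>Q) - (\<integral>\<omega>. g (W0 \<omega>) * W0 \<omega> \<partial>Q)\<bar>"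
      by (intro tendsto_intros limg)
    show "(\<lambda>n. c1 * (\<bar>1 - (\<integral>\<omega>. T (\<lambda>x. x) n \<omega> \<partial>Q)\<bar> + K) + (L + c * K')) \<longlonglongrightarrow> c1 * (\<bar>1 - 1\<bar> + K) + (L + c * K')"
      by (intro tendsto_intros limT)
  qed (use main in blast)
  moreover have "(\<integral>x. g' x - x * g x \<partial>distr Q borel W0) = (\<integral>\<omega>. g' (W0 \<omega>) \<partial>Q) - (\<integral>\<omega>. g (W0 \<omega>) * W0 \<omega> \<partial>Q)"
  proof -
    have "(\<integral>x. g' x - x * g x \<partial>distr Q borel W0) = (\<integral>\<omega>. g' (W0 \<omega>) - W0 \<omega> * g (W0 \<omega>) \<partial>Q)"
      by (rule integral_distr) measurable
    then show ?thesis
      using sqint_integrable[OF sG'[OF sqint_const[of 1]]] sqint_mult[OF sG sqint_W]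
      by (simp add: mult.commute)
  qed
  ultimately show ?thesis by simp
qed

end

section \<open>Second-order Poincare inequality\<close>

lemma sum5_sq_le: "(a + b + c + d + e)\<^sup>2 \<le> 5 * (a\<^sup>2 + b\<^sup>2 + c\<^sup>2 + d\<^sup>2 + e\<^sup>2)" for a b c d e :: real
proof -
  have "5 * (a\<^sup>2 + b\<^sup>2 + c\<^sup>2 + d\<^sup>2 + e\<^sup>2) - (a + b + c + d + e)\<^sup>2 =
     (a-b)\<^sup>2 + (a-c)\<^sup>2 + (a-d)\<^sup>2 + (a-e)\<^sup>2 + (b-c)\<^sup>2 + (b-d)\<^sup>2 + (b-e)\<^sup>2 + (c-d)\<^sup>2 + (c-e)\<^sup>2 + (d-e)\<^sup>2"
    by (simp add: power2_eq_square algebra_simps)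
  moreover have "\<dots> \<ge> 0" by (intro add_nonneg_nonneg zero_le_power2)
  ultimately show ?thesis by linarith
qed

lemma abs_diff_perturb:
  fixes a b c d e x :: real
  assumes "\<bar>a - b\<bar> \<le> x" "\<bar>a - c\<bar> \<le> e / 2" "\<bar>b - d\<bar> \<le> e / 2"
  shows "\<bar>c - d\<bar> \<le> x + e"
  using assms by linarith

lemma epowr_half_sq: "epowr (ennreal x) (1/2) = ennreal (sqrt x)" if "x \<ge> 0"
  using that by (simp add: epowr_def powr_half_sqrt)

context centred_functional
begin

section \<open>Effect of resampling one site on the discrepancy sum\<close>

definition q4 :: "nat \<Rightarrow> ennreal" where "q4 i = (\<integral>\<^sup>+\<omega>. ennreal ((u i \<omega>) ^ 4) \<partial>Q)"

text \<open>Product rule for the terms j \<noteq> i of T when site i is resampled: A1 collects the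
  changes of \<open>u j\<close>, A2 and A3 those of \<open>v j\<close>. The latter are split because
  \<open>v j\<close> reads copy 0 at site i if j < i, which is replaced by copy 2, and copy 1 if i <
  j, which is replaced by copy 3.\<close>

definition A1 :: "nat \<Rightarrow> nat \<Rightarrow> (nat \<times> nat \<Rightarrow> 'a) \<Rightarrow> real" where
  "A1 n i \<omega> = (\<Sum>j\<in>{..<n} - {i}. \<bar>D2 (\<lambda>_. 0) i 2 j 1 \<omega>\<bar> * \<bar>D1 (lead j) j 1 \<omega>\<bar>)"
definition A2 :: "nat \<Rightarrow> nat \<Rightarrow> (nat \<times> nat \<Rightarrow> 'a) \<Rightarrow> real" where
  "A2 n i \<omega> = (\<Sum>j\<in>{..<n} \<inter> {..<i}. \<bar>D2 (lead j) i 2 j 1 \<omega>\<bar> * \<bar>D1 ((\<lambda>_. 0)(i := 2)) j 1 \<omega>\<bar>)"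
definition A3 :: "nat \<Rightarrow> nat \<Rightarrow> (nat \<times> nat \<Rightarrow> 'a) \<Rightarrow> real" where
  "A3 n i \<omega> = (\<Sum>j\<in>{..<n} \<inter> {i<..}. \<bar>D2 (lead j) i 3 j 1 \<omega>\<bar> * \<bar>D1 ((\<lambda>_. 0)(i := 2)) j 1 \<omega>\<bar>)"

lemma A_meas [measurable]: "A1 n i \<in> borel_measurable Q" "A2 n i \<in> borel_measurable Q" "A3 n i \<in> borel_measurable Q"
  unfolding A1_def[abs_def] A2_def[abs_def] A3_def[abs_def] by measurable

text \<open>The last term is the diagonal j = i of T: 2 q4 before and 2 q4 after the
  resampling.\<close>

definition Vn :: "nat \<Rightarrow> nat \<Rightarrow> ennreal" where
  "Vn n i = (\<integral>\<^sup>+\<omega>. ennreal ((A1 n i \<omega>)\<^sup>2) \<partial>Q) + (\<integral>\<^sup>+\<omega>. ennreal ((A2 n i \<omega>)\<^sup>2) \<partial>Q)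
     + (\<integral>\<^sup>+\<omega>. ennreal ((A3 n i \<omega>)\<^sup>2) \<partial>Q) + 4 * q4 i"

lemma u_resamp2:
  assumes "j \<noteq> i"
  shows "u j (resamp sw2 {i} \<omega>) = D1 ((\<lambda>_. 0)(i := 2)) j 1 \<omega>"
    and "u j \<omega> - u j (resamp sw2 {i} \<omega>) = D2 (\<lambda>_. 0) i 2 j 1 \<omega>"
proof -
  have a: "W0 (resamp sw2 {i} \<omega>) = W ((\<lambda>_. 0)(i := 2)) \<omega>"
    unfolding W_resamp by (rule arg_cong[where f="\<lambda>s. W s \<omega>"]) (auto simp: sw2_def)
  have b: "W ((\<lambda>_. 0)(j := 1)) (resamp sw2 {i} \<omega>) = W ((\<lambda>_. 0)(i := 2, j := 1)) \<omega>"
    unfolding W_resamp using assms by (intro arg_cong[where f="\<lambda>s. W s \<omega>"]) (auto simp: sw2_def)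
  show "u j (resamp sw2 {i} \<omega>) = D1 ((\<lambda>_. 0)(i := 2)) j 1 \<omega>"
    unfolding u_eq a b D1_def ..
  then show "u j \<omega> - u j (resamp sw2 {i} \<omega>) = D2 (\<lambda>_. 0) i 2 j 1 \<omega>"
    by (simp only: u_eq D1_def D2_def)
qed

lemma v_resamp2:
  assumes "j \<noteq> i"
  shows "v j \<omega> - v j (resamp sw2 {i} \<omega>) = D2 (lead j) i (if i < j then 3 else 2) j 1 \<omega>"
proof -
  let ?b = "if i < j then 3 else 2 :: nat"
  have a: "W (lead j) (resamp sw2 {i} \<omega>) = W ((lead j)(i := ?b)) \<omega>"
    unfolding W_resamp by (rule arg_cong[where f="\<lambda>s. W s \<omega>"]) (auto simp: sw2_def lead_def)
  have b: "W (lead (Suc j)) (resamp sw2 {i} \<omega>) = W ((lead j)(i := ?b, j := 1)) \<omega>"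
    unfolding W_resamp using assms
    by (intro arg_cong[where f="\<lambda>s. W s \<omega>"]) (auto simp: sw2_def lead_def fun_eq_iff)
  show ?thesis unfolding v_eq a b D2_def lead_upd by linarith
qed

text \<open>Product rule ab - a'b' = (a - a') b + a' (b - b'), with \<open>\<phi>\<close>
  1-Lipschitz and of modulus |x|. The factor 5/4 comes from five terms under one square and from the
  squared 1/2 in T.\<close>

lemma T_resamp_diff:
  assumes \<phi>: "nice \<phi>"
  shows "(T \<phi> n \<omega> - T \<phi> n (resamp sw2 {i} \<omega>))\<^sup>2 \<le> 5/4 * ((A1 n i \<omega>)\<^sup>2 + (A2 n i \<omega>)\<^sup>2 + (A3 n i \<omega>)\<^sup>2
     + (u i \<omega> * v i \<omega>)\<^sup>2 + (u i (resamp sw2 {i} \<omega>) * v i (resamp sw2 {i} \<omega>))\<^sup>2)"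
proof -
  let ?w = "resamp sw2 {i} \<omega>"
  let ?d = "\<lambda>j. u j \<omega> * \<phi> (v j \<omega>) - u j ?w * \<phi> (v j ?w)"
  let ?e = "\<bar>u i \<omega> * v i \<omega>\<bar> + \<bar>u i ?w * v i ?w\<bar>"
  have ph: "\<bar>\<phi> x\<bar> = \<bar>x\<bar>" "\<bar>\<phi> x - \<phi> y\<bar> \<le> \<bar>x - y\<bar>" for x y using \<phi> by (auto simp: nice_def)
  have di: "\<bar>?d i\<bar> \<le> ?e"
    using abs_triangle_ineq4[of "u i \<omega> * \<phi> (v i \<omega>)" "u i ?w * \<phi> (v i ?w)"] by (simp add: abs_mult ph)
  define x where "x j = \<bar>D2 (\<lambda>_. 0) i 2 j 1 \<omega>\<bar> * \<bar>D1 (lead j) j 1 \<omega>\<bar>" for j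
  define y where "y j = \<bar>D2 (lead j) i (if i < j then 3 else 2) j 1 \<omega>\<bar> * \<bar>D1 ((\<lambda>_. 0)(i := 2)) j 1 \<omega>\<bar>" for j
  have dj: "\<bar>?d j\<bar> \<le> x j + y j" if "j \<noteq> i" for j
  proof -
    have e: "?d j = (u j \<omega> - u j ?w) * \<phi> (v j \<omega>) + u j ?w * (\<phi> (v j \<omega>) - \<phi> (v j ?w))"
      by (simp add: algebra_simps)
    have "\<bar>?d j\<bar> \<le> \<bar>u j \<omega> - u j ?w\<bar> * \<bar>v j \<omega>\<bar> + \<bar>u j ?w\<bar> * \<bar>v j \<omega> - v j ?w\<bar>"
      unfolding e by (intro order_trans[OF abs_triangle_ineq] add_mono) (auto simp: abs_mult ph intro!: mult_left_mono)
    also have "\<dots> = x j + y j"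
      unfolding u_resamp2(2)[OF that] v_resamp2[OF that] unfolding u_resamp2(1)[OF that] x_def y_def v_def
      by (rule arg_cong2[where f=plus, OF refl mult.commute])
    finally show ?thesis .
  qed
  have x: "(\<Sum>j\<in>{..<n} - {i}. x j) = A1 n i \<omega>" by (simp add: A1_def x_def)
  have y: "(\<Sum>j\<in>{..<n} - {i}. y j) = A2 n i \<omega> + A3 n i \<omega>"
  proof -
    have e: "{..<n} - {i} = ({..<n} \<inter> {..<i}) \<union> ({..<n} \<inter> {i<..})" by auto
    have "(\<Sum>j\<in>{..<n} - {i}. y j) = (\<Sum>j\<in>{..<n} \<inter> {..<i}. y j) + (\<Sum>j\<in>{..<n} \<inter> {i<..}. y j)"
      unfolding e by (rule sum.union_disjoint) auto
    moreover have "(\<Sum>j\<in>{..<n} \<inter> {..<i}. y j) = A2 n i \<omega>"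
      unfolding A2_def y_def by (intro sum.cong refl) auto
    moreover have "(\<Sum>j\<in>{..<n} \<inter> {i<..}. y j) = A3 n i \<omega>"
      unfolding A3_def y_def by (intro sum.cong refl) auto
    ultimately show ?thesis by simp
  qed
  have t: "\<bar>T \<phi> n \<omega> - T \<phi> n ?w\<bar> = \<bar>\<Sum>j<n. ?d j\<bar> / 2"
  proof -
    have "T \<phi> n \<omega> - T \<phi> n ?w = (\<Sum>j<n. ?d j) / 2"
      by (simp add: T_def sum_subtractf diff_divide_distrib)
    then show ?thesis by (simp only: abs_divide abs_numeral)
  qed
  have "\<bar>\<Sum>j<n. ?d j\<bar> \<le> (\<Sum>j\<in>{..<n} - {i}. \<bar>?d j\<bar>) + ?e"
  proof (cases "i < n")
    case True
    have "\<bar>\<Sum>j<n. ?d j\<bar> \<le> (\<Sum>j<n. \<bar>?d j\<bar>)" by (rule sum_abs)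
    also have "\<dots> = (\<Sum>j\<in>{..<n} - {i}. \<bar>?d j\<bar>) + \<bar>?d i\<bar>"
      using True by (subst sum.remove[of _ i]) auto
    finally show ?thesis using di by linarith
  next
    case False
    then have e: "{..<n} - {i} = {..<n}" by auto
    show ?thesis unfolding e
      by (intro add_increasing2 sum_abs add_nonneg_nonneg abs_ge_zero)
  qed
  also have "(\<Sum>j\<in>{..<n} - {i}. \<bar>?d j\<bar>) \<le> (\<Sum>j\<in>{..<n} - {i}. x j + y j)"
    by (intro sum_mono dj) auto
  also have "\<dots> = A1 n i \<omega> + (A2 n i \<omega> + A3 n i \<omega>)"
    unfolding sum.distrib x y ..
  finally have "\<bar>T \<phi> n \<omega> - T \<phi> n ?w\<bar> \<le> (A1 n i \<omega> + A2 n i \<omega> + A3 n i \<omega> + \<bar>u i \<omega> * v i \<omega>\<bar> + \<bar>u i ?w * v i ?w\<bar>) / 2"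
    unfolding t by simp
  then have "\<bar>T \<phi> n \<omega> - T \<phi> n ?w\<bar>\<^sup>2 \<le> ((A1 n i \<omega> + A2 n i \<omega> + A3 n i \<omega> + \<bar>u i \<omega> * v i \<omega>\<bar> + \<bar>u i ?w * v i ?w\<bar>) / 2)\<^sup>2"
    by (rule power_mono) simp
  also have "\<dots> \<le> 5/4 * ((A1 n i \<omega>)\<^sup>2 + (A2 n i \<omega>)\<^sup>2 + (A3 n i \<omega>)\<^sup>2 + \<bar>u i \<omega> * v i \<omega>\<bar>\<^sup>2 + \<bar>u i ?w * v i ?w\<bar>\<^sup>2)"
    using sum5_sq_le[of "A1 n i \<omega>" "A2 n i \<omega>" "A3 n i \<omega>" "\<bar>u i \<omega> * v i \<omega>\<bar>" "\<bar>u i ?w * v i ?w\<bar>"]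
    by (simp add: power_divide)
  finally show ?thesis by simp
qed

lemma T_resamp_nn:
  assumes \<phi>: "nice \<phi>"
  shows "(\<integral>\<^sup>+\<omega>. ennreal ((T \<phi> n \<omega> - T \<phi> n (resamp sw2 {i} \<omega>))\<^sup>2) \<partial>Q) \<le> ennreal (5/4) * Vn n i"
proof -
  let ?w = "\<lambda>\<omega>. resamp sw2 {i} \<omega>"
  let ?uv = "\<lambda>\<omega>. ennreal ((u i \<omega> * v i \<omega>)\<^sup>2)"
  have uv: "(\<integral>\<^sup>+\<omega>. ?uv \<omega> \<partial>Q) \<le> 2 * q4 i"
  proof -
    have "(\<integral>\<^sup>+\<omega>. ?uv \<omega> \<partial>Q) \<le> (\<integral>\<^sup>+\<omega>. ennreal ((u i \<omega>) ^ 4) + ennreal ((v i \<omega>) ^ 4) \<partial>Q)"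
      by (intro nn_integral_mono) (simp add: ennreal_plus[symmetric] mult_sq_le del: ennreal_plus)
    also have "\<dots> = q4 i + (\<integral>\<^sup>+\<omega>. ennreal ((v i \<omega>) ^ 4) \<partial>Q)"
      unfolding q4_def by (rule nn_integral_add) measurable
    also have "(\<integral>\<^sup>+\<omega>. ennreal ((v i \<omega>) ^ 4) \<partial>Q) = q4 i"
      unfolding q4_def by (rule nn_v_eq_u[of "\<lambda>x. ennreal (x ^ 4)"]) measurable
    finally show ?thesis by (simp add: mult_2)
  qed
  have uvw: "(\<integral>\<^sup>+\<omega>. ?uv (?w \<omega>) \<partial>Q) = (\<integral>\<^sup>+\<omega>. ?uv \<omega> \<partial>Q)"
    by (rule nn_integral_resamp[OF sw2_inj, of ?uv]) measurable
  have "(\<integral>\<^sup>+\<omega>. ennreal ((T \<phi> n \<omega> - T \<phi> n (?w \<omega>))\<^sup>2) \<partial>Q) \<le>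
     (\<integral>\<^sup>+\<omega>. ennreal (5/4) * (ennreal ((A1 n i \<omega>)\<^sup>2) + ennreal ((A2 n i \<omega>)\<^sup>2) + ennreal ((A3 n i \<omega>)\<^sup>2)
      + ?uv \<omega> + ?uv (?w \<omega>)) \<partial>Q)"
  proof (intro nn_integral_mono)
    fix \<omega>
    have "ennreal ((T \<phi> n \<omega> - T \<phi> n (?w \<omega>))\<^sup>2) \<le> ennreal (5/4 * ((A1 n i \<omega>)\<^sup>2 + (A2 n i \<omega>)\<^sup>2 + (A3 n i \<omega>)\<^sup>2
     + (u i \<omega> * v i \<omega>)\<^sup>2 + (u i (?w \<omega>) * v i (?w \<omega>))\<^sup>2))"
      by (intro ennreal_leI T_resamp_diff \<phi>)
    also have "\<dots> = ennreal (5/4) * (ennreal ((A1 n i \<omega>)\<^sup>2) + ennreal ((A2 n i \<omega>)\<^sup>2) + ennreal ((A3 n i \<omega>)\<^sup>2)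
      + ?uv \<omega> + ?uv (?w \<omega>))"
      by (subst ennreal_mult) (simp_all add: add_nonneg_nonneg)
    finally show "ennreal ((T \<phi> n \<omega> - T \<phi> n (?w \<omega>))\<^sup>2) \<le> \<dots>" .
  qed
  also have "\<dots> = ennreal (5/4) * ((\<integral>\<^sup>+\<omega>. ennreal ((A1 n i \<omega>)\<^sup>2) \<partial>Q) + (\<integral>\<^sup>+\<omega>. ennreal ((A2 n i \<omega>)\<^sup>2) \<partial>Q)
     + (\<integral>\<^sup>+\<omega>. ennreal ((A3 n i \<omega>)\<^sup>2) \<partial>Q) + (\<integral>\<^sup>+\<omega>. ?uv \<omega> \<partial>Q) + (\<integral>\<^sup>+\<omega>. ?uv (?w \<omega>) \<partial>Q))"
    by (simp add: nn_integral_cmult nn_integral_add)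
  also have "\<dots> \<le> ennreal (5/4) * Vn n i"
  proof -
    have "(\<integral>\<^sup>+\<omega>. ?uv \<omega> \<partial>Q) + (\<integral>\<^sup>+\<omega>. ?uv (?w \<omega>) \<partial>Q) \<le> 2 * q4 i + 2 * q4 i"
      unfolding uvw by (intro add_mono uv)
    also have "\<dots> = 4 * q4 i" by (simp add: distrib_right[symmetric])
    finally show ?thesis unfolding Vn_def add.assoc by (intro mult_left_mono add_left_mono) auto
  qed
  finally show ?thesis .
qed

text \<open>T reads copies 0 and 1 only, and \<open>sw2\<close> sends them to 2 and 3, so T and its
  full resampling are independent with equal means; this is the identity asked for by
  \<open>Efron_Stein\<close>. The factor 5/4 stays below the 2 allowed there.\<close>

lemma variance_T:
  assumes fo: "fourth" and \<phi>: "nice \<phi>" and X: "(\<Sum>i. Vn n i) \<le> ennreal X" "X \<ge> 0"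
  shows "(\<integral>\<omega>. (T \<phi> n \<omega>)\<^sup>2 \<partial>Q) - (\<integral>\<omega>. T \<phi> n \<omega> \<partial>Q)\<^sup>2 \<le> X"
proof (rule Efron_Stein[OF sw2_inv])
  show sT: "sqint (T \<phi> n)" by (rule sqint_T[OF fo \<phi>])
  note [measurable] = sqint_meas[OF sT]
  note sR = sqint_resamp[OF sw2_inj sT]
  have Tdep: "T \<phi> n \<omega> = T \<phi> n \<omega>'" if "\<And>k. k \<in> {0,1} \<times> UNIV \<Longrightarrow> \<omega> k = \<omega>' k" for \<omega> \<omega>' :: "nat \<times> nat \<Rightarrow> 'a"
  proof -
    have "W s \<omega> = W s \<omega>'" if "\<And>i. s i \<in> {0, 1}" for s
      using \<open>\<And>k. k \<in> {0,1} \<times> UNIV \<Longrightarrow> \<omega> k = \<omega>' k\<close> by (rule W_dep[of "{0,1} \<times> UNIV"]) (use that in auto)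
    then show ?thesis unfolding T_def v_eq u_eq by (simp add: lead_def)
  qed
  have "Q.indep_var borel (T \<phi> n) borel (\<lambda>\<omega>. T \<phi> n (resamp sw2 UNIV \<omega>))"
  proof (rule indep_disjoint[where A="{0,1} \<times> UNIV" and B="{2,3} \<times> UNIV"])
    show "{0, 1} \<times> UNIV \<inter> {2, 3} \<times> UNIV = ({} :: (nat \<times> nat) set)" by auto
    fix \<omega> \<omega>' :: "nat \<times> nat \<Rightarrow> 'a"
    assume e: "\<And>k. k \<in> {0,1} \<times> UNIV \<Longrightarrow> \<omega> k = \<omega>' k"
    then show "T \<phi> n \<omega> = T \<phi> n \<omega>'" by (rule Tdep)
  next
    fix \<omega> \<omega>' :: "nat \<times> nat \<Rightarrow> 'a"
    assume e: "\<And>k. k \<in> {2,3} \<times> UNIV \<Longrightarrow> \<omega> k = \<omega>' k"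
    show "T \<phi> n (resamp sw2 UNIV \<omega>) = T \<phi> n (resamp sw2 UNIV \<omega>')"
      by (rule Tdep) (auto simp: resamp_def relabel_def sw2_def intro!: e)
  qed measurable
  from Q.indep_var_lebesgue_integral[OF this] sqint_integrable[OF sT] sqint_integrable[OF sR]
  show "(\<integral>\<omega>. T \<phi> n \<omega> * T \<phi> n (resamp sw2 UNIV \<omega>) \<partial>Q) = (\<integral>\<omega>. T \<phi> n \<omega> \<partial>Q)\<^sup>2"
    using integral_resamp[OF sw2_inj, of "T \<phi> n" UNIV] by (simp add: power2_eq_square)
  fix N
  have sd: "sqint (\<lambda>\<omega>. T \<phi> n \<omega> - T \<phi> n (resamp sw2 {i} \<omega>))" for i by (intro sqint_diff sT sR)
  have "ennreal (\<Sum>i<N. \<integral>\<omega>. (T \<phi> n \<omega> - T \<phi> n (resamp sw2 {i} \<omega>))\<^sup>2 \<partial>Q)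
     = (\<Sum>i<N. \<integral>\<^sup>+\<omega>. ennreal ((T \<phi> n \<omega> - T \<phi> n (resamp sw2 {i} \<omega>))\<^sup>2) \<partial>Q)"
    using sd by (subst sum_ennreal[symmetric]) (auto simp: nn_integral_eq_integral sqint_def)
  also have "\<dots> \<le> (\<Sum>i<N. ennreal (5/4) * Vn n i)" by (intro sum_mono T_resamp_nn \<phi>)
  also have "\<dots> \<le> (\<Sum>i. ennreal (5/4) * Vn n i)" by (rule sum_le_suminf) auto
  also have "\<dots> = ennreal (5/4) * (\<Sum>i. Vn n i)" by simp
  also have "\<dots> \<le> ennreal (5/4) * ennreal X" by (intro mult_left_mono X) simp
  also have "\<dots> = ennreal (5/4 * X)" by (rule ennreal_mult[symmetric]) (use X in auto)
  also have "\<dots> \<le> ennreal (2 * X)" using X by (intro ennreal_leI) simp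
  finally show "(\<Sum>i<N. \<integral>\<omega>. (T \<phi> n \<omega> - T \<phi> n (resamp sw2 {i} \<omega>))\<^sup>2 \<partial>Q) \<le> 2 * X"
    using X by (simp add: ennreal_le_iff)
qed

text \<open>Integrability of the fourth powers is read off from a finite bound on the sums, since
  already \<open>Vn 0 j\<close> contains 4 q4 j.\<close>

lemma fourthI: assumes "\<And>n. (\<Sum>i. Vn n i) \<le> ennreal X" shows fourth
  unfolding fourth_def
proof
  fix j
  have "q4 j \<le> 4 * q4 j" using mult_right_mono[of 1 4 "q4 j"] by simp
  also have "\<dots> \<le> Vn 0 j" by (simp add: Vn_def)
  also have "\<dots> \<le> (\<Sum>i. Vn 0 i)" using sum_le_suminf[of "Vn 0" "{j}"] by simp
  also have "\<dots> \<le> ennreal X" by (rule assms)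
  finally show "integrable Q (\<lambda>\<omega>. (u j \<omega>) ^ 4)"
    unfolding q4_def by (intro integrableI_bounded) (auto simp: le_less_trans)
qed

section \<open>Normal approximation in terms of one-site quantities\<close>

lemma law_W0: "distr Q borel W0 = distr P borel f"
proof -
  have "distr P borel f = distr (distr Q P (sel (\<lambda>_. 0))) borel f" by (simp add: distr_sel)
  also have "\<dots> = distr Q borel (f \<circ> sel (\<lambda>_. 0))" by (rule distr_distr) measurable
  finally show ?thesis by (simp add: comp_def W_def[abs_def])
qed

abbreviation Z where "Z \<equiv> distr P borel f"

lemma Z_prob: "prob_space Z" by (rule P.prob_space_distr) measurable

lemma Z_int: "integrable Z (\<lambda>x. x)"
  unfolding law_W0[symmetric] using sqint_integrable[OF sqint_W] by (subst integrable_distr_eq) auto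

text \<open>An infinite right-hand side is trivial, and a finite one provides the integrability that
  the discrepancy bound needs. The test function is smoothed up to e/2. The constant 8 bounds the
  derivative of the Stein solution, and 6 is half the Lipschitz constant 12 of that
  derivative.\<close>

lemma wasserstein_abstract:
  assumes a: "\<And>n. (\<Sum>i. Vn n i) \<le> a"
    and b: "\<And>n. (\<Sum>j<n. \<integral>\<^sup>+\<omega>. ennreal ((u j \<omega>)\<^sup>2 * \<bar>v j \<omega>\<bar>) \<partial>Q) \<le> b"
  shows "wasserstein_dist Z std_normal_distribution \<le> 8 * epowr a (1/2) + 6 * b"
proof (cases "a = \<top> \<or> b = \<top>")
  case True
  then show ?thesis by (auto simp: epowr_def ennreal_mult_eq_top_iff)
next
  case False
  define X where "X = enn2real a"
  define L where "L = enn2real b"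
  have aX: "a = ennreal X" "X \<ge> 0" and bL: "b = ennreal L" "L \<ge> 0"
    using False by (auto simp: X_def L_def ennreal_enn2real_if)
  have fo: fourth by (rule fourthI[of X]) (use a aX in simp)
  have sX: "(sqrt X)\<^sup>2 = X" using aX by simp
  have main: "\<bar>(\<integral>u. h u \<partial>Z) - (\<integral>u. h u \<partial>std_normal_distribution)\<bar> \<le> 8 * sqrt X + 6 * L"
    if h: "1-lipschitz_on UNIV h" for h :: "real \<Rightarrow> real"
  proof -
    have hl: "\<bar>h x - h y\<bar> \<le> \<bar>x - y\<bar>" for x y
      using lipschitz_onD[OF h, of x y] by (simp add: dist_real_def)
    interpret Z: prob_space Z by (rule Z_prob)
    interpret N: prob_space std_normal_distribution by (rule std_normal_prob)
    have "\<bar>(\<integral>u. h u \<partial>Z) - (\<integral>u. h u \<partial>std_normal_distribution)\<bar> \<le> 8 * sqrt X + 6 * L + e" if e: "e > 0" for e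
    proof -
      obtain k k' where k: "\<And>x. (k has_real_derivative k' x) (at x)" "\<And>x. \<bar>k' x\<bar> \<le> 1" "\<And>x. \<bar>k x - h x\<bar> \<le> e/2"
        using lipschitz_smoothing[OF hl, of "e/2"] e by auto
      have kl: "\<bar>k x - k y\<bar> \<le> \<bar>x - y\<bar>" for x y
        using field_differentiable_bound[of UNIV k k' 1 x y] k by simp
      obtain g g' where g: "\<And>x. (g has_real_derivative g' x) (at x)"
          "\<And>x. g' x = x * g x + k x - (\<integral>s. k s \<partial>std_normal_distribution)"
          "\<And>x. \<bar>g x\<bar> \<le> 3" "\<And>x. \<bar>g' x\<bar> \<le> 8" "\<And>x y. \<bar>g' x - g' y\<bar> \<le> 12 * \<bar>x - y\<bar>"
        using stein_C1[OF k(1,2)] by blast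
      have gl: "\<bar>g x - g y\<bar> \<le> 8 * \<bar>x - y\<bar>" for x y
        using field_differentiable_bound[of UNIV g g' 8 x y] g by simp
      have gm[measurable]: "g \<in> borel_measurable borel"
        by (intro borel_measurable_continuous_onI lipschitz_on_continuous_on[of 8] lipschitz_onI)
           (use gl in \<open>auto simp: dist_real_def\<close>)
      have gm'[measurable]: "g' \<in> borel_measurable borel"
        by (intro borel_measurable_continuous_onI lipschitz_on_continuous_on[of 12] lipschitz_onI)
           (use g(5) in \<open>auto simp: dist_real_def\<close>)
      have st: "\<bar>(\<integral>x. g' x - x * g x \<partial>distr Q borel W0)\<bar> \<le> 8 * sqrt X + 6 * L + 0 * sqrt X"
      proof (rule stein_discrepancy[OF fo gm gl gm' g(4), where \<psi>="\<lambda>_. 12" and z=0])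
        fix x y show "\<bar>g y - g x - g' x * (y - x)\<bar> \<le> 12 * (y - x)\<^sup>2 + 0 * \<bar>(y - x) * (of_bool (y \<le> 0) - of_bool (x \<le> 0))\<bar>"
          using taylor_lipschitz[OF g(1) g(5), of y x] by simp
      next
        fix n
        show "(\<integral>\<omega>. (T (\<lambda>x. x) n \<omega>)\<^sup>2 \<partial>Q) - (\<integral>\<omega>. T (\<lambda>x. x) n \<omega> \<partial>Q)\<^sup>2 \<le> (sqrt X)\<^sup>2"
          unfolding sX by (rule variance_T[OF fo nice_id]) (use a aX in auto)
        show "(\<integral>\<omega>. (T abs n \<omega>)\<^sup>2 \<partial>Q) - (\<integral>\<omega>. T abs n \<omega> \<partial>Q)\<^sup>2 \<le> (sqrt X)\<^sup>2"
          unfolding sX by (rule variance_T[OF fo nice_abs]) (use a aX in auto)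
        have "(\<Sum>j<n. \<integral>\<^sup>+\<omega>. ennreal (12 * ((u j \<omega>)\<^sup>2 * \<bar>v j \<omega>\<bar>)) \<partial>Q) = 12 * (\<Sum>j<n. \<integral>\<^sup>+\<omega>. ennreal ((u j \<omega>)\<^sup>2 * \<bar>v j \<omega>\<bar>) \<partial>Q)"
          by (simp add: ennreal_mult' nn_integral_cmult sum_distrib_left)
        also have "\<dots> \<le> 12 * b" by (intro mult_left_mono b) simp
        also have "\<dots> = ennreal (2 * (6 * L))" by (simp add: bL ennreal_mult')
        finally show "(\<Sum>j<n. \<integral>\<^sup>+\<omega>. ennreal (12 * ((u j \<omega>)\<^sup>2 * \<bar>v j \<omega>\<bar>)) \<partial>Q) \<le> ennreal (2 * (6 * L))" .
      qed (use aX bL in auto)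
      have ikZ: "integrable Z k" and ihZ: "integrable Z h"
        by (auto intro!: lipschitz_integrable[OF Z_prob _ Z_int] kl hl)
      have ikN: "integrable std_normal_distribution k" and ihN: "integrable std_normal_distribution h"
        by (auto intro!: lipschitz_integrable[OF std_normal_prob _ std_normal_abs_moment(2)] kl hl)
      have law: "(\<integral>x. g' x - x * g x \<partial>distr Q borel W0) = (\<integral>x. k x \<partial>Z) - (\<integral>x. k x \<partial>std_normal_distribution)"
        unfolding law_W0 g(2) using ikZ Z.prob_space by simp
      have kZ: "\<bar>(\<integral>x. k x \<partial>Z) - (\<integral>x. h x \<partial>Z)\<bar> \<le> e/2"
      proof -
        have "\<bar>(\<integral>x. k x \<partial>Z) - (\<integral>x. h x \<partial>Z)\<bar> = \<bar>\<integral>x. k x - h x \<partial>Z\<bar>" using ikZ ihZ by simp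
        also have "\<dots> \<le> (\<integral>x. e/2 \<partial>Z)"
          using ikZ ihZ k(3) by (intro order_trans[OF integral_abs_bound] integral_mono) auto
        finally show ?thesis using Z.prob_space by simp
      qed
      have kN: "\<bar>(\<integral>x. k x \<partial>std_normal_distribution) - (\<integral>x. h x \<partial>std_normal_distribution)\<bar> \<le> e/2"
      proof -
        have "\<bar>(\<integral>x. k x \<partial>std_normal_distribution) - (\<integral>x. h x \<partial>std_normal_distribution)\<bar> = \<bar>\<integral>x. k x - h x \<partial>std_normal_distribution\<bar>"
          using ikN ihN by simp
        also have "\<dots> \<le> (\<integral>x. e/2 \<partial>std_normal_distribution)"
          using ikN ihN k(3) by (intro order_trans[OF integral_abs_bound] integral_mono) auto
        finally show ?thesis by (simp add: std_normal_UNIV)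
      qed
      show ?thesis by (rule abs_diff_perturb[OF _ kZ kN]) (use st[unfolded law] in simp)
    qed
    then show ?thesis by (rule field_le_epsilon)
  qed
  have "wasserstein_dist Z std_normal_distribution \<le> ennreal (8 * sqrt X + 6 * L)"
    unfolding wasserstein_dist_def by (intro SUP_least ennreal_leI) (use main in auto)
  also have "\<dots> = 8 * epowr a (1/2) + 6 * b"
    using aX bL by (simp add: epowr_half_sq ennreal_mult')
  finally show ?thesis .
qed

text \<open>The coefficient 4 is 3 + 1: the bound on g' and the jump term, both paired with the
  variance bound for T. The second order coefficient 4|x| + 2, halved, produces 2 c + b and is the
  origin of moments weighted by |W0|.\<close>

lemma kolmogorov_abstract:
  assumes a: "\<And>n. (\<Sum>i. Vn n i) \<le> a"
    and b: "\<And>n. (\<Sum>j<n. \<integral>\<^sup>+\<omega>. ennreal ((u j \<omega>)\<^sup>2 * \<bar>v j \<omega>\<bar>) \<partial>Q) \<le> b"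
    and c: "\<And>n. (\<Sum>j<n. \<integral>\<^sup>+\<omega>. ennreal (\<bar>W0 \<omega>\<bar> * ((u j \<omega>)\<^sup>2 * \<bar>v j \<omega>\<bar>)) \<partial>Q) \<le> c"
  shows "kolmogorov_dist Z std_normal_distribution \<le> 4 * epowr a (1/2) + b + 2 * c"
proof (cases "a = \<top> \<or> b = \<top> \<or> c = \<top>")
  case True
  then show ?thesis by (auto simp: epowr_def ennreal_mult_eq_top_iff)
next
  case False
  define X where "X = enn2real a"
  define L where "L = enn2real b"
  define G where "G = enn2real c"
  have aX: "a = ennreal X" "X \<ge> 0" and bL: "b = ennreal L" "L \<ge> 0" and cG: "c = ennreal G" "G \<ge> 0"
    using False by (auto simp: X_def L_def G_def ennreal_enn2real_if)
  have fo: fourth by (rule fourthI[of X]) (use a aX in simp)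
  have sX: "(sqrt X)\<^sup>2 = X" using aX by simp
  have main: "\<bar>cdf Z z - cdf std_normal_distribution z\<bar> \<le> 4 * sqrt X + L + 2 * G" for z
  proof -
    interpret Z: prob_space Z by (rule Z_prob)
    let ?p = "cdf std_normal_distribution z"
    obtain g where g: "\<And>x. \<bar>g x\<bar> \<le> 2" "g \<in> borel_measurable borel"
      "\<And>x. \<bar>x * g x + of_bool (x \<le> z) - ?p\<bar> \<le> 3" "\<And>x y. \<bar>g x - g y\<bar> \<le> 4 * \<bar>x - y\<bar>"
      "\<And>x y. \<bar>g y - g x - (x * g x + of_bool (x \<le> z) - ?p) * (y - x)\<bar>
       \<le> (4 * \<bar>x\<bar> + 2) * (y - x)\<^sup>2 + \<bar>(y - x) * (of_bool (y \<le> z) - of_bool (x \<le> z))\<bar>"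
      using stein_indicator by blast
    note [measurable] = g(2)
    have "\<bar>(\<integral>x. (x * g x + of_bool (x \<le> z) - ?p) - x * g x \<partial>distr Q borel W0)\<bar> \<le> 3 * sqrt X + (L + 2 * G) + 1 * sqrt X"
    proof (rule stein_discrepancy[OF fo g(2) g(4) _ g(3), where \<psi>="\<lambda>x. 4 * \<bar>x\<bar> + 2" and z=z])
      fix x y show "\<bar>g y - g x - (x * g x + of_bool (x \<le> z) - ?p) * (y - x)\<bar>
       \<le> (4 * \<bar>x\<bar> + 2) * (y - x)\<^sup>2 + 1 * \<bar>(y - x) * (of_bool (y \<le> z) - of_bool (x \<le> z))\<bar>"
        using g(5) by simp
    next
      fix n
      show "(\<integral>\<omega>. (T (\<lambda>x. x) n \<omega>)\<^sup>2 \<partial>Q) - (\<integral>\<omega>. T (\<lambda>x. x) n \<omega> \<partial>Q)\<^sup>2 \<le> (sqrt X)\<^sup>2"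
        unfolding sX by (rule variance_T[OF fo nice_id]) (use a aX in auto)
      show "(\<integral>\<omega>. (T abs n \<omega>)\<^sup>2 \<partial>Q) - (\<integral>\<omega>. T abs n \<omega> \<partial>Q)\<^sup>2 \<le> (sqrt X)\<^sup>2"
        unfolding sX by (rule variance_T[OF fo nice_abs]) (use a aX in auto)
      have "(\<Sum>j<n. \<integral>\<^sup>+\<omega>. ennreal ((4 * \<bar>W0 \<omega>\<bar> + 2) * ((u j \<omega>)\<^sup>2 * \<bar>v j \<omega>\<bar>)) \<partial>Q)
        = (\<Sum>j<n. \<integral>\<^sup>+\<omega>. 4 * ennreal (\<bar>W0 \<omega>\<bar> * ((u j \<omega>)\<^sup>2 * \<bar>v j \<omega>\<bar>)) + 2 * ennreal ((u j \<omega>)\<^sup>2 * \<bar>v j \<omega>\<bar>) \<partial>Q)"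
        by (intro sum.cong refl nn_integral_cong) (simp add: distrib_right ennreal_plus ennreal_mult' mult.assoc)
      also have "\<dots> = 4 * (\<Sum>j<n. \<integral>\<^sup>+\<omega>. ennreal (\<bar>W0 \<omega>\<bar> * ((u j \<omega>)\<^sup>2 * \<bar>v j \<omega>\<bar>)) \<partial>Q)
          + 2 * (\<Sum>j<n. \<integral>\<^sup>+\<omega>. ennreal ((u j \<omega>)\<^sup>2 * \<bar>v j \<omega>\<bar>) \<partial>Q)"
        by (simp add: nn_integral_add nn_integral_cmult sum.distrib sum_distrib_left)
      also have "\<dots> \<le> 4 * c + 2 * b" by (intro add_mono mult_left_mono b c) auto
      also have "\<dots> = ennreal (2 * (L + 2 * G))"
        using bL cG by (simp add: ennreal_mult' distrib_left ennreal_plus add.commute)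
      finally show "(\<Sum>j<n. \<integral>\<^sup>+\<omega>. ennreal ((4 * \<bar>W0 \<omega>\<bar> + 2) * ((u j \<omega>)\<^sup>2 * \<bar>v j \<omega>\<bar>)) \<partial>Q) \<le> ennreal (2 * (L + 2 * G))" .
    qed (use aX bL cG in auto)
    moreover have "(\<integral>x. (x * g x + of_bool (x \<le> z) - ?p) - x * g x \<partial>distr Q borel W0) = cdf Z z - ?p"
    proof -
      have "(\<integral>x. (x * g x + of_bool (x \<le> z) - ?p) - x * g x \<partial>distr Q borel W0) = (\<integral>x. indicator {..z} x - ?p \<partial>Z)"
        unfolding law_W0 by (intro Bochner_Integration.integral_cong) (auto simp: indicator_def)
      also have "\<dots> = (\<integral>x. indicator {..z} x \<partial>Z) - ?p"
        using Z.prob_space by (subst Bochner_Integration.integral_diff) (auto simp: Z.emeasure_eq_measure)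
      also have "(\<integral>x. indicator {..z} x \<partial>Z) = cdf Z z"
        by (simp add: cdf_def)
      finally show ?thesis .
    qed
    ultimately show ?thesis by linarith
  qed
  have "kolmogorov_dist Z std_normal_distribution \<le> ennreal (4 * sqrt X + L + 2 * G)"
    unfolding kolmogorov_dist_def by (intro SUP_least ennreal_leI main)
  also have "\<dots> = 4 * epowr a (1/2) + b + 2 * c"
    using aX bL cG by (simp add: epowr_half_sq ennreal_mult')
  finally show ?thesis .
qed

text \<open>Makes the local Kolmogorov bound trivial as soon as one of its terms reaches 1.\<close>

lemma kolmogorov_le_1: "kolmogorov_dist Z std_normal_distribution \<le> 1"
proof -
  interpret Z: prob_space Z by (rule Z_prob)
  interpret N: prob_space std_normal_distribution by (rule std_normal_prob)
  have "\<bar>cdf Z z - cdf std_normal_distribution z\<bar> \<le> 1" for z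
  proof -
    have "0 \<le> cdf Z z" "cdf Z z \<le> 1" "0 \<le> cdf std_normal_distribution z" "cdf std_normal_distribution z \<le> 1"
      by (simp_all add: cdf_def)
    then show ?thesis by linarith
  qed
  then show ?thesis unfolding kolmogorov_dist_def by (intro SUP_least) (simp add: ennreal_leI[of _ 1, simplified])
qed

end

section \<open>Hoelder inequalities\<close>

lemma epowr_0 [simp]: "epowr 0 t = 0"
  by (simp add: epowr_def)

lemma epowr_ennreal: "x \<ge> 0 \<Longrightarrow> epowr (ennreal x) t = ennreal (x powr t)"
  by (simp add: epowr_def)

lemma epowr_top [simp]: "epowr \<top> t = \<top>"
  by (simp add: epowr_def)

lemma epowr_eq_0: "epowr a t = 0 \<longleftrightarrow> a = 0"
  by (cases a) (auto simp: epowr_ennreal)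

lemma epowr_mono:
  assumes "a \<le> b" "t \<ge> 0" shows "epowr a t \<le> epowr b t"
proof (cases b)
  case (real y)
  then have "a \<noteq> \<top>" using assms(1) by (metis ennreal_neq_top top.extremum_unique)
  then obtain x where x: "a = ennreal x" "x \<ge> 0" by (cases a) auto
  then show ?thesis using real assms by (simp add: epowr_ennreal ennreal_leI powr_mono2 ennreal_le_iff)
qed simp

lemma epowr_mult:
  assumes "t > 0" shows "epowr (a * b) t = epowr a t * epowr b t"
proof (cases "a = 0 \<or> b = 0")
  case True then show ?thesis by auto
next
  case False
  then show ?thesis
    by (cases a; cases b)
       (auto simp: epowr_ennreal ennreal_mult[symmetric] powr_mult ennreal_mult_top ennreal_top_mult)
qed

lemma epowr_epowr: "epowr (epowr a s) t = epowr a (s * t)"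
  by (cases a) (auto simp: epowr_ennreal powr_powr)

lemma epowr_1 [simp]: "epowr a 1 = a"
  by (cases a) (auto simp: epowr_ennreal)

text \<open>After normalizing x + y to 1 this is z \<le> z powr t on the unit interval.\<close>

lemma epowr_add_le:
  assumes "0 < t" "t \<le> 1" shows "epowr (a + b) t \<le> epowr a t + epowr b t"
proof (cases "a = \<top> \<or> b = \<top>")
  case True then show ?thesis by auto
next
  case False
  then obtain x y where xy: "a = ennreal x" "x \<ge> 0" "b = ennreal y" "y \<ge> 0" by (cases a; cases b) auto
  have "(x + y) powr t \<le> x powr t + y powr t"
  proof (cases "x + y = 0")
    case False
    then have s: "x + y > 0" using xy by linarith
    have le: "z \<le> z powr t" if "0 \<le> z" "z \<le> 1" for z :: real
      using that assms powr_mono'[of t 1 z] by simp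
    have "1 = x / (x + y) + y / (x + y)" using s by (simp add: add_divide_distrib[symmetric])
    also have "\<dots> \<le> (x / (x + y)) powr t + (y / (x + y)) powr t"
      using xy s by (intro add_mono le) (auto simp: divide_le_eq)
    also have "\<dots> = (x powr t + y powr t) / (x + y) powr t"
      using xy s by (simp add: powr_divide add_divide_distrib)
    finally show ?thesis using s by (simp add: pos_le_divide_eq)
  qed (use xy in auto)
  then show ?thesis using xy by (simp add: epowr_ennreal ennreal_plus[symmetric] ennreal_leI del: ennreal_plus)
qed

text \<open>Young's inequality after normalizing both integrals. A vanishing integral is treated
  apart: the right-hand side is then 0 even if the other integral is infinite, and the integrand
  vanishes almost everywhere.\<close>

lemma Holder_two:
  fixes f g :: "'a \<Rightarrow> real"
  assumes [measurable]: "f \<in> borel_measurable N" "g \<in> borel_measurable N"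
    and fg: "\<And>x. f x \<ge> 0" "\<And>x. g x \<ge> 0" and \<theta>: "0 < \<theta>" "\<theta> < 1"
  shows "(\<integral>\<^sup>+x. ennreal (f x powr \<theta> * g x powr (1 - \<theta>)) \<partial>N)
    \<le> epowr (\<integral>\<^sup>+x. ennreal (f x) \<partial>N) \<theta> * epowr (\<integral>\<^sup>+x. ennreal (g x) \<partial>N) (1 - \<theta>)"
    (is "?L \<le> epowr ?F \<theta> * epowr ?G (1 - \<theta>)")
proof -
  consider "?F = 0 \<or> ?G = 0" | "?F \<noteq> 0" "?G \<noteq> 0" "?F = \<top> \<or> ?G = \<top>" | "?F \<noteq> 0" "?G \<noteq> 0" "?F \<noteq> \<top>" "?G \<noteq> \<top>"
    by blast
  then show ?thesis
  proof cases
    case 1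
    then have "AE x in N. f x powr \<theta> * g x powr (1 - \<theta>) = 0"
    proof
      assume "?F = 0"
      then have "AE x in N. ennreal (f x) = 0" by (subst (asm) nn_integral_0_iff_AE) auto
      then show ?thesis by eventually_elim (use fg in \<open>auto simp: ennreal_eq_0_iff order.antisym\<close>)
    next
      assume "?G = 0"
      then have "AE x in N. ennreal (g x) = 0" by (subst (asm) nn_integral_0_iff_AE) auto
      then show ?thesis by eventually_elim (use fg in \<open>auto simp: ennreal_eq_0_iff order.antisym\<close>)
    qed
    then have "?L = (\<integral>\<^sup>+x. 0 \<partial>N)" by (intro nn_integral_cong_AE) auto
    then show ?thesis by simp
  next
    case 2
    then have "epowr ?F \<theta> * epowr ?G (1 - \<theta>) = \<top>"
      by (auto simp: ennreal_mult_eq_top_iff epowr_eq_0)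
    then show ?thesis by simp
  next
    case 3
    then obtain a b where ab: "?F = ennreal a" "a > 0" "?G = ennreal b" "b > 0"
      by (cases ?F; cases ?G) (auto simp: less_le)
    let ?c = "a powr \<theta> * b powr (1 - \<theta>)"
    have pt: "f x powr \<theta> * g x powr (1 - \<theta>) \<le> ?c * (\<theta> / a * f x + (1 - \<theta>) / b * g x)" for x
    proof -
      have "(f x / a) powr \<theta> * (g x / b) powr (1 - \<theta>) \<le> \<theta> * (f x / a) + (1 - \<theta>) * (g x / b)"
      proof (cases "f x = 0 \<or> g x = 0")
        case True
        have "0 \<le> \<theta> * (f x / a) + (1 - \<theta>) * (g x / b)"
          using \<theta> fg[of x] ab by (intro add_nonneg_nonneg mult_nonneg_nonneg) auto
        then show ?thesis using True by auto
      next
        case False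
        then have "0 < f x / a" "0 < g x / b" using fg[of x] ab by (auto simp: less_le)
        then show ?thesis using \<theta> by (intro Youngs_inequality_0) auto
      qed
      then have "?c * ((f x / a) powr \<theta> * (g x / b) powr (1 - \<theta>)) \<le> ?c * (\<theta> * (f x / a) + (1 - \<theta>) * (g x / b))"
        by (intro mult_left_mono) auto
      moreover have "?c * ((f x / a) powr \<theta> * (g x / b) powr (1 - \<theta>)) = f x powr \<theta> * g x powr (1 - \<theta>)"
        using fg[of x] ab by (simp add: powr_divide)
      ultimately show ?thesis by simp
    qed
    have "?L \<le> (\<integral>\<^sup>+x. ennreal ?c * (ennreal (\<theta> / a) * ennreal (f x) + ennreal ((1 - \<theta>) / b) * ennreal (g x)) \<partial>N)"
    proof (intro nn_integral_mono)
      fix x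
      have "ennreal (f x powr \<theta> * g x powr (1 - \<theta>)) \<le> ennreal (?c * (\<theta> / a * f x + (1 - \<theta>) / b * g x))"
        by (rule ennreal_leI[OF pt])
      also have "\<dots> = ennreal ?c * (ennreal (\<theta> / a) * ennreal (f x) + ennreal ((1 - \<theta>) / b) * ennreal (g x))"
        using fg[of x] \<theta> ab
        by (simp only: ennreal_mult[symmetric] ennreal_plus[symmetric] mult_nonneg_nonneg divide_nonneg_pos
          add_nonneg_nonneg powr_ge_zero less_imp_le diff_ge_0_iff_ge)
      finally show "ennreal (f x powr \<theta> * g x powr (1 - \<theta>)) \<le> \<dots>" .
    qed
    also have "\<dots> = ennreal ?c * (ennreal (\<theta> / a) * ?F + ennreal ((1 - \<theta>) / b) * ?G)"
      by (simp add: nn_integral_cmult nn_integral_add)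
    also have "\<dots> = ennreal (?c * (\<theta> / a * a + (1 - \<theta>) / b * b))"
      using \<theta> ab by (simp only: ab(1,3) ennreal_mult[symmetric] ennreal_plus[symmetric] mult_nonneg_nonneg divide_nonneg_pos
          add_nonneg_nonneg powr_ge_zero less_imp_le diff_ge_0_iff_ge)
    also have "\<dots> = ennreal ?c" using ab by simp
    also have "\<dots> = epowr ?F \<theta> * epowr ?G (1 - \<theta>)"
      using ab by (simp add: epowr_ennreal ennreal_mult)
    finally show ?thesis .
  qed
qed

lemma Cauchy_Schwarz_epowr:
  fixes f g :: "'a \<Rightarrow> real"
  assumes "f \<in> borel_measurable N" "g \<in> borel_measurable N" "\<And>x. f x \<ge> 0" "\<And>x. g x \<ge> 0"
  shows "(\<integral>\<^sup>+x. ennreal (f x * g x) \<partial>N)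
    \<le> epowr (\<integral>\<^sup>+x. ennreal ((f x)\<^sup>2) \<partial>N) (1/2) * epowr (\<integral>\<^sup>+x. ennreal ((g x)\<^sup>2) \<partial>N) (1/2)"
  using Holder_two[of "\<lambda>x. (f x)\<^sup>2" N "\<lambda>x. (g x)\<^sup>2" "1/2"] assms
  by (simp add: powr_half_sqrt)

text \<open>An indicator equals its own powers, so the event can take the exponent lam and leave 1 -
  lam to the function. This is how weights are split off from moments.\<close>

lemma Holder_indicator:
  fixes h :: "'a \<Rightarrow> real"
  assumes E: "E \<in> sets N" and [measurable]: "h \<in> borel_measurable N" and h: "\<And>x. h x \<ge> 0" and lam: "0 < lam" "lam < 1"
  shows "(\<integral>\<^sup>+x. ennreal (indicator E x * h x) \<partial>N)
    \<le> epowr (emeasure N E) lam * epowr (\<integral>\<^sup>+x. ennreal (h x powr (1 / (1 - lam))) \<partial>N) (1 - lam)"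
proof -
  note [measurable] = E
  have "(\<integral>\<^sup>+x. ennreal ((indicator E x :: real) powr lam * (h x powr (1 / (1 - lam))) powr (1 - lam)) \<partial>N)
    \<le> epowr (\<integral>\<^sup>+x. ennreal (indicator E x) \<partial>N) lam * epowr (\<integral>\<^sup>+x. ennreal (h x powr (1 / (1 - lam))) \<partial>N) (1 - lam)"
    by (rule Holder_two) (use lam in auto)
  moreover have "(indicator E x :: real) powr lam * (h x powr (1 / (1 - lam))) powr (1 - lam) = indicator E x * h x" for x
    using lam h[of x] by (auto simp: powr_powr indicator_def)
  moreover have "(\<integral>\<^sup>+x. ennreal (indicator E x) \<partial>N) = emeasure N E"
    by (simp add: ennreal_indicator)
  ultimately show ?thesis by simp
qed

text \<open>The event is split off first; Cauchy-Schwarz twice then separates the four functions,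
  whence the exponent 4 / (1 - lam).\<close>

lemma Holder_four:
  fixes a b c d :: "'a \<Rightarrow> real"
  assumes E: "E \<in> sets N"
    and m [measurable]: "a \<in> borel_measurable N" "b \<in> borel_measurable N" "c \<in> borel_measurable N" "d \<in> borel_measurable N"
    and nn: "\<And>x. a x \<ge> 0" "\<And>x. b x \<ge> 0" "\<And>x. c x \<ge> 0" "\<And>x. d x \<ge> 0" and lam: "0 < lam" "lam < 1"
  defines "mm \<equiv> \<lambda>h. epowr (\<integral>\<^sup>+x. ennreal (h x powr (4 / (1 - lam))) \<partial>N) ((1 - lam) / 4)"
  shows "(\<integral>\<^sup>+x. ennreal (indicator E x * (a x * b x * (c x * d x))) \<partial>N)
    \<le> epowr (emeasure N E) lam * (mm a * mm b * (mm c * mm d))"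
proof -
  define r where "r = 1 / (1 - lam)"
  have r: "r > 0" "1 - lam > 0" using lam by (auto simp: r_def)
  define A where "A h = (\<integral>\<^sup>+x. ennreal (h x powr (4 / (1 - lam))) \<partial>N)" for h :: "'a \<Rightarrow> real"
  have p4: "((h powr r)\<^sup>2)\<^sup>2 = h powr (4 / (1 - lam))" if "h \<ge> 0" for h :: real
  proof (cases "h = 0")
    case False
    then have "h > 0" using that by simp
    then have "((h powr r)\<^sup>2)\<^sup>2 = h powr (r * 4)"
      by (simp add: powr_powr[symmetric] powr_numeral power_mult[symmetric])
    then show ?thesis by (simp add: r_def)
  qed simp
  have two: "(\<integral>\<^sup>+x. ennreal ((h x powr r * k x powr r)\<^sup>2) \<partial>N) \<le> epowr (A h) (1/2) * epowr (A k) (1/2)"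
    if [measurable]: "h \<in> borel_measurable N" "k \<in> borel_measurable N" and "\<And>x. h x \<ge> 0" "\<And>x. k x \<ge> 0" for h k
  proof -
    have "(\<integral>\<^sup>+x. ennreal ((h x powr r * k x powr r)\<^sup>2) \<partial>N) = (\<integral>\<^sup>+x. ennreal ((h x powr r)\<^sup>2 * (k x powr r)\<^sup>2) \<partial>N)"
      by (simp add: power_mult_distrib)
    also have "\<dots> \<le> epowr (\<integral>\<^sup>+x. ennreal (((h x powr r)\<^sup>2)\<^sup>2) \<partial>N) (1/2) * epowr (\<integral>\<^sup>+x. ennreal (((k x powr r)\<^sup>2)\<^sup>2) \<partial>N) (1/2)"
      by (rule Cauchy_Schwarz_epowr) auto
    finally show ?thesis using that by (simp only: p4 A_def)
  qed
  have "(\<integral>\<^sup>+x. ennreal (indicator E x * (a x * b x * (c x * d x))) \<partial>N)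
    \<le> epowr (emeasure N E) lam * epowr (\<integral>\<^sup>+x. ennreal ((a x * b x * (c x * d x)) powr (1 / (1 - lam))) \<partial>N) (1 - lam)"
    by (rule Holder_indicator[OF E]) (use nn lam in auto)
  also have "\<dots> \<le> epowr (emeasure N E) lam * (mm a * mm b * (mm c * mm d))"
  proof (intro mult_left_mono)
    have "(\<integral>\<^sup>+x. ennreal ((a x * b x * (c x * d x)) powr (1 / (1 - lam))) \<partial>N)
      = (\<integral>\<^sup>+x. ennreal ((a x powr r * b x powr r) * (c x powr r * d x powr r)) \<partial>N)"
      using nn by (intro nn_integral_cong) (simp add: powr_mult r_def)
    also have "\<dots> \<le> epowr (\<integral>\<^sup>+x. ennreal ((a x powr r * b x powr r)\<^sup>2) \<partial>N) (1/2) * epowr (\<integral>\<^sup>+x. ennreal ((c x powr r * d x powr r)\<^sup>2) \<partial>N) (1/2)"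
      by (rule Cauchy_Schwarz_epowr) auto
    also have "\<dots> \<le> epowr (epowr (A a) (1/2) * epowr (A b) (1/2)) (1/2) * epowr (epowr (A c) (1/2) * epowr (A d) (1/2)) (1/2)"
      by (intro mult_mono epowr_mono two m nn) auto
    also have "\<dots> = epowr (A a) (1/4) * epowr (A b) (1/4) * (epowr (A c) (1/4) * epowr (A d) (1/4))"
      by (simp add: epowr_mult epowr_epowr)
    finally have "epowr (\<integral>\<^sup>+x. ennreal ((a x * b x * (c x * d x)) powr (1 / (1 - lam))) \<partial>N) (1 - lam)
      \<le> epowr (epowr (A a) (1/4) * epowr (A b) (1/4) * (epowr (A c) (1/4) * epowr (A d) (1/4))) (1 - lam)"
      using r by (intro epowr_mono) auto
    also have "\<dots> = mm a * mm b * (mm c * mm d)"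
      using r by (simp add: epowr_mult epowr_epowr mm_def A_def)
    finally show "epowr (\<integral>\<^sup>+x. ennreal ((a x * b x * (c x * d x)) powr (1 / (1 - lam))) \<partial>N) (1 - lam) \<le> \<dots>" .
  qed simp
  finally show ?thesis .
qed

lemma suminf_ge_term: "f k \<le> (\<Sum>i. f i)" for f :: "nat \<Rightarrow> ennreal"
  using sum_le_suminf[of f "{k}"] by simp

lemma sum_le_suminf_ennreal: "finite I \<Longrightarrow> (\<Sum>i\<in>I. f i) \<le> (\<Sum>i. f i)" for f :: "nat \<Rightarrow> ennreal"
  by (rule sum_le_suminf) auto

section \<open>Action radii and scales\<close>

context site_copies
begin

text \<open>Two copies at a site are packed into one function, as \<^term>\<open>Q.indep_var\<close> needs a common type.\<close>

lemma distr_coord_sel: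
  fixes i a b
  defines "N \<equiv> PiM (UNIV :: nat set) (\<lambda>_. M i)" and "G \<equiv> \<lambda>\<omega> k. if k = (0::nat) then \<omega> (a, i) else \<omega> (b, i)"
  assumes "s i \<noteq> a" "s i \<noteq> b"
  shows "G \<in> Q \<rightarrow>\<^sub>M N" "distr Q (N \<Otimes>\<^sub>M P) (\<lambda>\<omega>. (G \<omega>, sel s \<omega>)) = distr Q N G \<Otimes>\<^sub>M P"
proof -
  show G: "G \<in> Q \<rightarrow>\<^sub>M N" unfolding G_def N_def
  proof (rule measurable_abs_UNIV)
    fix k :: nat show "(\<lambda>\<omega>. if k = 0 then \<omega> (a, i) else \<omega> (b, i)) \<in> Q \<rightarrow>\<^sub>M M i"
      by (cases "k = 0") simp_all
  qed
  have "Q.indep_var N G P (sel s)"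
    by (rule indep_disjoint[where A="{(a, i), (b, i)}" and B="range (\<lambda>k. (s k, k))"])
       (use assms(3,4) G in \<open>auto simp: sel_def G_def fun_eq_iff\<close>)
  then show "distr Q (N \<Otimes>\<^sub>M P) (\<lambda>\<omega>. (G \<omega>, sel s \<omega>)) = distr Q N G \<Otimes>\<^sub>M P"
    by (simp add: Q.indep_var_distribution_eq distr_sel)
qed

lemma indep_event_prob:
  assumes "{\<omega>\<in>space Q. p \<omega>} \<in> sets Q" "{\<omega>\<in>space Q. q \<omega>} \<in> sets Q" "A \<inter> B = {}"
    and "\<And>\<omega> \<omega>'. (\<And>k. k \<in> A \<Longrightarrow> \<omega> k = \<omega>' k) \<Longrightarrow> p \<omega> = p \<omega>'"
    and "\<And>\<omega> \<omega>'. (\<And>k. k \<in> B \<Longrightarrow> \<omega> k = \<omega>' k) \<Longrightarrow> q \<omega> = q \<omega>'"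
  shows "measure Q {\<omega>\<in>space Q. p \<omega> \<and> q \<omega>} = measure Q {\<omega>\<in>space Q. p \<omega>} * measure Q {\<omega>\<in>space Q. q \<omega>}"
proof -
  have p: "p \<in> Q \<rightarrow>\<^sub>M count_space UNIV" and q: "q \<in> Q \<rightarrow>\<^sub>M count_space UNIV"
    using assms(1,2) by (auto simp: pred_def)
  have "Q.indep_var (count_space UNIV) p (count_space UNIV) q"
    by (rule indep_disjoint[OF p q assms(3-5)])
  from Q.indep_varD[OF this, of "{True}" "{True}"]
  show ?thesis by (simp add: vimage_def Int_def conj_commute)
qed

end

section \<open>Exchanges of values that influence the functional\<close>

context centred_functional
begin

text \<open>The diagonal of a product of measurable spaces need not be measurable, so the event that
  two values at a site differ cannot be used directly. Positive influence is a measurable event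
  contained in it, and increments vanish almost surely outside.\<close>

definition infl :: "nat \<Rightarrow> 'a \<times> 'a \<Rightarrow> ennreal" where
  "infl i p = (\<integral>\<^sup>+z. ennreal \<bar>f (z(i := fst p)) - f (z(i := snd p))\<bar> \<partial>P)"

definition hit :: "nat \<Rightarrow> 'a \<times> 'a \<Rightarrow> bool" where
  "hit i p \<longleftrightarrow> p \<in> space (M i \<Otimes>\<^sub>M M i) \<and> infl i p \<noteq> 0"

lemma upd_measurable: "(\<lambda>(p, z). f (z(i := g p))) \<in> borel_measurable ((M i \<Otimes>\<^sub>M M i) \<Otimes>\<^sub>M P)"
  if [measurable]: "g \<in> M i \<Otimes>\<^sub>M M i \<rightarrow>\<^sub>M M i"
proof -
  have "(\<lambda>w k. if k = i then g (fst w) else snd w k) \<in> (M i \<Otimes>\<^sub>M M i) \<Otimes>\<^sub>M P \<rightarrow>\<^sub>M P"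
    unfolding P_def
  proof (rule measurable_abs_UNIV)
    fix k
    show "(\<lambda>w. if k = i then g (fst w) else snd w k) \<in> (M i \<Otimes>\<^sub>M M i) \<Otimes>\<^sub>M PiM UNIV M \<rightarrow>\<^sub>M M k"
      by (cases "k = i") simp_all
  qed
  from measurable_compose[OF this f_meas] show ?thesis
    by (simp add: split_beta' fun_upd_def[abs_def])
qed

lemma infl_measurable [measurable]: "infl i \<in> borel_measurable (M i \<Otimes>\<^sub>M M i)"
proof -
  have "(\<lambda>(p, z). ennreal \<bar>f (z(i := fst p)) - f (z(i := snd p))\<bar>) \<in> borel_measurable ((M i \<Otimes>\<^sub>M M i) \<Otimes>\<^sub>M P)"
    using upd_measurable[of fst i] upd_measurable[of snd i] by (simp add: split_beta')
  from P.borel_measurable_nn_integral[OF this] show ?thesis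
    by (simp add: infl_def[abs_def])
qed

lemma hit_measurable [measurable]: "Measurable.pred (M i \<Otimes>\<^sub>M M i) (hit i)"
  unfolding hit_def[abs_def] by measurable

lemma hit_neq: "hit i (x, y) \<Longrightarrow> x \<noteq> y"
  by (auto simp: hit_def infl_def)

text \<open>Fubini: the two values at site i are independent of the other sites, so where their
  influence is zero the increment vanishes for almost every environment.\<close>

lemma D1_hit:
  assumes sb: "s i \<noteq> b"
  shows "AE \<omega> in Q. hit i (\<omega> (s i, i), \<omega> (b, i)) \<or> D1 s i b \<omega> = 0"
proof -
  \<comment> \<open>A copy different from both copies read at i, so the environment shares no
    coordinate with the pair; its own value at i is overwritten afterwards.\<close>
  define d where "d = Suc (s i + b)"
  let ?h = "\<lambda>p z. (if hit i p then 0 else ennreal \<bar>f (z(i := fst p)) - f (z(i := snd p))\<bar>)"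
  let ?N = "PiM (UNIV :: nat set) (\<lambda>_. M i)"
  let ?G = "\<lambda>\<omega> k. if k = (0::nat) then \<omega> (s i, i) else \<omega> (b, i)"
  let ?m = "\<lambda>\<omega>. (?G \<omega>, sel (s(i := d)) \<omega>)"
  let ?k = "\<lambda>(g, z). ?h (g (0::nat), g (1::nat)) z"
  have hm0: "(\<lambda>(p, z). ?h p z) \<in> borel_measurable ((M i \<Otimes>\<^sub>M M i) \<Otimes>\<^sub>M P)"
    using upd_measurable[of fst i] upd_measurable[of snd i] by (simp add: split_beta')
  have "(\<lambda>w. ((fst w 0, fst w 1), snd w)) \<in> ?N \<Otimes>\<^sub>M P \<rightarrow>\<^sub>M (M i \<Otimes>\<^sub>M M i) \<Otimes>\<^sub>M P" by measurable
  from measurable_compose[OF this hm0] have hm: "?k \<in> borel_measurable (?N \<Otimes>\<^sub>M P)"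
    unfolding split_beta' fst_conv snd_conv .
  have sd: "(s(i := d)) i \<noteq> s i" "(s(i := d)) i \<noteq> b" by (auto simp: d_def)
  note dm = distr_coord_sel(2)[where s="s(i := d)" and i=i and a="s i" and b=b, OF sd]
    and G = distr_coord_sel(1)[where s="s(i := d)" and i=i and a="s i" and b=b, OF sd]
  have mm: "?m \<in> Q \<rightarrow>\<^sub>M ?N \<Otimes>\<^sub>M P" using G by measurable
  have hm': "?k \<in> borel_measurable (distr Q ?N ?G \<Otimes>\<^sub>M P)"
    using hm by (simp cong: measurable_cong_sets)
  have "(\<integral>\<^sup>+\<omega>. ?k (?m \<omega>) \<partial>Q) = (\<integral>\<^sup>+w. ?k w \<partial>distr Q (?N \<Otimes>\<^sub>M P) ?m)"
    by (rule nn_integral_distr[OF mm, symmetric]) (unfold measurable_distr_eq1, rule hm)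
  also have "\<dots> = (\<integral>\<^sup>+w. ?k w \<partial>(distr Q ?N ?G \<Otimes>\<^sub>M P))" unfolding dm ..
  also have "\<dots> = (\<integral>\<^sup>+g. \<integral>\<^sup>+z. ?k (g, z) \<partial>P \<partial>distr Q ?N ?G)"
    using P.nn_integral_fst[OF hm'] by simp
  also have "\<dots> = (\<integral>\<^sup>+g. 0 \<partial>distr Q ?N ?G)"
  proof (rule nn_integral_cong)
    fix g assume "g \<in> space (distr Q ?N ?G)"
    then have p: "(g 0, g 1) \<in> space (M i \<Otimes>\<^sub>M M i)" by (auto simp: space_pair_measure space_PiM)
    show "(\<integral>\<^sup>+z. ?k (g, z) \<partial>P) = 0"
    proof (cases "hit i (g 0, g 1)")
      case False
      then have "infl i (g 0, g 1) = 0" using p by (simp add: hit_def)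
      then show ?thesis using False by (simp add: infl_def)
    qed simp
  qed
  finally have "(\<integral>\<^sup>+\<omega>. ?k (?m \<omega>) \<partial>Q) = 0" by simp
  then have "AE \<omega> in Q. ?k (?m \<omega>) = 0"
    using nn_integral_0_iff_AE[OF measurable_compose[OF mm hm]] by simp
  then show ?thesis
  proof eventually_elim
    case (elim \<omega>)
    have "(sel (s(i := d)) \<omega>)(i := \<omega> (s i, i)) = sel s \<omega>" "(sel (s(i := d)) \<omega>)(i := \<omega> (b, i)) = sel (s(i := b)) \<omega>"
      by (auto simp: sel_def fun_eq_iff)
    with elim show ?case
      by (auto simp: D1_def W_def split: if_splits)
  qed
qed

end

definition spliced :: "(nat \<Rightarrow> nat) \<Rightarrow> (nat \<Rightarrow> nat) \<Rightarrow> nat set \<Rightarrow> nat \<Rightarrow> nat" where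
  "spliced s t B = (\<lambda>k. if k \<in> B then t k else s k)"

definition spl :: "nat set \<Rightarrow> (nat \<Rightarrow> 'a) \<times> (nat \<Rightarrow> 'a) \<Rightarrow> nat \<Rightarrow> 'a" where
  "spl B p = (\<lambda>k. if k \<in> B then snd p k else fst p k)"

text \<open>The interface to random fields: \<open>R i\<close> is an action radius, \<open>w\<close>
  bounds the probability of a scale, \<open>m1\<close> and \<open>m2\<close> are moments of discrete
  derivatives, and \<open>\<kappa>\<close> is the inverse standard deviation. The moment bounds
  range over finite \<open>B\<close>, as interpolation resamples finitely many sites at a
  time.\<close>

locale multiscale = centred_functional M f
  for M :: "nat \<Rightarrow> 'a measure" and f :: "(nat \<Rightarrow> 'a) \<Rightarrow> real" +
  fixes R :: "nat \<Rightarrow> (nat \<Rightarrow> 'a) \<times> (nat \<Rightarrow> 'a) \<Rightarrow> ennreal"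
    and w :: "nat \<Rightarrow> nat \<Rightarrow> real"
    and m1 :: "real \<Rightarrow> nat \<Rightarrow> nat \<Rightarrow> ennreal"
    and m2 :: "real \<Rightarrow> nat \<Rightarrow> nat \<Rightarrow> nat \<Rightarrow> nat \<Rightarrow> ennreal"
    and \<kappa> :: real
  assumes \<kappa>: "\<kappa> > 0"
    and R_meas [measurable]: "\<And>i. R i \<in> borel_measurable (P \<Otimes>\<^sub>M P)"
    and R_fin: "\<And>i. AE p in P \<Otimes>\<^sub>M P. R i p < \<top>"
    and w_bound: "\<And>i n. measure (P \<Otimes>\<^sub>M P) {p \<in> space (P \<Otimes>\<^sub>M P).
        ennreal (real n - 1) \<le> R i p \<and> R i p < ennreal (real n) \<and> hit i (fst p i, snd p i)} \<le> w i n"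
    and m1_bound: "\<And>i n B q. finite B \<Longrightarrow> i \<notin> B \<Longrightarrow> q > 0 \<Longrightarrow>
        (\<integral>\<^sup>+p. ennreal (\<bar>f (spl B p) - f (spl (insert i B) p)\<bar> powr q)
            * indicator {p. R i p < ennreal (real n)} p \<partial>(P \<Otimes>\<^sub>M P)) \<le> ennreal (\<kappa> powr q) * m1 q i n"
    and m2_bound: "\<And>i n j n' B q. finite B \<Longrightarrow> i \<notin> B \<Longrightarrow> j \<notin> B \<Longrightarrow> i \<noteq> j \<Longrightarrow> q > 0 \<Longrightarrow>
        (\<integral>\<^sup>+p. ennreal (\<bar>f (spl B p) - f (spl (insert i B) p) - f (spl (insert j B) p)
              + f (spl (insert i (insert j B)) p)\<bar> powr q)
            * indicator {p. R i p < ennreal (real n) \<and> R j p < ennreal (real n')} p \<partial>(P \<Otimes>\<^sub>M P))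
          \<le> ennreal (\<kappa> powr q) * m2 q i n j n'"
begin

lemma w_nonneg: "w i n \<ge> 0"
  using w_bound[of n i] measure_nonneg order_trans by blast

definition rad :: "(nat \<Rightarrow> nat) \<Rightarrow> (nat \<Rightarrow> nat) \<Rightarrow> nat \<Rightarrow> (nat \<times> nat \<Rightarrow> 'a) \<Rightarrow> ennreal" where
  "rad s t i \<omega> = R i (sel s \<omega>, sel t \<omega>)"

lemma rad_meas [measurable]: "rad s t i \<in> borel_measurable Q"
  unfolding rad_def[abs_def] by measurable

definition disj :: "(nat \<Rightarrow> nat) \<Rightarrow> (nat \<Rightarrow> nat) \<Rightarrow> bool" where "disj s t \<longleftrightarrow> (\<forall>i. s i \<noteq> t i)"

lemma sel_spliced: "sel (spliced s t B) \<omega> = spl B (sel s \<omega>, sel t \<omega>)"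
  by (auto simp: sel_def spliced_def spl_def)

lemma spliced_upd: "(spliced s t B)(i := t i) = spliced s t (insert i B)"
  by (auto simp: spliced_def fun_eq_iff)

lemma rad_fin: "disj s t \<Longrightarrow> AE \<omega> in Q. rad s t i \<omega> < \<top>"
proof -
  assume "disj s t"
  then have "AE p in distr Q (P \<Otimes>\<^sub>M P) (\<lambda>\<omega>. (sel s \<omega>, sel t \<omega>)). R i p < \<top>"
    using R_fin by (subst distr_sel_pair) (auto simp: disj_def)
  then show ?thesis unfolding rad_def by (rule AE_distrD[rotated]) measurable
qed

text \<open>Selections that differ at every site have the joint law of two independent
  configurations, so the moment hypothesis transfers to each such pair.\<close>

lemma D1_moment:
  assumes st: "disj s t" and B: "finite B" "i \<notin> B" and q: "q > 0" and c: "c = t i"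
  shows "(\<integral>\<^sup>+\<omega>. ennreal ((\<bar>D1 (spliced s t B) i c \<omega>\<bar> * of_bool (rad s t i \<omega> < ennreal (real n))) powr q) \<partial>Q)
     \<le> ennreal (\<kappa> powr q) * m1 q i n"
proof -
  let ?g = "\<lambda>p. ennreal (\<bar>f (spl B p) - f (spl (insert i B) p)\<bar> powr q) * indicator {p. R i p < ennreal (real n)} p"
  have sm: "spl B' \<in> P \<Otimes>\<^sub>M P \<rightarrow>\<^sub>M P" for B'
    unfolding P_def spl_def[abs_def]
  proof (rule measurable_abs_UNIV)
    fix k show "(\<lambda>p. if k \<in> B' then snd p k else fst p k) \<in> PiM UNIV M \<Otimes>\<^sub>M PiM UNIV M \<rightarrow>\<^sub>M M k"
      by (cases "k \<in> B'") simp_all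
  qed
  note [measurable] = measurable_compose[OF sm f_meas]
  have "(\<integral>\<^sup>+\<omega>. ennreal ((\<bar>D1 (spliced s t B) i c \<omega>\<bar> * of_bool (rad s t i \<omega> < ennreal (real n))) powr q) \<partial>Q)
     = (\<integral>\<^sup>+\<omega>. ?g (sel s \<omega>, sel t \<omega>) \<partial>Q)"
    using q by (intro nn_integral_cong)
       (auto simp: D1_def W_def c spliced_upd sel_spliced rad_def indicator_def)
  also have "\<dots> = (\<integral>\<^sup>+p. ?g p \<partial>(P \<Otimes>\<^sub>M P))"
    using st by (intro nn_integral_sel_pair) (auto simp: disj_def)
  finally show ?thesis using m1_bound[OF B q] by simp
qed

lemma D2_moment:
  assumes st: "disj s t" and B: "finite B" "i \<notin> B" "j \<notin> B" "i \<noteq> j" and q: "q > 0" and c: "b = t i" "c = t j"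
  shows "(\<integral>\<^sup>+\<omega>. ennreal ((\<bar>D2 (spliced s t B) i b j c \<omega>\<bar>
      * of_bool (rad s t i \<omega> < ennreal (real n) \<and> rad s t j \<omega> < ennreal (real n'))) powr q) \<partial>Q)
     \<le> ennreal (\<kappa> powr q) * m2 q i n j n'"
proof -
  let ?g = "\<lambda>p. ennreal (\<bar>f (spl B p) - f (spl (insert i B) p) - f (spl (insert j B) p)
              + f (spl (insert i (insert j B)) p)\<bar> powr q)
            * indicator {p. R i p < ennreal (real n) \<and> R j p < ennreal (real n')} p"
  have sm: "spl B' \<in> P \<Otimes>\<^sub>M P \<rightarrow>\<^sub>M P" for B'
    unfolding P_def spl_def[abs_def]
  proof (rule measurable_abs_UNIV)
    fix k show "(\<lambda>p. if k \<in> B' then snd p k else fst p k) \<in> PiM UNIV M \<Otimes>\<^sub>M PiM UNIV M \<rightarrow>\<^sub>M M k"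
      by (cases "k \<in> B'") simp_all
  qed
  note [measurable] = measurable_compose[OF sm f_meas]
  have "(\<integral>\<^sup>+\<omega>. ennreal ((\<bar>D2 (spliced s t B) i b j c \<omega>\<bar>
      * of_bool (rad s t i \<omega> < ennreal (real n) \<and> rad s t j \<omega> < ennreal (real n'))) powr q) \<partial>Q)
     = (\<integral>\<^sup>+\<omega>. ?g (sel s \<omega>, sel t \<omega>) \<partial>Q)"
    using q by (intro nn_integral_cong)
       (auto simp: D2_def W_def c spliced_upd sel_spliced rad_def indicator_def insert_commute)
  also have "\<dots> = (\<integral>\<^sup>+p. ?g p \<partial>(P \<Otimes>\<^sub>M P))"
    using st by (intro nn_integral_sel_pair) (auto simp: disj_def)
  finally show ?thesis using m2_bound[OF B q] by simp
qed

text \<open>A site whose action radius is read off from two reference pairs is assigned the maximum of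
  the two radii: truncated differences only grow with the scale.\<close>

definition Ev :: "(nat \<Rightarrow> nat) \<Rightarrow> (nat \<Rightarrow> nat) \<Rightarrow> (nat \<Rightarrow> nat) \<Rightarrow> (nat \<Rightarrow> nat) \<Rightarrow> nat \<Rightarrow> nat \<Rightarrow> (nat \<times> nat \<Rightarrow> 'a) \<Rightarrow> bool" where
  "Ev s t s' t' j n \<omega> \<longleftrightarrow> ennreal (real n - 1) \<le> max (rad s t j \<omega>) (rad s' t' j \<omega>)
     \<and> max (rad s t j \<omega>) (rad s' t' j \<omega>) < ennreal (real n) \<and> hit j (\<omega> (s j, j), \<omega> (t j, j))"

lemma Ev_meas [measurable]: "Measurable.pred Q (Ev s t s' t' j n)"
proof -
  have [measurable]: "Measurable.pred Q (\<lambda>\<omega>. hit j (\<omega> (s j, j), \<omega> (t j, j)))"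
    by (rule measurable_compose[OF _ hit_measurable]) measurable
  show ?thesis unfolding Ev_def[abs_def] by measurable
qed

lemma scale_exists:
  assumes "x < (\<top> :: ennreal)"
  obtains n :: nat where "ennreal (real n - 1) \<le> x" "x < ennreal (real n)"
proof -
  obtain y where y: "x = ennreal y" "y \<ge> 0" using assms by (cases x) auto
  let ?n = "nat \<lfloor>y\<rfloor> + 1"
  have "real ?n = of_int \<lfloor>y\<rfloor> + 1" using y by (simp add: of_nat_nat)
  then have n: "real ?n - 1 \<le> y" "y < real ?n" by linarith+
  show thesis
  proof (rule that)
    show "ennreal (real ?n - 1) \<le> x" unfolding y(1) by (rule ennreal_leI[OF n(1)])
    show "x < ennreal (real ?n)" unfolding y(1) ennreal_less_iff[OF y(2)] by (rule n(2))
  qed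
qed

lemma Ev_AE:
  assumes "disj s t" "disj s' t'"
  shows "AE \<omega> in Q. hit j (\<omega> (s j, j), \<omega> (t j, j)) \<longrightarrow> (\<exists>n. Ev s t s' t' j n \<omega>)"
  using rad_fin[OF assms(1), of j] rad_fin[OF assms(2), of j]
proof eventually_elim
  case (elim \<omega>)
  then have "max (rad s t j \<omega>) (rad s' t' j \<omega>) < \<top>" by simp
  then show ?case by (metis Ev_def scale_exists)
qed

lemma one_scale_prob:
  assumes "disj s t" "a = s j" "b = t j"
  shows "measure Q {\<omega>\<in>space Q. ennreal (real n - 1) \<le> rad s t j \<omega> \<and> rad s t j \<omega> < ennreal (real n)
     \<and> hit j (\<omega> (a, j), \<omega> (b, j))} \<le> w j n"
proof -
  let ?m = "\<lambda>\<omega>. (sel s \<omega>, sel t \<omega>)"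
  let ?S = "{p \<in> space (P \<Otimes>\<^sub>M P). ennreal (real n - 1) \<le> R j p \<and> R j p < ennreal (real n) \<and> hit j (fst p j, snd p j)}"
  have c: "(\<lambda>p. (fst p j, snd p j)) \<in> P \<Otimes>\<^sub>M P \<rightarrow>\<^sub>M M j \<Otimes>\<^sub>M M j"
    unfolding P_def by measurable
  have [measurable]: "Measurable.pred (P \<Otimes>\<^sub>M P) (\<lambda>p. hit j (fst p j, snd p j))"
    by (rule measurable_compose[OF c hit_measurable])
  have S: "?S \<in> sets (P \<Otimes>\<^sub>M P)" by measurable
  have mm: "?m \<in> Q \<rightarrow>\<^sub>M P \<Otimes>\<^sub>M P" by measurable
  have "{\<omega>\<in>space Q. ennreal (real n - 1) \<le> rad s t j \<omega> \<and> rad s t j \<omega> < ennreal (real n)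
     \<and> hit j (\<omega> (a, j), \<omega> (b, j))} = ?m -` ?S \<inter> space Q"
    using measurable_space[OF mm] by (auto simp: rad_def sel_def assms)
  then have "measure Q {\<omega>\<in>space Q. ennreal (real n - 1) \<le> rad s t j \<omega> \<and> rad s t j \<omega> < ennreal (real n)
     \<and> hit j (\<omega> (a, j), \<omega> (b, j))} = measure (distr Q (P \<Otimes>\<^sub>M P) ?m) ?S"
    using measure_distr[OF mm S] by simp
  also have "distr Q (P \<Otimes>\<^sub>M P) ?m = P \<Otimes>\<^sub>M P" by (rule distr_sel_pair) (use assms in \<open>auto simp: disj_def\<close>)
  finally show ?thesis using w_bound by simp
qed

text \<open>If the maximum of the two radii lies in the window, one of the radii does. Both pairs
  read the same copies at j, so \<open>hit\<close> is the same event for both, and two applications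
  of the one-radius bound add up.\<close>

lemma Ev_prob:
  assumes "disj s t" "disj s' t'" "s' j = s j" "t' j = t j"
  shows "measure Q {\<omega>\<in>space Q. Ev s t s' t' j n \<omega>} \<le> 2 * w j n"
proof -
  let ?A = "\<lambda>s t. {\<omega>\<in>space Q. ennreal (real n - 1) \<le> rad s t j \<omega> \<and> rad s t j \<omega> < ennreal (real n)
     \<and> hit j (\<omega> (s j, j), \<omega> (t j, j))}"
  have [measurable]: "Measurable.pred Q (\<lambda>\<omega>. hit j (\<omega> (s j, j), \<omega> (t j, j)))" for s t
    by (rule measurable_compose[OF _ hit_measurable]) measurable
  have "measure Q {\<omega>\<in>space Q. Ev s t s' t' j n \<omega>} \<le> measure Q (?A s t \<union> ?A s' t')"
    by (intro Q.finite_measure_mono) (auto simp: Ev_def assms le_max_iff_disj)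
  also have "\<dots> \<le> measure Q (?A s t) + measure Q (?A s' t')" by (rule measure_Un_le) measurable
  also have "\<dots> \<le> w j n + w j n" by (intro add_mono one_scale_prob assms refl)
  finally show ?thesis by simp
qed

end

lemma epowr_exp_add: "epowr x a * epowr x b = epowr x (a + b)"
  by (cases x) (auto simp: epowr_ennreal ennreal_mult[symmetric] powr_add ennreal_top_mult)

section \<open>Products of differences decomposed by scale\<close>

context multiscale
begin

definition mm1 :: "real \<Rightarrow> nat \<Rightarrow> nat \<Rightarrow> ennreal" where
  "mm1 lam i n = epowr (m1 (4 / (1 - lam)) i n) ((1 - lam) / 4)"
definition mm2 :: "real \<Rightarrow> nat \<Rightarrow> nat \<Rightarrow> nat \<Rightarrow> nat \<Rightarrow> ennreal" where
  "mm2 lam i n j n' = epowr (m2 (4 / (1 - lam)) i n j n') ((1 - lam) / 4)"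

lemma scaled_moment:
  assumes "X \<le> ennreal (\<kappa> powr q) * m" "q > 0"
  shows "epowr X (1 / q) \<le> ennreal \<kappa> * epowr m (1 / q)"
proof -
  have "epowr X (1 / q) \<le> epowr (ennreal (\<kappa> powr q) * m) (1 / q)"
    using assms by (intro epowr_mono) auto
  also have "\<dots> = ennreal \<kappa> * epowr m (1 / q)"
    using assms(2) \<kappa> by (simp add: epowr_mult epowr_ennreal powr_powr)
  finally show ?thesis .
qed

text \<open>Common shape of the summands of A1, A2 and A3. There are two reference pairs because the
  second difference and the first difference may read different copies at site i.\<close>

definition Xd :: "nat \<Rightarrow> (nat \<Rightarrow> nat) \<Rightarrow> (nat \<Rightarrow> nat) \<Rightarrow> (nat \<Rightarrow> nat) \<Rightarrow> (nat \<Rightarrow> nat) \<Rightarrow> nat set \<Rightarrow> nat set \<Rightarrow> nat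
    \<Rightarrow> (nat \<times> nat \<Rightarrow> 'a) \<Rightarrow> real" where
  "Xd i s t s' t' B B' j \<omega> = \<bar>D2 (spliced s t B) i (t i) j 1 \<omega>\<bar> * \<bar>D1 (spliced s' t' B') j 1 \<omega>\<bar>"

definition admis :: "nat \<Rightarrow> (nat \<Rightarrow> nat) \<Rightarrow> (nat \<Rightarrow> nat) \<Rightarrow> (nat \<Rightarrow> nat) \<Rightarrow> (nat \<Rightarrow> nat) \<Rightarrow> nat set \<Rightarrow> nat set \<Rightarrow> nat \<Rightarrow> bool" where
  "admis i s t s' t' B B' j \<longleftrightarrow> j \<noteq> i \<and> s j = 0 \<and> t j = 1 \<and> s' j = 0 \<and> t' j = 1 \<and> finite B \<and> finite B'
     \<and> i \<notin> B \<and> j \<notin> B \<and> j \<notin> B'"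

lemma Xd_meas [measurable]: "Xd i s t s' t' B B' j \<in> borel_measurable Q"
  unfolding Xd_def[abs_def] by measurable

text \<open>A second difference is a difference of two first differences at i in two environments,
  hence vanishes almost surely unless the exchange at i hits; the first difference gives the same at
  j.\<close>

lemma Xd_covered:
  assumes st: "disj s t" "disj s' t'" and a: "admis i s t s' t' B B' j"
  shows "AE \<omega> in Q. Xd i s t s' t' B B' j \<omega> = 0 \<or> ((\<exists>n. Ev s t s t i n \<omega>) \<and> (\<exists>n. Ev s t s' t' j n \<omega>))"
proof -
  let ?s = "spliced s t B" and ?s' = "spliced s' t' B'"
  have 1: "?s i \<noteq> t i" "(?s(j := 1)) i \<noteq> t i" "?s' j \<noteq> 1" "?s i = s i" "(?s(j := 1)) i = s i" "?s' j = 0" "s j = 0" "t j = 1"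
    using st a by (auto simp: admis_def spliced_def disj_def)
  have tw: "D2 ?s i (t i) j 1 \<omega> = D1 ?s i (t i) \<omega> - D1 (?s(j := 1)) i (t i) \<omega>" for \<omega>
    using a by (simp add: D2_def D1_def admis_def fun_upd_twist)
  show ?thesis
    using D1_hit[where s="?s" and i=i and b="t i", OF 1(1)] D1_hit[where s="?s(j := 1)" and i=i and b="t i", OF 1(2)]
      D1_hit[where s="?s'" and i=j and b=1, OF 1(3)] Ev_AE[OF st(1) st(1), of i] Ev_AE[OF st, of j]
  proof eventually_elim
    case (elim \<omega>)
    show ?case
    proof (cases "hit i (\<omega> (s i, i), \<omega> (t i, i)) \<and> hit j (\<omega> (0, j), \<omega> (1, j))")
      case True
      then show ?thesis using elim 1 by auto
    next
      case False
      then have "D2 ?s i (t i) j 1 \<omega> = 0 \<or> D1 ?s' j 1 \<omega> = 0"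
        using elim unfolding tw 1 by auto
      then show ?thesis by (auto simp: Xd_def)
    qed
  qed
qed

definition Ep :: "nat \<Rightarrow> (nat \<Rightarrow> nat) \<Rightarrow> (nat \<Rightarrow> nat) \<Rightarrow> (nat \<Rightarrow> nat) \<Rightarrow> (nat \<Rightarrow> nat) \<Rightarrow> nat \<Rightarrow> nat \<Rightarrow> nat \<Rightarrow> nat \<Rightarrow> nat \<Rightarrow> (nat \<times> nat \<Rightarrow> 'a) set" where
  "Ep i s t s' t' j k l l' l'' = {\<omega>\<in>space Q. Ev s t s t i l \<omega> \<and> Ev s t s' t' j l' \<omega> \<and> Ev s t s' t' k l'' \<omega>}"

lemma Ep_sets [measurable]: "Ep i s t s' t' j k l l' l'' \<in> sets Q"
  unfolding Ep_def by measurable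

text \<open>On \<open>Ep\<close> all radii are below their scales, so each factor may be truncated
  there without a change. Hoelder then separates the event from four truncated moments, each of
  which carries one factor \<open>\<kappa>\<close>.\<close>

lemma term_bound:
  assumes st: "disj s t" "disj s' t'" and a: "admis i s t s' t' B B' j" "admis i s t s' t' C C' k"
    and lam: "0 < lam" "lam < 1"
  shows "(\<integral>\<^sup>+\<omega>. ennreal (indicator (Ep i s t s' t' j k l l' l'') \<omega> * (Xd i s t s' t' B B' j \<omega> * Xd i s t s' t' C C' k \<omega>)) \<partial>Q)
    \<le> ennreal (measure Q (Ep i s t s' t' j k l l' l'') powr lam) *
      (ennreal (\<kappa> ^ 4) * (mm2 lam i l j l' * mm2 lam i l k l'' * (mm1 lam j l' * mm1 lam k l'')))"
proof -
  let ?E = "Ep i s t s' t' j k l l' l''"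
  define q where "q = 4 / (1 - lam)"
  have q: "q > 0" "(1 - lam) / 4 = 1 / q" using lam by (auto simp: q_def)
  let ?a = "\<lambda>\<omega>. \<bar>D2 (spliced s t B) i (t i) j 1 \<omega>\<bar> * of_bool (rad s t i \<omega> < ennreal (real l) \<and> rad s t j \<omega> < ennreal (real l'))"
  let ?b = "\<lambda>\<omega>. \<bar>D2 (spliced s t C) i (t i) k 1 \<omega>\<bar> * of_bool (rad s t i \<omega> < ennreal (real l) \<and> rad s t k \<omega> < ennreal (real l''))"
  let ?c = "\<lambda>\<omega>. \<bar>D1 (spliced s' t' B') j 1 \<omega>\<bar> * of_bool (rad s' t' j \<omega> < ennreal (real l'))"
  let ?d = "\<lambda>\<omega>. \<bar>D1 (spliced s' t' C') k 1 \<omega>\<bar> * of_bool (rad s' t' k \<omega> < ennreal (real l''))"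
  have eq: "indicator ?E \<omega> * (Xd i s t s' t' B B' j \<omega> * Xd i s t s' t' C C' k \<omega>)
     = indicator ?E \<omega> * (?a \<omega> * ?b \<omega> * (?c \<omega> * ?d \<omega>))" for \<omega>
  proof (cases "\<omega> \<in> ?E")
    case True
    then have "rad s t i \<omega> < ennreal (real l)" "rad s t j \<omega> < ennreal (real l')" "rad s t k \<omega> < ennreal (real l'')"
      "rad s' t' j \<omega> < ennreal (real l')" "rad s' t' k \<omega> < ennreal (real l'')"
      by (auto simp: Ep_def Ev_def)
    then show ?thesis by (simp add: Xd_def mult_ac)
  qed simp
  have m: "epowr (\<integral>\<^sup>+\<omega>. ennreal (?a \<omega> powr (4 / (1 - lam))) \<partial>Q) ((1 - lam) / 4) \<le> ennreal \<kappa> * mm2 lam i l j l'"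
    "epowr (\<integral>\<^sup>+\<omega>. ennreal (?b \<omega> powr (4 / (1 - lam))) \<partial>Q) ((1 - lam) / 4) \<le> ennreal \<kappa> * mm2 lam i l k l''"
    "epowr (\<integral>\<^sup>+\<omega>. ennreal (?c \<omega> powr (4 / (1 - lam))) \<partial>Q) ((1 - lam) / 4) \<le> ennreal \<kappa> * mm1 lam j l'"
    "epowr (\<integral>\<^sup>+\<omega>. ennreal (?d \<omega> powr (4 / (1 - lam))) \<partial>Q) ((1 - lam) / 4) \<le> ennreal \<kappa> * mm1 lam k l''"
    unfolding mm1_def mm2_def q_def[symmetric] q(2)
    by (intro scaled_moment D2_moment D1_moment st q; use a in \<open>auto simp: admis_def\<close>)+
  have "(\<integral>\<^sup>+\<omega>. ennreal (indicator ?E \<omega> * (Xd i s t s' t' B B' j \<omega> * Xd i s t s' t' C C' k \<omega>)) \<partial>Q)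
    \<le> epowr (emeasure Q ?E) lam * (epowr (\<integral>\<^sup>+\<omega>. ennreal (?a \<omega> powr (4 / (1 - lam))) \<partial>Q) ((1 - lam) / 4) *
        epowr (\<integral>\<^sup>+\<omega>. ennreal (?b \<omega> powr (4 / (1 - lam))) \<partial>Q) ((1 - lam) / 4) *
       (epowr (\<integral>\<^sup>+\<omega>. ennreal (?c \<omega> powr (4 / (1 - lam))) \<partial>Q) ((1 - lam) / 4) *
        epowr (\<integral>\<^sup>+\<omega>. ennreal (?d \<omega> powr (4 / (1 - lam))) \<partial>Q) ((1 - lam) / 4)))"
    unfolding eq by (rule Holder_four) (use lam in auto)
  also have "\<dots> \<le> epowr (emeasure Q ?E) lam * ((ennreal \<kappa> * mm2 lam i l j l') * (ennreal \<kappa> * mm2 lam i l k l'')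
      * ((ennreal \<kappa> * mm1 lam j l') * (ennreal \<kappa> * mm1 lam k l'')))"
    by (intro mult_left_mono mult_mono m) auto
  also have "\<dots> = ennreal (measure Q ?E powr lam) *
      (ennreal (\<kappa> ^ 4) * (mm2 lam i l j l' * mm2 lam i l k l'' * (mm1 lam j l' * mm1 lam k l'')))"
  proof -
    have "ennreal (\<kappa> ^ 4) = ennreal \<kappa> * ennreal \<kappa> * (ennreal \<kappa> * ennreal \<kappa>)"
      using \<kappa> by (simp add: ennreal_mult[symmetric] power4_eq_xxxx mult_ac)
    then show ?thesis by (simp add: Q.emeasure_eq_measure epowr_ennreal mult_ac)
  qed
  finally show ?thesis .
qed

lemma pair_bound:
  assumes st: "disj s t" "disj s' t'" and a: "admis i s t s' t' B B' j" "admis i s t s' t' C C' k"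
    and lam: "0 < lam" "lam < 1"
  shows "(\<integral>\<^sup>+\<omega>. ennreal (Xd i s t s' t' B B' j \<omega> * Xd i s t s' t' C C' k \<omega>) \<partial>Q)
    \<le> (\<Sum>l. \<Sum>l'. \<Sum>l''. ennreal (measure Q (Ep i s t s' t' j k l l' l'') powr lam) *
      (ennreal (\<kappa> ^ 4) * (mm2 lam i l j l' * mm2 lam i l k l'' * (mm1 lam j l' * mm1 lam k l''))))"
proof -
  let ?X = "\<lambda>\<omega>. Xd i s t s' t' B B' j \<omega> * Xd i s t s' t' C C' k \<omega>"
  let ?t = "\<lambda>l l' l'' \<omega>. ennreal (indicator (Ep i s t s' t' j k l l' l'') \<omega> * ?X \<omega>)"
  \<comment> \<open>Where both products are nonzero, each of the three sites has a scale, so the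
    point lies in one of the events \<open>Ep\<close>.\<close>
  have "AE \<omega> in Q. ennreal (?X \<omega>) \<le> (\<Sum>l. \<Sum>l'. \<Sum>l''. ?t l l' l'' \<omega>)"
    using Xd_covered[OF st a(1)] Xd_covered[OF st a(2)] AE_space
  proof eventually_elim
    case (elim \<omega>)
    show ?case
    proof (cases "?X \<omega> = 0")
      case False
      then obtain l l' l'' where "Ev s t s t i l \<omega>" "Ev s t s' t' j l' \<omega>" "Ev s t s' t' k l'' \<omega>"
        using elim by auto
      then have "ennreal (?X \<omega>) = ?t l l' l'' \<omega>" using elim by (simp add: Ep_def)
      also have "\<dots> \<le> (\<Sum>l''. ?t l l' l'' \<omega>)" by (rule suminf_ge_term)
      also have "\<dots> \<le> (\<Sum>l'. \<Sum>l''. ?t l l' l'' \<omega>)" by (rule suminf_ge_term)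
      also have "\<dots> \<le> (\<Sum>l. \<Sum>l'. \<Sum>l''. ?t l l' l'' \<omega>)" by (rule suminf_ge_term)
      finally show ?thesis .
    next
      case True
      show ?thesis unfolding True by simp
    qed
  qed
  then have "(\<integral>\<^sup>+\<omega>. ennreal (?X \<omega>) \<partial>Q) \<le> (\<integral>\<^sup>+\<omega>. (\<Sum>l. \<Sum>l'. \<Sum>l''. ?t l l' l'' \<omega>) \<partial>Q)"
    by (rule nn_integral_mono_AE)
  also have "\<dots> = (\<Sum>l. \<Sum>l'. \<Sum>l''. \<integral>\<^sup>+\<omega>. ?t l l' l'' \<omega> \<partial>Q)"
    by (simp add: nn_integral_suminf)
  also have "\<dots> \<le> (\<Sum>l. \<Sum>l'. \<Sum>l''. ennreal (measure Q (Ep i s t s' t' j k l l' l'') powr lam) *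
      (ennreal (\<kappa> ^ 4) * (mm2 lam i l j l' * mm2 lam i l k l'' * (mm1 lam j l' * mm1 lam k l''))))"
    by (intro suminf_le term_bound st a lam) auto
  finally show ?thesis .
qed

definition g1 :: "real \<Rightarrow> real \<Rightarrow> nat \<Rightarrow> nat \<Rightarrow> nat \<Rightarrow> ennreal" where
  "g1 \<theta> lam i j k = (\<Sum>l. \<Sum>l'. \<Sum>l''. ennreal ((w i l powr \<theta> * w j l' powr \<theta> * w k l'' powr \<theta>) powr lam)
      * mm2 lam i l j l' * mm2 lam i l k l'' * mm1 lam j l' * mm1 lam k l'')"

definition g2 :: "real \<Rightarrow> real \<Rightarrow> nat \<Rightarrow> nat \<Rightarrow> ennreal" where
  "g2 \<theta> lam i j = (\<Sum>l. \<Sum>l'. ennreal ((w i l powr \<theta> * w j l' powr \<theta>) powr lam)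
      * epowr (m2 (4 / (1 - lam)) i l j l') ((1 - lam) / 2) * epowr (m1 (4 / (1 - lam)) j l') ((1 - lam) / 2))"

text \<open>Each radius may depend on the whole field, so the three scale events need not be
  independent: a probability below 2a, 2b and 2c is only known to be at most 2 (abc)^(1/3). The case
  k = j is included.\<close>

lemma pair_general:
  assumes st: "disj s t" "disj s' t'" and a: "admis i s t s' t' B B' j" "admis i s t s' t' C C' k"
    and lam: "0 < lam" "lam < 1"
  shows "(\<integral>\<^sup>+\<omega>. ennreal (Xd i s t s' t' B B' j \<omega> * Xd i s t s' t' C C' k \<omega>) \<partial>Q) \<le> ennreal (2 * \<kappa> ^ 4) * g1 (1/3) lam i j k"
proof -
  have pr: "measure Q (Ep i s t s' t' j k l l' l'') powr lam
      \<le> 2 * (w i l powr (1/3) * w j l' powr (1/3) * w k l'' powr (1/3)) powr lam" for l l' l''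
  proof -
    let ?x = "measure Q (Ep i s t s' t' j k l l' l'')"
    let ?a = "w i l" and ?b = "w j l'" and ?c = "w k l''"
    have w0: "0 \<le> ?a" "0 \<le> ?b" "0 \<le> ?c" by (rule w_nonneg)+
    have "?x \<le> measure Q {\<omega>\<in>space Q. Ev s t s t i l \<omega>}" "?x \<le> measure Q {\<omega>\<in>space Q. Ev s t s' t' j l' \<omega>}"
       "?x \<le> measure Q {\<omega>\<in>space Q. Ev s t s' t' k l'' \<omega>}"
      by (intro Q.finite_measure_mono; auto simp: Ep_def)+
    moreover have "measure Q {\<omega>\<in>space Q. Ev s t s t i l \<omega>} \<le> 2 * ?a"
      "measure Q {\<omega>\<in>space Q. Ev s t s' t' j l' \<omega>} \<le> 2 * ?b"
      "measure Q {\<omega>\<in>space Q. Ev s t s' t' k l'' \<omega>} \<le> 2 * ?c"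
      using a by (auto intro!: Ev_prob st simp: admis_def)
    ultimately have x: "?x \<le> 2 * ?a" "?x \<le> 2 * ?b" "?x \<le> 2 * ?c" "0 \<le> ?x" by auto
    have p: "?x powr (1/3) \<le> (2 * y) powr (1/3)" if "?x \<le> 2 * y" for y
      using x(4) that by (intro powr_mono2) auto
    have "?x = ?x powr (1/3) * ?x powr (1/3) * ?x powr (1/3)"
      using x(4) by (cases "?x = 0") (simp_all add: powr_add[symmetric])
    also have "\<dots> \<le> (2 * ?a) powr (1/3) * (2 * ?b) powr (1/3) * (2 * ?c) powr (1/3)"
      by (intro mult_mono p x) auto
    also have "\<dots> = (2 powr (1/3) * 2 powr (1/3) * 2 powr (1/3)) * (?a powr (1/3) * ?b powr (1/3) * ?c powr (1/3))"
      using w0 by (simp add: powr_mult mult_ac)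
    also have "(2 powr (1/3) * 2 powr (1/3) * 2 powr (1/3) :: real) = 2"
      by (simp add: powr_add[symmetric])
    finally have "?x powr lam \<le> (2 * (?a powr (1/3) * ?b powr (1/3) * ?c powr (1/3))) powr lam"
      using lam x(4) by (intro powr_mono2) auto
    also have "\<dots> = 2 powr lam * (?a powr (1/3) * ?b powr (1/3) * ?c powr (1/3)) powr lam"
      by (simp add: powr_mult)
    also have "\<dots> \<le> 2 powr 1 * (?a powr (1/3) * ?b powr (1/3) * ?c powr (1/3)) powr lam"
      using lam by (intro mult_right_mono powr_mono) auto
    finally show ?thesis by simp
  qed
  have "(\<integral>\<^sup>+\<omega>. ennreal (Xd i s t s' t' B B' j \<omega> * Xd i s t s' t' C C' k \<omega>) \<partial>Q)
    \<le> (\<Sum>l. \<Sum>l'. \<Sum>l''. ennreal (measure Q (Ep i s t s' t' j k l l' l'') powr lam) *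
      (ennreal (\<kappa> ^ 4) * (mm2 lam i l j l' * mm2 lam i l k l'' * (mm1 lam j l' * mm1 lam k l''))))"
    by (rule pair_bound[OF assms])
  also have "\<dots> \<le> (\<Sum>l. \<Sum>l'. \<Sum>l''. ennreal (2 * \<kappa> ^ 4) * (ennreal ((w i l powr (1/3) * w j l' powr (1/3) * w k l'' powr (1/3)) powr lam)
      * mm2 lam i l j l' * mm2 lam i l k l'' * mm1 lam j l' * mm1 lam k l''))"
  proof (intro suminf_le)
    fix l l' l''
    let ?m = "mm2 lam i l j l' * mm2 lam i l k l'' * (mm1 lam j l' * mm1 lam k l'')"
    have "ennreal (measure Q (Ep i s t s' t' j k l l' l'') powr lam) * (ennreal (\<kappa> ^ 4) * ?m)
      \<le> ennreal (2 * (w i l powr (1/3) * w j l' powr (1/3) * w k l'' powr (1/3)) powr lam) * (ennreal (\<kappa> ^ 4) * ?m)"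
      by (intro mult_right_mono ennreal_leI pr) simp
    also have "\<dots> = ennreal (2 * \<kappa> ^ 4) * (ennreal ((w i l powr (1/3) * w j l' powr (1/3) * w k l'' powr (1/3)) powr lam)
      * mm2 lam i l j l' * mm2 lam i l k l'' * mm1 lam j l' * mm1 lam k l'')"
      using \<kappa> by (simp add: ennreal_mult mult_ac)
    finally show "ennreal (measure Q (Ep i s t s' t' j k l l' l'') powr lam) * (ennreal (\<kappa> ^ 4) * ?m) \<le> \<dots>" .
  qed auto
  finally show ?thesis by (simp add: g1_def)
qed

section \<open>Radii that depend on their own site only\<close>

definition local_R :: "(nat \<Rightarrow> 'a \<times> 'a \<Rightarrow> ennreal) \<Rightarrow> bool" where
  "local_R r \<longleftrightarrow> (\<forall>i. r i \<in> borel_measurable (M i \<Otimes>\<^sub>M M i) \<and>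
     (\<forall>p\<in>space (P \<Otimes>\<^sub>M P). R i p = r i (fst p i, snd p i)))"

definition Lv :: "(nat \<Rightarrow> 'a \<times> 'a \<Rightarrow> ennreal) \<Rightarrow> nat \<Rightarrow> nat \<Rightarrow> 'a \<times> 'a \<Rightarrow> bool" where
  "Lv r j n p \<longleftrightarrow> ennreal (real n - 1) \<le> r j p \<and> r j p < ennreal (real n) \<and> hit j p"

lemma local_rad: "local_R r \<Longrightarrow> \<omega> \<in> space Q \<Longrightarrow> rad s t j \<omega> = r j (\<omega> (s j, j), \<omega> (t j, j))"
  using measurable_space[OF sel_measurable, of \<omega>] 
  by (auto simp: local_R_def rad_def sel_def space_pair_measure)

lemma local_Ev: "local_R r \<Longrightarrow> \<omega> \<in> space Q \<Longrightarrow> s' j = s j \<Longrightarrow> t' j = t j \<Longrightarrow>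
    Ev s t s' t' j n \<omega> \<longleftrightarrow> Lv r j n (\<omega> (s j, j), \<omega> (t j, j))"
  by (simp add: Ev_def Lv_def local_rad)

lemma Lv_meas: "local_R r \<Longrightarrow> {\<omega>\<in>space Q. Lv r j n (\<omega> (a, j), \<omega> (b, j))} \<in> sets Q"
proof -
  assume "local_R r"
  then have [measurable]: "r j \<in> borel_measurable (M j \<Otimes>\<^sub>M M j)" by (simp add: local_R_def)
  have "Measurable.pred (M j \<Otimes>\<^sub>M M j) (Lv r j n)" unfolding Lv_def[abs_def] by measurable
  from measurable_compose[OF _ this, of "\<lambda>\<omega>. (\<omega> (a, j), \<omega> (b, j))" Q]
  show ?thesis by (simp add: pred_def)
qed

lemma Lv_prob:
  assumes "local_R r" "a \<noteq> b"
  shows "measure Q {\<omega>\<in>space Q. Lv r j n (\<omega> (a, j), \<omega> (b, j))} \<le> w j n"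
proof -
  have "{\<omega>\<in>space Q. Lv r j n (\<omega> (a, j), \<omega> (b, j))} = {\<omega>\<in>space Q. ennreal (real n - 1) \<le> rad (\<lambda>_. a) (\<lambda>_. b) j \<omega>
     \<and> rad (\<lambda>_. a) (\<lambda>_. b) j \<omega> < ennreal (real n) \<and> hit j (\<omega> (a, j), \<omega> (b, j))}"
    using local_rad[OF assms(1)] by (auto simp: Lv_def)
  then show ?thesis using one_scale_prob[of "\<lambda>_. a" "\<lambda>_. b" a j b n] assms(2) by (simp add: disj_def)
qed

lemma Lv_two:
  assumes r: "local_R r" and ab: "a \<noteq> b" "a' \<noteq> b'" and ij: "i \<noteq> j"
  shows "measure Q {\<omega>\<in>space Q. Lv r i l (\<omega> (a, i), \<omega> (b, i)) \<and> Lv r j l' (\<omega> (a', j), \<omega> (b', j))} \<le> w i l * w j l'"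
proof -
  have "measure Q {\<omega>\<in>space Q. Lv r i l (\<omega> (a, i), \<omega> (b, i)) \<and> Lv r j l' (\<omega> (a', j), \<omega> (b', j))}
     = measure Q {\<omega>\<in>space Q. Lv r i l (\<omega> (a, i), \<omega> (b, i))} * measure Q {\<omega>\<in>space Q. Lv r j l' (\<omega> (a', j), \<omega> (b', j))}"
  proof (rule indep_event_prob[where A="UNIV \<times> {i}" and B="UNIV \<times> {j}"])
    show "UNIV \<times> {i} \<inter> UNIV \<times> {j} = ({} :: (nat \<times> nat) set)" using ij by auto
  qed (simp_all add: Lv_meas[OF r])
  also have "\<dots> \<le> w i l * w j l'"
    by (intro mult_mono Lv_prob r ab w_nonneg measure_nonneg)
  finally show ?thesis .
qed

text \<open>Values at distinct sites are independent whichever copies are read, so the weights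
  multiply with no loss in the exponent.\<close>

lemma Lv_three:
  assumes r: "local_R r" and ab: "a \<noteq> b" "a' \<noteq> b'" "a'' \<noteq> b''" and ij: "i \<noteq> j" "i \<noteq> k" "j \<noteq> k"
  shows "measure Q {\<omega>\<in>space Q. Lv r i l (\<omega> (a, i), \<omega> (b, i)) \<and> Lv r j l' (\<omega> (a', j), \<omega> (b', j))
      \<and> Lv r k l'' (\<omega> (a'', k), \<omega> (b'', k))} \<le> w i l * w j l' * w k l''"
proof -
  have "measure Q {\<omega>\<in>space Q. Lv r i l (\<omega> (a, i), \<omega> (b, i)) \<and> (Lv r j l' (\<omega> (a', j), \<omega> (b', j)) \<and> Lv r k l'' (\<omega> (a'', k), \<omega> (b'', k)))}
     = measure Q {\<omega>\<in>space Q. Lv r i l (\<omega> (a, i), \<omega> (b, i))}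
      * measure Q {\<omega>\<in>space Q. Lv r j l' (\<omega> (a', j), \<omega> (b', j)) \<and> Lv r k l'' (\<omega> (a'', k), \<omega> (b'', k))}"
  proof (rule indep_event_prob[where A="UNIV \<times> {i}" and B="UNIV \<times> {j, k}"])
    show "UNIV \<times> {i} \<inter> UNIV \<times> {j, k} = ({} :: (nat \<times> nat) set)" using ij by auto
    show "{\<omega> \<in> space Q. Lv r j l' (\<omega> (a', j), \<omega> (b', j)) \<and> Lv r k l'' (\<omega> (a'', k), \<omega> (b'', k))} \<in> sets Q"
      using sets.Int[OF Lv_meas[OF r] Lv_meas[OF r], of j l' a' b' k l'' a'' b'']
      by (simp add: Int_def conj_ac cong: conj_cong)
  qed (simp_all add: Lv_meas[OF r])
  also have "\<dots> \<le> w i l * (w j l' * w k l'')"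
    by (intro mult_mono Lv_prob Lv_two r ab ij w_nonneg measure_nonneg)
  finally show ?thesis by (simp add: mult.assoc)
qed

text \<open>Both reference pairs read copies 0 and 1 at j and k, so the maximum in \<open>Ev\<close>
  is over two equal radii, and \<open>Ep\<close> splits into events of single sites.\<close>

lemma local_Ep:
  assumes r: "local_R r" and a: "admis i s t s' t' B B' j" "admis i s t s' t' C C' k"
  shows "Ep i s t s' t' j k l l' l'' = {\<omega>\<in>space Q. Lv r i l (\<omega> (s i, i), \<omega> (t i, i)) \<and> Lv r j l' (\<omega> (0, j), \<omega> (1, j))
      \<and> Lv r k l'' (\<omega> (0, k), \<omega> (1, k))}"
proof -
  have "Ev s t s t i l \<omega> \<longleftrightarrow> Lv r i l (\<omega> (s i, i), \<omega> (t i, i))" "Ev s t s' t' j l' \<omega> \<longleftrightarrow> Lv r j l' (\<omega> (0, j), \<omega> (1, j))"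
    "Ev s t s' t' k l'' \<omega> \<longleftrightarrow> Lv r k l'' (\<omega> (0, k), \<omega> (1, k))" if "\<omega> \<in> space Q" for \<omega>
    using a by (simp_all add: local_Ev[OF r that] admis_def)
  then show ?thesis by (auto simp: Ep_def)
qed

lemma pair_local:
  assumes r: "local_R r" and st: "disj s t" "disj s' t'"
    and a: "admis i s t s' t' B B' j" "admis i s t s' t' C C' k" and jk: "j \<noteq> k" and lam: "0 < lam" "lam < 1"
  shows "(\<integral>\<^sup>+\<omega>. ennreal (Xd i s t s' t' B B' j \<omega> * Xd i s t s' t' C C' k \<omega>) \<partial>Q) \<le> ennreal (\<kappa> ^ 4) * g1 1 lam i j k"
proof -
  have pr: "measure Q (Ep i s t s' t' j k l l' l'') \<le> w i l * w j l' * w k l''" for l l' l''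
    unfolding local_Ep[OF r a] by (rule Lv_three) (use r a st jk in \<open>auto simp: disj_def admis_def\<close>)
  have "(\<integral>\<^sup>+\<omega>. ennreal (Xd i s t s' t' B B' j \<omega> * Xd i s t s' t' C C' k \<omega>) \<partial>Q)
    \<le> (\<Sum>l. \<Sum>l'. \<Sum>l''. ennreal (measure Q (Ep i s t s' t' j k l l' l'') powr lam) *
      (ennreal (\<kappa> ^ 4) * (mm2 lam i l j l' * mm2 lam i l k l'' * (mm1 lam j l' * mm1 lam k l''))))"
    by (rule pair_bound[OF st a lam])
  also have "\<dots> \<le> (\<Sum>l. \<Sum>l'. \<Sum>l''. ennreal (\<kappa> ^ 4) * (ennreal ((w i l powr 1 * w j l' powr 1 * w k l'' powr 1) powr lam)
      * mm2 lam i l j l' * mm2 lam i l k l'' * mm1 lam j l' * mm1 lam k l''))"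
  proof (intro suminf_le)
    fix l l' l''
    let ?m = "mm2 lam i l j l' * mm2 lam i l k l'' * (mm1 lam j l' * mm1 lam k l'')"
    have "ennreal (measure Q (Ep i s t s' t' j k l l' l'') powr lam) * (ennreal (\<kappa> ^ 4) * ?m)
      \<le> ennreal ((w i l * w j l' * w k l'') powr lam) * (ennreal (\<kappa> ^ 4) * ?m)"
      using lam by (intro mult_right_mono ennreal_leI powr_mono2 pr) auto
    also have "\<dots> = ennreal (\<kappa> ^ 4) * (ennreal ((w i l powr 1 * w j l' powr 1 * w k l'' powr 1) powr lam)
      * mm2 lam i l j l' * mm2 lam i l k l'' * mm1 lam j l' * mm1 lam k l'')"
      using w_nonneg by (simp add: mult_ac)
    finally show "ennreal (measure Q (Ep i s t s' t' j k l l' l'') powr lam) * (ennreal (\<kappa> ^ 4) * ?m) \<le> \<dots>" .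
  qed auto
  finally show ?thesis by (simp add: g1_def)
qed

lemma Lv_scale_unique: "Lv r j n p \<Longrightarrow> Lv r j n' p \<Longrightarrow> n = n'"
proof -
  have *: "\<not> n < n'" if "Lv r j n p" "Lv r j n' p" for n n'
  proof
    assume "n < n'"
    then have "ennreal (real n) \<le> ennreal (real n' - 1)" by (intro ennreal_leI) linarith
    then show False using that by (auto simp: Lv_def)
  qed
  assume "Lv r j n p" "Lv r j n' p"
  then show ?thesis using * by (meson linorder_neqE_nat)
qed

text \<open>On the diagonal only the sites i and j occur, so only two independent events are
  available. The two scales at j must agree, as windows of different scales are disjoint. This is
  the origin of S2.\<close>

lemma square_local:
  assumes r: "local_R r" and st: "disj s t" "disj s' t'"
    and a: "admis i s t s' t' B B' j" and lam: "0 < lam" "lam < 1"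
  shows "(\<integral>\<^sup>+\<omega>. ennreal (Xd i s t s' t' B B' j \<omega> * Xd i s t s' t' B B' j \<omega>) \<partial>Q) \<le> ennreal (\<kappa> ^ 4) * g2 1 lam i j"
proof -
  have z: "measure Q (Ep i s t s' t' j j l l' l'') = 0" if "l'' \<noteq> l'" for l l' l''
  proof -
    have "Ep i s t s' t' j j l l' l'' = {}"
      unfolding local_Ep[OF r a a] using that by (auto dest: Lv_scale_unique)
    then show ?thesis by simp
  qed
  have pr: "measure Q (Ep i s t s' t' j j l l' l') \<le> w i l * w j l'" for l l'
  proof -
    have "measure Q (Ep i s t s' t' j j l l' l') = measure Q {\<omega>\<in>space Q. Lv r i l (\<omega> (s i, i), \<omega> (t i, i)) \<and> Lv r j l' (\<omega> (0, j), \<omega> (1, j))}"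
      unfolding local_Ep[OF r a a] by (simp cong: conj_cong)
    also have "\<dots> \<le> w i l * w j l'"
      by (rule Lv_two) (use r a st in \<open>auto simp: disj_def admis_def\<close>)
    finally show ?thesis .
  qed
  let ?t = "\<lambda>l l' l''. ennreal (measure Q (Ep i s t s' t' j j l l' l'') powr lam) *
      (ennreal (\<kappa> ^ 4) * (mm2 lam i l j l' * mm2 lam i l j l'' * (mm1 lam j l' * mm1 lam j l'')))"
  have "(\<integral>\<^sup>+\<omega>. ennreal (Xd i s t s' t' B B' j \<omega> * Xd i s t s' t' B B' j \<omega>) \<partial>Q) \<le> (\<Sum>l. \<Sum>l'. \<Sum>l''. ?t l l' l'')"
    by (rule pair_bound[OF st a a lam])
  also have "\<dots> = (\<Sum>l. \<Sum>l'. ?t l l' l')"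
  proof (intro suminf_cong)
    fix l l'
    have "(\<Sum>l''. ?t l l' l'') = (\<Sum>l''\<in>{l'}. ?t l l' l'')"
      by (rule suminf_finite) (use z in auto)
    then show "(\<Sum>l''. ?t l l' l'') = ?t l l' l'" by simp
  qed
  also have "\<dots> \<le> (\<Sum>l. \<Sum>l'. ennreal (\<kappa> ^ 4) * (ennreal ((w i l powr 1 * w j l' powr 1) powr lam)
      * epowr (m2 (4 / (1 - lam)) i l j l') ((1 - lam) / 2) * epowr (m1 (4 / (1 - lam)) j l') ((1 - lam) / 2)))"
  proof (intro suminf_le)
    fix l l'
    have sq: "epowr x ((1 - lam) / 4) * epowr x ((1 - lam) / 4) = epowr x ((1 - lam) / 2)" for x
      using epowr_exp_add[of x "(1 - lam) / 4" "(1 - lam) / 4"] by simp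
    have "?t l l' l' \<le> ennreal ((w i l * w j l') powr lam) *
      (ennreal (\<kappa> ^ 4) * (mm2 lam i l j l' * mm2 lam i l j l' * (mm1 lam j l' * mm1 lam j l')))"
      using lam by (intro mult_right_mono ennreal_leI powr_mono2 pr) auto
    also have "\<dots> = ennreal (\<kappa> ^ 4) * (ennreal ((w i l powr 1 * w j l' powr 1) powr lam)
      * epowr (m2 (4 / (1 - lam)) i l j l') ((1 - lam) / 2) * epowr (m1 (4 / (1 - lam)) j l') ((1 - lam) / 2))"
      unfolding mm1_def mm2_def sq using w_nonneg by (simp add: mult_ac)
    finally show "?t l l' l' \<le> \<dots>" .
  qed auto
  finally show ?thesis by (simp add: g2_def)
qed

end

section \<open>Summing over scales\<close>

text \<open>Every factor is at most the maximum of the three moduli.\<close>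

lemma amgm_421: "\<bar>x\<bar> * (a\<^sup>2 * \<bar>b\<bar>) \<le> x ^ 4 + a ^ 4 + b ^ 4" for x a b :: real
proof -
  let ?m = "max \<bar>x\<bar> (max \<bar>a\<bar> \<bar>b\<bar>)"
  have "\<bar>x\<bar> * (\<bar>a\<bar>\<^sup>2 * \<bar>b\<bar>) \<le> ?m * (?m\<^sup>2 * ?m)"
    by (intro mult_mono power_mono) auto
  also have "\<dots> = ?m ^ 4" by (simp add: power2_eq_square power4_eq_xxxx)
  also have "\<dots> \<le> \<bar>x\<bar> ^ 4 + \<bar>a\<bar> ^ 4 + \<bar>b\<bar> ^ 4"
    by (auto simp: max_def)
  finally show ?thesis by (simp add: power_even_abs)
qed

lemma amgm_21: "a\<^sup>2 * \<bar>b\<bar> \<le> \<bar>a\<bar> ^ 3 + \<bar>b\<bar> ^ 3" for a b :: real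
proof -
  let ?m = "max \<bar>a\<bar> \<bar>b\<bar>"
  have "\<bar>a\<bar>\<^sup>2 * \<bar>b\<bar> \<le> ?m\<^sup>2 * ?m" by (intro mult_mono power_mono) auto
  also have "\<dots> = ?m ^ 3" by (simp add: power2_eq_square power3_eq_cube)
  also have "\<dots> \<le> \<bar>a\<bar> ^ 3 + \<bar>b\<bar> ^ 3" by (auto simp: max_def)
  finally show ?thesis by simp
qed

lemma amgm_42: "(a\<^sup>2 * \<bar>b\<bar>)\<^sup>2 \<le> \<bar>a\<bar> ^ 6 + \<bar>b\<bar> ^ 6" for a b :: real
proof -
  let ?m = "max \<bar>a\<bar> \<bar>b\<bar>"
  have "\<bar>a\<bar>\<^sup>2 * \<bar>b\<bar> \<le> ?m\<^sup>2 * ?m" by (intro mult_mono power_mono) auto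
  also have "\<dots> = ?m ^ 3" by (simp add: power2_eq_square power3_eq_cube)
  finally have "(a\<^sup>2 * \<bar>b\<bar>)\<^sup>2 \<le> (?m ^ 3)\<^sup>2" by (intro power_mono) auto
  also have "\<dots> = ?m ^ 6" by (simp add: power_mult[symmetric])
  also have "\<dots> \<le> \<bar>a\<bar> ^ 6 + \<bar>b\<bar> ^ 6" by (auto simp: max_def)
  finally show ?thesis .
qed

lemma pow_powr: "a \<ge> 0 \<Longrightarrow> k > 0 \<Longrightarrow> (a ^ k) powr x = a powr (real k * x)" for a x :: real
  by (cases "a = 0") (simp_all add: powr_realpow[symmetric] powr_powr)

context multiscale
begin

text \<open>From here to \<open>G2s\<close>: sums over enumerated sites and scales for one fixed
  exponent lam, without the power of the standard deviation, the outer root and the infimum of the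
  final quantities.\<close>

definition S1s :: "real \<Rightarrow> real \<Rightarrow> ennreal" where "S1s \<theta> lam = (\<Sum>i. \<Sum>j. \<Sum>k. g1 \<theta> lam i j k)"
definition S2s :: "real \<Rightarrow> real \<Rightarrow> ennreal" where "S2s \<theta> lam = (\<Sum>i. \<Sum>j. g2 \<theta> lam i j)"
definition h :: "real \<Rightarrow> real \<Rightarrow> nat \<Rightarrow> ennreal" where
  "h q lam i = (\<Sum>l. ennreal (w i l powr lam) * epowr (m1 (q / (1 - lam)) i l) (1 - lam))"
definition S3s :: "real \<Rightarrow> ennreal" where "S3s lam = (\<Sum>i. h 4 lam i)"
definition S4s :: "real \<Rightarrow> ennreal" where "S4s lam = (\<Sum>i. h 3 lam i)"
definition G1s :: "real \<Rightarrow> ennreal" where "G1s lam = (\<Sum>i. epowr (h 6 lam i) (1/2))"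
definition G2s :: "real \<Rightarrow> ennreal" where
  "G2s lam = (\<Sum>i. \<Sum>l. ennreal (w i l powr lam) * epowr (m1 (6 / (1 - lam)) i l) ((1 - lam) / 2))"

lemma group_square:
  assumes J: "finite J" and pos: "\<And>j \<omega>. 0 \<le> X j \<omega>" and m: "\<And>j. X j \<in> borel_measurable Q"
  shows "(\<integral>\<^sup>+\<omega>. ennreal ((\<Sum>j\<in>J. X j \<omega>)\<^sup>2) \<partial>Q) = (\<Sum>j\<in>J. \<Sum>k\<in>J. \<integral>\<^sup>+\<omega>. ennreal (X j \<omega> * X k \<omega>) \<partial>Q)"
proof -
  note [measurable] = m
  have "(\<integral>\<^sup>+\<omega>. ennreal ((\<Sum>j\<in>J. X j \<omega>)\<^sup>2) \<partial>Q) = (\<integral>\<^sup>+\<omega>. (\<Sum>j\<in>J. \<Sum>k\<in>J. ennreal (X j \<omega> * X k \<omega>)) \<partial>Q)"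
    using pos by (intro nn_integral_cong) (simp add: power2_eq_square sum_product sum_ennreal sum_nonneg)
  also have "\<dots> = (\<Sum>j\<in>J. \<Sum>k\<in>J. \<integral>\<^sup>+\<omega>. ennreal (X j \<omega> * X k \<omega>) \<partial>Q)"
    by (simp add: nn_integral_sum)
  finally show ?thesis .
qed

lemma Xd_nonneg: "0 \<le> Xd i s t s' t' B B' j \<omega>"
  by (simp add: Xd_def)

lemma group_general:
  assumes st: "disj s t" "disj s' t'" and J: "finite J" and a: "\<And>j. j \<in> J \<Longrightarrow> admis i s t s' t' (B j) (B' j) j"
    and lam: "0 < lam" "lam < 1"
  shows "(\<integral>\<^sup>+\<omega>. ennreal ((\<Sum>j\<in>J. Xd i s t s' t' (B j) (B' j) j \<omega>)\<^sup>2) \<partial>Q) \<le> ennreal (2 * \<kappa> ^ 4) * (\<Sum>j. \<Sum>k. g1 (1/3) lam i j k)"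
proof -
  have "(\<integral>\<^sup>+\<omega>. ennreal ((\<Sum>j\<in>J. Xd i s t s' t' (B j) (B' j) j \<omega>)\<^sup>2) \<partial>Q)
    = (\<Sum>j\<in>J. \<Sum>k\<in>J. \<integral>\<^sup>+\<omega>. ennreal (Xd i s t s' t' (B j) (B' j) j \<omega> * Xd i s t s' t' (B k) (B' k) k \<omega>) \<partial>Q)"
    by (rule group_square[OF J Xd_nonneg Xd_meas])
  also have "\<dots> \<le> (\<Sum>j\<in>J. \<Sum>k\<in>J. ennreal (2 * \<kappa> ^ 4) * g1 (1/3) lam i j k)"
    by (intro sum_mono pair_general st a lam)
  also have "\<dots> \<le> (\<Sum>j\<in>J. \<Sum>k. ennreal (2 * \<kappa> ^ 4) * g1 (1/3) lam i j k)"
    by (intro sum_mono sum_le_suminf_ennreal J)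
  also have "\<dots> \<le> (\<Sum>j. \<Sum>k. ennreal (2 * \<kappa> ^ 4) * g1 (1/3) lam i j k)"
    by (intro sum_le_suminf_ennreal J)
  finally show ?thesis by simp
qed

text \<open>Off-diagonal and diagonal pairs get separate exponents, because S1 and S2 are infima
  taken independently of each other.\<close>

lemma group_local:
  assumes r: "local_R r" and st: "disj s t" "disj s' t'" and J: "finite J"
    and a: "\<And>j. j \<in> J \<Longrightarrow> admis i s t s' t' (B j) (B' j) j"
    and lam: "0 < lam" "lam < 1" "0 < lam'" "lam' < 1"
  shows "(\<integral>\<^sup>+\<omega>. ennreal ((\<Sum>j\<in>J. Xd i s t s' t' (B j) (B' j) j \<omega>)\<^sup>2) \<partial>Q)
    \<le> ennreal (\<kappa> ^ 4) * ((\<Sum>j. \<Sum>k. g1 1 lam i j k) + (\<Sum>j. g2 1 lam' i j))"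
proof -
  let ?K = "ennreal (\<kappa> ^ 4)"
  have "(\<integral>\<^sup>+\<omega>. ennreal ((\<Sum>j\<in>J. Xd i s t s' t' (B j) (B' j) j \<omega>)\<^sup>2) \<partial>Q)
    = (\<Sum>j\<in>J. \<Sum>k\<in>J. \<integral>\<^sup>+\<omega>. ennreal (Xd i s t s' t' (B j) (B' j) j \<omega> * Xd i s t s' t' (B k) (B' k) k \<omega>) \<partial>Q)"
    by (rule group_square[OF J Xd_nonneg Xd_meas])
  also have "\<dots> \<le> (\<Sum>j\<in>J. \<Sum>k\<in>J. ?K * g1 1 lam i j k + (if k = j then ?K * g2 1 lam' i j else 0))"
  proof (intro sum_mono)
    fix j k assume jk: "j \<in> J" "k \<in> J"
    show "(\<integral>\<^sup>+\<omega>. ennreal (Xd i s t s' t' (B j) (B' j) j \<omega> * Xd i s t s' t' (B k) (B' k) k \<omega>) \<partial>Q)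
      \<le> ?K * g1 1 lam i j k + (if k = j then ?K * g2 1 lam' i j else 0)"
    proof (cases "k = j")
      case True
      then show ?thesis using square_local[OF r st a[OF jk(1)] lam(3,4)] by (simp add: add_increasing)
    next
      case False
      then show ?thesis using pair_local[OF r st a[OF jk(1)] a[OF jk(2)] _ lam(1,2)] by simp
    qed
  qed
  also have "\<dots> = (\<Sum>j\<in>J. \<Sum>k\<in>J. ?K * g1 1 lam i j k) + (\<Sum>j\<in>J. ?K * g2 1 lam' i j)"
    using J by (simp add: sum.distrib)
  also have "\<dots> \<le> (\<Sum>j. \<Sum>k. ?K * g1 1 lam i j k) + (\<Sum>j. ?K * g2 1 lam' i j)"
    by (intro add_mono sum_le_suminf_ennreal J order_trans[OF sum_mono sum_le_suminf_ennreal])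
  finally show ?thesis by (simp add: distrib_left)
qed

text \<open>The second difference exchanges copy 0 for copy 2 at i, whereas \<open>lead j\<close> in
  the first difference may read copy 1 at i. Hence one factor has the partner copy 2 at i, and the
  other the partner copy 1 everywhere.\<close>

lemma A1_eq: "A1 n i \<omega> = (\<Sum>j\<in>{..<n} - {i}. Xd i (\<lambda>_. 0) ((\<lambda>_. 1)(i := 2)) (\<lambda>_. 0) (\<lambda>_. 1) {} {..<j} j \<omega>)"
proof -
  have "spliced (\<lambda>_. 0) ((\<lambda>_. 1)(i := 2)) {} = (\<lambda>_. 0)" "spliced (\<lambda>_. 0) (\<lambda>_. 1) {..<j} = lead j" for j
    by (auto simp: spliced_def lead_def)
  then show ?thesis by (simp add: A1_def Xd_def)
qed

lemma A2_eq: "A2 n i \<omega> = (\<Sum>j\<in>{..<n} \<inter> {..<i}. Xd i (\<lambda>_. 0) ((\<lambda>_. 1)(i := 2)) (\<lambda>_. 0) ((\<lambda>_. 1)(i := 2)) {..<j} {i} j \<omega>)"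
proof -
  have "spliced (\<lambda>_. 0) ((\<lambda>_. 1)(i := 2)) {..<j} = lead j" if "j < i" for j
    using that by (auto simp: spliced_def lead_def)
  moreover have "spliced (\<lambda>_. 0) ((\<lambda>_. 1)(i := 2)) {i} = (\<lambda>_. 0)(i := 2)"
    by (auto simp: spliced_def)
  ultimately show ?thesis by (simp add: A2_def Xd_def)
qed

text \<open>For i < j the selection \<open>lead j\<close> already reads copy 1 at i. Copy 1 becomes
  the base value there, its partner is copy 3, and i is taken out of the spliced set.\<close>

lemma A3_eq: "A3 n i \<omega> = (\<Sum>j\<in>{..<n} \<inter> {i<..}. Xd i ((\<lambda>_. 0)(i := 1)) ((\<lambda>_. 1)(i := 3)) ((\<lambda>_. 0)(i := 2)) (\<lambda>_. 1) ({..<j} - {i}) {} j \<omega>)"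
proof -
  have "spliced ((\<lambda>_. 0)(i := 1)) ((\<lambda>_. 1)(i := 3)) ({..<j} - {i}) = lead j" if "i < j" for j
    using that by (auto simp: spliced_def lead_def)
  moreover have "spliced ((\<lambda>_. 0)(i := 2)) (\<lambda>_. 1) {} = (\<lambda>_. 0)(i := 2)"
    by (auto simp: spliced_def)
  ultimately show ?thesis by (simp add: A3_def Xd_def)
qed

text \<open>A1, A2 and A3 are three instances of a single bound that is uniform in the
  selections.\<close>

lemma group_Vn:
  assumes "\<And>s t s' t' J B B'. disj s t \<Longrightarrow> disj s' t' \<Longrightarrow> finite J \<Longrightarrow> (\<And>j. j \<in> J \<Longrightarrow> admis i s t s' t' (B j) (B' j) j) \<Longrightarrow>
      (\<integral>\<^sup>+\<omega>. ennreal ((\<Sum>j\<in>J. Xd i s t s' t' (B j) (B' j) j \<omega>)\<^sup>2) \<partial>Q) \<le> K"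
  shows "Vn n i \<le> 3 * K + 4 * q4 i"
proof -
  have "(\<integral>\<^sup>+\<omega>. ennreal ((A1 n i \<omega>)\<^sup>2) \<partial>Q) \<le> K" "(\<integral>\<^sup>+\<omega>. ennreal ((A2 n i \<omega>)\<^sup>2) \<partial>Q) \<le> K" "(\<integral>\<^sup>+\<omega>. ennreal ((A3 n i \<omega>)\<^sup>2) \<partial>Q) \<le> K"
    unfolding A1_eq A2_eq A3_eq by (rule assms; auto simp: disj_def admis_def)+
  then have "Vn n i \<le> K + K + K + 4 * q4 i"
    unfolding Vn_def by (intro add_mono) auto
  also have "K + K + K = 3 * K"
  proof -
    have "(3 :: ennreal) = 1 + 1 + 1" by simp
    then show ?thesis by (simp only: distrib_right mult_1)
  qed
  finally show ?thesis .
qed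

text \<open>A nonzero increment almost surely has a scale, on whose window it coincides with its
  truncation; Hoelder then splits off the weight window by window.\<close>

lemma scale_single:
  assumes st: "disj s t" and B: "finite B" "i \<notin> B" and c: "c = t i" and lam: "0 < lam" "lam < 1" and k: "k > 0"
  shows "(\<integral>\<^sup>+\<omega>. ennreal (\<bar>D1 (spliced s t B) i c \<omega>\<bar> ^ k) \<partial>Q) \<le> ennreal (\<kappa> ^ k) * h (real k) lam i"
proof -
  let ?D = "D1 (spliced s t B) i c"
  let ?E = "\<lambda>l. {\<omega>\<in>space Q. Ev s t s t i l \<omega>}"
  let ?t = "\<lambda>l \<omega>. ennreal (indicator (?E l) \<omega> * (\<bar>?D \<omega>\<bar> * of_bool (rad s t i \<omega> < ennreal (real l))) ^ k)"
  define q where "q = real k / (1 - lam)"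
  have q: "q > 0" using lam k by (simp add: q_def)
  have si: "(spliced s t B) i \<noteq> t i" "(spliced s t B) i = s i" using B st by (auto simp: spliced_def disj_def)
  have "AE \<omega> in Q. ennreal (\<bar>?D \<omega>\<bar> ^ k) \<le> (\<Sum>l. ?t l \<omega>)"
    using D1_hit[where s="spliced s t B" and i=i and b="t i", OF si(1)] Ev_AE[OF st st, of i] AE_space
  proof eventually_elim
    case (elim \<omega>)
    show ?case
    proof (cases "?D \<omega> = 0")
      case True
      then show ?thesis using k by (simp add: zero_power)
    next
      case False
      then have "hit i (\<omega> (s i, i), \<omega> (t i, i))" using elim(1) si c by simp
      then obtain l where l: "Ev s t s t i l \<omega>" using elim(2) by blast
      then have "ennreal (\<bar>?D \<omega>\<bar> ^ k) = ?t l \<omega>" using elim(3) by (simp add: Ev_def)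
      also have "\<dots> \<le> (\<Sum>l. ?t l \<omega>)" by (rule suminf_ge_term)
      finally show ?thesis .
    qed
  qed
  then have "(\<integral>\<^sup>+\<omega>. ennreal (\<bar>?D \<omega>\<bar> ^ k) \<partial>Q) \<le> (\<integral>\<^sup>+\<omega>. (\<Sum>l. ?t l \<omega>) \<partial>Q)"
    by (rule nn_integral_mono_AE)
  also have "\<dots> = (\<Sum>l. \<integral>\<^sup>+\<omega>. ?t l \<omega> \<partial>Q)" by (rule nn_integral_suminf) measurable
  also have "\<dots> \<le> (\<Sum>l. ennreal (\<kappa> ^ k) * (ennreal (w i l powr lam) * epowr (m1 q i l) (1 - lam)))"
  proof (intro suminf_le)
    fix l
    let ?a = "\<lambda>\<omega>. \<bar>?D \<omega>\<bar> * of_bool (rad s t i \<omega> < ennreal (real l))"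
    have pk: "((?a \<omega>) ^ k) powr (1 / (1 - lam)) = ?a \<omega> powr q" for \<omega>
      using pow_powr[of "?a \<omega>" k "1 / (1 - lam)"] k by (simp add: q_def)
    have "(\<integral>\<^sup>+\<omega>. ?t l \<omega> \<partial>Q) \<le> epowr (emeasure Q (?E l)) lam
        * epowr (\<integral>\<^sup>+\<omega>. ennreal (((?a \<omega>) ^ k) powr (1 / (1 - lam))) \<partial>Q) (1 - lam)"
      by (rule Holder_indicator) (use lam in auto)
    also have "\<dots> \<le> ennreal (w i l powr lam) * (ennreal (\<kappa> ^ k) * epowr (m1 q i l) (1 - lam))"
    proof (intro mult_mono)
      have "measure Q (?E l) \<le> w i l"
        using one_scale_prob[OF st, of "s i" i "t i" l] by (simp add: Ev_def)
      then show "epowr (emeasure Q (?E l)) lam \<le> ennreal (w i l powr lam)"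
        using lam by (simp add: Q.emeasure_eq_measure epowr_ennreal ennreal_leI powr_mono2)
      have "epowr (\<integral>\<^sup>+\<omega>. ennreal (?a \<omega> powr q) \<partial>Q) (1 - lam) \<le> epowr (ennreal (\<kappa> powr q) * m1 q i l) (1 - lam)"
        using lam by (intro epowr_mono D1_moment[OF st B q c]) auto
      also have "\<dots> = ennreal (\<kappa> ^ k) * epowr (m1 q i l) (1 - lam)"
        using lam \<kappa> by (simp add: epowr_mult epowr_ennreal powr_powr q_def powr_realpow)
      finally show "epowr (\<integral>\<^sup>+\<omega>. ennreal (((?a \<omega>) ^ k) powr (1 / (1 - lam))) \<partial>Q) (1 - lam) \<le> ennreal (\<kappa> ^ k) * epowr (m1 q i l) (1 - lam)"
        unfolding pk .
    qed auto
    also have "\<dots> = ennreal (\<kappa> ^ k) * (ennreal (w i l powr lam) * epowr (m1 q i l) (1 - lam))"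
      by (simp add: mult_ac)
    finally show "(\<integral>\<^sup>+\<omega>. ?t l \<omega> \<partial>Q) \<le> \<dots>" .
  qed auto
  finally show ?thesis by (simp add: h_def q_def)
qed

lemma u_spliced: "u j = D1 (spliced (\<lambda>_. 0) (\<lambda>_. 1) {}) j 1"
proof -
  have "spliced (\<lambda>_. 0) (\<lambda>_. 1) {} = (\<lambda>_. 0)" by (simp add: spliced_def)
  then show ?thesis by (simp add: u_def)
qed

lemma u_moment:
  assumes "0 < lam" "lam < 1" "k > 0"
  shows "(\<integral>\<^sup>+\<omega>. ennreal (\<bar>u j \<omega>\<bar> ^ k) \<partial>Q) \<le> ennreal (\<kappa> ^ k) * h (real k) lam j"
  unfolding u_spliced by (rule scale_single) (use assms in \<open>auto simp: disj_def\<close>)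

lemma q4_bound: "0 < lam \<Longrightarrow> lam < 1 \<Longrightarrow> q4 j \<le> ennreal (\<kappa> ^ 4) * h 4 lam j"
  using u_moment[of lam 4 j] by (simp add: q4_def power_even_abs)

lemma v_moment_eq: "(\<integral>\<^sup>+\<omega>. ennreal (\<bar>v j \<omega>\<bar> ^ k) \<partial>Q) = (\<integral>\<^sup>+\<omega>. ennreal (\<bar>u j \<omega>\<bar> ^ k) \<partial>Q)"
  by (rule nn_v_eq_u[of "\<lambda>x. ennreal (\<bar>x\<bar> ^ k)"]) measurable

lemma third_bound:
  assumes "0 < lam" "lam < 1"
  shows "(\<Sum>j<n. \<integral>\<^sup>+\<omega>. ennreal ((u j \<omega>)\<^sup>2 * \<bar>v j \<omega>\<bar>) \<partial>Q) \<le> 2 * (ennreal (\<kappa> ^ 3) * S4s lam)"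
proof -
  have "(\<Sum>j<n. \<integral>\<^sup>+\<omega>. ennreal ((u j \<omega>)\<^sup>2 * \<bar>v j \<omega>\<bar>) \<partial>Q) \<le> (\<Sum>j<n. 2 * (ennreal (\<kappa> ^ 3) * h 3 lam j))"
  proof (intro sum_mono)
    fix j
    have "(\<integral>\<^sup>+\<omega>. ennreal ((u j \<omega>)\<^sup>2 * \<bar>v j \<omega>\<bar>) \<partial>Q) \<le> (\<integral>\<^sup>+\<omega>. ennreal (\<bar>u j \<omega>\<bar> ^ 3) + ennreal (\<bar>v j \<omega>\<bar> ^ 3) \<partial>Q)"
      by (intro nn_integral_mono) (simp add: ennreal_plus[symmetric] amgm_21 ennreal_leI del: ennreal_plus)
    also have "\<dots> = (\<integral>\<^sup>+\<omega>. ennreal (\<bar>u j \<omega>\<bar> ^ 3) \<partial>Q) + (\<integral>\<^sup>+\<omega>. ennreal (\<bar>v j \<omega>\<bar> ^ 3) \<partial>Q)"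
      by (rule nn_integral_add) measurable
    also have "\<dots> = 2 * (\<integral>\<^sup>+\<omega>. ennreal (\<bar>u j \<omega>\<bar> ^ 3) \<partial>Q)" by (simp add: v_moment_eq mult_2)
    also have "\<dots> \<le> 2 * (ennreal (\<kappa> ^ 3) * h 3 lam j)"
      using u_moment[OF assms, of 3 j] by (intro mult_left_mono) auto
    finally show "(\<integral>\<^sup>+\<omega>. ennreal ((u j \<omega>)\<^sup>2 * \<bar>v j \<omega>\<bar>) \<partial>Q) \<le> 2 * (ennreal (\<kappa> ^ 3) * h 3 lam j)" .
  qed
  also have "\<dots> \<le> (\<Sum>j. 2 * (ennreal (\<kappa> ^ 3) * h 3 lam j))" by (rule sum_le_suminf_ennreal) simp
  also have "\<dots> = 2 * (ennreal (\<kappa> ^ 3) * S4s lam)" by (simp add: S4s_def)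
  finally show ?thesis .
qed

lemma W_sq_nn: "(\<integral>\<^sup>+\<omega>. ennreal ((W s \<omega>)\<^sup>2) \<partial>Q) = 1"
  using sqint_W[of s] integral_W(2)[of s] by (simp add: nn_integral_eq_integral sqint_def)

lemma epowr_two_half: "epowr (2 * x) (1/2) \<le> 2 * epowr x (1/2)"
proof -
  have "epowr (2 * x) (1/2) = epowr 2 (1/2) * epowr x (1/2)" by (rule epowr_mult) simp
  also have "epowr 2 (1/2) \<le> epowr 4 (1/2)" by (intro epowr_mono) auto
  also have "epowr 4 (1/2) = 2"
    using epowr_half_sq[of 4] by simp
  finally show ?thesis by (simp add: mult_right_mono)
qed

text \<open>Cauchy-Schwarz removes |W0|, of second moment 1, before the scales are separated. This
  is why the root in G1 stands outside the sum over scales.\<close>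

lemma sixth_general:
  assumes "0 < lam" "lam < 1"
  shows "(\<Sum>j<n. \<integral>\<^sup>+\<omega>. ennreal (\<bar>W0 \<omega>\<bar> * ((u j \<omega>)\<^sup>2 * \<bar>v j \<omega>\<bar>)) \<partial>Q) \<le> 2 * (ennreal (\<kappa> ^ 3) * G1s lam)"
proof -
  have "(\<Sum>j<n. \<integral>\<^sup>+\<omega>. ennreal (\<bar>W0 \<omega>\<bar> * ((u j \<omega>)\<^sup>2 * \<bar>v j \<omega>\<bar>)) \<partial>Q) \<le> (\<Sum>j<n. 2 * (ennreal (\<kappa> ^ 3) * epowr (h 6 lam j) (1/2)))"
  proof (intro sum_mono)
    fix j
    have "(\<integral>\<^sup>+\<omega>. ennreal (((u j \<omega>)\<^sup>2 * \<bar>v j \<omega>\<bar>)\<^sup>2) \<partial>Q) \<le> (\<integral>\<^sup>+\<omega>. ennreal (\<bar>u j \<omega>\<bar> ^ 6) + ennreal (\<bar>v j \<omega>\<bar> ^ 6) \<partial>Q)"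
      by (intro nn_integral_mono) (simp only: ennreal_plus[symmetric] amgm_42 ennreal_leI zero_le_power abs_ge_zero)
    also have "\<dots> = (\<integral>\<^sup>+\<omega>. ennreal (\<bar>u j \<omega>\<bar> ^ 6) \<partial>Q) + (\<integral>\<^sup>+\<omega>. ennreal (\<bar>v j \<omega>\<bar> ^ 6) \<partial>Q)"
      by (rule nn_integral_add) measurable
    also have "\<dots> = 2 * (\<integral>\<^sup>+\<omega>. ennreal (\<bar>u j \<omega>\<bar> ^ 6) \<partial>Q)" by (simp only: v_moment_eq mult_2)
    also have "\<dots> \<le> 2 * (ennreal (\<kappa> ^ 6) * h 6 lam j)"
      using u_moment[OF assms, of 6 j] by (intro mult_left_mono) auto
    finally have s: "(\<integral>\<^sup>+\<omega>. ennreal (((u j \<omega>)\<^sup>2 * \<bar>v j \<omega>\<bar>)\<^sup>2) \<partial>Q) \<le> 2 * (ennreal (\<kappa> ^ 6) * h 6 lam j)" .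
    have "(\<integral>\<^sup>+\<omega>. ennreal (\<bar>W0 \<omega>\<bar> * ((u j \<omega>)\<^sup>2 * \<bar>v j \<omega>\<bar>)) \<partial>Q)
      \<le> epowr (\<integral>\<^sup>+\<omega>. ennreal (\<bar>W0 \<omega>\<bar>\<^sup>2) \<partial>Q) (1/2) * epowr (\<integral>\<^sup>+\<omega>. ennreal (((u j \<omega>)\<^sup>2 * \<bar>v j \<omega>\<bar>)\<^sup>2) \<partial>Q) (1/2)"
      by (rule Cauchy_Schwarz_epowr) auto
    also have "\<dots> = epowr (\<integral>\<^sup>+\<omega>. ennreal (((u j \<omega>)\<^sup>2 * \<bar>v j \<omega>\<bar>)\<^sup>2) \<partial>Q) (1/2)"
      using epowr_half_sq[of 1] by (simp only: power2_abs W_sq_nn) simp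
    also have "\<dots> \<le> epowr (2 * (ennreal (\<kappa> ^ 6) * h 6 lam j)) (1/2)" using s by (intro epowr_mono) auto
    also have "\<dots> \<le> 2 * epowr (ennreal (\<kappa> ^ 6) * h 6 lam j) (1/2)" by (rule epowr_two_half)
    also have "\<dots> = 2 * (ennreal (\<kappa> ^ 3) * epowr (h 6 lam j) (1/2))"
    proof -
      have "sqrt (\<kappa> ^ 6) = \<kappa> ^ 3" using \<kappa> real_sqrt_abs[of "\<kappa> ^ 3"] by (simp add: power_mult[symmetric])
      then show ?thesis using \<kappa> by (simp add: epowr_mult epowr_half_sq)
    qed
    finally show "(\<integral>\<^sup>+\<omega>. ennreal (\<bar>W0 \<omega>\<bar> * ((u j \<omega>)\<^sup>2 * \<bar>v j \<omega>\<bar>)) \<partial>Q) \<le> 2 * (ennreal (\<kappa> ^ 3) * epowr (h 6 lam j) (1/2))" .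
  qed
  also have "\<dots> \<le> (\<Sum>j. 2 * (ennreal (\<kappa> ^ 3) * epowr (h 6 lam j) (1/2)))" by (rule sum_le_suminf_ennreal) simp
  also have "\<dots> = 2 * (ennreal (\<kappa> ^ 3) * G1s lam)" by (simp add: G1s_def)
  finally show ?thesis .
qed

text \<open>With copy 2 at site j the functional does not see the copies 0 and 1 that decide the
  event, so the expectation factorizes, and the second moment of the functional is 1.\<close>

lemma indep_event_square:
  assumes r: "local_R r"
  shows "(\<integral>\<^sup>+\<omega>. ennreal (of_bool (Lv r j l (\<omega> (0, j), \<omega> (1, j))) * (W ((\<lambda>_. 0)(j := 2)) \<omega>)\<^sup>2) \<partial>Q)
     = ennreal (measure Q {\<omega>\<in>space Q. Lv r j l (\<omega> (0, j), \<omega> (1, j))})"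
proof -
  let ?p = "\<lambda>\<omega>. of_bool (Lv r j l (\<omega> (0, j), \<omega> (1, j))) :: real"
  let ?W = "W ((\<lambda>_. 0)(j := 2))"
  have pm[measurable]: "Measurable.pred Q (\<lambda>\<omega>. Lv r j l (\<omega> (0, j), \<omega> (1, j)))"
    using Lv_meas[OF r, of j l 0 1] by (simp add: pred_def)
  note [measurable] = pm[unfolded One_nat_def]
  have "Q.indep_var borel ?p borel (\<lambda>\<omega>. (?W \<omega>)\<^sup>2)"
  proof (rule indep_disjoint[where A="{(0, j), (1, j)}" and B="range (\<lambda>i. (((\<lambda>_. 0)(j := 2)) i, i))"])
    fix \<omega> \<omega>' :: "nat \<times> nat \<Rightarrow> 'a"
    assume "\<And>k. k \<in> range (\<lambda>i. (((\<lambda>_. 0)(j := 2)) i, i)) \<Longrightarrow> \<omega> k = \<omega>' k"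
    then show "(?W \<omega>)\<^sup>2 = (?W \<omega>')\<^sup>2"
      using W_dep[of "range (\<lambda>i. (((\<lambda>_. 0)(j := 2)) i, i))" \<omega> \<omega>' "(\<lambda>_. 0)(j := 2)"] by simp
  next
    show "?p \<in> borel_measurable Q" by measurable
  qed auto
  moreover have ip: "integrable Q ?p"
    by (rule Q.integrable_const_bound[of _ 1]) auto
  moreover have iW: "integrable Q (\<lambda>\<omega>. (?W \<omega>)\<^sup>2)" using sqint_W by (simp add: sqint_def)
  ultimately have "(\<integral>\<omega>. ?p \<omega> * (?W \<omega>)\<^sup>2 \<partial>Q) = (\<integral>\<omega>. ?p \<omega> \<partial>Q) * 1" and i: "integrable Q (\<lambda>\<omega>. ?p \<omega> * (?W \<omega>)\<^sup>2)"
    using Q.indep_var_lebesgue_integral[of ?p "\<lambda>\<omega>. (?W \<omega>)\<^sup>2"] Q.indep_var_integrable[of ?p "\<lambda>\<omega>. (?W \<omega>)\<^sup>2"]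
    by (simp_all add: integral_W(2))
  moreover have "(\<integral>\<omega>. ?p \<omega> \<partial>Q) = measure Q {\<omega>\<in>space Q. Lv r j l (\<omega> (0, j), \<omega> (1, j))}"
  proof -
    have "(\<integral>\<omega>. ?p \<omega> \<partial>Q) = (\<integral>\<omega>. indicator {\<omega>\<in>space Q. Lv r j l (\<omega> (0, j), \<omega> (1, j))} \<omega> \<partial>Q)"
      by (intro Bochner_Integration.integral_cong) auto
    also have "\<dots> = measure Q {\<omega>\<in>space Q. Lv r j l (\<omega> (0, j), \<omega> (1, j))}"
      by (simp add: Int_absorb1 subset_eq)
    finally show ?thesis .
  qed
  ultimately show ?thesis by (simp add: nn_integral_eq_integral)
qed

text \<open>Copies 1 and 2 are interchangeable at site j.\<close>

lemma fresh_q4: "(\<integral>\<^sup>+\<omega>. ennreal ((D1 (\<lambda>_. 0) j 2 \<omega>) ^ 4) \<partial>Q) = q4 j"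
proof -
  define tw where "tw c = (if c = 1 then 2 else if c = 2 then 1 else c)" for c :: nat
  have "tw (tw c) = c" for c by (simp add: tw_def)
  then have "inj tw" by (metis injI)
  have "u j (resamp tw {j} \<omega>) = D1 (\<lambda>_. 0) j 2 \<omega>" for \<omega>
  proof -
    have "W0 (resamp tw {j} \<omega>) = W0 \<omega>"
      unfolding W_resamp by (rule arg_cong[where f="\<lambda>s. W s \<omega>"]) (auto simp: tw_def)
    moreover have "W ((\<lambda>_. 0)(j := 1)) (resamp tw {j} \<omega>) = W ((\<lambda>_. 0)(j := 2)) \<omega>"
      unfolding W_resamp by (rule arg_cong[where f="\<lambda>s. W s \<omega>"]) (auto simp: tw_def)
    ultimately show ?thesis by (simp only: u_eq D1_def)
  qed
  then show ?thesis
    using nn_integral_resamp[OF \<open>inj tw\<close>, of "\<lambda>\<omega>. ennreal ((u j \<omega>) ^ 4)" "{j}"] by (simp add: q4_def)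
qed


text \<open>Cauchy-Schwarz in each window separately. Independence of the fresh functional yields
  the probability of the window to the power 1/2; the sixth moment yields the weight to the power
  lam/2 and the moment to the power (1 - lam)/2. Together they give the power lam of the weight,
  with the root inside the sum over scales: the term of G2.\<close>

lemma fresh_sixth:
  assumes r: "local_R r" and lam: "0 < lam" "lam < 1"
  shows "(\<integral>\<^sup>+\<omega>. ennreal (\<bar>W ((\<lambda>_. 0)(j := 2)) \<omega>\<bar> * ((u j \<omega>)\<^sup>2 * \<bar>v j \<omega>\<bar>)) \<partial>Q)
    \<le> 2 * (ennreal (\<kappa> ^ 3) * (\<Sum>l. ennreal (w j l powr lam) * epowr (m1 (6 / (1 - lam)) j l) ((1 - lam) / 2)))"
proof -
  let ?W = "W ((\<lambda>_. 0)(j := 2))"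
  let ?p = "\<lambda>l \<omega>. of_bool (Lv r j l (\<omega> (0, j), \<omega> (1, j))) :: real"
  let ?t = "\<lambda>l \<omega>. ennreal ((?p l \<omega> * \<bar>?W \<omega>\<bar>) * (?p l \<omega> * ((u j \<omega>)\<^sup>2 * \<bar>v j \<omega>\<bar>)))"
  let ?q = "6 / (1 - lam)"
  have pm[measurable]: "Measurable.pred Q (\<lambda>\<omega>. Lv r j l (\<omega> (0, j), \<omega> (1, j)))" for l
    using Lv_meas[OF r, of j l 0 1] by (simp add: pred_def)
  note [measurable] = pm[unfolded One_nat_def]
  have q: "?q > 0" using lam by simp
  have d01: "disj (\<lambda>_. 0) (\<lambda>_. 1)" by (simp add: disj_def)
  have "AE \<omega> in Q. ennreal (\<bar>?W \<omega>\<bar> * ((u j \<omega>)\<^sup>2 * \<bar>v j \<omega>\<bar>)) \<le> (\<Sum>l. ?t l \<omega>)"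
    using D1_hit[where s="\<lambda>_. 0" and i=j and b=1, simplified] Ev_AE[OF d01 d01, of j] AE_space
  proof eventually_elim
    case (elim \<omega>)
    show ?case
    proof (cases "u j \<omega> = 0")
      case False
      then have "hit j (\<omega> (0, j), \<omega> (1, j))" using elim(1) by (simp add: u_def)
      then obtain l where "Ev (\<lambda>_. 0) (\<lambda>_. 1) (\<lambda>_. 0) (\<lambda>_. 1) j l \<omega>" using elim(2) by blast
      then have "Lv r j l (\<omega> (0, j), \<omega> (1, j))" by (simp add: local_Ev[OF r elim(3)])
      then have "ennreal (\<bar>?W \<omega>\<bar> * ((u j \<omega>)\<^sup>2 * \<bar>v j \<omega>\<bar>)) = ?t l \<omega>" by simp
      also have "\<dots> \<le> (\<Sum>l. ?t l \<omega>)" by (rule suminf_ge_term)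
      finally show ?thesis .
    qed simp
  qed
  then have "(\<integral>\<^sup>+\<omega>. ennreal (\<bar>?W \<omega>\<bar> * ((u j \<omega>)\<^sup>2 * \<bar>v j \<omega>\<bar>)) \<partial>Q) \<le> (\<integral>\<^sup>+\<omega>. (\<Sum>l. ?t l \<omega>) \<partial>Q)"
    by (rule nn_integral_mono_AE)
  also have "\<dots> = (\<Sum>l. \<integral>\<^sup>+\<omega>. ?t l \<omega> \<partial>Q)" by (rule nn_integral_suminf) measurable
  also have "\<dots> \<le> (\<Sum>l. 2 * (ennreal (\<kappa> ^ 3) * (ennreal (w j l powr lam) * epowr (m1 ?q j l) ((1 - lam) / 2))))"
  proof (intro suminf_le)
    fix l
    let ?E = "{\<omega>\<in>space Q. Lv r j l (\<omega> (0, j), \<omega> (1, j))}"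
    let ?N = "ennreal (\<kappa> ^ 6) * (ennreal (w j l powr lam) * epowr (m1 ?q j l) (1 - lam))"
    have Ew: "measure Q ?E \<le> w j l" by (rule Lv_prob[OF r]) simp
    have six: "(\<integral>\<^sup>+\<omega>. ennreal (?p l \<omega> * \<bar>D1 (spliced (\<lambda>_. 0) (\<lambda>_. 1) B) j 1 \<omega>\<bar> ^ 6) \<partial>Q) \<le> ?N" if B: "finite B" "j \<notin> B" for B
    proof -
      let ?D = "D1 (spliced (\<lambda>_. 0) (\<lambda>_. 1) B) j 1"
      let ?a = "\<lambda>\<omega>. \<bar>?D \<omega>\<bar> * of_bool (rad (\<lambda>_. 0) (\<lambda>_. 1) j \<omega> < ennreal (real l))"
      have pk: "((?a \<omega>) ^ 6) powr (1 / (1 - lam)) = ?a \<omega> powr ?q" for \<omega>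
        using pow_powr[of "?a \<omega>" 6 "1 / (1 - lam)"] by simp
      have "(\<integral>\<^sup>+\<omega>. ennreal (?p l \<omega> * \<bar>?D \<omega>\<bar> ^ 6) \<partial>Q) = (\<integral>\<^sup>+\<omega>. ennreal (indicator ?E \<omega> * (?a \<omega>) ^ 6) \<partial>Q)"
        by (intro nn_integral_cong) (auto simp: local_rad[OF r] Lv_def indicator_def)
      also have "\<dots> \<le> epowr (emeasure Q ?E) lam
        * epowr (\<integral>\<^sup>+\<omega>. ennreal (((?a \<omega>) ^ 6) powr (1 / (1 - lam))) \<partial>Q) (1 - lam)"
        by (rule Holder_indicator) (use lam in auto)
      also have "\<dots> \<le> ennreal (w j l powr lam) * (ennreal (\<kappa> ^ 6) * epowr (m1 ?q j l) (1 - lam))"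
      proof (intro mult_mono)
        show "epowr (emeasure Q ?E) lam \<le> ennreal (w j l powr lam)"
          using lam Ew by (simp add: Q.emeasure_eq_measure epowr_ennreal ennreal_leI powr_mono2)
        have "epowr (\<integral>\<^sup>+\<omega>. ennreal (?a \<omega> powr ?q) \<partial>Q) (1 - lam) \<le> epowr (ennreal (\<kappa> powr ?q) * m1 ?q j l) (1 - lam)"
          using lam by (intro epowr_mono D1_moment[OF d01 B q]) auto
        also have "\<dots> = ennreal (\<kappa> ^ 6) * epowr (m1 ?q j l) (1 - lam)"
        proof -
          have "?q * (1 - lam) = 6" using lam by (simp add: divide_eq_eq)
          then have "(\<kappa> powr ?q) powr (1 - lam) = \<kappa> ^ 6"
            using \<kappa> powr_realpow[of \<kappa> 6] by (simp only: powr_powr) simp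
          then show ?thesis using lam \<kappa> by (simp add: epowr_mult epowr_ennreal)
        qed
        finally show "epowr (\<integral>\<^sup>+\<omega>. ennreal (((?a \<omega>) ^ 6) powr (1 / (1 - lam))) \<partial>Q) (1 - lam) \<le> ennreal (\<kappa> ^ 6) * epowr (m1 ?q j l) (1 - lam)"
          unfolding pk .
      qed auto
      also have "\<dots> = ?N" by (simp add: mult_ac)
      finally show ?thesis .
    qed
    have vs: "v j = D1 (spliced (\<lambda>_. 0) (\<lambda>_. 1) {..<j}) j 1"
    proof -
      have "spliced (\<lambda>_. 0) (\<lambda>_. 1) {..<j} = lead j" by (auto simp: spliced_def lead_def)
      then show ?thesis by (simp add: v_def)
    qed
    have "(\<integral>\<^sup>+\<omega>. ennreal ((?p l \<omega> * ((u j \<omega>)\<^sup>2 * \<bar>v j \<omega>\<bar>))\<^sup>2) \<partial>Q)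
      \<le> (\<integral>\<^sup>+\<omega>. ennreal (?p l \<omega> * \<bar>u j \<omega>\<bar> ^ 6) + ennreal (?p l \<omega> * \<bar>v j \<omega>\<bar> ^ 6) \<partial>Q)"
    proof (intro nn_integral_mono)
      fix \<omega>
      have "(?p l \<omega> * ((u j \<omega>)\<^sup>2 * \<bar>v j \<omega>\<bar>))\<^sup>2 \<le> ?p l \<omega> * \<bar>u j \<omega>\<bar> ^ 6 + ?p l \<omega> * \<bar>v j \<omega>\<bar> ^ 6"
        using amgm_42[of "u j \<omega>" "v j \<omega>"] by auto
      then show "ennreal ((?p l \<omega> * ((u j \<omega>)\<^sup>2 * \<bar>v j \<omega>\<bar>))\<^sup>2) \<le> ennreal (?p l \<omega> * \<bar>u j \<omega>\<bar> ^ 6) + ennreal (?p l \<omega> * \<bar>v j \<omega>\<bar> ^ 6)"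
      proof -
        assume le: "(?p l \<omega> * ((u j \<omega>)\<^sup>2 * \<bar>v j \<omega>\<bar>))\<^sup>2 \<le> ?p l \<omega> * \<bar>u j \<omega>\<bar> ^ 6 + ?p l \<omega> * \<bar>v j \<omega>\<bar> ^ 6"
        have "ennreal (?p l \<omega> * \<bar>u j \<omega>\<bar> ^ 6) + ennreal (?p l \<omega> * \<bar>v j \<omega>\<bar> ^ 6) = ennreal (?p l \<omega> * \<bar>u j \<omega>\<bar> ^ 6 + ?p l \<omega> * \<bar>v j \<omega>\<bar> ^ 6)"
          by (rule ennreal_plus[symmetric]) simp_all
        then show ?thesis using ennreal_leI[OF le] by (simp only:)
      qed
    qed
    also have "\<dots> = (\<integral>\<^sup>+\<omega>. ennreal (?p l \<omega> * \<bar>u j \<omega>\<bar> ^ 6) \<partial>Q) + (\<integral>\<^sup>+\<omega>. ennreal (?p l \<omega> * \<bar>v j \<omega>\<bar> ^ 6) \<partial>Q)"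
      by (rule nn_integral_add) measurable
    also have "\<dots> \<le> ?N + ?N"
      unfolding u_spliced vs by (intro add_mono six) auto
    finally have s: "(\<integral>\<^sup>+\<omega>. ennreal ((?p l \<omega> * ((u j \<omega>)\<^sup>2 * \<bar>v j \<omega>\<bar>))\<^sup>2) \<partial>Q) \<le> 2 * ?N"
      by (simp only: mult_2)
    have "(\<integral>\<^sup>+\<omega>. ?t l \<omega> \<partial>Q) \<le> epowr (\<integral>\<^sup>+\<omega>. ennreal ((?p l \<omega> * \<bar>?W \<omega>\<bar>)\<^sup>2) \<partial>Q) (1/2)
        * epowr (\<integral>\<^sup>+\<omega>. ennreal ((?p l \<omega> * ((u j \<omega>)\<^sup>2 * \<bar>v j \<omega>\<bar>))\<^sup>2) \<partial>Q) (1/2)"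
      by (rule Cauchy_Schwarz_epowr) auto
    also have "(\<integral>\<^sup>+\<omega>. ennreal ((?p l \<omega> * \<bar>?W \<omega>\<bar>)\<^sup>2) \<partial>Q) = (\<integral>\<^sup>+\<omega>. ennreal (?p l \<omega> * (?W \<omega>)\<^sup>2) \<partial>Q)"
      by (intro nn_integral_cong) (simp add: power_mult_distrib)
    also have "\<dots> = ennreal (measure Q ?E)" by (rule indep_event_square[OF r])
    also have "epowr (ennreal (measure Q ?E)) (1/2) * epowr (\<integral>\<^sup>+\<omega>. ennreal ((?p l \<omega> * ((u j \<omega>)\<^sup>2 * \<bar>v j \<omega>\<bar>))\<^sup>2) \<partial>Q) (1/2)
      \<le> ennreal (w j l powr (lam / 2)) * (2 * epowr ?N (1/2))"
    proof (intro mult_mono)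
      \<comment> \<open>Probabilities are at most 1, so the exponent 1/2 may be lowered to lam/2 in
        order to match the other factor.\<close>
      have "measure Q ?E powr (1/2) \<le> measure Q ?E powr (lam / 2)"
        using lam by (intro powr_mono') auto
      also have "\<dots> \<le> w j l powr (lam / 2)" using lam Ew by (intro powr_mono2) auto
      finally show "epowr (ennreal (measure Q ?E)) (1/2) \<le> ennreal (w j l powr (lam / 2))"
        by (simp add: epowr_ennreal ennreal_leI)
      show "epowr (\<integral>\<^sup>+\<omega>. ennreal ((?p l \<omega> * ((u j \<omega>)\<^sup>2 * \<bar>v j \<omega>\<bar>))\<^sup>2) \<partial>Q) (1/2) \<le> 2 * epowr ?N (1/2)"
        using s by (intro order_trans[OF epowr_mono epowr_two_half]) auto
    qed auto
    also have "\<dots> = 2 * (ennreal (\<kappa> ^ 3) * (ennreal (w j l powr lam) * epowr (m1 ?q j l) ((1 - lam) / 2)))"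
    proof -
      have k6: "sqrt (\<kappa> ^ 6) = \<kappa> ^ 3" using \<kappa> real_sqrt_abs[of "\<kappa> ^ 3"] by (simp add: power_mult[symmetric])
      have "epowr ?N (1/2) = ennreal (\<kappa> ^ 3) * (ennreal (w j l powr (lam / 2)) * epowr (m1 ?q j l) ((1 - lam) / 2))"
        using \<kappa> k6 by (simp add: epowr_mult epowr_half_sq epowr_epowr)
          (simp add: epowr_def powr_half_sqrt[symmetric] powr_powr)
      moreover have "ennreal (w j l powr (lam / 2)) * ennreal (w j l powr (lam / 2)) = ennreal (w j l powr lam)"
        by (simp add: ennreal_mult[symmetric] powr_add[symmetric])
      moreover have "ennreal (w j l powr (lam / 2)) * (2 * (ennreal (\<kappa> ^ 3) * (ennreal (w j l powr (lam / 2)) * epowr (m1 ?q j l) ((1 - lam) / 2))))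
        = 2 * (ennreal (\<kappa> ^ 3) * ((ennreal (w j l powr (lam / 2)) * ennreal (w j l powr (lam / 2))) * epowr (m1 ?q j l) ((1 - lam) / 2)))"
        by (simp only: mult_ac)
      ultimately show ?thesis by (simp only:)
    qed
    finally show "(\<integral>\<^sup>+\<omega>. ?t l \<omega> \<partial>Q) \<le> \<dots>" .
  qed auto
  finally show ?thesis by simp
qed

text \<open>W0 itself depends on the values that decide the radius at j. Passing to a fresh copy at
  j costs an increment at j, whose product with u^2 |v| is of fourth order and goes into S3.\<close>

lemma sixth_local:
  assumes r: "local_R r" and lam: "0 < lam" "lam < 1" "0 < lam'" "lam' < 1"
  shows "(\<Sum>j<n. \<integral>\<^sup>+\<omega>. ennreal (\<bar>W0 \<omega>\<bar> * ((u j \<omega>)\<^sup>2 * \<bar>v j \<omega>\<bar>)) \<partial>Q)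
    \<le> 2 * (ennreal (\<kappa> ^ 3) * G2s lam) + 3 * (ennreal (\<kappa> ^ 4) * S3s lam')"
proof -
  let ?g = "\<lambda>j. (\<Sum>l. ennreal (w j l powr lam) * epowr (m1 (6 / (1 - lam)) j l) ((1 - lam) / 2))"
  have "(\<Sum>j<n. \<integral>\<^sup>+\<omega>. ennreal (\<bar>W0 \<omega>\<bar> * ((u j \<omega>)\<^sup>2 * \<bar>v j \<omega>\<bar>)) \<partial>Q)
    \<le> (\<Sum>j<n. 2 * (ennreal (\<kappa> ^ 3) * ?g j) + 3 * (ennreal (\<kappa> ^ 4) * h 4 lam' j))"
  proof (intro sum_mono)
    fix j
    let ?W = "W ((\<lambda>_. 0)(j := 2))" and ?d = "D1 (\<lambda>_. 0) j 2"
    have "(\<integral>\<^sup>+\<omega>. ennreal (\<bar>W0 \<omega>\<bar> * ((u j \<omega>)\<^sup>2 * \<bar>v j \<omega>\<bar>)) \<partial>Q)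
      \<le> (\<integral>\<^sup>+\<omega>. ennreal (\<bar>?W \<omega>\<bar> * ((u j \<omega>)\<^sup>2 * \<bar>v j \<omega>\<bar>)) + (ennreal (?d \<omega> ^ 4) + ennreal (u j \<omega> ^ 4) + ennreal (v j \<omega> ^ 4)) \<partial>Q)"
    proof (intro nn_integral_mono)
      fix \<omega>
      have "\<bar>W0 \<omega>\<bar> \<le> \<bar>?W \<omega>\<bar> + \<bar>?d \<omega>\<bar>" by (simp add: D1_def)
      then have "\<bar>W0 \<omega>\<bar> * ((u j \<omega>)\<^sup>2 * \<bar>v j \<omega>\<bar>) \<le> (\<bar>?W \<omega>\<bar> + \<bar>?d \<omega>\<bar>) * ((u j \<omega>)\<^sup>2 * \<bar>v j \<omega>\<bar>)"
        by (rule mult_right_mono) simp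
      also have "\<dots> \<le> \<bar>?W \<omega>\<bar> * ((u j \<omega>)\<^sup>2 * \<bar>v j \<omega>\<bar>) + (?d \<omega> ^ 4 + u j \<omega> ^ 4 + v j \<omega> ^ 4)"
        unfolding distrib_right by (intro add_left_mono amgm_421)
      finally have "ennreal (\<bar>W0 \<omega>\<bar> * ((u j \<omega>)\<^sup>2 * \<bar>v j \<omega>\<bar>)) \<le> ennreal (\<bar>?W \<omega>\<bar> * ((u j \<omega>)\<^sup>2 * \<bar>v j \<omega>\<bar>) + (?d \<omega> ^ 4 + u j \<omega> ^ 4 + v j \<omega> ^ 4))"
        by (rule ennreal_leI)
      then show "ennreal (\<bar>W0 \<omega>\<bar> * ((u j \<omega>)\<^sup>2 * \<bar>v j \<omega>\<bar>)) \<le> ennreal (\<bar>?W \<omega>\<bar> * ((u j \<omega>)\<^sup>2 * \<bar>v j \<omega>\<bar>)) + (ennreal (?d \<omega> ^ 4) + ennreal (u j \<omega> ^ 4) + ennreal (v j \<omega> ^ 4))"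
        by simp
    qed
    also have "\<dots> = (\<integral>\<^sup>+\<omega>. ennreal (\<bar>?W \<omega>\<bar> * ((u j \<omega>)\<^sup>2 * \<bar>v j \<omega>\<bar>)) \<partial>Q) + ((\<integral>\<^sup>+\<omega>. ennreal (?d \<omega> ^ 4) \<partial>Q)
        + (\<integral>\<^sup>+\<omega>. ennreal (u j \<omega> ^ 4) \<partial>Q) + (\<integral>\<^sup>+\<omega>. ennreal (v j \<omega> ^ 4) \<partial>Q))"
      by (simp add: nn_integral_add)
    also have "(\<integral>\<^sup>+\<omega>. ennreal (v j \<omega> ^ 4) \<partial>Q) = q4 j"
      unfolding q4_def by (rule nn_v_eq_u[of "\<lambda>x. ennreal (x ^ 4)"]) measurable
    also have "(\<integral>\<^sup>+\<omega>. ennreal (u j \<omega> ^ 4) \<partial>Q) = q4 j" by (simp add: q4_def)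
    also have "(\<integral>\<^sup>+\<omega>. ennreal (?d \<omega> ^ 4) \<partial>Q) = q4 j" by (rule fresh_q4)
    also have "q4 j + q4 j + q4 j = 3 * q4 j"
    proof -
      have "(3 :: ennreal) = 1 + 1 + 1" by simp
      then show ?thesis by (simp only: distrib_right mult_1)
    qed
    also have "(\<integral>\<^sup>+\<omega>. ennreal (\<bar>?W \<omega>\<bar> * ((u j \<omega>)\<^sup>2 * \<bar>v j \<omega>\<bar>)) \<partial>Q) + 3 * q4 j
      \<le> 2 * (ennreal (\<kappa> ^ 3) * ?g j) + 3 * (ennreal (\<kappa> ^ 4) * h 4 lam' j)"
      by (intro add_mono fresh_sixth[OF r lam(1,2)] mult_left_mono q4_bound lam) auto
    finally show "(\<integral>\<^sup>+\<omega>. ennreal (\<bar>W0 \<omega>\<bar> * ((u j \<omega>)\<^sup>2 * \<bar>v j \<omega>\<bar>)) \<partial>Q) \<le> \<dots>" .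
  qed
  also have "\<dots> \<le> (\<Sum>j. 2 * (ennreal (\<kappa> ^ 3) * ?g j) + 3 * (ennreal (\<kappa> ^ 4) * h 4 lam' j))" by (rule sum_le_suminf_ennreal) simp
  also have "\<dots> = 2 * (ennreal (\<kappa> ^ 3) * G2s lam) + 3 * (ennreal (\<kappa> ^ 4) * S3s lam')"
    by (simp add: G2s_def S3s_def suminf_add[symmetric])
  finally show ?thesis .
qed

text \<open>The coefficient 9 dominates 3 times 2 and 4, and it is a square, in view of the root
  taken later.\<close>

lemma Vn_general:
  assumes lam: "0 < lam1" "lam1 < 1" "0 < lam3" "lam3 < 1"
  shows "(\<Sum>i. Vn n i) \<le> ennreal (9 * \<kappa> ^ 4) * (S1s (1/3) lam1 + S3s lam3)"
proof -
  have "(\<Sum>i. Vn n i) \<le> (\<Sum>i. ennreal (9 * \<kappa> ^ 4) * ((\<Sum>j. \<Sum>k. g1 (1/3) lam1 i j k) + h 4 lam3 i))"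
  proof (intro suminf_le)
    fix i
    have "Vn n i \<le> 3 * (ennreal (2 * \<kappa> ^ 4) * (\<Sum>j. \<Sum>k. g1 (1/3) lam1 i j k)) + 4 * q4 i"
      by (rule group_Vn) (rule group_general[OF _ _ _ _ lam(1,2)])
    also have "\<dots> \<le> ennreal (9 * \<kappa> ^ 4) * (\<Sum>j. \<Sum>k. g1 (1/3) lam1 i j k) + ennreal (9 * \<kappa> ^ 4) * h 4 lam3 i"
    proof (intro add_mono)
      have "3 * ennreal (2 * \<kappa> ^ 4) \<le> ennreal (9 * \<kappa> ^ 4)"
        using ennreal_mult'[of 3 "2 * \<kappa> ^ 4"] ennreal_leI[of "6 * \<kappa> ^ 4" "9 * \<kappa> ^ 4"] \<kappa> by simp
      from mult_right_mono[OF this] show "3 * (ennreal (2 * \<kappa> ^ 4) * (\<Sum>j. \<Sum>k. g1 (1/3) lam1 i j k)) \<le> ennreal (9 * \<kappa> ^ 4) * (\<Sum>j. \<Sum>k. g1 (1/3) lam1 i j k)"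
        by (simp add: mult.assoc)
      have "4 * ennreal (\<kappa> ^ 4) \<le> ennreal (9 * \<kappa> ^ 4)"
        using ennreal_mult'[of 4 "\<kappa> ^ 4"] ennreal_leI[of "4 * \<kappa> ^ 4" "9 * \<kappa> ^ 4"] \<kappa> by simp
      from mult_right_mono[OF this, of "h 4 lam3 i"] mult_left_mono[OF q4_bound[OF lam(3,4), of i], of 4]
      show "4 * q4 i \<le> ennreal (9 * \<kappa> ^ 4) * h 4 lam3 i" by (simp add: mult.assoc)
    qed
    finally show "Vn n i \<le> ennreal (9 * \<kappa> ^ 4) * ((\<Sum>j. \<Sum>k. g1 (1/3) lam1 i j k) + h 4 lam3 i)"
      by (simp add: distrib_left)
  qed auto
  also have "\<dots> = ennreal (9 * \<kappa> ^ 4) * (S1s (1/3) lam1 + S3s lam3)"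
    by (simp add: S1s_def S3s_def suminf_add[symmetric])
  finally show ?thesis .
qed

lemma Vn_local:
  assumes r: "local_R r" and lam: "0 < lam1" "lam1 < 1" "0 < lam2" "lam2 < 1" "0 < lam3" "lam3 < 1"
  shows "(\<Sum>i. Vn n i) \<le> ennreal (9 * \<kappa> ^ 4) * (S1s 1 lam1 + S2s 1 lam2 + S3s lam3)"
proof -
  let ?G = "\<lambda>i. (\<Sum>j. \<Sum>k. g1 1 lam1 i j k) + (\<Sum>j. g2 1 lam2 i j)"
  have "(\<Sum>i. Vn n i) \<le> (\<Sum>i. ennreal (9 * \<kappa> ^ 4) * (?G i + h 4 lam3 i))"
  proof (intro suminf_le)
    fix i
    have "Vn n i \<le> 3 * (ennreal (\<kappa> ^ 4) * ?G i) + 4 * q4 i"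
      by (rule group_Vn) (rule group_local[OF r _ _ _ _ lam(1,2) lam(3,4)])
    also have "\<dots> \<le> ennreal (9 * \<kappa> ^ 4) * ?G i + ennreal (9 * \<kappa> ^ 4) * h 4 lam3 i"
    proof (intro add_mono)
      have "3 * ennreal (\<kappa> ^ 4) \<le> ennreal (9 * \<kappa> ^ 4)"
        using ennreal_mult'[of 3 "\<kappa> ^ 4"] ennreal_leI[of "3 * \<kappa> ^ 4" "9 * \<kappa> ^ 4"] \<kappa> by simp
      from mult_right_mono[OF this] show "3 * (ennreal (\<kappa> ^ 4) * ?G i) \<le> ennreal (9 * \<kappa> ^ 4) * ?G i"
        by (simp add: mult.assoc)
      have "4 * ennreal (\<kappa> ^ 4) \<le> ennreal (9 * \<kappa> ^ 4)"
        using ennreal_mult'[of 4 "\<kappa> ^ 4"] ennreal_leI[of "4 * \<kappa> ^ 4" "9 * \<kappa> ^ 4"] \<kappa> by simp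
      from mult_right_mono[OF this, of "h 4 lam3 i"] mult_left_mono[OF q4_bound[OF lam(5,6), of i], of 4]
      show "4 * q4 i \<le> ennreal (9 * \<kappa> ^ 4) * h 4 lam3 i" by (simp add: mult.assoc)
    qed
    finally show "Vn n i \<le> ennreal (9 * \<kappa> ^ 4) * (?G i + h 4 lam3 i)"
      by (simp add: distrib_left)
  qed auto
  also have "\<dots> = ennreal (9 * \<kappa> ^ 4) * (S1s 1 lam1 + S2s 1 lam2 + S3s lam3)"
    by (simp add: S1s_def S2s_def S3s_def suminf_add[symmetric])
  finally show ?thesis .
qed

lemma epowr_root: "epowr (ennreal (9 * \<kappa> ^ 4) * Y) (1/2) = 3 * (ennreal (\<kappa>\<^sup>2) * epowr Y (1/2))"
proof -
  have "sqrt (9 * \<kappa> ^ 4) = 3 * \<kappa>\<^sup>2"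
    using real_sqrt_abs[of "3 * \<kappa>\<^sup>2"] by (simp add: power_mult_distrib power_mult[symmetric])
  moreover have "ennreal (3 * \<kappa>\<^sup>2) = 3 * ennreal (\<kappa>\<^sup>2)"
    using ennreal_mult'[of 3 "\<kappa>\<^sup>2"] by simp
  ultimately show ?thesis using epowr_half_sq[of "9 * \<kappa> ^ 4"] by (simp add: epowr_mult mult.assoc)
qed

lemma epowr_half_add: "epowr (a + b) (1/2) \<le> epowr a (1/2) + epowr b (1/2)"
  by (rule epowr_add_le) auto

text \<open>The root of \<open>\<kappa> ^ 4\<close> becomes the factor sigma^(-2) in front of S1, S2
  and S3.\<close>

definition rt :: "ennreal \<Rightarrow> ennreal" where "rt x = ennreal (\<kappa>\<^sup>2) * epowr x (1/2)"

text \<open>24 is 8 times 3, from the Stein solution and from the root of the 9 in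
  \<open>Vn_general\<close>. The remaining coefficient is smaller and rounded up.\<close>

lemma wasserstein_general:
  assumes lam: "0 < lam1" "lam1 < 1" "0 < lam3" "lam3 < 1" "0 < lam4" "lam4 < 1"
  shows "wasserstein_dist Z std_normal_distribution
    \<le> 24 * (rt (S1s (1/3) lam1) + rt (S3s lam3) + ennreal (\<kappa> ^ 3) * S4s lam4)"
proof -
  have "wasserstein_dist Z std_normal_distribution \<le> 8 * epowr (ennreal (9 * \<kappa> ^ 4) * (S1s (1/3) lam1 + S3s lam3)) (1/2)
      + 6 * (2 * (ennreal (\<kappa> ^ 3) * S4s lam4))"
    by (rule wasserstein_abstract[OF Vn_general[OF lam(1-4)] third_bound[OF lam(5,6)]])
  also have "\<dots> = 24 * (ennreal (\<kappa>\<^sup>2) * epowr (S1s (1/3) lam1 + S3s lam3) (1/2)) + 12 * (ennreal (\<kappa> ^ 3) * S4s lam4)"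
    unfolding epowr_root by (simp add: mult.assoc[symmetric])
  also have "\<dots> \<le> 24 * (ennreal (\<kappa>\<^sup>2) * (epowr (S1s (1/3) lam1) (1/2) + epowr (S3s lam3) (1/2))) + 24 * (ennreal (\<kappa> ^ 3) * S4s lam4)"
    by (intro add_mono mult_left_mono mult_right_mono epowr_half_add) auto
  finally show ?thesis by (simp add: rt_def distrib_left)
qed

lemma kolmogorov_general:
  assumes lam: "0 < lam1" "lam1 < 1" "0 < lam3" "lam3 < 1" "0 < lam4" "lam4 < 1" "0 < lam5" "lam5 < 1"
  shows "kolmogorov_dist Z std_normal_distribution
    \<le> 24 * (rt (S1s (1/3) lam1) + rt (S3s lam3) + ennreal (\<kappa> ^ 3) * S4s lam4 + ennreal (\<kappa> ^ 3) * G1s lam5)"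
proof -
  have "kolmogorov_dist Z std_normal_distribution \<le> 4 * epowr (ennreal (9 * \<kappa> ^ 4) * (S1s (1/3) lam1 + S3s lam3)) (1/2)
      + (2 * (ennreal (\<kappa> ^ 3) * S4s lam4)) + 2 * (2 * (ennreal (\<kappa> ^ 3) * G1s lam5))"
    by (rule kolmogorov_abstract[OF Vn_general[OF lam(1-4)] third_bound[OF lam(5,6)] sixth_general[OF lam(7,8)]])
  also have "\<dots> = 12 * (ennreal (\<kappa>\<^sup>2) * epowr (S1s (1/3) lam1 + S3s lam3) (1/2)) + 2 * (ennreal (\<kappa> ^ 3) * S4s lam4)
      + 4 * (ennreal (\<kappa> ^ 3) * G1s lam5)"
    unfolding epowr_root by (simp add: mult.assoc[symmetric])
  also have "\<dots> \<le> 24 * (ennreal (\<kappa>\<^sup>2) * (epowr (S1s (1/3) lam1) (1/2) + epowr (S3s lam3) (1/2))) + 24 * (ennreal (\<kappa> ^ 3) * S4s lam4)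
      + 24 * (ennreal (\<kappa> ^ 3) * G1s lam5)"
    by (intro add_mono mult_mono mult_left_mono epowr_half_add) auto
  finally show ?thesis by (simp add: rt_def distrib_left)
qed

lemma epowr_half_add3: "epowr (a + b + c) (1/2) \<le> epowr a (1/2) + epowr b (1/2) + epowr c (1/2)"
  by (rule order_trans[OF epowr_half_add add_right_mono[OF epowr_half_add]])

lemma wasserstein_local:
  assumes r: "local_R r"
    and lam: "0 < lam1" "lam1 < 1" "0 < lam2" "lam2 < 1" "0 < lam3" "lam3 < 1" "0 < lam4" "lam4 < 1"
  shows "wasserstein_dist Z std_normal_distribution
    \<le> 24 * (rt (S1s 1 lam1) + rt (S2s 1 lam2) + rt (S3s lam3) + ennreal (\<kappa> ^ 3) * S4s lam4)"
proof -
  have "wasserstein_dist Z std_normal_distribution \<le> 8 * epowr (ennreal (9 * \<kappa> ^ 4) * (S1s 1 lam1 + S2s 1 lam2 + S3s lam3)) (1/2)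
      + 6 * (2 * (ennreal (\<kappa> ^ 3) * S4s lam4))"
    by (rule wasserstein_abstract[OF Vn_local[OF r lam(1-6)] third_bound[OF lam(7,8)]])
  also have "\<dots> = 24 * (ennreal (\<kappa>\<^sup>2) * epowr (S1s 1 lam1 + S2s 1 lam2 + S3s lam3) (1/2)) + 12 * (ennreal (\<kappa> ^ 3) * S4s lam4)"
    unfolding epowr_root by (simp add: mult.assoc[symmetric])
  also have "\<dots> \<le> 24 * (ennreal (\<kappa>\<^sup>2) * (epowr (S1s 1 lam1) (1/2) + epowr (S2s 1 lam2) (1/2) + epowr (S3s lam3) (1/2))) + 24 * (ennreal (\<kappa> ^ 3) * S4s lam4)"
    by (intro add_mono mult_left_mono mult_right_mono epowr_half_add3) auto
  finally show ?thesis by (simp add: rt_def distrib_left)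
qed

text \<open>The fresh copies leave S3 without its root, that is the square of
  \<open>rt (S3s lam3)\<close>. If this quantity is below 1, its square is smaller still; otherwise
  the bound holds because the distance is at most 1.\<close>

lemma kolmogorov_local:
  assumes r: "local_R r"
    and lam: "0 < lam1" "lam1 < 1" "0 < lam2" "lam2 < 1" "0 < lam3" "lam3 < 1" "0 < lam4" "lam4 < 1" "0 < lam5" "lam5 < 1"
  shows "kolmogorov_dist Z std_normal_distribution
    \<le> 24 * (rt (S1s 1 lam1) + rt (S2s 1 lam2) + rt (S3s lam3) + ennreal (\<kappa> ^ 3) * S4s lam4 + ennreal (\<kappa> ^ 3) * G2s lam5)"
proof (cases "rt (S3s lam3) \<ge> 1")
  case True
  have "kolmogorov_dist Z std_normal_distribution \<le> 1" by (rule kolmogorov_le_1)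
  also have "1 \<le> 24 * rt (S3s lam3)" using mult_mono[of 1 24 1 "rt (S3s lam3)"] True by simp
  also have "\<dots> \<le> 24 * (rt (S1s 1 lam1) + rt (S2s 1 lam2) + rt (S3s lam3) + ennreal (\<kappa> ^ 3) * S4s lam4 + ennreal (\<kappa> ^ 3) * G2s lam5)"
    by (intro mult_left_mono) (auto intro: add_increasing add_increasing2)
  finally show ?thesis .
next
  case False
  have sq: "ennreal (\<kappa> ^ 4) * S3s lam3 = rt (S3s lam3) * rt (S3s lam3)"
  proof -
    have "epowr (S3s lam3) (1/2) * epowr (S3s lam3) (1/2) = S3s lam3"
      using epowr_exp_add[of "S3s lam3" "1/2" "1/2"] by simp
    moreover have "ennreal (\<kappa>\<^sup>2) * ennreal (\<kappa>\<^sup>2) = ennreal (\<kappa> ^ 4)"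
      by (simp add: ennreal_mult[symmetric] power_add[symmetric])
    moreover have "rt (S3s lam3) * rt (S3s lam3)
        = (ennreal (\<kappa>\<^sup>2) * ennreal (\<kappa>\<^sup>2)) * (epowr (S3s lam3) (1/2) * epowr (S3s lam3) (1/2))"
      unfolding rt_def by (simp only: mult_ac)
    ultimately show ?thesis by (simp only:)
  qed
  have S3: "ennreal (\<kappa> ^ 4) * S3s lam3 \<le> rt (S3s lam3)"
    unfolding sq using False mult_left_mono[of "rt (S3s lam3)" 1 "rt (S3s lam3)"] by simp
  have "kolmogorov_dist Z std_normal_distribution \<le> 4 * epowr (ennreal (9 * \<kappa> ^ 4) * (S1s 1 lam1 + S2s 1 lam2 + S3s lam3)) (1/2)
      + (2 * (ennreal (\<kappa> ^ 3) * S4s lam4)) + 2 * (2 * (ennreal (\<kappa> ^ 3) * G2s lam5) + 3 * (ennreal (\<kappa> ^ 4) * S3s lam3))"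
    by (rule kolmogorov_abstract[OF Vn_local[OF r lam(1-6)] third_bound[OF lam(7,8)] sixth_local[OF r lam(9,10) lam(5,6)]])
  also have "\<dots> = 12 * (ennreal (\<kappa>\<^sup>2) * epowr (S1s 1 lam1 + S2s 1 lam2 + S3s lam3) (1/2)) + 2 * (ennreal (\<kappa> ^ 3) * S4s lam4)
      + (4 * (ennreal (\<kappa> ^ 3) * G2s lam5) + 6 * (ennreal (\<kappa> ^ 4) * S3s lam3))"
    unfolding epowr_root by (simp add: mult.assoc[symmetric] distrib_left)
  \<comment> \<open>S3 is counted twice, with 12 from the root and another 12 that covers the fresh
    copies; together they exhaust the 24.\<close>
  also have "\<dots> \<le> 12 * (ennreal (\<kappa>\<^sup>2) * (epowr (S1s 1 lam1) (1/2) + epowr (S2s 1 lam2) (1/2) + epowr (S3s lam3) (1/2))) + 24 * (ennreal (\<kappa> ^ 3) * S4s lam4)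
      + (24 * (ennreal (\<kappa> ^ 3) * G2s lam5) + 12 * rt (S3s lam3))"
    by (intro add_mono mult_mono mult_left_mono epowr_half_add3 S3) auto
  also have "\<dots> = 12 * rt (S1s 1 lam1) + 12 * rt (S2s 1 lam2) + (12 * rt (S3s lam3) + 12 * rt (S3s lam3))
      + 24 * (ennreal (\<kappa> ^ 3) * S4s lam4) + 24 * (ennreal (\<kappa> ^ 3) * G2s lam5)"
    by (simp only: rt_def distrib_left add_ac)
  also have "\<dots> \<le> 24 * rt (S1s 1 lam1) + 24 * rt (S2s 1 lam2) + 24 * rt (S3s lam3)
      + 24 * (ennreal (\<kappa> ^ 3) * S4s lam4) + 24 * (ennreal (\<kappa> ^ 3) * G2s lam5)"
    by (intro add_mono mult_right_mono) (auto simp: distrib_right[symmetric])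
  finally show ?thesis by (simp add: distrib_left)
qed

end

section \<open>Factorization through generating maps\<close>

text \<open>The integral of a non-measurable function is the supremum over simple functions below
  it. These pull back along \<open>T\<close> but need not push forward, which is the reason for the
  inequality.\<close>

lemma nn_integral_distr_le:
  assumes "T \<in> N \<rightarrow>\<^sub>M N'"
  shows "(\<integral>\<^sup>+x. g x \<partial>distr N N' T) \<le> (\<integral>\<^sup>+x. g (T x) \<partial>N)"
  unfolding nn_integral_def[of "distr N N' T"]
proof (rule SUP_least)
  fix s assume "s \<in> {s. simple_function (distr N N' T) s \<and> s \<le> g}"
  then have s: "simple_function (distr N N' T) s" "s \<le> g" by auto
  have sm: "s \<in> borel_measurable (distr N N' T)" using s(1) by (rule borel_measurable_simple_function)
  have "integral\<^sup>S (distr N N' T) s = (\<integral>\<^sup>+x. s x \<partial>distr N N' T)"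
    using s(1) by (rule nn_integral_eq_simple_integral[symmetric])
  also have "\<dots> = (\<integral>\<^sup>+x. s (T x) \<partial>N)" by (rule nn_integral_distr[OF assms]) (use sm in simp)
  also have "\<dots> \<le> (\<integral>\<^sup>+x. g (T x) \<partial>N)" using s(2) by (intro nn_integral_mono) (auto simp: le_fun_def)
  finally show "integral\<^sup>S (distr N N' T) s \<le> (\<integral>\<^sup>+x. g (T x) \<partial>N)" .
qed

text \<open>Apply the preceding inequality to the composition of g with \<open>T\<close> and use
  that \<open>T\<close> is its own inverse. Here g will contain comparisons of fields at uncountably
  many points, so its measurability is not at hand.\<close>

lemma nn_integral_involution_le:
  assumes T: "T \<in> N \<rightarrow>\<^sub>M N" "distr N N T = N" "\<And>x. x \<in> space N \<Longrightarrow> T (T x) = x"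
  shows "(\<integral>\<^sup>+x. g (T x) \<partial>N) \<le> (\<integral>\<^sup>+x. g x \<partial>N)"
proof -
  have "(\<integral>\<^sup>+x. g (T x) \<partial>N) = (\<integral>\<^sup>+x. g (T x) \<partial>distr N N T)" by (simp only: T(2))
  also have "\<dots> \<le> (\<integral>\<^sup>+x. g (T (T x)) \<partial>N)" by (rule nn_integral_distr_le[OF T(1)])
  also have "\<dots> = (\<integral>\<^sup>+x. g x \<partial>N)" by (intro nn_integral_cong) (simp add: T(3))
  finally show ?thesis .
qed

text \<open>Passes an almost sure statement from a larger space to the image law. \<open>S\<close>
  is measurable for the completion only, so it is exchanged for its main part, which differs from it
  by a null set.\<close>

lemma AE_completion_mem:
  assumes S: "S \<in> sets (completion N)" and T: "T \<in> L \<rightarrow>\<^sub>M N" "distr L N T = N" and ae: "AE x in L. T x \<in> S"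
  shows "AE y in N. y \<in> S"
proof -
  have "AE y in N. y \<in> S \<longleftrightarrow> y \<in> main_part N S"
  proof -
    obtain N' where N': "N' \<in> null_sets N" "null_part N S \<subseteq> N'"
      using null_part[OF S] by blast
    have "AE y in N. y \<notin> N'" using N'(1) by (rule AE_not_in)
    then show ?thesis
      by eventually_elim (use N'(2) main_part_null_part_Un[OF S] in blast)
  qed
  then have e: "AE y in N. y \<in> main_part N S \<longleftrightarrow> y \<in> S" by eventually_elim auto
  have m: "main_part N S \<in> sets N" using S by (rule main_part_sets)
  have "AE x in L. T x \<in> main_part N S \<longleftrightarrow> T x \<in> S"
    using e by (intro AE_distrD[OF T(1)]) (simp only: T(2))
  with ae have "AE x in L. T x \<in> main_part N S" by eventually_elim auto
  then have "AE y in distr L N T. y \<in> main_part N S"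
    using m by (subst AE_distr_iff[OF T(1)]) (auto simp: T(1))
  then have "AE y in N. y \<in> main_part N S" by (simp only: T(2))
  with e show ?thesis by eventually_elim auto
qed

text \<open>Doob-Dynkin: g is recovered from its strict superlevel sets at rational heights, each of
  which is the preimage of some measurable set \<open>A q\<close>.\<close>

lemma vimage_algebra_factor:
  fixes g :: "'a \<Rightarrow> ennreal"
  assumes T: "T \<in> S \<rightarrow> space N" and g: "g \<in> borel_measurable (vimage_algebra S T N)"
  obtains h where "h \<in> borel_measurable N" "\<And>x. x \<in> S \<Longrightarrow> g x = h (T x)"
proof -
  have "\<exists>A. A \<in> sets N \<and> (\<forall>x\<in>S. ennreal (of_rat q) < g x \<longleftrightarrow> T x \<in> A)" for q :: rat
  proof -
    have "{x \<in> space (vimage_algebra S T N). ennreal (of_rat q) < g x} \<in> sets (vimage_algebra S T N)"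
      using g by measurable
    then obtain A where "A \<in> sets N" "{x \<in> S. ennreal (of_rat q) < g x} = T -` A \<inter> S"
      using sets_vimage_algebra2[OF T] by auto
    then show ?thesis by (intro exI[of _ A]) blast
  qed
  then obtain A where A: "\<And>q. A q \<in> sets N" "\<And>q x. x \<in> S \<Longrightarrow> ennreal (of_rat q) < g x \<longleftrightarrow> T x \<in> A q"
    by metis
  note [measurable] = A(1)
  define h where "h y = (SUP q. if y \<in> A q then ennreal (of_rat q) else 0)" for y
  show thesis
  proof (rule that)
    show "h \<in> borel_measurable N" unfolding h_def[abs_def] by measurable
    fix x assume x: "x \<in> S"
    have "h (T x) \<le> g x" unfolding h_def
      by (intro SUP_least) (use A(2)[OF x] in \<open>auto intro: less_imp_le\<close>)
    moreover have "g x \<le> h (T x)"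
    proof (rule ccontr)
      assume "\<not> g x \<le> h (T x)"
      then have "h (T x) < g x" by simp
      then obtain y where y: "h (T x) < y" "y < g x" using dense by blast
      then obtain a where a: "h (T x) = ennreal a" "a \<ge> 0" by (cases "h (T x)") auto
      obtain b where b: "y = ennreal b" "b \<ge> 0" using y(2) by (cases y) auto
      have "a < b" using y(1) a b by (simp add: ennreal_less_iff)
      then obtain q where q: "a < of_rat q" "of_rat q < b" using of_rat_dense by blast
      have "ennreal (of_rat q) < g x"
        using y(2) b q a by (meson ennreal_leI less_imp_le order_le_less_trans)
      then have "T x \<in> A q" using A(2)[OF x] by simp
      then have "ennreal (of_rat q) \<le> h (T x)" unfolding h_def by (intro SUP_upper2[of q]) auto
      then show False using a q by (simp add: ennreal_le_iff)
    qed
    ultimately show "g x = h (T x)" by (rule antisym[rotated])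
  qed
qed

text \<open>Half of the side 2n + 1 is the half side 1/2 of the unit cube plus n. Hence an action
  radius below n makes the agreement indicators of the discrete derivatives at scale n equal to
  1.\<close>

lemma fat_cube_subset:
  assumes "r < real n" shows "fat_cube x r \<subseteq> cube (2 * real n + 1) x"
proof
  fix y assume "y \<in> fat_cube x r"
  then obtain q b where y: "y = q + b" "q \<in> cube 1 x" "norm b \<le> r" by (auto simp: fat_cube_def)
  have bi: "\<bar>b $ i\<bar> < real n" for i
    using component_le_norm_cart[of b i] y(3) assms by linarith
  show "y \<in> cube (2 * real n + 1) x"
    unfolding y(1) cube_def mem_Collect_eq
  proof
    fix i
    have "rvec x $ i - 1 / 2 \<le> q $ i" "q $ i < rvec x $ i + 1 / 2"
      using y(2) by (auto simp: cube_def)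
    then show "rvec x $ i - (2 * real n + 1) / 2 \<le> (q + b) $ i \<and> (q + b) $ i < rvec x $ i + (2 * real n + 1) / 2"
      using bi[of i] unfolding vector_add_component add_divide_distrib by linarith
  qed
qed

lemma fat_cube_translate: "y + rvec z \<in> fat_cube (x + z) r \<longleftrightarrow> y \<in> fat_cube x r"
proof -
  have rv: "rvec (x + z) = rvec x + (rvec z :: real ^ 'd)" for x z :: "int ^ 'd"
    by (simp add: rvec_def vec_eq_iff)
  have c: "q + rvec z \<in> cube 1 (x + z) \<longleftrightarrow> q \<in> cube 1 x" for q :: "real ^ 'd" and x z
    by (simp add: cube_def rv)
  show ?thesis
  proof
    assume "y + rvec z \<in> fat_cube (x + z) r"
    then obtain q b where "y + rvec z = q + b" "q \<in> cube 1 (x + z)" "b \<in> cball 0 r" by (auto simp: fat_cube_def)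
    then have "y = (q - rvec z) + b" "q - rvec z \<in> cube 1 x" "b \<in> cball 0 r"
      using c[of "q - rvec z" z x] by (auto simp: algebra_simps)
    then show "y \<in> fat_cube x r" unfolding fat_cube_def by blast
  next
    assume "y \<in> fat_cube x r"
    then obtain q b where "y = q + b" "q \<in> cube 1 x" "b \<in> cball 0 r" by (auto simp: fat_cube_def)
    then have "y + rvec z = (q + rvec z) + b" "q + rvec z \<in> cube 1 (x + z)" "b \<in> cball 0 r"
      using c[of q z x] by (auto simp: algebra_simps)
    then show "y + rvec z \<in> fat_cube (x + z) r" unfolding fat_cube_def by blast
  qed
qed

lemma sum_le_infsum_ennreal: "finite F \<Longrightarrow> F \<subseteq> A \<Longrightarrow> sum f F \<le> infsum f A" for f :: "'b \<Rightarrow> ennreal"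
  by (subst nonneg_infsum_complete) (auto intro: SUP_upper)

lemma nn_integral_count_space_le_infsum:
  fixes f :: "'b \<Rightarrow> ennreal"
  assumes "countable A"
  shows "(\<integral>\<^sup>+x. f x \<partial>count_space A) \<le> infsum f A"
proof (cases "finite A")
  case True
  then show ?thesis by (simp add: nn_integral_count_space_finite)
next
  case False
  let ?g = "from_nat_into A"
  have bij: "bij_betw ?g UNIV A" using assms False by (rule bij_betw_from_nat_into)
  have "(\<integral>\<^sup>+x. f x \<partial>count_space A) = (\<integral>\<^sup>+i. f (?g i) \<partial>count_space UNIV)"
    by (rule nn_integral_bij_count_space[OF bij, symmetric])
  also have "\<dots> = (\<Sum>i. f (?g i))" by (rule nn_integral_count_space_nat)
  also have "\<dots> = (SUP n. \<Sum>i<n. f (?g i))" by (rule suminf_eq_SUP) 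
  also have "\<dots> \<le> infsum f A"
  proof (rule SUP_least)
    fix n
    have "(\<Sum>i<n. f (?g i)) = sum f (?g ` {..<n})"
      using bij by (subst sum.reindex) (auto simp: bij_betw_def inj_on_def)
    also have "\<dots> \<le> infsum f A"
      using bij by (intro sum_le_infsum_ennreal) (auto simp: bij_betw_def)
    finally show "(\<Sum>i<n. f (?g i)) \<le> infsum f A" .
  qed
  finally show ?thesis .
qed

text \<open>The passage from sums over enumerations to the unordered sums of the final quantities;
  indices outside the range of g only enlarge the right-hand side.\<close>

lemma suminf_le_infsum:
  fixes f :: "'b \<Rightarrow> ennreal" and g :: "'c \<Rightarrow> 'b"
  assumes "inj g" "range g \<subseteq> A" "countable A"
  shows "(\<integral>\<^sup>+x. f (g x) \<partial>count_space UNIV) \<le> infsum f A"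
proof -
  have "(\<integral>\<^sup>+x. f (g x) \<partial>count_space UNIV) = (\<integral>\<^sup>+x. f x \<partial>count_space (range g))"
    by (rule nn_integral_bij_count_space) (use assms(1) in \<open>simp add: bij_betw_def\<close>)
  also have "\<dots> \<le> infsum f (range g)"
    by (rule nn_integral_count_space_le_infsum) (rule countable_subset[OF assms(2,3)])
  also have "\<dots> \<le> infsum f A"
    by (rule infsum_mono_neutral) (use assms(2) in \<open>auto intro: nonneg_summable_on_complete\<close>)
  finally show ?thesis .
qed

section \<open>Gluing configurations\<close>

locale field_functional =
  fixes D :: "('w, 'e, 'm, 'v, 'd::finite) field_model" and \<zeta> :: "(real ^ 'd \<Rightarrow> 'v) \<Rightarrow> real"
  assumes adm: "admissible_model D" and admZ: "admissible_Z D \<zeta>"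
begin

abbreviation X where "X \<equiv> field_X D"
abbreviation X' where "X' \<equiv> field_X' D"
abbreviation CF where "CF \<equiv> confs D"
abbreviation A where "A \<equiv> transf D"
abbreviation E where "E \<equiv> space (base D)"

lemma parts: "partitioned_fields D" "completely_independent D" "iid_copy D" "shift_action D"
    "stationary_transformation D" "measurable_events D"
  using adm by (auto simp: admissible_model_def)

sublocale PSp: prob_space "PS D"
  using parts(1) by (simp add: partitioned_fields_def)

lemma X_meas [measurable]: "X \<in> PS D \<rightarrow>\<^sub>M CF" and A_meas [measurable]: "A \<in> CF \<rightarrow>\<^sub>M out_fields D"
  using parts(1) by (auto simp: partitioned_fields_def)
lemma X'_meas [measurable]: "X' \<in> PS D \<rightarrow>\<^sub>M CF"
  using parts(3) by (auto simp: iid_copy_def)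
lemma \<zeta>_meas [measurable]: "\<zeta> \<in> borel_measurable (out_fields D)"
  using admZ by (auto simp: admissible_Z_def)

lemma cells_disjoint: "t \<in> Zl D \<Longrightarrow> t' \<in> Zl D \<Longrightarrow> e \<in> cell D x t \<Longrightarrow> e \<in> cell D x' t' \<Longrightarrow> x = x' \<and> t = t'"
proof -
  assume a: "t \<in> Zl D" "t' \<in> Zl D" "e \<in> cell D x t" "e \<in> cell D x' t'"
  have "disjoint_family_on (\<lambda>(x, t). cell D x t) (sites D)"
    using parts(1) by (simp add: partitioned_fields_def)
  from disjoint_family_onD[OF this, of "(x, t)" "(x', t')"] a show ?thesis
    by (auto simp: sites_def)
qed

lemma cells_cover: "(\<Union>(x, t)\<in>sites D. cell D x t) = E"
  using parts(1) by (simp add: partitioned_fields_def)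

lemma cell_sub: "t \<in> Zl D \<Longrightarrow> cell D x t \<subseteq> E"
  using cells_cover by (fastforce simp: sites_def)

lemma countable_sites: "countable (sites D)" by simp

text \<open>The index type \<open>'d\<close> is nonempty, so Z^d is infinite, even if l = 0 and the
  empty list is the only point of Z^l. The sites can therefore be enumerated bijectively by the
  natural numbers.\<close>

lemma infinite_sites: "infinite (sites D)"
proof
  assume "finite (sites D)"
  then have "finite (fst ` sites D)" by simp
  moreover have "replicate (ldim D) 0 \<in> Zl D" by (simp add: Zl_def)
  then have "fst ` sites D = UNIV" by (force simp: sites_def image_iff)
  ultimately have fin: "finite (UNIV :: (int ^ 'd) set)" by simp
  have "inj (\<lambda>n::nat. (\<chi> i. int n) :: int ^ 'd)" by (rule injI) (simp add: vec_eq_iff)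
  then have "finite (UNIV :: nat set)" using fin by (meson finite_subset finite_imageD subset_UNIV)
  then show False by simp
qed

definition en :: "nat \<Rightarrow> (int ^ 'd) \<times> int list" where "en = from_nat_into (sites D)"

lemma en_bij: "bij_betw en UNIV (sites D)"
  unfolding en_def by (rule bij_betw_from_nat_into[OF countable_sites infinite_sites])

lemma en_inj: "inj en" using en_bij by (simp add: bij_betw_def)
lemma en_range: "range en = sites D" using en_bij by (simp add: bij_betw_def)
lemma en_eq [simp]: "en i = en j \<longleftrightarrow> i = j" using en_inj by (auto dest: injD)

definition ex :: "nat \<Rightarrow> int ^ 'd" where "ex i = fst (en i)"
definition et :: "nat \<Rightarrow> int list" where "et i = snd (en i)"
definition cl :: "nat \<Rightarrow> 'e set" where "cl i = cell D (ex i) (et i)"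

lemma en_pair: "en i = (ex i, et i)" by (simp add: ex_def et_def)
lemma et_Zl: "et i \<in> Zl D"
  using en_range by (metis en_pair mem_Sigma_iff rangeI sites_def)

definition num :: "'e \<Rightarrow> nat" where "num e = (SOME i. e \<in> cl i)"

lemma num_cl: "e \<in> E \<Longrightarrow> e \<in> cl (num e)"
proof -
  assume "e \<in> E"
  then have "e \<in> (\<Union>(x, t)\<in>sites D. cell D x t)" by (simp only: cells_cover)
  then obtain p where p: "p \<in> sites D" "e \<in> cell D (fst p) (snd p)"
    by (auto simp: split_beta')
  obtain i where "p = en i" using p(1) en_range by auto
  then have "e \<in> cl i" using p(2) by (simp add: cl_def ex_def et_def)
  then show ?thesis unfolding num_def by (rule someI)
qed

lemma num_eq: "e \<in> cl i \<Longrightarrow> num e = i"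
proof -
  assume e: "e \<in> cl i"
  then have "e \<in> cl (num e)" unfolding num_def by (rule someI)
  with e have "ex i = ex (num e) \<and> et i = et (num e)"
    using cells_disjoint[OF et_Zl et_Zl] by (auto simp: cl_def)
  then have "en (num e) = en i" by (simp add: en_pair)
  then show ?thesis by simp
qed

lemma cl_sub: "cl i \<subseteq> E" unfolding cl_def by (rule cell_sub[OF et_Zl])

text \<open>A coordinate is the whole restriction of X to one cell, so a single abstract value is
  itself a function.\<close>

definition Mc :: "nat \<Rightarrow> ('e \<Rightarrow> 'm) measure" where
  "Mc i = distr (PS D) (PiM (cl i) (\<lambda>_. valM D)) (\<lambda>\<omega>. restrict (X \<omega>) (cl i))"

lemma restr_meas: "S \<subseteq> E \<Longrightarrow> (\<lambda>\<xi>. restrict \<xi> S) \<in> CF \<rightarrow>\<^sub>M PiM S (\<lambda>_. valM D)"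
  unfolding confs_def by (rule measurable_restrict_subset)

lemma sets_Mc: "sets (Mc i) = sets (PiM (cl i) (\<lambda>_. valM D))" by (simp add: Mc_def)

sublocale C: site_copies Mc
proof (rule site_copies.intro)
  fix i show "prob_space (Mc i)" unfolding Mc_def
    by (rule PSp.prob_space_distr) (rule measurable_compose[OF X_meas restr_meas[OF cl_sub]])
qed

definition glue :: "(nat \<Rightarrow> 'e \<Rightarrow> 'm) \<Rightarrow> 'e \<Rightarrow> 'm" where "glue x = (\<lambda>e\<in>E. x (num e) e)"

lemma glue_meas [measurable]: "glue \<in> C.P \<rightarrow>\<^sub>M CF"
  unfolding glue_def confs_def
proof (rule measurable_restrict)
  fix e assume e: "e \<in> E"
  have "(\<lambda>x. x (num e)) \<in> C.P \<rightarrow>\<^sub>M Mc (num e)" unfolding C.P_def by simp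
  moreover have "(\<lambda>y. y e) \<in> Mc (num e) \<rightarrow>\<^sub>M valM D"
    using measurable_component_singleton[OF num_cl[OF e], of "\<lambda>_. valM D"]
    by (simp add: sets_Mc cong: measurable_cong_sets)
  ultimately show "(\<lambda>x. x (num e) e) \<in> C.P \<rightarrow>\<^sub>M valM D" by (rule measurable_compose)
qed

definition LX :: "('e \<Rightarrow> 'm) measure" where "LX = distr (PS D) CF X"

lemma X_space: "\<omega> \<in> space (PS D) \<Longrightarrow> X \<omega> \<in> space CF" "\<omega> \<in> space (PS D) \<Longrightarrow> X' \<omega> \<in> space CF"
  using measurable_space[OF X_meas] measurable_space[OF X'_meas] by auto

lemma CF_ext: "\<xi> \<in> space CF \<Longrightarrow> e \<notin> E \<Longrightarrow> \<xi> e = undefined"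
  by (auto simp: confs_def space_PiM PiE_iff extensional_def)

lemma CF_eqI: "\<xi> \<in> space CF \<Longrightarrow> \<eta> \<in> space CF \<Longrightarrow> (\<And>e. e \<in> E \<Longrightarrow> \<xi> e = \<eta> e) \<Longrightarrow> \<xi> = \<eta>"
  using CF_ext by (metis ext)

text \<open>Complete independence makes the joint law of all cell restrictions a product; reindexing
  by \<open>en\<close> and reassembling the cells returns X.\<close>

lemma distr_glue: "distr C.P CF glue = LX"
proof -
  let ?Ms = "\<lambda>(x, t). PiM (cell D x t) (\<lambda>_. valM D)"
  let ?Xs = "\<lambda>(x, t) \<omega>. restrict (X \<omega>) (cell D x t)"
  let ?N = "\<lambda>p. distr (PS D) (?Ms p) (?Xs p)"
  have rv: "?Xs p \<in> PS D \<rightarrow>\<^sub>M ?Ms p" if "p \<in> sites D" for p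
    using that measurable_compose[OF X_meas restr_meas[OF cell_sub]] by (auto simp: sites_def)
  have ind: "PSp.indep_vars ?Ms ?Xs (sites D)"
    using parts(2) by (simp add: completely_independent_def)
  have ne: "sites D \<noteq> {}" using infinite_sites by auto
  have d1: "distr (PS D) (PiM (sites D) ?Ms) (\<lambda>\<omega>. \<lambda>p\<in>sites D. ?Xs p \<omega>) = PiM (sites D) ?N"
    using PSp.indep_vars_iff_distr_eq_PiM'[OF ne rv] ind by simp
  have Nen: "?N (en i) = Mc i" for i by (simp add: en_pair Mc_def cl_def)
  have en_in: "en i \<in> sites D" for i using en_range by auto
  have "distr (PiM (sites D) ?N) (PiM UNIV (\<lambda>i. ?N (en i))) (\<lambda>\<omega>. \<lambda>i\<in>UNIV. \<omega> (en i)) = PiM UNIV (\<lambda>i. ?N (en i))"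
  proof (rule distr_PiM_reindex)
    fix p assume "p \<in> sites D"
    then show "prob_space (?N p)" by (intro PSp.prob_space_distr rv)
  qed (use en_inj en_in in auto)
  then have d2: "distr (PiM (sites D) ?N) C.P (\<lambda>\<omega> i. \<omega> (en i)) = C.P"
    unfolding Nen C.P_def by (simp add: restrict_def)
  have m2: "(\<lambda>\<omega> i. \<omega> (en i)) \<in> PiM (sites D) ?Ms \<rightarrow>\<^sub>M C.P"
    unfolding C.P_def
  proof (rule measurable_abs_UNIV)
    fix i
    have "(\<lambda>\<omega>. \<omega> (en i)) \<in> PiM (sites D) ?Ms \<rightarrow>\<^sub>M ?Ms (en i)"
      by (rule measurable_component_singleton[OF en_in])
    then show "(\<lambda>\<omega>. \<omega> (en i)) \<in> PiM (sites D) ?Ms \<rightarrow>\<^sub>M Mc i"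
      by (simp add: en_pair sets_Mc cl_def cong: measurable_cong_sets)
  qed
  have m1: "(\<lambda>\<omega>. \<lambda>p\<in>sites D. ?Xs p \<omega>) \<in> PS D \<rightarrow>\<^sub>M PiM (sites D) ?Ms"
    by (rule measurable_restrict) (rule rv)
  let ?r = "\<lambda>\<omega> i. (\<lambda>p\<in>sites D. ?Xs p \<omega>) (en i)"
  have "C.P = distr (PiM (sites D) ?N) C.P (\<lambda>\<omega> i. \<omega> (en i))" by (rule d2[symmetric])
  also have "\<dots> = distr (distr (PS D) (PiM (sites D) ?Ms) (\<lambda>\<omega>. \<lambda>p\<in>sites D. ?Xs p \<omega>)) C.P (\<lambda>\<omega> i. \<omega> (en i))"
    by (simp only: d1)
  also have "\<dots> = distr (PS D) C.P ?r"
    by (subst distr_distr[OF m2 m1]) (simp add: comp_def)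
  finally have PC: "C.P = distr (PS D) C.P ?r" .
  have m3: "?r \<in> PS D \<rightarrow>\<^sub>M C.P" using measurable_compose[OF m1 m2] .
  have "distr C.P CF glue = distr (distr (PS D) C.P ?r) CF glue" using PC by simp
  also have "\<dots> = distr (PS D) CF (glue \<circ> ?r)" by (rule distr_distr[OF glue_meas m3])
  also have "\<dots> = LX" unfolding LX_def
  proof (rule distr_cong)
    fix \<omega> assume w: "\<omega> \<in> space (PS D)"
    show "(glue \<circ> ?r) \<omega> = X \<omega>"
    proof (rule CF_eqI)
      show "(glue \<circ> ?r) \<omega> \<in> space CF"
        using w measurable_space[OF measurable_compose[OF m3 glue_meas]] by simp
      show "X \<omega> \<in> space CF" using w by (rule X_space)
      fix e assume e: "e \<in> E"
      then have "e \<in> cell D (ex (num e)) (et (num e))" using num_cl by (simp add: cl_def)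
      moreover have "(ex (num e), et (num e)) \<in> sites D" using en_in by (simp add: en_pair[symmetric])
      ultimately show "(glue \<circ> ?r) \<omega> e = X \<omega> e" using e by (simp add: glue_def en_pair)
    qed
  qed simp_all
  finally show ?thesis .
qed

section \<open>The joint law of the field and its copy\<close>

abbreviation PL where "PL \<equiv> pair_law D"
abbreviation CC where "CC \<equiv> CF \<Otimes>\<^sub>M CF"

definition glue2 :: "(nat \<Rightarrow> 'e \<Rightarrow> 'm) \<times> (nat \<Rightarrow> 'e \<Rightarrow> 'm) \<Rightarrow> ('e \<Rightarrow> 'm) \<times> ('e \<Rightarrow> 'm)" where
  "glue2 p = (glue (fst p), glue (snd p))"

lemma glue2_meas [measurable]: "glue2 \<in> C.P \<Otimes>\<^sub>M C.P \<rightarrow>\<^sub>M CC"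
  unfolding glue2_def[abs_def] by measurable

lemma LX_prob: "prob_space LX" unfolding LX_def by (rule PSp.prob_space_distr) measurable

lemma PL_eq: "PL = LX \<Otimes>\<^sub>M LX"
proof -
  have "PSp.indep_var CF X CF X'" "distr (PS D) CF X' = LX"
    using parts(3) by (auto simp: iid_copy_def LX_def)
  then show ?thesis
    using PSp.indep_var_distribution_eq[of CF X CF X'] by (simp add: pair_law_def LX_def)
qed

lemma sets_PL [simp, measurable_cong]: "sets PL = sets CC" by (simp add: pair_law_def)
lemma space_PL: "space PL = space CC" by (simp add: pair_law_def)
lemma XX_meas [measurable]: "(\<lambda>\<omega>. (X \<omega>, X' \<omega>)) \<in> PS D \<rightarrow>\<^sub>M CC" by measurable

lemma distr_glue2: "distr (C.P \<Otimes>\<^sub>M C.P) CC glue2 = PL"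
proof -
  have "prob_space (distr C.P CF glue)" by (rule C.P.prob_space_distr) measurable
  then have "sigma_finite_measure (distr C.P CF glue)" by (rule prob_space_imp_sigma_finite)
  from pair_measure_distr[OF glue_meas glue_meas this] show ?thesis
    by (simp add: distr_glue PL_eq glue2_def[abs_def] split_beta')
qed

lemma splice_eq: "e \<in> E \<Longrightarrow> B \<subseteq> sites D \<Longrightarrow> splice D B \<xi> \<eta> e = (if en (num e) \<in> B then \<eta> e else \<xi> e)"
proof -
  assume e: "e \<in> E" and B: "B \<subseteq> sites D"
  have "(\<exists>(x, t)\<in>B. e \<in> cell D x t) \<longleftrightarrow> en (num e) \<in> B"
  proof
    assume "\<exists>(x, t)\<in>B. e \<in> cell D x t"
    then obtain x t where xt: "(x, t) \<in> B" "e \<in> cell D x t" by auto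
    then obtain i where i: "(x, t) = en i" using B en_range by blast
    then have "e \<in> cl i" using xt(2) by (simp add: cl_def ex_def et_def flip: i)
    then show "en (num e) \<in> B" using xt(1) i by (simp add: num_eq)
  next
    assume "en (num e) \<in> B"
    then show "\<exists>(x, t)\<in>B. e \<in> cell D x t"
      using num_cl[OF e] by (intro bexI[of _ "en (num e)"]) (auto simp: en_pair cl_def)
  qed
  then show ?thesis by (simp add: splice_def)
qed

lemma splice_out: "e \<notin> E \<Longrightarrow> B \<subseteq> sites D \<Longrightarrow> splice D B \<xi> \<eta> e = \<xi> e"
  using cell_sub by (fastforce simp: splice_def sites_def)

text \<open>\<open>B\<close> may be infinite: each value of the spliced field is a value of one of
  the two configurations, and which one is decided by the cell alone.\<close>

lemma splice_meas: "B \<subseteq> sites D \<Longrightarrow> (\<lambda>p. splice D B (fst p) (snd p)) \<in> CC \<rightarrow>\<^sub>M CF"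
proof -
  assume B: "B \<subseteq> sites D"
  have "(\<lambda>p. \<lambda>e\<in>E. if en (num e) \<in> B then snd p e else fst p e) \<in> CC \<rightarrow>\<^sub>M CF"
    unfolding confs_def
  proof (rule measurable_restrict)
    fix e assume e: "e \<in> E"
    show "(\<lambda>p. if en (num e) \<in> B then snd p e else fst p e) \<in> PiM E (\<lambda>_. valM D) \<Otimes>\<^sub>M PiM E (\<lambda>_. valM D) \<rightarrow>\<^sub>M valM D"
      using e by (cases "en (num e) \<in> B") simp_all
  qed
  then show ?thesis
  proof (rule measurable_cong[THEN iffD1, rotated])
    fix p assume "p \<in> space CC"
    then have "fst p \<in> space CF" by (auto simp: space_pair_measure)
    then show "(\<lambda>e\<in>E. if en (num e) \<in> B then snd p e else fst p e) = splice D B (fst p) (snd p)"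
      using B by (auto simp: fun_eq_iff splice_eq splice_out CF_ext restrict_def)
  qed
qed

lemma splice_glue: "splice D (en ` B) (glue x) (glue y) = glue (spl B (x, y))"
proof
  fix e
  have B: "en ` B \<subseteq> sites D" using en_range by auto
  show "splice D (en ` B) (glue x) (glue y) e = glue (spl B (x, y)) e"
    by (cases "e \<in> E") (auto simp: splice_eq splice_out B glue_def spl_def)
qed

text \<open>Unlike splicing, the exchange in both directions is an involution that preserves the
  joint law of X and X'.\<close>

definition swapB :: "((int ^ 'd) \<times> int list) set \<Rightarrow> ('e \<Rightarrow> 'm) \<times> ('e \<Rightarrow> 'm) \<Rightarrow> ('e \<Rightarrow> 'm) \<times> ('e \<Rightarrow> 'm)" where
  "swapB B p = (splice D B (fst p) (snd p), splice D B (snd p) (fst p))"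

lemma swapB_meas: assumes "B \<subseteq> sites D" shows "swapB B \<in> CC \<rightarrow>\<^sub>M CC"
proof -
  have "(\<lambda>p. (snd p, fst p)) \<in> CC \<rightarrow>\<^sub>M CC" by measurable
  from measurable_compose[OF this splice_meas[OF assms]] splice_meas[OF assms]
  show ?thesis unfolding swapB_def[abs_def] by simp
qed

lemma swapB_inv: "B \<subseteq> sites D \<Longrightarrow> p \<in> space CC \<Longrightarrow> swapB B (swapB B p) = p"
proof -
  assume B: "B \<subseteq> sites D" and p: "p \<in> space CC"
  then have c: "fst p \<in> space CF" "snd p \<in> space CF" by (auto simp: space_pair_measure)
  have "splice D B (splice D B \<xi> \<eta>) (splice D B \<eta> \<xi>) = \<xi>" for \<xi> \<eta>
  proof
    fix e show "splice D B (splice D B \<xi> \<eta>) (splice D B \<eta> \<xi>) e = \<xi> e"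
      using B by (cases "e \<in> E") (simp_all add: splice_eq splice_out)
  qed
  then show ?thesis by (simp add: swapB_def)
qed

text \<open>X^(C \<union> B) is X^C formed after exchanging X and X' on B. Differences at a
  perturbed field are thus differences at X seen through a measure-preserving map.\<close>

lemma splice_swapB:
  assumes "B \<subseteq> sites D" "C \<subseteq> sites D" "B \<inter> C = {}"
  shows "splice D C (fst (swapB B p)) (snd (swapB B p)) = splice D (C \<union> B) (fst p) (snd p)"
proof
  fix e
  have "C \<union> B \<subseteq> sites D" using assms by auto
  then show "splice D C (fst (swapB B p)) (snd (swapB B p)) e = splice D (C \<union> B) (fst p) (snd p) e"
    using assms by (cases "e \<in> E") (auto simp: splice_eq splice_out swapB_def)
qed

text \<open>In terms of copies, the exchange selects copy 1 instead of copy 0 on B and conversely,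
  which does not change the law of a pair of selections.\<close>

lemma distr_swapB:
  assumes B: "B \<subseteq> sites D" shows "distr PL PL (swapB B) = PL"
proof -
  define B0 where "B0 = en -` B"
  have Be: "B = en ` B0" using B en_range by (auto simp: B0_def)
  let ?m = "\<lambda>\<omega>. (C.sel (\<lambda>_. 0) \<omega>, C.sel (\<lambda>_. 1) \<omega>)"
  let ?s = "\<lambda>i. if i \<in> B0 then 1 else 0" and ?t = "\<lambda>i. if i \<in> B0 then 0 else 1 :: nat"
  let ?n = "\<lambda>\<omega>. (C.sel ?s \<omega>, C.sel ?t \<omega>)"
  have mm: "?m \<in> C.Q \<rightarrow>\<^sub>M C.P \<Otimes>\<^sub>M C.P" "?n \<in> C.Q \<rightarrow>\<^sub>M C.P \<Otimes>\<^sub>M C.P" by measurable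
  have g: "swapB B (glue2 (?m \<omega>)) = glue2 (?n \<omega>)" for \<omega>
    unfolding swapB_def glue2_def fst_conv snd_conv Be splice_glue
    by (auto simp: spl_def C.sel_def intro!: arg_cong[where f=glue])
  have sm: "swapB B \<in> PL \<rightarrow>\<^sub>M PL" using swapB_meas[OF B] by (simp cong: measurable_cong_sets)
  have PL1: "PL = distr C.Q CC (glue2 \<circ> ?m)"
    by (subst distr_distr[OF glue2_meas mm(1), symmetric]) (simp add: C.distr_sel_pair distr_glue2)
  have PL2: "PL = distr C.Q CC (glue2 \<circ> ?n)"
    by (subst distr_distr[OF glue2_meas mm(2), symmetric]) (simp add: C.distr_sel_pair distr_glue2)
  have gm: "glue2 \<circ> ?m \<in> C.Q \<rightarrow>\<^sub>M CC" using measurable_compose[OF mm(1) glue2_meas] by (simp add: comp_def)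
  have "distr PL PL (swapB B) = distr PL CC (swapB B)" by (rule distr_cong) simp_all
  also have "\<dots> = distr (distr C.Q CC (glue2 \<circ> ?m)) CC (swapB B)" using PL1 by simp
  also have "\<dots> = distr C.Q CC (swapB B \<circ> (glue2 \<circ> ?m))" by (rule distr_distr[OF swapB_meas[OF B] gm])
  also have "swapB B \<circ> (glue2 \<circ> ?m) = glue2 \<circ> ?n" by (rule ext) (simp only: comp_def g)
  also have "distr C.Q CC (glue2 \<circ> ?n) = PL" using PL2 by simp
  finally show ?thesis .
qed

end

section \<open>Transfer to random fields\<close>

context field_functional
begin

definition Ag :: "(real ^ 'd) set \<Rightarrow> ((int ^ 'd) \<times> int list) set \<Rightarrow> ((int ^ 'd) \<times> int list) set
    \<Rightarrow> ('e \<Rightarrow> 'm) \<times> ('e \<Rightarrow> 'm) \<Rightarrow> bool" where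
  "Ag S B B' p \<longleftrightarrow> (\<forall>y. y \<notin> S \<longrightarrow> A (splice D B (fst p) (snd p)) y = A (splice D B' (fst p) (snd p)) y)"

lemma agree_Ag: "agree D S B B' \<omega> \<longleftrightarrow> Ag S B B' (X \<omega>, X' \<omega>)"
  by (simp add: agree_def Ag_def pert_def)

lemma Ag_swapB:
  assumes "B \<subseteq> sites D" "C \<subseteq> sites D" "C' \<subseteq> sites D" "B \<inter> C = {}" "B \<inter> C' = {}"
  shows "Ag S C C' (swapB B p) \<longleftrightarrow> Ag S (C \<union> B) (C' \<union> B) p"
  using assms by (simp add: Ag_def splice_swapB)

lemma Ag_mono: "S \<subseteq> S' \<Longrightarrow> Ag S B B' p \<Longrightarrow> Ag S' B B' p"
  by (auto simp: Ag_def)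

lemma fat_cube_mono: "r \<le> r' \<Longrightarrow> fat_cube x r \<subseteq> fat_cube x r'"
  unfolding fat_cube_def by force

lemma swapB_PL: "B \<subseteq> sites D \<Longrightarrow> swapB B \<in> PL \<rightarrow>\<^sub>M PL"
  using swapB_meas by (simp cong: measurable_cong_sets)

lemma XX_PL: "(\<lambda>\<omega>. (X \<omega>, X' \<omega>)) \<in> PS D \<rightarrow>\<^sub>M PL"
  by (simp cong: measurable_cong_sets)

lemma distr_XX: "distr (PS D) PL (\<lambda>\<omega>. (X \<omega>, X' \<omega>)) = PL"
proof -
  have "distr (PS D) PL (\<lambda>\<omega>. (X \<omega>, X' \<omega>)) = distr (PS D) CC (\<lambda>\<omega>. (X \<omega>, X' \<omega>))"
    by (rule distr_cong) simp_all
  then show ?thesis by (simp add: pair_law_def)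
qed

text \<open>The measurability assumption concerns \<open>A(\<X>)\<close> only; exchanging \<open>\<X>\<close> and \<open>\<X>'\<close> on \<open>B\<close> extends
  its use to \<open>A(\<X>\<^sup>B)\<close>.\<close>

lemma AE_transfer:
  assumes t: "t \<in> Zl D" and B: "B \<subseteq> sites D" "(x, t) \<notin> B" and r: "r \<in> borel_measurable CC"
    and ae: "AE \<omega> in PS D. Ag (fat_cube x (r (X \<omega>, X' \<omega>))) (insert (x, t) B) B (X \<omega>, X' \<omega>)"
  shows "AE p in PL. Ag (fat_cube x (r p)) (insert (x, t) B) B p"
proof -
  have xt: "{(x, t)} \<subseteq> sites D" "B \<inter> {(x, t)} = {}" using t B by (auto simp: sites_def)
  \<comment> \<open>The measurability hypothesis holds for every measurable radius. Composing r with
    the exchange makes the exchanged event the desired one.\<close>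
  let ?r = "\<lambda>p. r (swapB B p)"
  let ?S = "{p \<in> space CC. \<forall>y. y \<notin> fat_cube x (?r p) \<longrightarrow> A (splice D {(x, t)} (fst p) (snd p)) y = A (fst p) y}"
  have rm: "?r \<in> borel_measurable CC" using measurable_compose[OF swapB_meas[OF B(1)] r] .
  have "\<forall>r\<in>borel_measurable CC. {p \<in> space CC. \<forall>y. y \<notin> fat_cube x (r p) \<longrightarrow>
      A (splice D {(x, t)} (fst p) (snd p)) y = A (fst p) y} \<in> sets (completion PL)"
    using parts(6) t unfolding measurable_events_def by blast
  from bspec[OF this rm] have S: "?S \<in> sets (completion PL)" .
  have SAg: "swapB B p \<in> ?S \<longleftrightarrow> Ag (fat_cube x (r p)) (insert (x, t) B) B p" if p: "p \<in> space CC" for p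
  proof -
    have "swapB B p \<in> space CC" using p by (rule measurable_space[OF swapB_meas[OF B(1)]])
    moreover have "fst (swapB B p) = splice D B (fst p) (snd p)" by (simp add: swapB_def)
    ultimately show ?thesis
      using splice_swapB[OF B(1) xt, of p] swapB_inv[OF B(1) p] by (simp add: Ag_def)
  qed
  let ?T = "\<lambda>\<omega>. swapB B (X \<omega>, X' \<omega>)"
  have T: "?T \<in> PS D \<rightarrow>\<^sub>M PL" using measurable_compose[OF XX_PL swapB_PL[OF B(1)]] .
  have dT: "distr (PS D) PL ?T = PL"
    using distr_distr[OF swapB_PL[OF B(1)] XX_PL] by (simp add: distr_XX distr_swapB[OF B(1)] comp_def)
  have "AE \<omega> in PS D. ?T \<omega> \<in> ?S"
    using ae AE_space by eventually_elim (use SAg measurable_space[OF XX_meas] in blast)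
  then have "AE p in PL. p \<in> ?S" by (rule AE_completion_mem[OF S T dT])
  then have "AE p in PL. swapB B p \<in> ?S"
    by (intro AE_distrD[OF swapB_PL[OF B(1)]]) (simp only: distr_swapB[OF B(1)])
  with AE_space show ?thesis
    by eventually_elim (use SAg space_PL in auto)
qed

section \<open>Translations of the fields\<close>

abbreviation tr where "tr \<equiv> translate D"
definition tr2 :: "int ^ 'd \<Rightarrow> ('e \<Rightarrow> 'm) \<times> ('e \<Rightarrow> 'm) \<Rightarrow> ('e \<Rightarrow> 'm) \<times> ('e \<Rightarrow> 'm)" where
  "tr2 z p = (tr z (fst p), tr z (snd p))"

lemma shift_cell: "t \<in> Zl D \<Longrightarrow> e \<in> cell D x t \<Longrightarrow> shift D z e \<in> cell D (x + z) t"
  using parts(4) unfolding shift_action_def by blast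

lemma site_of: "t \<in> Zl D \<Longrightarrow> e \<in> cell D x t \<Longrightarrow> en (num e) = (x, t)"
proof -
  assume t: "t \<in> Zl D" and e: "e \<in> cell D x t"
  have "e \<in> cell D (ex (num e)) (et (num e))" using num_cl[of e] cell_sub[OF t] e by (auto simp: cl_def)
  then show ?thesis using cells_disjoint[OF t et_Zl e] by (simp add: en_pair)
qed

lemma num_cell: "e \<in> E \<Longrightarrow> e \<in> cell D (ex (num e)) (et (num e))"
  using num_cl by (simp add: cl_def)

lemma shift_E: "e \<in> E \<Longrightarrow> shift D z e \<in> E"
  using shift_cell[OF et_Zl num_cell] cell_sub[OF et_Zl] by blast

lemma site_shift: "e \<in> E \<Longrightarrow> en (num (shift D z e)) = (ex (num e) + z, et (num e))"
  by (rule site_of[OF et_Zl shift_cell[OF et_Zl num_cell]])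

lemma shift_shift: "e \<in> E \<Longrightarrow> shift D z (shift D z' e) = shift D (z + z') e"
  using parts(4) by (simp add: shift_action_def)

lemma shift_0: "e \<in> E \<Longrightarrow> shift D 0 e = e"
  using parts(4) by (simp add: shift_action_def)

lemma tr_meas: "tr z \<in> CF \<rightarrow>\<^sub>M CF"
  unfolding translate_def confs_def
  by (rule measurable_restrict) (rule measurable_component_singleton[OF shift_E])

lemma tr2_meas: "tr2 z \<in> CC \<rightarrow>\<^sub>M CC"
  unfolding tr2_def[abs_def] using measurable_compose[OF _ tr_meas, of _ CC] by simp

lemma tr_inv: "\<xi> \<in> space CF \<Longrightarrow> tr z (tr (- z) \<xi>) = \<xi>"
proof -
  assume x: "\<xi> \<in> space CF"
  show ?thesis
  proof
    fix e show "tr z (tr (- z) \<xi>) e = \<xi> e"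
      using CF_ext[OF x] shift_E[of e z] shift_shift[of e "- z" z] shift_0[of e]
      by (cases "e \<in> E") (simp_all add: translate_def)
  qed
qed

lemma tr2_inv: "p \<in> space CC \<Longrightarrow> tr2 z (tr2 (- z) p) = p"
  by (auto simp: tr2_def tr_inv space_pair_measure)

lemma distr_tr: "distr LX CF (tr z) = LX"
proof -
  have "distr LX CF (tr z) = distr (PS D) CF (tr z \<circ> X)"
    unfolding LX_def by (rule distr_distr[OF tr_meas X_meas])
  then show ?thesis using parts(5) by (simp add: stationary_transformation_def LX_def comp_def)
qed

lemma distr_tr2: "distr PL PL (tr2 z) = PL"
proof -
  have "prob_space (distr LX CF (tr z))" using LX_prob by (simp add: distr_tr)
  then have s: "sigma_finite_measure (distr LX CF (tr z))" by (rule prob_space_imp_sigma_finite)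
  have m: "tr z \<in> LX \<rightarrow>\<^sub>M CF" using tr_meas by (simp add: LX_def)
  have "PL = distr PL CC (tr2 z)"
    using pair_measure_distr[OF m m s] by (simp add: distr_tr PL_eq tr2_def[abs_def] split_beta')
  also have "\<dots> = distr PL PL (tr2 z)" by (rule distr_cong) simp_all
  finally show ?thesis ..
qed

lemma tr2_PL: "tr2 z \<in> PL \<rightarrow>\<^sub>M PL"
  using tr2_meas by (simp cong: measurable_cong_sets)

text \<open>The translate reads at e the value at \<open>shift D z e\<close>, so its site (x, t)
  corresponds to the site (x + z, t) of the original field.\<close>

definition shiftB :: "int ^ 'd \<Rightarrow> ((int ^ 'd) \<times> int list) set \<Rightarrow> ((int ^ 'd) \<times> int list) set" where
  "shiftB z B = {(x, t). (x + z, t) \<in> B}"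

lemma shiftB_sites: "B \<subseteq> sites D \<Longrightarrow> shiftB z B \<subseteq> sites D"
  by (auto simp: shiftB_def sites_def)

lemma splice_tr:
  assumes "B \<subseteq> sites D"
  shows "tr z (splice D B \<xi> \<eta>) = splice D (shiftB z B) (tr z \<xi>) (tr z \<eta>)"
proof
  fix e
  have "en (num e) \<in> shiftB z B \<longleftrightarrow> en (num (shift D z e)) \<in> B" if "e \<in> E"
    unfolding site_shift[OF that] en_pair[of "num e"] by (simp add: shiftB_def)
  then show "tr z (splice D B \<xi> \<eta>) e = splice D (shiftB z B) (tr z \<xi>) (tr z \<eta>) e"
    using shift_E[of e z] splice_eq[OF _ assms, of "shift D z e"] splice_eq[OF _ shiftB_sites[OF assms], of e]
      splice_out[OF _ shiftB_sites[OF assms], of e]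
    by (cases "e \<in> E") (simp_all add: translate_def)
qed

text \<open>A spliced field is the first component after an exchange and thus has the law of X. In
  this way the almost sure equivariance of A extends to every X^B.\<close>

lemma AE_LX_splice:
  assumes "AE \<xi> in LX. R \<xi>" "B \<subseteq> sites D"
  shows "AE p in PL. R (splice D B (fst p) (snd p))"
proof -
  have f: "fst \<in> PL \<rightarrow>\<^sub>M CF" by simp
  have "distr PL CF fst = distr (PS D) CF (fst \<circ> (\<lambda>\<omega>. (X \<omega>, X' \<omega>)))"
    unfolding pair_law_def by (rule distr_distr) auto
  then have dL: "distr PL CF fst = LX" by (simp add: LX_def comp_def)
  have "AE p in PL. R (fst p)" by (rule AE_distrD[OF f]) (unfold dL, rule assms(1))
  then have "AE p in PL. R (fst (swapB B p))"
    by (intro AE_distrD[OF swapB_PL[OF assms(2)]]) (simp only: distr_swapB[OF assms(2)])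
  then show ?thesis by (simp add: swapB_def)
qed

lemma AE_tr_splice:
  assumes "B \<subseteq> sites D"
  shows "AE p in PL. A (splice D (shiftB z B) (tr z (fst p)) (tr z (snd p))) = (\<lambda>y. A (splice D B (fst p) (snd p)) (y + rvec z))"
proof -
  have "AE \<xi> in LX. A (tr z \<xi>) = (\<lambda>y. A \<xi> (y + rvec z))"
    using parts(5) unfolding stationary_transformation_def LX_def by blast
  from AE_LX_splice[OF this assms] show ?thesis by (simp add: splice_tr[OF assms])
qed

section \<open>The normalized functional of glued configurations\<close>

definition F :: "('e \<Rightarrow> 'm) \<Rightarrow> real" where "F \<xi> = \<zeta> (A \<xi>)"
lemma F_meas [measurable]: "F \<in> borel_measurable CF"
  unfolding F_def[abs_def] by (rule measurable_compose[OF A_meas \<zeta>_meas])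

abbreviation \<sigma> where "\<sigma> \<equiv> Zsigma D \<zeta>"
lemma \<sigma>_pos: "\<sigma> > 0" using admZ by (simp add: admissible_Z_def)

definition fn :: "(nat \<Rightarrow> 'e \<Rightarrow> 'm) \<Rightarrow> real" where "fn x = (F (glue x) - Zmean D \<zeta>) / \<sigma>"

lemma distr_fn:
  fixes g :: "real \<Rightarrow> real"
  assumes "g \<in> borel_measurable borel"
  shows "(\<integral>x. g (fn x) \<partial>C.P) = (\<integral>\<omega>. g ((Zvar D \<zeta> \<omega> - Zmean D \<zeta>) / \<sigma>) \<partial>PS D)"
    and "integrable C.P (\<lambda>x. g (fn x)) \<longleftrightarrow> integrable (PS D) (\<lambda>\<omega>. g ((Zvar D \<zeta> \<omega> - Zmean D \<zeta>) / \<sigma>))"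
proof -
  note [measurable] = assms
  let ?k = "\<lambda>\<xi>. g ((F \<xi> - Zmean D \<zeta>) / \<sigma>)"
  have k: "?k \<in> borel_measurable CF" by measurable
  show "(\<integral>x. g (fn x) \<partial>C.P) = (\<integral>\<omega>. g ((Zvar D \<zeta> \<omega> - Zmean D \<zeta>) / \<sigma>) \<partial>PS D)"
    using integral_distr[OF glue_meas k] integral_distr[OF X_meas k]
    by (simp add: distr_glue LX_def fn_def Zvar_def F_def)
  show "integrable C.P (\<lambda>x. g (fn x)) \<longleftrightarrow> integrable (PS D) (\<lambda>\<omega>. g ((Zvar D \<zeta> \<omega> - Zmean D \<zeta>) / \<sigma>))"
    using integrable_distr_eq[OF glue_meas k] integrable_distr_eq[OF X_meas k]
    by (simp add: distr_glue LX_def fn_def Zvar_def F_def)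
qed

lemma fn_meas [measurable]: "fn \<in> borel_measurable C.P"
  unfolding fn_def[abs_def] by measurable

sublocale cf: centred_functional Mc fn
proof (unfold_locales)
  have m: "(\<lambda>\<omega>. Zvar D \<zeta> \<omega>) \<in> borel_measurable (PS D)"
    unfolding Zvar_def F_def[symmetric] by measurable
  have sq: "integrable (PS D) (\<lambda>\<omega>. (Zvar D \<zeta> \<omega>)\<^sup>2)" using admZ by (simp add: admissible_Z_def)
  have i: "integrable (PS D) (Zvar D \<zeta>)" by (rule PSp.square_integrable_imp_integrable[OF m sq])
  have i2: "integrable (PS D) (\<lambda>\<omega>. (Zvar D \<zeta> \<omega> - Zmean D \<zeta>)\<^sup>2)"
    using i sq by (simp add: power2_diff)
  show "fn \<in> borel_measurable C.P" by measurable
  show "integrable C.P (\<lambda>x. (fn x)\<^sup>2)"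
    using i2 by (subst distr_fn(2)[of "\<lambda>x. x\<^sup>2"]) (simp_all add: power_divide)
  show "(\<integral>x. fn x \<partial>C.P) = 0"
    using distr_fn(1)[of "\<lambda>x. x"] i by (simp add: Zmean_def PSp.prob_space)
  have "\<sigma>\<^sup>2 = (\<integral>\<omega>. (Zvar D \<zeta> \<omega> - Zmean D \<zeta>)\<^sup>2 \<partial>PS D)"
    by (simp add: Zsigma_def)
  moreover have "\<sigma>\<^sup>2 \<noteq> 0" using \<sigma>_pos by simp
  ultimately show "(\<integral>x. (fn x)\<^sup>2 \<partial>C.P) = 1"
    using distr_fn(1)[of "\<lambda>x. x\<^sup>2"] by (simp add: power_divide)
qed

lemma Z_law: "cf.Z = normalized_law D \<zeta>"
proof -
  let ?k = "\<lambda>\<xi>. (F \<xi> - Zmean D \<zeta>) / \<sigma>"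
  have k: "?k \<in> CF \<rightarrow>\<^sub>M borel" by measurable
  have "cf.Z = distr (distr C.P CF glue) borel ?k"
    by (subst distr_distr[OF k glue_meas]) (simp add: comp_def fn_def[abs_def])
  also have "\<dots> = distr (PS D) borel (?k \<circ> X)"
    unfolding distr_glue LX_def by (rule distr_distr[OF k X_meas])
  finally show ?thesis by (simp add: normalized_law_def comp_def Zvar_def F_def)
qed

end

locale radii = field_functional D \<zeta>
  for D :: "('w, 'e, 'm, 'v, 'd::finite) field_model" and \<zeta> +
  fixes \<rho> and R0 :: "int list \<Rightarrow> ('e \<Rightarrow> 'm) \<times> ('e \<Rightarrow> 'm) \<Rightarrow> ennreal"
  assumes rf: "radius_family D \<rho>"
    and R0_meas: "\<And>t. t \<in> Zl D \<Longrightarrow> R0 t \<in> borel_measurable (confs D \<Otimes>\<^sub>M confs D)"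
    and R0_eq: "\<And>t \<omega>. t \<in> Zl D \<Longrightarrow> \<omega> \<in> space (PS D) \<Longrightarrow> sup_radius D \<rho> 0 t \<omega> = R0 t (field_X D \<omega>, field_X' D \<omega>)"
begin

lemma R0_fin: assumes t: "t \<in> Zl D" shows "AE p in PL. R0 t p < \<top>"
proof -
  have "AE \<omega> in PS D. sup_radius D \<rho> 0 t \<omega> < \<top>"
    using rf t by (simp add: radius_family_def)
  with AE_space have "AE \<omega> in PS D. R0 t (X \<omega>, X' \<omega>) < \<top>"
    by eventually_elim (use R0_eq[OF t] in simp)
  moreover note [measurable] = R0_meas[OF t]
  ultimately show ?thesis unfolding pair_law_def by (subst AE_distr_iff) measurable
qed

text \<open>The supremum dominates the radius for every \<open>B\<close> at once, and enlarging a
  radius keeps it an action radius.\<close>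

lemma base_AE:
  assumes t: "t \<in> Zl D" and B: "B \<subseteq> sites D" "(0, t) \<notin> B"
  shows "AE p in PL. Ag (fat_cube 0 (enn2real (R0 t p))) (insert (0, t) B) B p"
proof (rule AE_transfer[OF t B])
  show "(\<lambda>p. enn2real (R0 t p)) \<in> borel_measurable CC" using R0_meas[OF t] by measurable
  have "AE \<omega> in PS D. sup_radius D \<rho> 0 t \<omega> < \<top>"
    and "AE \<omega> in PS D. \<forall>y. y \<notin> fat_cube 0 (\<rho> 0 t B \<omega>) \<longrightarrow> A (pert D (insert (0, t) B) \<omega>) y = A (pert D B \<omega>) y"
    using rf t B by (auto simp: radius_family_def action_radius_def)
  then show "AE \<omega> in PS D. Ag (fat_cube 0 (enn2real (R0 t (X \<omega>, X' \<omega>)))) (insert (0, t) B) B (X \<omega>, X' \<omega>)"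
    using AE_space
  proof eventually_elim
    case (elim \<omega>)
    have "ennreal (\<rho> 0 t B \<omega>) \<le> sup_radius D \<rho> 0 t \<omega>"
      unfolding sup_radius_def by (rule SUP_upper) (use B in simp)
    then have "ennreal (\<rho> 0 t B \<omega>) \<le> R0 t (X \<omega>, X' \<omega>)" "R0 t (X \<omega>, X' \<omega>) < \<top>"
      using elim by (simp_all add: R0_eq[OF t])
    then have "\<rho> 0 t B \<omega> \<le> enn2real (R0 t (X \<omega>, X' \<omega>))"
      by (cases "R0 t (X \<omega>, X' \<omega>)") (auto simp: ennreal_le_iff)
    then have "Ag (fat_cube 0 (\<rho> 0 t B \<omega>)) (insert (0, t) B) B (X \<omega>, X' \<omega>) \<Longrightarrow> ?case"
      using Ag_mono fat_cube_mono by blast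
    then show ?case using elim(2) by (simp add: Ag_def pert_def)
  qed
qed

text \<open>The radius at a general site is the translated radius of the origin and not
  \<open>sup_radius\<close> at that site: the weight involves the origin only, and no relation
  between the given radii at different sites is assumed.\<close>

definition Rz :: "nat \<Rightarrow> ('e \<Rightarrow> 'm) \<times> ('e \<Rightarrow> 'm) \<Rightarrow> ennreal" where
  "Rz i p = R0 (et i) (tr2 (ex i) p)"

lemma Rz_meas [measurable]: "Rz i \<in> borel_measurable CC"
  unfolding Rz_def[abs_def] by (rule measurable_compose[OF tr2_meas R0_meas[OF et_Zl]])

lemma Rz_fin: "AE p in PL. Rz i p < \<top>"
  unfolding Rz_def using R0_fin[OF et_Zl, of i]
  by (intro AE_distrD[OF tr2_PL]) (simp only: distr_tr2)

text \<open>The statement at the origin is carried over by the translation, which preserves the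
  joint law; equivariance of A is applied to both fields that are compared.\<close>

lemma site_AE:
  assumes B: "B \<subseteq> sites D" "en i \<notin> B"
  shows "AE p in PL. Ag (fat_cube (ex i) (enn2real (Rz i p))) (insert (en i) B) B p"
proof -
  let ?z = "ex i" and ?t = "et i"
  have iB: "insert (en i) B \<subseteq> sites D" using B en_range by auto
  have s: "shiftB ?z B \<subseteq> sites D" "(0, ?t) \<notin> shiftB ?z B" "shiftB ?z (insert (en i) B) = insert (0, ?t) (shiftB ?z B)"
    using B shiftB_sites by (auto simp: shiftB_def en_pair)
  have "AE p in PL. Ag (fat_cube 0 (enn2real (R0 ?t (tr2 ?z p)))) (insert (0, ?t) (shiftB ?z B)) (shiftB ?z B) (tr2 ?z p)"
    using base_AE[OF et_Zl s(1,2)] by (intro AE_distrD[OF tr2_PL]) (simp only: distr_tr2)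
  with AE_tr_splice[OF B(1), of ?z] AE_tr_splice[OF iB, of ?z] show ?thesis
  proof eventually_elim
    case (elim p)
    show ?case unfolding Ag_def
    proof (intro allI impI)
      fix y assume y: "y \<notin> fat_cube ?z (enn2real (Rz i p))"
      have "y - rvec ?z \<notin> fat_cube 0 (enn2real (R0 ?t (tr2 ?z p)))"
        using y fat_cube_translate[of "y - rvec ?z" ?z 0] by (simp add: Rz_def)
      then have "A (splice D (insert (0, ?t) (shiftB ?z B)) (tr ?z (fst p)) (tr ?z (snd p))) (y - rvec ?z)
        = A (splice D (shiftB ?z B) (tr ?z (fst p)) (tr ?z (snd p))) (y - rvec ?z)"
        using elim(3) by (simp add: Ag_def tr2_def)
      then show "A (splice D (insert (en i) B) (fst p) (snd p)) y = A (splice D B (fst p) (snd p)) y"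
        using elim(1,2) by (simp add: s(3))
    qed
  qed
qed

lemma site_AE_cube:
  assumes B: "B \<subseteq> sites D" "en i \<notin> B"
  shows "AE p in PL. Rz i p < ennreal (real n) \<longrightarrow> Ag (cube (2 * real n + 1) (ex i)) (insert (en i) B) B p"
  using site_AE[OF B]
proof eventually_elim
  case (elim p)
  show ?case
  proof
    assume "Rz i p < ennreal (real n)"
    then have "enn2real (Rz i p) < real n" by (cases "Rz i p") (auto simp: ennreal_less_iff)
    then show "Ag (cube (2 * real n + 1) (ex i)) (insert (en i) B) B p"
      using elim fat_cube_subset Ag_mono by blast
  qed
qed

definition Rn :: "nat \<Rightarrow> (nat \<Rightarrow> 'e \<Rightarrow> 'm) \<times> (nat \<Rightarrow> 'e \<Rightarrow> 'm) \<Rightarrow> ennreal" where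
  "Rn i p = Rz i (glue2 p)"
definition wn :: "nat \<Rightarrow> nat \<Rightarrow> real" where "wn i n = weight D \<rho> (et i) n"
definition m1n :: "real \<Rightarrow> nat \<Rightarrow> nat \<Rightarrow> ennreal" where
  "m1n q i n = abs_moment (PS D) q (deriv1 D \<zeta> (ex i, et i, n))"
definition m2n :: "real \<Rightarrow> nat \<Rightarrow> nat \<Rightarrow> nat \<Rightarrow> nat \<Rightarrow> ennreal" where
  "m2n q i n j n' = abs_moment (PS D) q (deriv2 D \<zeta> (ex i, et i, n) (ex j, et j, n'))"

definition Fs :: "((int ^ 'd) \<times> int list) set \<Rightarrow> ('e \<Rightarrow> 'm) \<times> ('e \<Rightarrow> 'm) \<Rightarrow> real" where
  "Fs B p = F (splice D B (fst p) (snd p))"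

lemma Fs_meas: "B \<subseteq> sites D \<Longrightarrow> Fs B \<in> borel_measurable CC"
  unfolding Fs_def[abs_def] by (rule measurable_compose[OF splice_meas F_meas])

lemma Fs_swapB: "B \<subseteq> sites D \<Longrightarrow> C \<subseteq> sites D \<Longrightarrow> B \<inter> C = {} \<Longrightarrow> Fs C (swapB B p) = Fs (C \<union> B) p"
  by (simp add: Fs_def splice_swapB)

lemma fn_spl: "fn (spl B p) = (Fs (en ` B) (glue2 p) - Zmean D \<zeta>) / \<sigma>"
  by (simp add: fn_def Fs_def glue2_def splice_glue)

lemma Zpert_Fs: "Zpert D \<zeta> B \<omega> = Fs B (X \<omega>, X' \<omega>)"
  by (simp add: Zpert_def Fs_def pert_def F_def)

text \<open>The integrand g contains agreement events and need not be measurable, so the change of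
  variables is made with one-sided inequalities.\<close>

lemma PL_to_PS:
  assumes B: "B \<subseteq> sites D" and k: "AE p in PL. k p \<le> g (swapB B p)"
  shows "(\<integral>\<^sup>+p. k p \<partial>PL) \<le> (\<integral>\<^sup>+\<omega>. g (X \<omega>, X' \<omega>) \<partial>PS D)"
proof -
  have "(\<integral>\<^sup>+p. k p \<partial>PL) \<le> (\<integral>\<^sup>+p. g (swapB B p) \<partial>PL)" by (rule nn_integral_mono_AE[OF k])
  also have "\<dots> \<le> (\<integral>\<^sup>+p. g p \<partial>PL)"
    by (rule nn_integral_involution_le[OF swapB_PL[OF B] distr_swapB[OF B]]) (simp add: space_PL swapB_inv[OF B])
  also have "\<dots> \<le> (\<integral>\<^sup>+\<omega>. g (X \<omega>, X' \<omega>) \<partial>PS D)"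
    unfolding pair_law_def by (rule nn_integral_distr_le) measurable
  finally show ?thesis .
qed

lemma from_glue2:
  assumes "k \<in> borel_measurable CC" "q > 0" and S: "S \<inter> space CC \<in> sets CC"
  shows "(\<integral>\<^sup>+p. ennreal ((\<bar>k (glue2 p)\<bar> / \<sigma>) powr q) * indicator S (glue2 p) \<partial>(C.P \<Otimes>\<^sub>M C.P))
    = ennreal ((1 / \<sigma>) powr q) * (\<integral>\<^sup>+p. ennreal (\<bar>k p\<bar> powr q) * indicator S p \<partial>PL)"
proof -
  note [measurable] = assms(1)
  define S' where "S' = S \<inter> space CC"
  have S'[measurable]: "S' \<in> sets CC" using S by (simp add: S'_def)
  let ?h = "\<lambda>p. ennreal ((\<bar>k p\<bar> / \<sigma>) powr q) * indicator S' p"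
  have h: "?h \<in> borel_measurable CC" by measurable
  have sp: "glue2 p \<in> space CC" if "p \<in> space (C.P \<Otimes>\<^sub>M C.P)" for p
    using that by (rule measurable_space[OF glue2_meas])
  have "(\<integral>\<^sup>+p. ennreal ((\<bar>k (glue2 p)\<bar> / \<sigma>) powr q) * indicator S (glue2 p) \<partial>(C.P \<Otimes>\<^sub>M C.P)) = (\<integral>\<^sup>+p. ?h (glue2 p) \<partial>(C.P \<Otimes>\<^sub>M C.P))"
    by (intro nn_integral_cong) (simp add: indicator_def sp S'_def)
  also have "\<dots> = (\<integral>\<^sup>+p. ?h p \<partial>distr (C.P \<Otimes>\<^sub>M C.P) CC glue2)"
    by (rule nn_integral_distr[OF glue2_meas, symmetric]) (unfold measurable_distr_eq1, rule h)
  also have "\<dots> = (\<integral>\<^sup>+p. ?h p \<partial>PL)" by (simp only: distr_glue2)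
  also have "\<dots> = (\<integral>\<^sup>+p. ennreal ((1 / \<sigma>) powr q) * (ennreal (\<bar>k p\<bar> powr q) * indicator S' p) \<partial>PL)"
    using \<sigma>_pos by (intro nn_integral_cong)
      (simp add: powr_divide ennreal_mult[symmetric] mult.assoc[symmetric])
  also have "\<dots> = ennreal ((1 / \<sigma>) powr q) * (\<integral>\<^sup>+p. ennreal (\<bar>k p\<bar> powr q) * indicator S' p \<partial>PL)"
    by (intro nn_integral_cmult) measurable
  also have "(\<integral>\<^sup>+p. ennreal (\<bar>k p\<bar> powr q) * indicator S' p \<partial>PL) = (\<integral>\<^sup>+p. ennreal (\<bar>k p\<bar> powr q) * indicator S p \<partial>PL)"
    by (intro nn_integral_cong) (simp add: indicator_def space_PL S'_def)
  finally show ?thesis .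
qed

lemma en_sub: "en ` B \<subseteq> sites D" using en_range by auto
lemma en_in: "en i \<in> sites D" using en_range by auto

text \<open>The exchange on the sites of \<open>B\<close> turns the increment at X^B into the
  increment at X, and where the radius is below n the agreement indicator in the discrete derivative
  is 1.\<close>

lemma m1n_bound:
  assumes B: "finite B" "i \<notin> B" and q: "q > 0"
  shows "(\<integral>\<^sup>+p. ennreal (\<bar>fn (spl B p) - fn (spl (insert i B) p)\<bar> powr q)
      * indicator {p. Rn i p < ennreal (real n)} p \<partial>(C.P \<Otimes>\<^sub>M C.P)) \<le> ennreal ((1 / \<sigma>) powr q) * m1n q i n" (is "?L \<le> _")
proof -
  let ?B = "en ` B"
  have iB: "en i \<notin> ?B" using B by auto
  let ?k = "\<lambda>p. Fs ?B p - Fs (insert (en i) ?B) p"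
  let ?S = "{p. Rz i p < ennreal (real n)}"
  let ?g = "\<lambda>p. ennreal (\<bar>(Fs {} p - Fs {en i} p) * of_bool (Ag (cube (2 * real n + 1) (ex i)) {en i} {} p)\<bar> powr q)"
  have km: "?k \<in> borel_measurable CC" using en_sub en_in by (intro borel_measurable_diff Fs_meas) auto
  have "{p \<in> space CC. Rz i p < ennreal (real n)} \<in> sets CC" by measurable
  then have S: "?S \<inter> space CC \<in> sets CC" by (simp add: Int_def conj_commute)
  have "(\<integral>\<^sup>+p. ennreal (\<bar>fn (spl B p) - fn (spl (insert i B) p)\<bar> powr q) * indicator {p. Rn i p < ennreal (real n)} p \<partial>(C.P \<Otimes>\<^sub>M C.P))
     = (\<integral>\<^sup>+p. ennreal ((\<bar>?k (glue2 p)\<bar> / \<sigma>) powr q) * indicator ?S (glue2 p) \<partial>(C.P \<Otimes>\<^sub>M C.P))"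
    using \<sigma>_pos by (intro nn_integral_cong) (simp add: fn_spl Rn_def indicator_def diff_divide_distrib[symmetric] abs_divide)
  also have "\<dots> = ennreal ((1 / \<sigma>) powr q) * (\<integral>\<^sup>+p. ennreal (\<bar>?k p\<bar> powr q) * indicator ?S p \<partial>PL)"
    by (rule from_glue2[OF km q S])
  finally have eq: "?L = ennreal ((1 / \<sigma>) powr q) * (\<integral>\<^sup>+p. ennreal (\<bar>?k p\<bar> powr q) * indicator ?S p \<partial>PL)" .
  have "(\<integral>\<^sup>+p. ennreal (\<bar>?k p\<bar> powr q) * indicator ?S p \<partial>PL) \<le> (\<integral>\<^sup>+\<omega>. ?g (X \<omega>, X' \<omega>) \<partial>PS D)"
  proof (rule PL_to_PS[OF en_sub])
    show "AE p in PL. ennreal (\<bar>?k p\<bar> powr q) * indicator ?S p \<le> ?g (swapB ?B p)"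
      using site_AE_cube[OF en_sub iB, of n]
    proof eventually_elim
      case (elim p)
      have "Fs {} (swapB ?B p) = Fs ?B p" "Fs {en i} (swapB ?B p) = Fs (insert (en i) ?B) p"
        "Ag (cube (2 * real n + 1) (ex i)) {en i} {} (swapB ?B p) = Ag (cube (2 * real n + 1) (ex i)) (insert (en i) ?B) ?B p"
        using en_in[of i] iB Fs_swapB[OF en_sub, of "{}" B p] Fs_swapB[OF en_sub, of "{en i}" B p]
          Ag_swapB[OF en_sub, of "{en i}" "{}" B "cube (2 * real n + 1) (ex i)" p] by auto
      then show ?case using elim by (auto simp: indicator_def)
    qed
  qed
  also have "(\<integral>\<^sup>+\<omega>. ?g (X \<omega>, X' \<omega>) \<partial>PS D) = m1n q i n"
    unfolding m1n_def abs_moment_def deriv1_def by (simp add: Zpert_Fs agree_Ag en_pair)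
  finally show ?thesis unfolding eq by (rule mult_left_mono) simp
qed

text \<open>The four indicators compare fields with and without one site, in the absence and in the
  presence of the other. After the exchange these are agreements for the sets \<open>B\<close>,
  \<open>B\<close> with i and \<open>B\<close> with j, which is where a radius uniform in the
  perturbed set is used.\<close>

lemma m2n_bound:
  assumes B: "finite B" "i \<notin> B" "j \<notin> B" "i \<noteq> j" and q: "q > 0"
  shows "(\<integral>\<^sup>+p. ennreal (\<bar>fn (spl B p) - fn (spl (insert i B) p) - fn (spl (insert j B) p)
        + fn (spl (insert i (insert j B)) p)\<bar> powr q)
      * indicator {p. Rn i p < ennreal (real n) \<and> Rn j p < ennreal (real n')} p \<partial>(C.P \<Otimes>\<^sub>M C.P))
      \<le> ennreal ((1 / \<sigma>) powr q) * m2n q i n j n'" (is "?L \<le> _")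
proof -
  let ?B = "en ` B"
  let ?a = "en i" and ?b = "en j"
  have iB: "?a \<notin> ?B" "?b \<notin> ?B" "?a \<noteq> ?b" "?a \<notin> insert ?b ?B" "?b \<notin> insert ?a ?B" using B by auto
  have sub: "insert ?b ?B \<subseteq> sites D" "insert ?a ?B \<subseteq> sites D" using en_sub en_in by auto
  let ?k = "\<lambda>p. Fs ?B p - Fs (insert ?a ?B) p - Fs (insert ?b ?B) p + Fs (insert ?a (insert ?b ?B)) p"
  let ?S = "{p. Rz i p < ennreal (real n) \<and> Rz j p < ennreal (real n')}"
  let ?ci = "cube (2 * real n + 1) (ex i)" and ?cj = "cube (2 * real n' + 1) (ex j)"
  let ?g = "\<lambda>p. ennreal (\<bar>(Fs {} p - Fs {?a} p - Fs {?b} p + Fs {?a, ?b} p)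
      * of_bool (Ag ?ci {?a} {} p) * of_bool (Ag ?ci {?a, ?b} {?b} p)
      * of_bool (Ag ?cj {?b} {} p) * of_bool (Ag ?cj {?a, ?b} {?a} p)\<bar> powr q)"
  have km: "?k \<in> borel_measurable CC"
    using en_sub en_in by (intro borel_measurable_diff borel_measurable_add Fs_meas) auto
  have "{p \<in> space CC. Rz i p < ennreal (real n) \<and> Rz j p < ennreal (real n')} \<in> sets CC" by measurable
  then have S: "?S \<inter> space CC \<in> sets CC" by (simp add: Int_def conj_ac)
  have "(\<integral>\<^sup>+p. ennreal (\<bar>fn (spl B p) - fn (spl (insert i B) p) - fn (spl (insert j B) p)
        + fn (spl (insert i (insert j B)) p)\<bar> powr q)
      * indicator {p. Rn i p < ennreal (real n) \<and> Rn j p < ennreal (real n')} p \<partial>(C.P \<Otimes>\<^sub>M C.P))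
     = (\<integral>\<^sup>+p. ennreal ((\<bar>?k (glue2 p)\<bar> / \<sigma>) powr q) * indicator ?S (glue2 p) \<partial>(C.P \<Otimes>\<^sub>M C.P))"
  proof (intro nn_integral_cong)
    fix p
    have "fn (spl B p) - fn (spl (insert i B) p) - fn (spl (insert j B) p) + fn (spl (insert i (insert j B)) p) = ?k (glue2 p) / \<sigma>"
      by (simp add: fn_spl diff_divide_distrib add_divide_distrib)
    then have "\<bar>fn (spl B p) - fn (spl (insert i B) p) - fn (spl (insert j B) p) + fn (spl (insert i (insert j B)) p)\<bar> = \<bar>?k (glue2 p)\<bar> / \<sigma>"
      using \<sigma>_pos by (simp only: abs_divide abs_of_pos)
    then show "ennreal (\<bar>fn (spl B p) - fn (spl (insert i B) p) - fn (spl (insert j B) p)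
        + fn (spl (insert i (insert j B)) p)\<bar> powr q)
      * indicator {p. Rn i p < ennreal (real n) \<and> Rn j p < ennreal (real n')} p = ennreal ((\<bar>?k (glue2 p)\<bar> / \<sigma>) powr q) * indicator ?S (glue2 p)"
      by (simp only: Rn_def indicator_def mem_Collect_eq)
  qed
  also have "\<dots> = ennreal ((1 / \<sigma>) powr q) * (\<integral>\<^sup>+p. ennreal (\<bar>?k p\<bar> powr q) * indicator ?S p \<partial>PL)"
    by (rule from_glue2[OF km q S])
  finally have eq: "?L = ennreal ((1 / \<sigma>) powr q) * (\<integral>\<^sup>+p. ennreal (\<bar>?k p\<bar> powr q) * indicator ?S p \<partial>PL)" .
  have "(\<integral>\<^sup>+p. ennreal (\<bar>?k p\<bar> powr q) * indicator ?S p \<partial>PL) \<le> (\<integral>\<^sup>+\<omega>. ?g (X \<omega>, X' \<omega>) \<partial>PS D)"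
  proof (rule PL_to_PS[OF en_sub])
    show "AE p in PL. ennreal (\<bar>?k p\<bar> powr q) * indicator ?S p \<le> ?g (swapB ?B p)"
      using site_AE_cube[OF en_sub iB(1), of n] site_AE_cube[OF en_sub iB(2), of n']
        site_AE_cube[OF sub(1) iB(4), of n] site_AE_cube[OF sub(2) iB(5), of n']
    proof eventually_elim
      case (elim p)
      have ab: "{?a} \<subseteq> sites D" "{?b} \<subseteq> sites D" "{?a, ?b} \<subseteq> sites D" "{} \<subseteq> sites D"
        "?B \<inter> {?a} = {}" "?B \<inter> {?b} = {}" "?B \<inter> {?a, ?b} = {}" "?B \<inter> {} = {}"
        using en_in iB by auto
      note F = Fs_swapB[OF en_sub ab(4,8)] Fs_swapB[OF en_sub ab(1,5)] Fs_swapB[OF en_sub ab(2,6)] Fs_swapB[OF en_sub ab(3,7)]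
      note G = Ag_swapB[OF en_sub ab(1,4,5,8)] Ag_swapB[OF en_sub ab(3,2,7,6)] Ag_swapB[OF en_sub ab(2,4,6,8)] Ag_swapB[OF en_sub ab(3,1,7,5)]
      show ?case
      proof (cases "p \<in> ?S")
        case True
        then have "Ag ?ci (insert ?a ?B) ?B p" "Ag ?cj (insert ?b ?B) ?B p" "Ag ?ci (insert ?a (insert ?b ?B)) (insert ?b ?B) p"
          "Ag ?cj (insert ?a (insert ?b ?B)) (insert ?a ?B) p"
          using elim by (auto simp: insert_commute)
        then show ?thesis using True by (simp add: F G)
      qed simp
    qed
  qed
  also have "(\<integral>\<^sup>+\<omega>. ?g (X \<omega>, X' \<omega>) \<partial>PS D) = m2n q i n j n'"
    unfolding m2n_def abs_moment_def deriv2_def by (simp add: Zpert_Fs agree_Ag en_pair)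
  finally show ?thesis unfolding eq by (rule mult_left_mono) simp
qed

lemma restrict_glue: "x \<in> space C.P \<Longrightarrow> restrict (glue x) (cl i) = x i"
proof
  fix e assume x: "x \<in> space C.P"
  then have "x i \<in> space (Mc i)" by (auto simp: C.P_def space_PiM)
  then have "x i \<in> extensional (cl i)" by (simp add: Mc_def space_PiM PiE_iff)
  then show "restrict (glue x) (cl i) e = x i e"
    using cl_sub[of i] num_eq[of e i] by (auto simp: glue_def extensional_def)
qed

text \<open>Translation moves the site to the origin, where the weight is defined. Positive
  influence forces the two cell restrictions to differ, so X differs from its perturbation; this
  inclusion of events gives an inequality.\<close>

lemma wn_bound:
  "measure (C.P \<Otimes>\<^sub>M C.P) {p \<in> space (C.P \<Otimes>\<^sub>M C.P).
     ennreal (real n - 1) \<le> Rn i p \<and> Rn i p < ennreal (real n) \<and> cf.hit i (fst p i, snd p i)} \<le> wn i n"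
proof -
  let ?z = "ex i" and ?t = "et i"
  let ?rs = "\<lambda>p. (restrict (fst p) (cl i), restrict (snd p) (cl i))"
  let ?S = "{p \<in> space CC. ennreal (real n - 1) \<le> Rz i p \<and> Rz i p < ennreal (real n) \<and> cf.hit i (?rs p)}"
  have "?rs \<in> CC \<rightarrow>\<^sub>M PiM (cl i) (\<lambda>_. valM D) \<Otimes>\<^sub>M PiM (cl i) (\<lambda>_. valM D)"
    using measurable_compose[OF measurable_fst restr_meas[OF cl_sub]] measurable_compose[OF measurable_snd restr_meas[OF cl_sub]]
    by (rule measurable_Pair)
  then have rs: "?rs \<in> CC \<rightarrow>\<^sub>M Mc i \<Otimes>\<^sub>M Mc i"
    by (simp add: sets_Mc cong: measurable_cong_sets sets_pair_measure_cong)
  have [measurable]: "Measurable.pred CC (\<lambda>p. cf.hit i (?rs p))"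
    by (rule measurable_compose[OF rs cf.hit_measurable])
  have S: "?S \<in> sets CC" by measurable
  then have S': "?S \<in> sets PL" by simp
  have "{p \<in> space (C.P \<Otimes>\<^sub>M C.P). ennreal (real n - 1) \<le> Rn i p \<and> Rn i p < ennreal (real n) \<and> cf.hit i (fst p i, snd p i)}
     = glue2 -` ?S \<inter> space (C.P \<Otimes>\<^sub>M C.P)"
    using measurable_space[OF glue2_meas] by (auto simp: Rn_def glue2_def restrict_glue space_pair_measure)
  then have "measure (C.P \<Otimes>\<^sub>M C.P) {p \<in> space (C.P \<Otimes>\<^sub>M C.P).
     ennreal (real n - 1) \<le> Rn i p \<and> Rn i p < ennreal (real n) \<and> cf.hit i (fst p i, snd p i)} = measure PL ?S"
    using measure_distr[OF glue2_meas S] by (simp add: distr_glue2)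
  also have "measure PL ?S = measure (distr PL PL (tr2 (- ?z))) ?S" by (simp only: distr_tr2)
  also have "\<dots> = measure PL (tr2 (- ?z) -` ?S \<inter> space PL)" by (rule measure_distr[OF tr2_PL S'])
  also have "\<dots> = measure (distr (PS D) PL (\<lambda>\<omega>. (X \<omega>, X' \<omega>))) (tr2 (- ?z) -` ?S \<inter> space PL)" by (simp only: distr_XX)
  also have "\<dots> = measure (PS D) ((\<lambda>\<omega>. (X \<omega>, X' \<omega>)) -` (tr2 (- ?z) -` ?S \<inter> space PL) \<inter> space (PS D))"
    by (rule measure_distr[OF XX_PL]) (rule measurable_sets[OF tr2_PL S'])
  also have "\<dots> \<le> wn i n"
    unfolding wn_def weight_def
  proof (rule PSp.finite_measure_mono)
    have [measurable]: "(\<lambda>\<omega>. R0 ?t (X \<omega>, X' \<omega>)) \<in> borel_measurable (PS D)"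
      by (rule measurable_compose[OF XX_meas R0_meas[OF et_Zl]])
    have N: "{\<omega> \<in> space (PS D). X \<omega> \<noteq> pert D {(0, ?t)} \<omega>} \<in> sets (PS D)"
      using parts(6) et_Zl unfolding measurable_events_def by blast
    have N1: "{\<omega> \<in> space (PS D). ennreal (real n - 1) \<le> R0 ?t (X \<omega>, X' \<omega>) \<and> R0 ?t (X \<omega>, X' \<omega>) < ennreal (real n)} \<in> sets (PS D)"
      by measurable
    have "{\<omega> \<in> space (PS D). ennreal (real n - 1) \<le> R0 ?t (X \<omega>, X' \<omega>) \<and> R0 ?t (X \<omega>, X' \<omega>) < ennreal (real n)}
       \<inter> {\<omega> \<in> space (PS D). X \<omega> \<noteq> pert D {(0, ?t)} \<omega>} \<in> sets (PS D)"
      by (rule sets.Int[OF N1 N])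
    also have "{\<omega> \<in> space (PS D). ennreal (real n - 1) \<le> R0 ?t (X \<omega>, X' \<omega>) \<and> R0 ?t (X \<omega>, X' \<omega>) < ennreal (real n)}
       \<inter> {\<omega> \<in> space (PS D). X \<omega> \<noteq> pert D {(0, ?t)} \<omega>} = {\<omega> \<in> space (PS D). ennreal (real n - 1) \<le> sup_radius D \<rho> 0 ?t \<omega> \<and>
        sup_radius D \<rho> 0 ?t \<omega> < ennreal (real n) \<and> X \<omega> \<noteq> pert D {(0, ?t)} \<omega>}"
      by (auto simp: R0_eq[OF et_Zl])
    finally show "{\<omega> \<in> space (PS D). ennreal (real n - 1) \<le> sup_radius D \<rho> 0 ?t \<omega> \<and>
        sup_radius D \<rho> 0 ?t \<omega> < ennreal (real n) \<and> X \<omega> \<noteq> pert D {(0, ?t)} \<omega>} \<in> sets (PS D)" .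
    show "(\<lambda>\<omega>. (X \<omega>, X' \<omega>)) -` (tr2 (- ?z) -` ?S \<inter> space PL) \<inter> space (PS D) \<subseteq> {\<omega> \<in> space (PS D). ennreal (real n - 1) \<le> sup_radius D \<rho> 0 ?t \<omega> \<and>
        sup_radius D \<rho> 0 ?t \<omega> < ennreal (real n) \<and> X \<omega> \<noteq> pert D {(0, ?t)} \<omega>}"
    proof
      fix \<omega> assume "\<omega> \<in> (\<lambda>\<omega>. (X \<omega>, X' \<omega>)) -` (tr2 (- ?z) -` ?S \<inter> space PL) \<inter> space (PS D)"
      then have w: "\<omega> \<in> space (PS D)" and h: "tr2 (- ?z) (X \<omega>, X' \<omega>) \<in> ?S" by auto
      have c: "(X \<omega>, X' \<omega>) \<in> space CC" using w by (rule measurable_space[OF XX_meas])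
      have R: "Rz i (tr2 (- ?z) (X \<omega>, X' \<omega>)) = sup_radius D \<rho> 0 ?t \<omega>"
        by (simp add: Rz_def tr2_inv[OF c] R0_eq[OF et_Zl w])
      have "restrict (tr (- ?z) (X \<omega>)) (cl i) \<noteq> restrict (tr (- ?z) (X' \<omega>)) (cl i)"
        using h by (auto simp: tr2_def dest: cf.hit_neq)
      then obtain e where e: "e \<in> cl i" "tr (- ?z) (X \<omega>) e \<noteq> tr (- ?z) (X' \<omega>) e"
        by (metis restrict_ext)
      then have eE: "e \<in> E" using cl_sub by blast
      let ?e = "shift D (- ?z) e"
      \<comment> \<open>The shift by minus \<open>ex i\<close> carries the cell of site i to the
        cell of the origin, where the perturbation is made.\<close>
      have "?e \<in> cell D (?z + - ?z) ?t" using e(1) by (intro shift_cell[OF et_Zl]) (simp add: cl_def)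
      then have e0: "?e \<in> cell D 0 ?t" by simp
      have "X \<omega> ?e \<noteq> X' \<omega> ?e" using e(2) eE by (simp add: translate_def)
      moreover have "pert D {(0, ?t)} \<omega> ?e = X' \<omega> ?e" using e0 by (simp add: pert_def splice_def)
      ultimately have "X \<omega> \<noteq> pert D {(0, ?t)} \<omega>" by metis
      then show "\<omega> \<in> {\<omega> \<in> space (PS D). ennreal (real n - 1) \<le> sup_radius D \<rho> 0 ?t \<omega> \<and>
        sup_radius D \<rho> 0 ?t \<omega> < ennreal (real n) \<and> X \<omega> \<noteq> pert D {(0, ?t)} \<omega>}"
        using w h R by simp
    qed
  qed
  finally show ?thesis .
qed

sublocale ms: multiscale Mc fn Rn wn m1n m2n "1 / \<sigma>"
proof (unfold_locales)
  show "1 / \<sigma> > 0" using \<sigma>_pos by simp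
  show "Rn i \<in> borel_measurable (C.P \<Otimes>\<^sub>M C.P)" for i
    unfolding Rn_def[abs_def] by (rule measurable_compose[OF glue2_meas Rz_meas])
  show "AE p in C.P \<Otimes>\<^sub>M C.P. Rn i p < \<top>" for i
    unfolding Rn_def using Rz_fin[of i] by (intro AE_distrD[OF glue2_meas]) (simp only: distr_glue2)
qed (fact wn_bound m1n_bound m2n_bound)+

end

section \<open>Sums over sites\<close>

text \<open>For c > 0 and finite x one subtracts x and divides by c. Otherwise x is infinite, which
  is trivial, or \<open>ennreal c\<close> is 0 and one index of \<open>I\<close> gives the
  claim.\<close>

lemma le_add_mult_INF:
  fixes f :: "'i \<Rightarrow> ennreal"
  assumes "I \<noteq> {}" "\<And>l. l \<in> I \<Longrightarrow> d \<le> x + ennreal c * f l"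
  shows "d \<le> x + ennreal c * (INF l\<in>I. f l)"
proof (cases "c > 0 \<and> x < \<top>")
  case True
  then have c: "ennreal c * (ennreal (1 / c) * y) = y" for y
    by (simp add: mult.assoc[symmetric] ennreal_mult''[symmetric])
  have c': "ennreal (1 / c) * (ennreal c * y) = y" for y
    using c[of y] by (simp add: mult.left_commute)
  have "ennreal (1 / c) * (d - x) \<le> f l" if "l \<in> I" for l
  proof -
    have "d - x \<le> ennreal c * f l" using assms(2)[OF that] True by (auto simp: ennreal_minus_le_iff)
    then have "ennreal (1 / c) * (d - x) \<le> ennreal (1 / c) * (ennreal c * f l)" by (rule mult_left_mono) simp
    then show ?thesis by (simp only: c')
  qed
  then have "ennreal (1 / c) * (d - x) \<le> (INF l\<in>I. f l)" by (rule INF_greatest)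
  then have "ennreal c * (ennreal (1 / c) * (d - x)) \<le> ennreal c * (INF l\<in>I. f l)" by (rule mult_left_mono) simp
  then have "d - x \<le> ennreal c * (INF l\<in>I. f l)" by (simp only: c)
  then show ?thesis using True by (simp add: ennreal_minus_le_iff)
next
  case False
  then show ?thesis using assms by (auto simp: ennreal_neg top.not_eq_extremum[symmetric])
qed

lemma count_space_nested:
  "(\<integral>\<^sup>+i. (\<integral>\<^sup>+x. F i x \<partial>count_space UNIV) \<partial>count_space UNIV) = (\<integral>\<^sup>+(i, x). F i x \<partial>count_space UNIV)"
  for F :: "'b \<Rightarrow> 'c \<Rightarrow> ennreal"
  using nn_integral_fst_count_space[of "\<lambda>(i, x). F i x"] by simp

context field_functional
begin

definition ix :: "nat \<Rightarrow> nat \<Rightarrow> (int ^ 'd) \<times> int list \<times> nat" where "ix i l = (ex i, et i, l)"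

lemma ix_eq [simp]: "ix i l = ix j l' \<longleftrightarrow> i = j \<and> l = l'"
  unfolding ix_def using en_eq[of i j] unfolding en_pair by blast

lemma in_idx: "p \<in> UNIV \<times> Zl D \<times> UNIV \<Longrightarrow> snd (snd p) \<noteq> 0 \<Longrightarrow> p \<in> idx D"
  by (auto simp: idx_def)

lemma idx_in: "p \<in> idx D \<Longrightarrow> p \<in> UNIV \<times> Zl D \<times> UNIV" by (auto simp: idx_def)

text \<open>Scales are enumerated from 0, whereas \<open>idx\<close> starts at 1. The summands to
  which this is applied vanish at scale 0, since no radius is below 0 and the weight there is
  0.\<close>

lemma sums_le_infsum1:
  fixes g :: "_ \<Rightarrow> ennreal"
  assumes "\<And>p. snd (snd p) = 0 \<Longrightarrow> g p = 0"
  shows "(\<Sum>i. \<Sum>l. g (ix i l)) \<le> infsum g (idx D)"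
proof -
  let ?I = "UNIV \<times> Zl D \<times> UNIV :: ((int ^ 'd) \<times> int list \<times> nat) set"
  have "(\<Sum>i. \<Sum>l. g (ix i l)) = (\<integral>\<^sup>+p. g (case p of (i, l) \<Rightarrow> ix i l) \<partial>count_space UNIV)"
    by (simp only: nn_integral_count_space_nat[symmetric] count_space_nested) (simp add: split_beta')
  also have "\<dots> \<le> infsum g ?I"
  proof (rule suminf_le_infsum)
    show "range (\<lambda>p. case p of (i, l) \<Rightarrow> ix i l) \<subseteq> ?I" by (auto simp: ix_def et_Zl)
  qed (auto intro!: injI)
  also have "\<dots> = infsum g (idx D)"
    by (rule infsum_cong_neutral) (use assms in_idx idx_in in \<open>blast+\<close>)
  finally show ?thesis .
qed

lemma sums_le_infsum2:
  fixes g :: "_ \<Rightarrow> ennreal"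
  assumes "\<And>p q. snd (snd p) = 0 \<or> snd (snd q) = 0 \<Longrightarrow> g (p, q) = 0"
  shows "(\<Sum>i. \<Sum>j. \<Sum>l. \<Sum>l'. g (ix i l, ix j l')) \<le> infsum g (idx D \<times> idx D)"
proof -
  let ?I = "UNIV \<times> Zl D \<times> UNIV :: ((int ^ 'd) \<times> int list \<times> nat) set"
  let ?h = "\<lambda>p. case p of (i, j, l, l') \<Rightarrow> (ix i l, ix j l')"
  have "(\<Sum>i. \<Sum>j. \<Sum>l. \<Sum>l'. g (ix i l, ix j l')) = (\<integral>\<^sup>+p. g (?h p) \<partial>count_space UNIV)"
    by (simp only: nn_integral_count_space_nat[symmetric] count_space_nested) (simp add: split_beta')
  also have "\<dots> \<le> infsum g (?I \<times> ?I)"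
  proof (rule suminf_le_infsum)
    show "range ?h \<subseteq> ?I \<times> ?I" by (auto simp: ix_def et_Zl)
  qed (auto intro!: injI)
  also have "\<dots> = infsum g (idx D \<times> idx D)"
  proof (rule infsum_cong_neutral)
    fix p assume "p \<in> ?I \<times> ?I - idx D \<times> idx D"
    then show "g p = 0" using assms in_idx by (cases p) blast
  qed (use idx_in in blast)+
  finally show ?thesis .
qed

lemma sums_le_infsum3:
  fixes g :: "_ \<Rightarrow> ennreal"
  assumes "\<And>p q r. snd (snd p) = 0 \<or> snd (snd q) = 0 \<or> snd (snd r) = 0 \<Longrightarrow> g (p, q, r) = 0"
  shows "(\<Sum>i. \<Sum>j. \<Sum>k. \<Sum>l. \<Sum>l'. \<Sum>l''. g (ix i l, ix j l', ix k l'')) \<le> infsum g (idx D \<times> idx D \<times> idx D)"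
proof -
  let ?I = "UNIV \<times> Zl D \<times> UNIV :: ((int ^ 'd) \<times> int list \<times> nat) set"
  let ?h = "\<lambda>p. case p of (i, j, k, l, l', l'') \<Rightarrow> (ix i l, ix j l', ix k l'')"
  have "(\<Sum>i. \<Sum>j. \<Sum>k. \<Sum>l. \<Sum>l'. \<Sum>l''. g (ix i l, ix j l', ix k l'')) = (\<integral>\<^sup>+p. g (?h p) \<partial>count_space UNIV)"
    by (simp only: nn_integral_count_space_nat[symmetric] count_space_nested) (simp add: split_beta')
  also have "\<dots> \<le> infsum g (?I \<times> ?I \<times> ?I)"
  proof (rule suminf_le_infsum)
    show "range ?h \<subseteq> ?I \<times> ?I \<times> ?I" by (auto simp: ix_def et_Zl)
  qed (auto intro!: injI)
  also have "\<dots> = infsum g (idx D \<times> idx D \<times> idx D)"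
  proof (rule infsum_cong_neutral)
    fix p assume "p \<in> ?I \<times> ?I \<times> ?I - idx D \<times> idx D \<times> idx D"
    then show "g p = 0" using assms in_idx by (cases p) blast
  qed (use idx_in in blast)+
  finally show ?thesis .
qed

end

context radii
begin

lemma weight_0: "weight D \<rho> t 0 = 0"
  by (simp add: weight_def)

lemma idx_weight_0: "snd (snd p) = 0 \<Longrightarrow> idx_weight D \<rho> p = 0"
  by (cases p) (simp add: idx_weight_def weight_0)

lemma ix_unfold: "wn i l = idx_weight D \<rho> (ix i l)" "m1n q i l = abs_moment (PS D) q (deriv1 D \<zeta> (ix i l))"
  "m2n q i l j l' = abs_moment (PS D) q (deriv2 D \<zeta> (ix i l) (ix j l'))"
  by (simp_all add: ix_def wn_def m1n_def m2n_def idx_weight_def)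

definition t1 :: "real \<Rightarrow> real \<Rightarrow> _ \<Rightarrow> ennreal" where "t1 \<theta> lam = (\<lambda>(i, i', i'').
           ennreal ((idx_weight D \<rho> i powr \<theta> * idx_weight D \<rho> i' powr \<theta>
                       * idx_weight D \<rho> i'' powr \<theta>) powr lam)
           * epowr (abs_moment (PS D) (4 / (1 - lam)) (deriv2 D \<zeta> i i')) ((1 - lam) / 4)
           * epowr (abs_moment (PS D) (4 / (1 - lam)) (deriv2 D \<zeta> i i'')) ((1 - lam) / 4)
           * epowr (abs_moment (PS D) (4 / (1 - lam)) (deriv1 D \<zeta> i')) ((1 - lam) / 4)
           * epowr (abs_moment (PS D) (4 / (1 - lam)) (deriv1 D \<zeta> i'')) ((1 - lam) / 4))"

definition t2 :: "real \<Rightarrow> real \<Rightarrow> _ \<Rightarrow> ennreal" where "t2 \<theta> lam = (\<lambda>(i, i').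
           ennreal ((idx_weight D \<rho> i powr \<theta> * idx_weight D \<rho> i' powr \<theta>) powr lam)
           * epowr (abs_moment (PS D) (4 / (1 - lam)) (deriv2 D \<zeta> i i')) ((1 - lam) / 2)
           * epowr (abs_moment (PS D) (4 / (1 - lam)) (deriv1 D \<zeta> i')) ((1 - lam) / 2))"

definition b34 :: "real \<Rightarrow> real \<Rightarrow> real \<Rightarrow> ennreal" where "b34 q a lam =
        (\<Sum>\<^sub>\<infinity>i\<in>idx D. ennreal (idx_weight D \<rho> i powr lam)
           * epowr (abs_moment (PS D) (q / (1 - lam)) (deriv1 D \<zeta> i)) ((1 - lam) / a))"

definition b5 :: "real \<Rightarrow> ennreal" where "b5 lam = (\<Sum>\<^sub>\<infinity>(x, t)\<in>sites D. epowr
          (\<Sum>\<^sub>\<infinity>n\<in>{1..}. ennreal (weight D \<rho> t n powr lam)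
             * epowr (abs_moment (PS D) (6 / (1 - lam)) (deriv1 D \<zeta> (x, t, n))) (1 - lam))
          (1 / 2))"

lemma S1s_le: "ms.S1s \<theta> lam \<le> infsum (t1 \<theta> lam) (idx D \<times> idx D \<times> idx D)"
proof -
  have "(\<Sum>i. \<Sum>j. \<Sum>k. \<Sum>l. \<Sum>l'. \<Sum>l''. t1 \<theta> lam (ix i l, ix j l', ix k l'')) \<le> infsum (t1 \<theta> lam) (idx D \<times> idx D \<times> idx D)"
    by (rule sums_le_infsum3) (auto simp: t1_def idx_weight_0)
  then show ?thesis by (simp add: t1_def ms.S1s_def ms.g1_def ms.mm1_def ms.mm2_def ix_unfold)
qed

lemma S2s_le: "ms.S2s \<theta> lam \<le> infsum (t2 \<theta> lam) (idx D \<times> idx D)"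
proof -
  have "(\<Sum>i. \<Sum>j. \<Sum>l. \<Sum>l'. t2 \<theta> lam (ix i l, ix j l')) \<le> infsum (t2 \<theta> lam) (idx D \<times> idx D)"
    by (rule sums_le_infsum2) (auto simp: t2_def idx_weight_0)
  then show ?thesis by (simp add: t2_def ms.S2s_def ms.g2_def ix_unfold)
qed

lemma h_le: "(\<Sum>i. \<Sum>l. ennreal (wn i l powr lam) * epowr (m1n (q / (1 - lam)) i l) ((1 - lam) / a)) \<le> b34 q a lam"
  unfolding b34_def ix_unfold by (rule sums_le_infsum1) (simp add: idx_weight_0)

lemma G1s_le: "ms.G1s lam \<le> b5 lam"
proof -
  let ?k = "\<lambda>(x, t). epowr (\<Sum>\<^sub>\<infinity>n\<in>{1..}. ennreal (weight D \<rho> t n powr lam)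
             * epowr (abs_moment (PS D) (6 / (1 - lam)) (deriv1 D \<zeta> (x, t, n))) (1 - lam)) (1 / 2)"
  have "epowr (ms.h 6 lam i) (1/2) \<le> ?k (en i)" for i
  proof -
    let ?g = "\<lambda>n. ennreal (weight D \<rho> (et i) n powr lam)
             * epowr (abs_moment (PS D) (6 / (1 - lam)) (deriv1 D \<zeta> (ex i, et i, n))) (1 - lam)"
    have "ms.h 6 lam i = (\<integral>\<^sup>+n. ?g (id n) \<partial>count_space UNIV)"
      by (simp add: ms.h_def wn_def m1n_def nn_integral_count_space_nat)
    also have "\<dots> \<le> infsum ?g UNIV" by (rule suminf_le_infsum) auto
    also have "\<dots> = infsum ?g {1..}"
      by (rule infsum_cong_neutral) (auto simp: weight_0 not_le)
    finally show ?thesis by (simp add: en_pair epowr_mono)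
  qed
  then have "ms.G1s lam \<le> (\<Sum>i. ?k (en i))" unfolding ms.G1s_def by (intro suminf_le) auto
  also have "\<dots> = (\<integral>\<^sup>+i. ?k (en i) \<partial>count_space UNIV)" by (rule nn_integral_count_space_nat[symmetric])
  also have "\<dots> \<le> infsum ?k (sites D)" by (rule suminf_le_infsum) (use en_inj en_range in auto)
  finally show ?thesis by (simp add: b5_def)
qed

end

text \<open>The five infima have independent parameters and are pulled out one at a time; the sum is
  rotated so that the next one stands last.\<close>

lemma le_sum_INF:
  fixes f1 f2 f3 f4 f5 :: "'i \<Rightarrow> ennreal"
  assumes I: "I \<noteq> {}"
    and le: "\<And>l1 l2 l3 l4 l5. l1 \<in> I \<Longrightarrow> l2 \<in> I \<Longrightarrow> l3 \<in> I \<Longrightarrow> l4 \<in> I \<Longrightarrow> l5 \<in> I \<Longrightarrow>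
      d \<le> ennreal c * (ennreal k1 * f1 l1 + ennreal k2 * f2 l2 + ennreal k3 * f3 l3 + ennreal k4 * f4 l4 + ennreal k5 * f5 l5)"
    and c: "c > 0"
  shows "d \<le> ennreal c * (ennreal k1 * (INF l\<in>I. f1 l) + ennreal k2 * (INF l\<in>I. f2 l) + ennreal k3 * (INF l\<in>I. f3 l)
      + ennreal k4 * (INF l\<in>I. f4 l) + ennreal k5 * (INF l\<in>I. f5 l))"
proof -
  define d' where "d' = ennreal (1 / c) * d"
  have cc: "ennreal c * (ennreal (1 / c) * y) = y" for y
    using c by (simp add: mult.assoc[symmetric] ennreal_mult''[symmetric])
  have iff: "d \<le> ennreal c * y \<longleftrightarrow> d' \<le> y" for y
  proof
    assume "d \<le> ennreal c * y"
    then have "d' \<le> ennreal (1 / c) * (ennreal c * y)" unfolding d'_def by (rule mult_left_mono) simp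
    then show "d' \<le> y" using cc[of y] by (simp add: mult.left_commute)
  next
    assume "d' \<le> y"
    then have "ennreal c * d' \<le> ennreal c * y" by (rule mult_left_mono) simp
    then show "d \<le> ennreal c * y" by (simp only: d'_def cc)
  qed
  note le' = le[unfolded iff]
  have 1: "d' \<le> ennreal k1 * f1 l1 + ennreal k2 * f2 l2 + ennreal k3 * f3 l3 + ennreal k4 * f4 l4 + ennreal k5 * (INF l\<in>I. f5 l)"
    if "l1 \<in> I" "l2 \<in> I" "l3 \<in> I" "l4 \<in> I" for l1 l2 l3 l4
    by (rule le_add_mult_INF[OF I]) (rule le'[OF that])
  have 2: "d' \<le> ennreal k1 * f1 l1 + ennreal k2 * f2 l2 + ennreal k3 * f3 l3 + ennreal k5 * (INF l\<in>I. f5 l) + ennreal k4 * (INF l\<in>I. f4 l)"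
    if "l1 \<in> I" "l2 \<in> I" "l3 \<in> I" for l1 l2 l3
    by (rule le_add_mult_INF[OF I]) (use 1[OF that] in \<open>simp add: ac_simps\<close>)
  have 3: "d' \<le> ennreal k1 * f1 l1 + ennreal k2 * f2 l2 + ennreal k4 * (INF l\<in>I. f4 l) + ennreal k5 * (INF l\<in>I. f5 l) + ennreal k3 * (INF l\<in>I. f3 l)"
    if "l1 \<in> I" "l2 \<in> I" for l1 l2
    by (rule le_add_mult_INF[OF I]) (use 2[OF that] in \<open>simp add: ac_simps\<close>)
  have 4: "d' \<le> ennreal k1 * f1 l1 + ennreal k3 * (INF l\<in>I. f3 l) + ennreal k4 * (INF l\<in>I. f4 l) + ennreal k5 * (INF l\<in>I. f5 l) + ennreal k2 * (INF l\<in>I. f2 l)"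
    if "l1 \<in> I" for l1
    by (rule le_add_mult_INF[OF I]) (use 3[OF that] in \<open>simp add: ac_simps\<close>)
  have "d' \<le> ennreal k2 * (INF l\<in>I. f2 l) + ennreal k3 * (INF l\<in>I. f3 l) + ennreal k4 * (INF l\<in>I. f4 l) + ennreal k5 * (INF l\<in>I. f5 l) + ennreal k1 * (INF l\<in>I. f1 l)"
    by (rule le_add_mult_INF[OF I]) (use 4 in \<open>simp add: ac_simps\<close>)
  then show ?thesis unfolding iff by (simp add: ac_simps)
qed

context radii
begin

lemma S_eq:
  "S1 D \<rho> \<zeta> \<theta> = ennreal (1 / \<sigma> ^ 2) * (INF lam\<in>{0<..<1}. epowr (infsum (t1 \<theta> lam) (idx D \<times> idx D \<times> idx D)) (1/2))"
  "S2 D \<rho> \<zeta> \<theta> = ennreal (1 / \<sigma> ^ 2) * (INF lam\<in>{0<..<1}. epowr (infsum (t2 \<theta> lam) (idx D \<times> idx D)) (1/2))"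
  "S3 D \<rho> \<zeta> = ennreal (1 / \<sigma> ^ 2) * (INF lam\<in>{0<..<1}. epowr (b34 4 1 lam) (1/2))"
  "S4 D \<rho> \<zeta> = ennreal (1 / \<sigma> ^ 3) * (INF lam\<in>{0<..<1}. b34 3 1 lam)"
  "G1 D \<rho> \<zeta> = ennreal (1 / \<sigma> ^ 3) * (INF lam\<in>{0<..<1}. b5 lam)"
  "G2 D \<rho> \<zeta> = ennreal (1 / \<sigma> ^ 3) * (INF lam\<in>{0<..<1}. b34 6 2 lam)"
  by (simp_all add: S1_def S2_def S3_def S4_def G1_def G2_def t1_def t2_def b34_def b5_def)

lemma terms_le:
  "ms.rt (ms.S1s \<theta> lam) \<le> ennreal (1 / \<sigma> ^ 2) * epowr (infsum (t1 \<theta> lam) (idx D \<times> idx D \<times> idx D)) (1/2)"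
  "ms.rt (ms.S2s \<theta> lam) \<le> ennreal (1 / \<sigma> ^ 2) * epowr (infsum (t2 \<theta> lam) (idx D \<times> idx D)) (1/2)"
  "ms.rt (ms.S3s lam) \<le> ennreal (1 / \<sigma> ^ 2) * epowr (b34 4 1 lam) (1/2)"
  "ennreal ((1 / \<sigma>) ^ 3) * ms.S4s lam \<le> ennreal (1 / \<sigma> ^ 3) * b34 3 1 lam"
  "ennreal ((1 / \<sigma>) ^ 3) * ms.G1s lam \<le> ennreal (1 / \<sigma> ^ 3) * b5 lam"
  "ennreal ((1 / \<sigma>) ^ 3) * ms.G2s lam \<le> ennreal (1 / \<sigma> ^ 3) * b34 6 2 lam"
proof -
  have s: "(1 / \<sigma>) ^ n = 1 / \<sigma> ^ n" for n by (simp add: power_divide)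
  show "ms.rt (ms.S1s \<theta> lam) \<le> ennreal (1 / \<sigma> ^ 2) * epowr (infsum (t1 \<theta> lam) (idx D \<times> idx D \<times> idx D)) (1/2)"
    "ms.rt (ms.S2s \<theta> lam) \<le> ennreal (1 / \<sigma> ^ 2) * epowr (infsum (t2 \<theta> lam) (idx D \<times> idx D)) (1/2)"
    unfolding ms.rt_def s by (intro mult_left_mono epowr_mono S1s_le S2s_le; simp)+
  have "ms.S3s lam \<le> b34 4 1 lam"
    using h_le[of lam 4 1] by (simp add: ms.S3s_def ms.h_def)
  then show "ms.rt (ms.S3s lam) \<le> ennreal (1 / \<sigma> ^ 2) * epowr (b34 4 1 lam) (1/2)"
    unfolding ms.rt_def s by (intro mult_left_mono epowr_mono) simp_all
  have "ms.S4s lam \<le> b34 3 1 lam" "ms.G2s lam \<le> b34 6 2 lam"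
    using h_le[of lam 3 1] h_le[of lam 6 2] by (simp_all add: ms.S4s_def ms.G2s_def ms.h_def)
  then show "ennreal ((1 / \<sigma>) ^ 3) * ms.S4s lam \<le> ennreal (1 / \<sigma> ^ 3) * b34 3 1 lam"
    "ennreal ((1 / \<sigma>) ^ 3) * ms.G1s lam \<le> ennreal (1 / \<sigma> ^ 3) * b5 lam"
    "ennreal ((1 / \<sigma>) ^ 3) * ms.G2s lam \<le> ennreal (1 / \<sigma> ^ 3) * b34 6 2 lam"
    unfolding s using G1s_le[of lam] by (auto intro!: mult_left_mono)
qed

lemma general_bounds:
  "wasserstein_dist (normalized_law D \<zeta>) std_normal_distribution
    \<le> ennreal 24 * (S1 D \<rho> \<zeta> (1/3) + S2 D \<rho> \<zeta> (1/2) + S3 D \<rho> \<zeta> + S4 D \<rho> \<zeta>)"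
  "kolmogorov_dist (normalized_law D \<zeta>) std_normal_distribution
    \<le> ennreal 24 * (S1 D \<rho> \<zeta> (1/3) + S2 D \<rho> \<zeta> (1/2) + S3 D \<rho> \<zeta> + S4 D \<rho> \<zeta> + G1 D \<rho> \<zeta>)"
proof -
  have c: "ennreal 24 = 24" by simp
  \<comment> \<open>Four terms are fitted into the five slots of \<open>le_sum_INF\<close> by a
    fifth one with coefficient 0.\<close>
  have "wasserstein_dist (normalized_law D \<zeta>) std_normal_distribution
    \<le> ennreal 24 * (S1 D \<rho> \<zeta> (1/3) + S2 D \<rho> \<zeta> (1/2) + S3 D \<rho> \<zeta> + S4 D \<rho> \<zeta> + ennreal 0 * (INF l\<in>{0<..<1::real}. 0))"
    unfolding S_eq
  proof (rule le_sum_INF)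
    fix l1 l2 l3 l4 l5 :: real assume l: "l1 \<in> {0<..<1}" "l2 \<in> {0<..<1}" "l3 \<in> {0<..<1}" "l4 \<in> {0<..<1}" "l5 \<in> {0<..<1}"
    \<comment> \<open>The second slot starts at 0, as the diagonal pairs have been estimated within
      the sum for S1(1/3).\<close>
    have "wasserstein_dist (normalized_law D \<zeta>) std_normal_distribution
      \<le> 24 * (ms.rt (ms.S1s (1/3) l1) + 0 + ms.rt (ms.S3s l3) + ennreal ((1 / \<sigma>) ^ 3) * ms.S4s l4 + 0)"
      using ms.wasserstein_general[of l1 l3 l4] l by (simp add: Z_law)
    also have "\<dots> \<le> ennreal 24 * (ennreal (1 / \<sigma> ^ 2) * epowr (infsum (t1 (1/3) l1) (idx D \<times> idx D \<times> idx D)) (1/2)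
        + ennreal (1 / \<sigma> ^ 2) * epowr (infsum (t2 (1/2) l2) (idx D \<times> idx D)) (1/2)
        + ennreal (1 / \<sigma> ^ 2) * epowr (b34 4 1 l3) (1/2) + ennreal (1 / \<sigma> ^ 3) * b34 3 1 l4 + ennreal 0 * 0)"
      unfolding c by (intro mult_left_mono add_mono terms_le) simp_all
    finally show "wasserstein_dist (normalized_law D \<zeta>) std_normal_distribution \<le> \<dots>" .
  qed simp_all
  then show "wasserstein_dist (normalized_law D \<zeta>) std_normal_distribution
    \<le> ennreal 24 * (S1 D \<rho> \<zeta> (1/3) + S2 D \<rho> \<zeta> (1/2) + S3 D \<rho> \<zeta> + S4 D \<rho> \<zeta>)" by simp
  show "kolmogorov_dist (normalized_law D \<zeta>) std_normal_distribution
    \<le> ennreal 24 * (S1 D \<rho> \<zeta> (1/3) + S2 D \<rho> \<zeta> (1/2) + S3 D \<rho> \<zeta> + S4 D \<rho> \<zeta> + G1 D \<rho> \<zeta>)"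
    unfolding S_eq
  proof (rule le_sum_INF)
    fix l1 l2 l3 l4 l5 :: real assume l: "l1 \<in> {0<..<1}" "l2 \<in> {0<..<1}" "l3 \<in> {0<..<1}" "l4 \<in> {0<..<1}" "l5 \<in> {0<..<1}"
    have "kolmogorov_dist (normalized_law D \<zeta>) std_normal_distribution
      \<le> 24 * (ms.rt (ms.S1s (1/3) l1) + 0 + ms.rt (ms.S3s l3) + ennreal ((1 / \<sigma>) ^ 3) * ms.S4s l4 + ennreal ((1 / \<sigma>) ^ 3) * ms.G1s l5)"
      using ms.kolmogorov_general[of l1 l3 l4 l5] l by (simp add: Z_law)
    also have "\<dots> \<le> ennreal 24 * (ennreal (1 / \<sigma> ^ 2) * epowr (infsum (t1 (1/3) l1) (idx D \<times> idx D \<times> idx D)) (1/2)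
        + ennreal (1 / \<sigma> ^ 2) * epowr (infsum (t2 (1/2) l2) (idx D \<times> idx D)) (1/2)
        + ennreal (1 / \<sigma> ^ 2) * epowr (b34 4 1 l3) (1/2) + ennreal (1 / \<sigma> ^ 3) * b34 3 1 l4 + ennreal (1 / \<sigma> ^ 3) * b5 l5)"
      unfolding c by (intro mult_left_mono add_mono terms_le) simp_all
    finally show "kolmogorov_dist (normalized_law D \<zeta>) std_normal_distribution \<le> \<dots>" .
  qed simp_all
qed

lemma local_bounds:
  assumes r: "ms.local_R r"
  shows "wasserstein_dist (normalized_law D \<zeta>) std_normal_distribution
    \<le> ennreal 24 * (S1 D \<rho> \<zeta> 1 + S2 D \<rho> \<zeta> 1 + S3 D \<rho> \<zeta> + S4 D \<rho> \<zeta>)"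
  "kolmogorov_dist (normalized_law D \<zeta>) std_normal_distribution
    \<le> ennreal 24 * (S1 D \<rho> \<zeta> 1 + S2 D \<rho> \<zeta> 1 + S3 D \<rho> \<zeta> + S4 D \<rho> \<zeta> + G2 D \<rho> \<zeta>)"
proof -
  have c: "ennreal 24 = 24" by simp
  have "wasserstein_dist (normalized_law D \<zeta>) std_normal_distribution
    \<le> ennreal 24 * (S1 D \<rho> \<zeta> 1 + S2 D \<rho> \<zeta> 1 + S3 D \<rho> \<zeta> + S4 D \<rho> \<zeta> + ennreal 0 * (INF l\<in>{0<..<1::real}. 0))"
    unfolding S_eq
  proof (rule le_sum_INF)
    fix l1 l2 l3 l4 l5 :: real assume l: "l1 \<in> {0<..<1}" "l2 \<in> {0<..<1}" "l3 \<in> {0<..<1}" "l4 \<in> {0<..<1}" "l5 \<in> {0<..<1}"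
    have "wasserstein_dist (normalized_law D \<zeta>) std_normal_distribution
      \<le> 24 * (ms.rt (ms.S1s 1 l1) + ms.rt (ms.S2s 1 l2) + ms.rt (ms.S3s l3) + ennreal ((1 / \<sigma>) ^ 3) * ms.S4s l4 + 0)"
      using ms.wasserstein_local[OF r, of l1 l2 l3 l4] l by (simp add: Z_law)
    also have "\<dots> \<le> ennreal 24 * (ennreal (1 / \<sigma> ^ 2) * epowr (infsum (t1 1 l1) (idx D \<times> idx D \<times> idx D)) (1/2)
        + ennreal (1 / \<sigma> ^ 2) * epowr (infsum (t2 1 l2) (idx D \<times> idx D)) (1/2)
        + ennreal (1 / \<sigma> ^ 2) * epowr (b34 4 1 l3) (1/2) + ennreal (1 / \<sigma> ^ 3) * b34 3 1 l4 + ennreal 0 * 0)"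
      unfolding c by (intro mult_left_mono add_mono terms_le) simp_all
    finally show "wasserstein_dist (normalized_law D \<zeta>) std_normal_distribution \<le> \<dots>" .
  qed simp_all
  then show "wasserstein_dist (normalized_law D \<zeta>) std_normal_distribution
    \<le> ennreal 24 * (S1 D \<rho> \<zeta> 1 + S2 D \<rho> \<zeta> 1 + S3 D \<rho> \<zeta> + S4 D \<rho> \<zeta>)" by simp
  show "kolmogorov_dist (normalized_law D \<zeta>) std_normal_distribution
    \<le> ennreal 24 * (S1 D \<rho> \<zeta> 1 + S2 D \<rho> \<zeta> 1 + S3 D \<rho> \<zeta> + S4 D \<rho> \<zeta> + G2 D \<rho> \<zeta>)"
    unfolding S_eq
  proof (rule le_sum_INF)
    fix l1 l2 l3 l4 l5 :: real assume l: "l1 \<in> {0<..<1}" "l2 \<in> {0<..<1}" "l3 \<in> {0<..<1}" "l4 \<in> {0<..<1}" "l5 \<in> {0<..<1}"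
    have "kolmogorov_dist (normalized_law D \<zeta>) std_normal_distribution
      \<le> 24 * (ms.rt (ms.S1s 1 l1) + ms.rt (ms.S2s 1 l2) + ms.rt (ms.S3s l3) + ennreal ((1 / \<sigma>) ^ 3) * ms.S4s l4 + ennreal ((1 / \<sigma>) ^ 3) * ms.G2s l5)"
      using ms.kolmogorov_local[OF r, of l1 l2 l3 l4 l5] l by (simp add: Z_law)
    also have "\<dots> \<le> ennreal 24 * (ennreal (1 / \<sigma> ^ 2) * epowr (infsum (t1 1 l1) (idx D \<times> idx D \<times> idx D)) (1/2)
        + ennreal (1 / \<sigma> ^ 2) * epowr (infsum (t2 1 l2) (idx D \<times> idx D)) (1/2)
        + ennreal (1 / \<sigma> ^ 2) * epowr (b34 4 1 l3) (1/2) + ennreal (1 / \<sigma> ^ 3) * b34 3 1 l4 + ennreal (1 / \<sigma> ^ 3) * b34 6 2 l5)"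
      unfolding c by (intro mult_left_mono add_mono terms_le) simp_all
    finally show "kolmogorov_dist (normalized_law D \<zeta>) std_normal_distribution \<le> \<dots>" .
  qed simp_all
qed

end

section \<open>The main theorem\<close>

context field_functional
begin

text \<open>By Doob-Dynkin the supremum of the radii becomes a function of a pair of configurations,
  which can then be composed with translations and exchanges.\<close>

lemma general_case:
  assumes rf: "radius_family D \<rho>"
  obtains R0 where "radii D \<zeta> \<rho> R0"
proof -
  have "\<exists>h. h \<in> borel_measurable CC \<and> (\<forall>\<omega>\<in>space (PS D). sup_radius D \<rho> 0 t \<omega> = h (X \<omega>, X' \<omega>))"
    if t: "t \<in> Zl D" for t
  proof -
    have g: "sup_radius D \<rho> 0 t \<in> borel_measurable (vimage_algebra (space (PS D)) (\<lambda>\<omega>. (X \<omega>, X' \<omega>)) CC)"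
      using rf t by (simp add: radius_family_def pair_algebra_def)
    have T: "(\<lambda>\<omega>. (X \<omega>, X' \<omega>)) \<in> space (PS D) \<rightarrow> space CC"
      using measurable_space[OF XX_meas] by blast
    obtain h where "h \<in> borel_measurable CC" "\<And>\<omega>. \<omega> \<in> space (PS D) \<Longrightarrow> sup_radius D \<rho> 0 t \<omega> = h (X \<omega>, X' \<omega>)"
      by (rule vimage_algebra_factor[OF T g]) (rule that)
    then show ?thesis by blast
  qed
  then obtain R0 where "\<And>t. t \<in> Zl D \<Longrightarrow> R0 t \<in> borel_measurable CC \<and>
      (\<forall>\<omega>\<in>space (PS D). sup_radius D \<rho> 0 t \<omega> = R0 t (X \<omega>, X' \<omega>))" by metis
  then have "radii D \<zeta> \<rho> R0" using rf by unfold_locales auto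
  then show thesis by (rule that)
qed

end

locale local_radii_model = field_functional D \<zeta>
  for D :: "('w, 'e, 'm, 'v, 'd::finite) field_model" and \<zeta> +
  fixes r and K :: "int ^ 'd \<Rightarrow> int list \<Rightarrow> ('e \<Rightarrow> 'm) \<times> ('e \<Rightarrow> 'm) \<Rightarrow> ennreal"
  assumes lr: "local_radii D r"
    and K_meas: "\<And>x t. t \<in> Zl D \<Longrightarrow> K x t \<in> borel_measurable
      (PiM (cell D x t) (\<lambda>_. valM D) \<Otimes>\<^sub>M PiM (cell D x t) (\<lambda>_. valM D))"
    and K_eq: "\<And>x t \<omega>. t \<in> Zl D \<Longrightarrow> \<omega> \<in> space (PS D) \<Longrightarrow>
      ennreal (r x t \<omega>) = K x t (restrict (field_X D \<omega>) (cell D x t), restrict (field_X' D \<omega>) (cell D x t))"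
begin

definition Rc :: "int ^ 'd \<Rightarrow> int list \<Rightarrow> ('e \<Rightarrow> 'm) \<times> ('e \<Rightarrow> 'm) \<Rightarrow> ennreal" where
  "Rc x t p = K x t (restrict (fst p) (cell D x t), restrict (snd p) (cell D x t))"

lemma Rc_meas: "t \<in> Zl D \<Longrightarrow> Rc x t \<in> borel_measurable CC"
proof -
  assume t: "t \<in> Zl D"
  let ?C = "PiM (cell D x t) (\<lambda>_. valM D)"
  have "(\<lambda>p. (restrict (fst p) (cell D x t), restrict (snd p) (cell D x t))) \<in> CC \<rightarrow>\<^sub>M ?C \<Otimes>\<^sub>M ?C"
    using measurable_compose[OF measurable_fst restr_meas[OF cell_sub[OF t]]]
      measurable_compose[OF measurable_snd restr_meas[OF cell_sub[OF t]]]
    by (rule measurable_Pair)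
  from measurable_compose[OF this K_meas[OF t]] show ?thesis by (simp add: Rc_def[abs_def])
qed

lemma Rc_eq: "t \<in> Zl D \<Longrightarrow> \<omega> \<in> space (PS D) \<Longrightarrow> ennreal (r x t \<omega>) = Rc x t (X \<omega>, X' \<omega>)"
  by (simp add: Rc_def K_eq)

lemma lr_parts: assumes "t \<in> Zl D"
  shows "r x t \<in> borel_measurable (pair_algebra D)" "\<omega> \<in> space (PS D) \<Longrightarrow> 0 \<le> r x t \<omega>"
    "AE \<omega> in PS D. \<forall>y. y \<notin> fat_cube x (r x t \<omega>) \<longrightarrow> A (pert D (insert (x, t) {}) \<omega>) y = A (pert D {} \<omega>) y"
  using lr assms unfolding local_radii_def action_radius_def by blast+

lemma Rc_real: "t \<in> Zl D \<Longrightarrow> \<omega> \<in> space (PS D) \<Longrightarrow> enn2real (Rc x t (X \<omega>, X' \<omega>)) = r x t \<omega>"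
  using lr_parts(2) by (simp flip: Rc_eq)

lemma Rc_swapB:
  assumes t: "t \<in> Zl D" and B: "B \<subseteq> sites D" "(x, t) \<notin> B"
  shows "Rc x t (swapB B p) = Rc x t p"
proof -
  have "restrict (splice D B \<xi> \<eta>) (cell D x t) = restrict \<xi> (cell D x t)" for \<xi> \<eta>
  proof (rule restrict_ext)
    fix e assume e: "e \<in> cell D x t"
    then have "e \<in> E" using cell_sub[OF t] by blast
    then show "splice D B \<xi> \<eta> e = \<xi> e" using B site_of[OF t e] by (simp add: splice_eq)
  qed
  then show ?thesis by (simp add: Rc_def swapB_def)
qed

text \<open>Exchanging \<open>\<X>\<close> and \<open>\<X>'\<close> on \<open>B\<close> does not affect a radius which is local to a cell outside \<open>B\<close>.\<close>

lemma action_radius_local: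
  assumes t: "t \<in> Zl D" and B: "B \<subseteq> sites D"
  shows "action_radius D B x t (r x t)"
proof -
  have "AE \<omega> in PS D. \<forall>y. y \<notin> fat_cube x (r x t \<omega>) \<longrightarrow> A (pert D (insert (x, t) B) \<omega>) y = A (pert D B \<omega>) y"
  \<comment> \<open>If (x, t) already lies in \<open>B\<close>, the two perturbed fields
    coincide.\<close>
  proof (cases "(x, t) \<in> B")
    case False
    have xt: "{(x, t)} \<subseteq> sites D" "B \<inter> {(x, t)} = {}" using t False by (auto simp: sites_def)
    have m: "(\<lambda>p. enn2real (Rc x t p)) \<in> borel_measurable CC" using Rc_meas[OF t] by measurable
    have "AE p in PL. Ag (fat_cube x (enn2real (Rc x t p))) (insert (x, t) {}) {} p"
    proof (rule AE_transfer[OF t _ _ m])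
      show "AE \<omega> in PS D. Ag (fat_cube x (enn2real (Rc x t (X \<omega>, X' \<omega>)))) (insert (x, t) {}) {} (X \<omega>, X' \<omega>)"
        using lr_parts(3)[OF t, of x] AE_space
        by eventually_elim (simp add: Rc_real[OF t] Ag_def pert_def)
    qed simp_all
    then have "AE p in PL. Ag (fat_cube x (enn2real (Rc x t (swapB B p)))) {(x, t)} {} (swapB B p)"
      by (intro AE_distrD[OF swapB_PL[OF B]]) (simp only: distr_swapB[OF B])
    then have "AE p in PL. Ag (fat_cube x (enn2real (Rc x t p))) (insert (x, t) B) B p"
      using Ag_swapB[OF B xt(1) _ xt(2), of "{}"] by (simp add: Rc_swapB[OF t B False])
    then have "AE \<omega> in PS D. Ag (fat_cube x (enn2real (Rc x t (X \<omega>, X' \<omega>)))) (insert (x, t) B) B (X \<omega>, X' \<omega>)"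
      by (intro AE_distrD[OF XX_PL]) (simp only: distr_XX)
    with AE_space show ?thesis
      by eventually_elim (simp add: Rc_real[OF t] Ag_def pert_def)
  qed (simp add: insert_absorb)
  then show ?thesis using lr_parts[OF t] by (simp add: action_radius_def)
qed

lemma sup_radius_local: "sup_radius D (\<lambda>x t B. r x t) x t \<omega> = ennreal (r x t \<omega>)"
  by (simp add: sup_radius_def Pow_not_empty)

lemma radius_family_local: "radius_family D (\<lambda>x t B. r x t)"
  unfolding radius_family_def sup_radius_local[abs_def]
  using action_radius_local lr_parts(1) by auto

sublocale rl: radii D \<zeta> "\<lambda>x t B. r x t" "Rc 0"
  by unfold_locales (simp_all add: radius_family_local Rc_meas sup_radius_local Rc_eq)

text \<open>The radius at site i comes from the origin by translation, and the shift maps the cell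
  at the origin onto the cell of site i, so locality survives the translation.\<close>

lemma local_R_Rn:
  "rl.ms.local_R (\<lambda>i p. K 0 (et i) (\<lambda>e\<in>cell D 0 (et i). fst p (shift D (ex i) e), \<lambda>e\<in>cell D 0 (et i). snd p (shift D (ex i) e)))"
  unfolding rl.ms.local_R_def
proof (intro allI conjI ballI)
  fix i
  let ?C = "PiM (cell D 0 (et i)) (\<lambda>_. valM D)"
  have sc: "shift D (ex i) e \<in> cl i" if "e \<in> cell D 0 (et i)" for e
    using shift_cell[OF et_Zl that, of "ex i"] by (simp add: cl_def)
  have s: "(\<lambda>y. \<lambda>e\<in>cell D 0 (et i). y (shift D (ex i) e)) \<in> Mc i \<rightarrow>\<^sub>M ?C"
  proof (rule measurable_restrict)
    fix e assume "e \<in> cell D 0 (et i)"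
    from measurable_component_singleton[OF sc[OF this], of "\<lambda>_. valM D"]
    show "(\<lambda>y. y (shift D (ex i) e)) \<in> Mc i \<rightarrow>\<^sub>M valM D"
      by (simp add: sets_Mc cong: measurable_cong_sets)
  qed
  have "(\<lambda>p. (\<lambda>e\<in>cell D 0 (et i). fst p (shift D (ex i) e), \<lambda>e\<in>cell D 0 (et i). snd p (shift D (ex i) e)))
      \<in> Mc i \<Otimes>\<^sub>M Mc i \<rightarrow>\<^sub>M ?C \<Otimes>\<^sub>M ?C"
    by (rule measurable_Pair[OF measurable_compose[OF measurable_fst s] measurable_compose[OF measurable_snd s]])
  from measurable_compose[OF this K_meas[OF et_Zl]]
  show "(\<lambda>p. K 0 (et i) (\<lambda>e\<in>cell D 0 (et i). fst p (shift D (ex i) e), \<lambda>e\<in>cell D 0 (et i). snd p (shift D (ex i) e)))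
      \<in> borel_measurable (Mc i \<Otimes>\<^sub>M Mc i)" .
  have "restrict (tr (ex i) (glue x)) (cell D 0 (et i)) = (\<lambda>e\<in>cell D 0 (et i). x i (shift D (ex i) e))" for x
  proof (rule restrict_ext)
    fix e assume e: "e \<in> cell D 0 (et i)"
    then have "e \<in> E" "shift D (ex i) e \<in> E" using cell_sub[OF et_Zl] sc cl_sub by blast+
    then show "tr (ex i) (glue x) e = x i (shift D (ex i) e)"
      using num_eq[OF sc[OF e]] by (simp add: translate_def glue_def)
  qed
  then show "rl.Rn i p = K 0 (et i) (\<lambda>e\<in>cell D 0 (et i). fst (fst p i, snd p i) (shift D (ex i) e),
      \<lambda>e\<in>cell D 0 (et i). snd (fst p i, snd p i) (shift D (ex i) e))" for p
    by (simp add: rl.Rn_def rl.Rz_def Rc_def tr2_def glue2_def)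
qed

end

context field_functional
begin

lemma local_case:
  assumes lr: "local_radii D r"
  obtains K where "local_radii_model D \<zeta> r K"
proof -
  have "\<exists>h. h \<in> borel_measurable (PiM (cell D x t) (\<lambda>_. valM D) \<Otimes>\<^sub>M PiM (cell D x t) (\<lambda>_. valM D)) \<and>
      (\<forall>\<omega>\<in>space (PS D). ennreal (r x t \<omega>) = h (restrict (X \<omega>) (cell D x t), restrict (X' \<omega>) (cell D x t)))"
    if t: "t \<in> Zl D" for x t
  proof -
    let ?C = "PiM (cell D x t) (\<lambda>_. valM D)"
    let ?T = "\<lambda>\<omega>. (restrict (X \<omega>) (cell D x t), restrict (X' \<omega>) (cell D x t))"
    have [measurable]: "r x t \<in> borel_measurable (vimage_algebra (space (PS D)) ?T (?C \<Otimes>\<^sub>M ?C))"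
      using lr t by (simp add: local_radii_def cell_algebra_def)
    have g: "(\<lambda>\<omega>. ennreal (r x t \<omega>)) \<in> borel_measurable (vimage_algebra (space (PS D)) ?T (?C \<Otimes>\<^sub>M ?C))"
      by measurable
    have "?T \<in> PS D \<rightarrow>\<^sub>M ?C \<Otimes>\<^sub>M ?C"
      by (rule measurable_Pair[OF measurable_compose[OF X_meas restr_meas[OF cell_sub[OF t]]]
            measurable_compose[OF X'_meas restr_meas[OF cell_sub[OF t]]]])
    from measurable_space[OF this] have T: "?T \<in> space (PS D) \<rightarrow> space (?C \<Otimes>\<^sub>M ?C)" by blast
    obtain h where "h \<in> borel_measurable (?C \<Otimes>\<^sub>M ?C)" "\<And>\<omega>. \<omega> \<in> space (PS D) \<Longrightarrow> ennreal (r x t \<omega>) = h (?T \<omega>)"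
      by (rule vimage_algebra_factor[OF T g]) (rule that)
    then show ?thesis by blast
  qed
  note ex = someI_ex[OF this]
  let ?K = "\<lambda>x t. SOME h. h \<in> borel_measurable (PiM (cell D x t) (\<lambda>_. valM D) \<Otimes>\<^sub>M PiM (cell D x t) (\<lambda>_. valM D)) \<and>
      (\<forall>\<omega>\<in>space (PS D). ennreal (r x t \<omega>) = h (restrict (X \<omega>) (cell D x t), restrict (X' \<omega>) (cell D x t)))"
  have "local_radii_model D \<zeta> r ?K"
  proof unfold_locales
    show "?K x t \<in> borel_measurable (PiM (cell D x t) (\<lambda>_. valM D) \<Otimes>\<^sub>M PiM (cell D x t) (\<lambda>_. valM D))"
      if "t \<in> Zl D" for x t using ex[OF that, of x] by (rule conjunct1)
    show "ennreal (r x t \<omega>) = ?K x t (restrict (X \<omega>) (cell D x t), restrict (X' \<omega>) (cell D x t))"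
      if "t \<in> Zl D" "\<omega> \<in> space (PS D)" for x t \<omega>
      using ex[OF that(1), of x] that(2) by blast
  qed (rule lr)
  then show thesis by (rule that)
qed

end

theorem theorem2p4:
  shows "\<exists>C>0. \<forall>(D :: ('w, 'e, 'm, 'v, 'd::finite) field_model) \<zeta>.
    admissible_model D \<longrightarrow> admissible_Z D \<zeta> \<longrightarrow>
    (\<forall>\<rho>. radius_family D \<rho> \<longrightarrow>
       wasserstein_dist (normalized_law D \<zeta>) std_normal_distribution
         \<le> ennreal C * (S1 D \<rho> \<zeta> (1/3) + S2 D \<rho> \<zeta> (1/2) + S3 D \<rho> \<zeta> + S4 D \<rho> \<zeta>) \<and>
       kolmogorov_dist (normalized_law D \<zeta>) std_normal_distribution
         \<le> ennreal C * (S1 D \<rho> \<zeta> (1/3) + S2 D \<rho> \<zeta> (1/2) + S3 D \<rho> \<zeta> + S4 D \<rho> \<zeta> + G1 D \<rho> \<zeta>)) \<and>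
    (\<forall>r. local_radii D r \<longrightarrow>
       (let \<rho> = (\<lambda>x t B. r x t) in
         radius_family D \<rho> \<and>
         (\<forall>x. \<forall>t\<in>Zl D. \<forall>\<omega>\<in>space (PS D). sup_radius D \<rho> x t \<omega> = ennreal (r x t \<omega>)) \<and>
         wasserstein_dist (normalized_law D \<zeta>) std_normal_distribution
           \<le> ennreal C * (S1 D \<rho> \<zeta> 1 + S2 D \<rho> \<zeta> 1 + S3 D \<rho> \<zeta> + S4 D \<rho> \<zeta>) \<and>
         kolmogorov_dist (normalized_law D \<zeta>) std_normal_distribution
           \<le> ennreal C * (S1 D \<rho> \<zeta> 1 + S2 D \<rho> \<zeta> 1 + S3 D \<rho> \<zeta> + S4 D \<rho> \<zeta> + G2 D \<rho> \<zeta>)))"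
proof (intro exI[of _ 24] conjI allI impI)
  fix D :: "('w, 'e, 'm, 'v, 'd) field_model" and \<zeta>
  assume "admissible_model D" "admissible_Z D \<zeta>"
  then interpret field_functional D \<zeta> by unfold_locales
  {
    fix \<rho> assume "radius_family D \<rho>"
    then obtain R0 where "radii D \<zeta> \<rho> R0" by (rule general_case)
    then interpret radii D \<zeta> \<rho> R0 .
    show "wasserstein_dist (normalized_law D \<zeta>) std_normal_distribution
        \<le> ennreal 24 * (S1 D \<rho> \<zeta> (1/3) + S2 D \<rho> \<zeta> (1/2) + S3 D \<rho> \<zeta> + S4 D \<rho> \<zeta>)"
      "kolmogorov_dist (normalized_law D \<zeta>) std_normal_distribution
        \<le> ennreal 24 * (S1 D \<rho> \<zeta> (1/3) + S2 D \<rho> \<zeta> (1/2) + S3 D \<rho> \<zeta> + S4 D \<rho> \<zeta> + G1 D \<rho> \<zeta>)"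
      by (fact general_bounds)+
  }
  fix r assume "local_radii D r"
  then obtain K where "local_radii_model D \<zeta> r K" by (rule local_case)
  then interpret local_radii_model D \<zeta> r K .
  show "let \<rho> = \<lambda>x t B. r x t in
         radius_family D \<rho> \<and>
         (\<forall>x. \<forall>t\<in>Zl D. \<forall>\<omega>\<in>space (PS D). sup_radius D \<rho> x t \<omega> = ennreal (r x t \<omega>)) \<and>
         wasserstein_dist (normalized_law D \<zeta>) std_normal_distribution
           \<le> ennreal 24 * (S1 D \<rho> \<zeta> 1 + S2 D \<rho> \<zeta> 1 + S3 D \<rho> \<zeta> + S4 D \<rho> \<zeta>) \<and>
         kolmogorov_dist (normalized_law D \<zeta>) std_normal_distribution
           \<le> ennreal 24 * (S1 D \<rho> \<zeta> 1 + S2 D \<rho> \<zeta> 1 + S3 D \<rho> \<zeta> + S4 D \<rho> \<zeta> + G2 D \<rho> \<zeta>)"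
    unfolding Let_def
    using radius_family_local sup_radius_local rl.local_bounds[OF local_R_Rn] by blast
qed simp

end
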